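(* Let $G$ and $H$ be finite groups of order $n$ with composition series $S$ and $S'$ respectively, such that $\alpha$ is an upper bound for the order of every composition factor of $S$ and of $S'$. Then one can decide deterministically whether $S \cong S'$ in time $n^{O(\alpha/\log\alpha)}$.
   Context: Groups are given by multiplication tables and composition series by the subsets corresponding to their subgroups. A composition series $G_0 = 1 \triangleleft \cdots \triangleleft G_m = G$ is a maximal subnormal series; its factors $G_{i+1}/G_i$ are its composition factors. Composition series $G_0=1\triangleleft\cdots\triangleleft G_m=G$ and $H_0=1\triangleleft\cdots\triangleleft H_m=H$ are isomorphic ($S\cong S'$) if there is an isomorphism $\phi:G\to H$ with $\phi(G_i)=H_i$ for all $i$. *)

theory Defs
  imports Complex_Main "HOL-Algebra.Coset"
begin

definition subnormal_series :: "('a, 'b) monoid_scheme \<Rightarrow> 'a set list \<Rightarrow> bool" where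
  "subnormal_series G S \<longleftrightarrow>
     S \<noteq> [] \<and> hd S = {\<one>\<^bsub>G\<^esub>} \<and> last S = carrier G \<and>
     (\<forall>i. Suc i < length S \<longrightarrow> S ! i \<lhd> G\<lparr>carrier := S ! Suc i\<rparr>)"

text \<open>A composition series is a subnormal series without repetitions that is maximal
  with respect to refinement.\<close>

definition composition_series :: "('a, 'b) monoid_scheme \<Rightarrow> 'a set list \<Rightarrow> bool" where
  "composition_series G S \<longleftrightarrow>
     subnormal_series G S \<and> distinct S \<and>
     (\<forall>T. subnormal_series G T \<and> distinct T \<and> set S \<subseteq> set T \<longrightarrow> T = S)"

definition series_factor :: "('a, 'b) monoid_scheme \<Rightarrow> 'a set list \<Rightarrow> nat \<Rightarrow> 'a set monoid" where
  "series_factor G S i = G\<lparr>carrier := S ! Suc i\<rparr> Mod (S ! i)"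

definition factor_orders_bounded ::
    "('a, 'b) monoid_scheme \<Rightarrow> 'a set list \<Rightarrow> real \<Rightarrow> bool" where
  "factor_orders_bounded G S \<alpha> \<longleftrightarrow>
     (\<forall>i. Suc i < length S \<longrightarrow> real (order (series_factor G S i)) \<le> \<alpha>)"

definition series_iso ::
    "('a, 'c) monoid_scheme \<Rightarrow> 'a set list \<Rightarrow> ('b, 'd) monoid_scheme \<Rightarrow> 'b set list \<Rightarrow> bool" where
  "series_iso G S H T \<longleftrightarrow>
     length S = length T \<and> (\<exists>\<phi>\<in>iso G H. \<forall>i<length S. \<phi> ` (S ! i) = T ! i)"

text \<open>The model of computation is a deterministic random access machine in the style of Cook and Reckhow:
  registers hold natural numbers, subtraction is truncated, and every instruction has unit cost.
  As multiplication is not an instruction, running times agree with those of Turing machines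
  up to polynomials. The input is a list of numbers on a read-only random access tape.
  Unless it jumps, the machine proceeds to the next instruction; it halts on leaving the program.\<close>

datatype instr =
    Const nat nat      \<comment> \<open>\<open>R\<^sub>i := c\<close>\<close>
  | Add nat nat nat    \<comment> \<open>\<open>R\<^sub>i := R\<^sub>j + R\<^sub>k\<close>\<close>
  | Sub nat nat nat    \<comment> \<open>\<open>R\<^sub>i := R\<^sub>j - R\<^sub>k\<close>\<close>
  | Load nat nat       \<comment> \<open>\<open>R\<^sub>i :=\<close> the register with address \<open>R\<^sub>j\<close>\<close>
  | Store nat nat      \<comment> \<open>the register with address \<open>R\<^sub>i\<close> \<open>:= R\<^sub>j\<close>\<close>
  | Read nat nat       \<comment> \<open>\<open>R\<^sub>i :=\<close> the input number at position \<open>R\<^sub>j\<close>, or \<open>0\<close> past the end\<close>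
  | JumpPos nat nat    \<comment> \<open>if \<open>R\<^sub>i > 0\<close>, go to the given program position\<close>

type_synonym program = "instr list"

type_synonym config = "nat \<times> (nat \<Rightarrow> nat)"

fun exec_instr :: "nat list \<Rightarrow> instr \<Rightarrow> config \<Rightarrow> config" where
  "exec_instr xs (Const i c) (pc, R) = (Suc pc, R(i := c))"
| "exec_instr xs (Add i j k) (pc, R) = (Suc pc, R(i := R j + R k))"
| "exec_instr xs (Sub i j k) (pc, R) = (Suc pc, R(i := R j - R k))"
| "exec_instr xs (Load i j) (pc, R) = (Suc pc, R(i := R (R j)))"
| "exec_instr xs (Store i j) (pc, R) = (Suc pc, R(R i := R j))"
| "exec_instr xs (Read i j) (pc, R) =
     (Suc pc, R(i := (if R j < length xs then xs ! R j else 0)))"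
| "exec_instr xs (JumpPos i l) (pc, R) = (if R i > 0 then l else Suc pc, R)"

definition halted :: "program \<Rightarrow> config \<Rightarrow> bool" where
  "halted P c \<longleftrightarrow> length P \<le> fst c"

definition step :: "program \<Rightarrow> nat list \<Rightarrow> config \<Rightarrow> config" where
  "step P xs c = (if halted P c then c else exec_instr xs (P ! fst c) c)"

definition run :: "program \<Rightarrow> nat list \<Rightarrow> nat \<Rightarrow> config" where
  "run P xs t = (step P xs ^^ t) (0, \<lambda>_. 0)"

text \<open>The answer of a halted machine is ``yes'' iff register \<open>0\<close> is nonzero.\<close>

definition decides_in_time :: "program \<Rightarrow> nat list \<Rightarrow> real \<Rightarrow> bool \<Rightarrow> bool" where
  "decides_in_time P xs b Q \<longleftrightarrow>
     (\<exists>t. real t \<le> b \<and> halted P (run P xs t) \<and> (snd (run P xs t) 0 \<noteq> 0 \<longleftrightarrow> Q))"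

text \<open>A group given by its multiplication table has carrier \<open>{..<n}\<close>; its identity may be any
  element. The table is written row by row, and a subset is written as its indicator vector.\<close>

definition encode_table :: "nat \<Rightarrow> nat monoid \<Rightarrow> nat list" where
  "encode_table n G = concat (map (\<lambda>i. map (\<lambda>j. i \<otimes>\<^bsub>G\<^esub> j) [0..<n]) [0..<n])"

definition encode_subset :: "nat \<Rightarrow> nat set \<Rightarrow> nat list" where
  "encode_subset n A = map (\<lambda>x. if x \<in> A then 1 else 0) [0..<n]"

definition encode_series :: "nat \<Rightarrow> nat set list \<Rightarrow> nat list" where
  "encode_series n S = length S # concat (map (encode_subset n) S)"

definition encode_instance ::
    "nat \<Rightarrow> nat monoid \<Rightarrow> nat set list \<Rightarrow> nat monoid \<Rightarrow> nat set list \<Rightarrow> nat list" where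
  "encode_instance n G S H T =
     n # encode_table n G @ encode_series n S @ encode_table n H @ encode_series n T"

end

theory Submission
  imports Defs "HOL-Algebra.Generated_Groups"
begin

text \<open>
  Let \<open>A\<^sub>i\<close> be the group of automorphisms of \<open>G\<^sub>i\<close> that preserve \<open>G\<^sub>0, \<dots>, G\<^sub>i\<close>. The algorithm climbs the
  series, keeping generators of \<open>A\<^sub>i\<close> and one isomorphism \<open>G\<^sub>i \<rightarrow> H\<^sub>i\<close> of series. Every factor of order \<open>q\<close> is
  generated by at most \<open>log\<^sub>2 q\<close> elements, so the images \<open>h\<close> of generators \<open>y\<close> of \<open>G\<^sub>i\<^sub>+\<^sub>1\<close> modulo \<open>G\<^sub>i\<close> can be
  enumerated. A map \<open>\<phi>\<close> on \<open>G\<^sub>i\<close> extends by \<open>y \<mapsto> h\<close> iff it intertwines conjugation by \<open>y\<close> and by \<open>h\<close> and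
  maps finitely many relator values \<open>w(y)\<close> to \<open>w(h)\<close>. Imposing the first condition on \<open>G\<^sub>1\<close>, then on \<open>G\<^sub>2\<close>,
  and so on, and then the relators one at a time, gives a tower of subgroups of \<open>A\<^sub>i\<close>: since \<open>G\<^sub>i\<close> is normal
  in \<open>G\<^sub>i\<^sub>+\<^sub>1\<close>, an intertwined conjugation is a homomorphism, and its restriction to \<open>G\<^sub>j\<^sub>+\<^sub>1\<close> is determined by
  that to \<open>G\<^sub>j\<close> and by \<open>log\<^sub>2 \<alpha>\<close> values. So all indices in the tower are at most \<open>n\<close> to the power
  \<open>(log\<^sub>2 \<alpha>)\<^sup>2\<close>, and the sifting method of Furst, Hopcroft and Luks finds a solution in time polynomial in
  that number. Finally \<open>(log\<^sub>2 \<alpha>)\<^sup>2 = O(\<alpha> / log \<alpha>)\<close>.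
\<close>

section \<open>A functional language and its compiler\<close>

text \<open>Guessing images for the generators of all factors at once costs up to \<open>n\<close>
  to the power \<open>log n\<close>, however small \<alpha> is. So only one factor may be guessed at
  a time, and the automorphisms have to be carried along, by generators because there can be far too
  many to list. For a fixed guess, the isomorphisms of \<open>G_i\<close> that extend form the empty
  set or a coset of a subgroup of \<open>A_i\<close>; sifting finds a point of such a coset. The
  obstacle is that this subgroup may have a huge index in \<open>A_i\<close>: intertwining a
  conjugation on all of \<open>G_i\<close> at once has too many outcomes, and imposing it term by
  term is what makes each step small. Conjugation by \<open>y\<close> need not preserve a lower term
  \<open>G_j\<close>, which is only known to be normal in the next term. This is harmless: it is
  enough that the conjugates of \<open>G_j\<close> lie in \<open>G_i\<close>, where the maps are
  defined. Since the machine program must be exhibited with a proved step count, it is compiled from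
  a language in which a bound on the loops bounds the time.\<close>

datatype val = NV nat | PV val val

primrec nv :: "val \<Rightarrow> nat" where "nv (NV k) = k" | "nv (PV a b) = 1"
primrec fstv :: "val \<Rightarrow> val" where "fstv (NV k) = NV 0" | "fstv (PV a b) = a"
primrec sndv :: "val \<Rightarrow> val" where "sndv (NV k) = NV 0" | "sndv (PV a b) = b"
text \<open>A list is a right-nested pair that ends in \<open>NV 0\<close>;
  \<open>vlist_unfold\<close> is the form in which a compiled loop walks along it, testing only
  \<open>nv\<close>.\<close>

primrec vlist :: "val \<Rightarrow> val list" where
  "vlist (NV k) = (if k = 0 then [] else [NV 0])" | "vlist (PV a b) = a # vlist b"

lemma vlist_unfold: "vlist v = (if nv v = 0 then [] else fstv v # vlist (sndv v))"
  by (cases v) auto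

text \<open>Variables are positions in an environment that grows at its end, so a variable keeps its
  number under further binders. \<open>CallE\<close> inlines a body that sees nothing but its
  argument, so each function is verified once, in a one-element environment.\<close>

datatype exp = Var nat | Num nat | AddE exp exp | SubE exp exp | RdE exp | PairE exp exp
  | FstE exp | SndE exp | IfE exp exp exp | LetE exp exp | CallE exp exp
  | ForE exp exp exp | FoldE exp exp exp

definition read_at :: "nat list \<Rightarrow> nat \<Rightarrow> nat" where
  "read_at xs k = (if k < length xs then xs ! k else 0)"

primrec eval :: "exp \<Rightarrow> nat list \<Rightarrow> val list \<Rightarrow> val" where
  "eval (Var i) xs env = env ! i"
| "eval (Num c) xs env = NV c"
| "eval (AddE a b) xs env = NV (nv (eval a xs env) + nv (eval b xs env))"
| "eval (SubE a b) xs env = NV (nv (eval a xs env) - nv (eval b xs env))"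
| "eval (RdE a) xs env = NV (read_at xs (nv (eval a xs env)))"
| "eval (PairE a b) xs env = PV (eval a xs env) (eval b xs env)"
| "eval (FstE a) xs env = fstv (eval a xs env)"
| "eval (SndE a) xs env = sndv (eval a xs env)"
| "eval (IfE c a b) xs env = (if nv (eval c xs env) > 0 then eval a xs env else eval b xs env)"
| "eval (LetE a b) xs env = eval b xs (env @ [eval a xs env])"
| "eval (CallE f a) xs env = eval f xs [eval a xs env]"
| "eval (ForE n i b) xs env =
     foldl (\<lambda>acc k. eval b xs (env @ [acc, NV k])) (eval i xs env) [0..<nv (eval n xs env)]"
| "eval (FoldE l i b) xs env =
     foldl (\<lambda>acc x. eval b xs (env @ [acc, x])) (eval i xs env) (vlist (eval l xs env))"

text \<open>There is no recursion, so if all loops run at most \<open>B\<close> times, then the running time is at most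
  \<open>steps_bound B e\<close>, a polynomial in \<open>B\<close>.\<close>

primrec fold_all :: "('a \<Rightarrow> 'b \<Rightarrow> bool) \<Rightarrow> ('a \<Rightarrow> 'b \<Rightarrow> 'a) \<Rightarrow> 'a \<Rightarrow> 'b list \<Rightarrow> bool" where
  "fold_all Q f a [] = True"
| "fold_all Q f a (x # l) = (Q a x \<and> fold_all Q f (f a x) l)"

text \<open>Follows the actual evaluation: of a conditional only the branch taken counts, and the
  length of a loop may depend on data.\<close>

primrec bounded_loops :: "exp \<Rightarrow> nat \<Rightarrow> nat list \<Rightarrow> val list \<Rightarrow> bool" where
  "bounded_loops (Var i) B xs env = True"
| "bounded_loops (Num c) B xs env = True"
| "bounded_loops (AddE a b) B xs env = (bounded_loops a B xs env \<and> bounded_loops b B xs env)"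
| "bounded_loops (SubE a b) B xs env = (bounded_loops a B xs env \<and> bounded_loops b B xs env)"
| "bounded_loops (RdE a) B xs env = bounded_loops a B xs env"
| "bounded_loops (PairE a b) B xs env = (bounded_loops a B xs env \<and> bounded_loops b B xs env)"
| "bounded_loops (FstE a) B xs env = bounded_loops a B xs env"
| "bounded_loops (SndE a) B xs env = bounded_loops a B xs env"
| "bounded_loops (IfE c a b) B xs env =
     (bounded_loops c B xs env \<and> (if nv (eval c xs env) > 0 then bounded_loops a B xs env else bounded_loops b B xs env))"
| "bounded_loops (LetE a b) B xs env = (bounded_loops a B xs env \<and> bounded_loops b B xs (env @ [eval a xs env]))"
| "bounded_loops (CallE f a) B xs env = (bounded_loops a B xs env \<and> bounded_loops f B xs [eval a xs env])"
| "bounded_loops (ForE n i b) B xs env =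
     (bounded_loops n B xs env \<and> bounded_loops i B xs env \<and> nv (eval n xs env) \<le> B \<and>
      fold_all (\<lambda>acc k. bounded_loops b B xs (env @ [acc, NV k])) (\<lambda>acc k. eval b xs (env @ [acc, NV k]))
        (eval i xs env) [0..<nv (eval n xs env)])"
| "bounded_loops (FoldE l i b) B xs env =
     (bounded_loops l B xs env \<and> bounded_loops i B xs env \<and> length (vlist (eval l xs env)) \<le> B \<and>
      fold_all (\<lambda>acc x. bounded_loops b B xs (env @ [acc, x])) (\<lambda>acc x. eval b xs (env @ [acc, x]))
        (eval i xs env) (vlist (eval l xs env)))"

primrec scoped :: "nat \<Rightarrow> exp \<Rightarrow> bool" where
  "scoped d (Var i) = (i < d)"
| "scoped d (Num c) = True"
| "scoped d (AddE a b) = (scoped d a \<and> scoped d b)"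
| "scoped d (SubE a b) = (scoped d a \<and> scoped d b)"
| "scoped d (RdE a) = scoped d a"
| "scoped d (PairE a b) = (scoped d a \<and> scoped d b)"
| "scoped d (FstE a) = scoped d a"
| "scoped d (SndE a) = scoped d a"
| "scoped d (IfE c a b) = (scoped d c \<and> scoped d a \<and> scoped d b)"
| "scoped d (LetE a b) = (scoped d a \<and> scoped (Suc d) b)"
| "scoped d (CallE f a) = (scoped d a \<and> scoped 1 f)"
| "scoped d (ForE n i b) = (scoped d n \<and> scoped d i \<and> scoped (d + 2) b)"
| "scoped d (FoldE n i b) = (scoped d n \<and> scoped d i \<and> scoped (d + 2) b)"

text \<open>Any upper bound on the stack height will do, so sums stand where maxima would be
  sharper.\<close>

primrec regs :: "exp \<Rightarrow> nat" where
  "regs (Var i) = 1"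
| "regs (Num c) = 1"
| "regs (AddE a b) = regs a + regs b + 1"
| "regs (SubE a b) = regs a + regs b + 1"
| "regs (RdE a) = regs a"
| "regs (PairE a b) = regs a + regs b + 1"
| "regs (FstE a) = regs a"
| "regs (SndE a) = regs a"
| "regs (IfE c a b) = regs c + regs a + regs b"
| "regs (LetE a b) = regs a + regs b + 1"
| "regs (CallE f a) = regs a + regs f + 1"
| "regs (ForE n i b) = regs n + regs i + regs b + 4"
| "regs (FoldE n i b) = regs n + regs i + regs b + 4"

text \<open>Registers: 0 is the answer, 1 the heap pointer, 2 to 5 are scratch, 6 up to \<open>W\<close> is a static
  stack, and the heap starts at \<open>W\<close> with a cell for \<open>NV 0\<close>. A value is a heap cell of three
  registers; the cell of a number points to the cell at \<open>W\<close> twice, and that of a pair has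
  number 1, which explains the junk values of \<open>nv\<close>, \<open>fstv\<close>, \<open>sndv\<close> and \<open>vlist\<close>.\<close>

definition alloc :: "nat \<Rightarrow> instr list" where
  "alloc t = [Store 1 3, Const 2 1, Add 1 1 2, Store 1 4, Add 1 1 2, Store 1 5, Add 1 1 2,
     Const 2 3, Sub t 1 2]"

definition move :: "nat \<Rightarrow> nat \<Rightarrow> instr list" where
  "move i j = [Const 2 0, Add i j 2]"

definition jump :: "nat \<Rightarrow> instr list" where
  "jump l = [Const 2 1, JumpPos 2 l]"

text \<open>Jump targets are absolute, so the lengths of code fragments must be known before the
  code itself; \<open>length_comp_code\<close> confirms them.\<close>

primrec code_len :: "exp \<Rightarrow> nat" where
  "code_len (Var i) = 2"
| "code_len (Num c) = 12"
| "code_len (AddE a b) = code_len a + code_len b + 14"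
| "code_len (SubE a b) = code_len a + code_len b + 14"
| "code_len (RdE a) = code_len a + 13"
| "code_len (PairE a b) = code_len a + code_len b + 14"
| "code_len (FstE a) = code_len a + 3"
| "code_len (SndE a) = code_len a + 3"
| "code_len (IfE c a b) = code_len c + code_len a + code_len b + 4"
| "code_len (LetE a b) = code_len a + code_len b + 2"
| "code_len (CallE f a) = code_len a + code_len f + 2"
| "code_len (ForE n i b) = code_len n + code_len i + code_len b + 27"
| "code_len (FoldE n i b) = code_len n + code_len i + code_len b + 16"

text \<open>\<open>\<rho>\<close> lists the registers of the variables, \<open>t\<close> is the
  target and the first free register, and \<open>p\<close> is the position of the code in the
  program. \<open>ForE\<close> keeps in \<open>t\<close> the number of rounds left, in
  \<open>t + 1\<close> the accumulator, in \<open>t + 2\<close> the index as a heap cell and in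
  \<open>t + 3\<close> the raw index. \<open>FoldE\<close> keeps in \<open>t\<close> the rest of the
  list, in \<open>t + 1\<close> the accumulator and in \<open>t + 2\<close> the current
  element.\<close>

primrec comp_code :: "nat \<Rightarrow> exp \<Rightarrow> nat list \<Rightarrow> nat \<Rightarrow> nat \<Rightarrow> instr list" where
  "comp_code W (Var i) \<rho> t p = move t (\<rho> ! i)"
| "comp_code W (Num c) \<rho> t p = [Const 3 c, Const 4 W, Const 5 W] @ alloc t"
| "comp_code W (AddE a b) \<rho> t p = comp_code W a \<rho> t p @ comp_code W b \<rho> (t + 1) (p + code_len a) @
     [Load 3 t, Load 4 (t + 1), Add 3 3 4, Const 4 W, Const 5 W] @ alloc t"
| "comp_code W (SubE a b) \<rho> t p = comp_code W a \<rho> t p @ comp_code W b \<rho> (t + 1) (p + code_len a) @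
     [Load 3 t, Load 4 (t + 1), Sub 3 3 4, Const 4 W, Const 5 W] @ alloc t"
| "comp_code W (RdE a) \<rho> t p = comp_code W a \<rho> t p @ [Load 3 t, Read 3 3, Const 4 W, Const 5 W] @ alloc t"
| "comp_code W (PairE a b) \<rho> t p = comp_code W a \<rho> t p @ comp_code W b \<rho> (t + 1) (p + code_len a) @
     [Const 3 1, Const 2 0, Add 4 t 2, Add 5 (t + 1) 2, Const 2 0] @ alloc t"
| "comp_code W (FstE a) \<rho> t p = comp_code W a \<rho> t p @ [Const 2 1, Add 2 t 2, Load t 2]"
| "comp_code W (SndE a) \<rho> t p = comp_code W a \<rho> t p @ [Const 2 2, Add 2 t 2, Load t 2]"
| "comp_code W (IfE c a b) \<rho> t p = comp_code W c \<rho> t p @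
     [Load 2 t, JumpPos 2 (p + code_len c + code_len b + 4)] @
     comp_code W b \<rho> t (p + code_len c + 2) @ jump (p + code_len c + code_len b + 4 + code_len a) @
     comp_code W a \<rho> t (p + code_len c + code_len b + 4)"
| "comp_code W (LetE a b) \<rho> t p = comp_code W a \<rho> t p @ comp_code W b (\<rho> @ [t]) (t + 1) (p + code_len a) @ move t (t + 1)"
| "comp_code W (CallE f a) \<rho> t p = comp_code W a \<rho> t p @ comp_code W f [t] (t + 1) (p + code_len a) @ move t (t + 1)"
| "comp_code W (ForE n i b) \<rho> t p = comp_code W n \<rho> t p @ [Load t t] @ comp_code W i \<rho> (t + 1) (p + code_len n + 1) @
     [Const (t + 3) 0] @
     [JumpPos t (p + code_len n + code_len i + 5)] @ jump (p + code_len n + code_len i + code_len b + 25) @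
     [Const 2 0, Add 3 (t + 3) 2, Const 4 W, Const 5 W] @ alloc (t + 2) @
     comp_code W b (\<rho> @ [t + 1, t + 2]) (t + 4) (p + code_len n + code_len i + 18) @
     move (t + 1) (t + 4) @ [Const 2 1, Sub t t 2, Add (t + 3) (t + 3) 2] @
     jump (p + code_len n + code_len i + 2) @ move t (t + 1)"
| "comp_code W (FoldE l i b) \<rho> t p = comp_code W l \<rho> t p @ comp_code W i \<rho> (t + 1) (p + code_len l) @
     [Load 2 t, JumpPos 2 (p + code_len l + code_len i + 4)] @ jump (p + code_len l + code_len i + code_len b + 14) @
     [Const 2 1, Add 2 t 2, Load (t + 2) 2] @
     comp_code W b (\<rho> @ [t + 1, t + 2]) (t + 3) (p + code_len l + code_len i + 7) @
     move (t + 1) (t + 3) @ [Const 2 2, Add 2 t 2, Load t 2] @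
     jump (p + code_len l + code_len i) @ move t (t + 1)"

lemma length_comp_code [simp]: "length (comp_code W e \<rho> t p) = code_len e"
  by (induction e arbitrary: \<rho> t p) (auto simp: alloc_def move_def jump_def)

primrec steps_bound :: "nat \<Rightarrow> exp \<Rightarrow> nat" where
  "steps_bound B (Var i) = 2"
| "steps_bound B (Num c) = 12"
| "steps_bound B (AddE a b) = steps_bound B a + steps_bound B b + 14"
| "steps_bound B (SubE a b) = steps_bound B a + steps_bound B b + 14"
| "steps_bound B (RdE a) = steps_bound B a + 13"
| "steps_bound B (PairE a b) = steps_bound B a + steps_bound B b + 14"
| "steps_bound B (FstE a) = steps_bound B a + 3"
| "steps_bound B (SndE a) = steps_bound B a + 3"
| "steps_bound B (IfE c a b) = steps_bound B c + steps_bound B a + steps_bound B b + 4"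
| "steps_bound B (LetE a b) = steps_bound B a + steps_bound B b + 2"
| "steps_bound B (CallE f a) = steps_bound B a + steps_bound B f + 2"
| "steps_bound B (ForE n i b) = steps_bound B n + steps_bound B i + 7 + B * (steps_bound B b + 21)"
| "steps_bound B (FoldE n i b) = steps_bound B n + steps_bound B i + 6 + B * (steps_bound B b + 12)"

text \<open>Bounds of the form \<open>K * (B + 1) ^ D\<close> are closed under addition and under
  multiplication by \<open>B\<close>. The base \<open>B + 1\<close> is at least 1, so raising an
  exponent only weakens a bound.\<close>

lemma steps_bound_poly: "\<exists>K D. \<forall>B. steps_bound B e \<le> K * (B + 1) ^ D"
proof (induction e)
  have add: "\<exists>K D. \<forall>B. f B + g B \<le> K * (B + 1) ^ D"
    if "\<exists>K D. \<forall>B. f B \<le> K * (B + 1) ^ D" "\<exists>K D. \<forall>B. g B \<le> K * (B + 1) ^ D" for f g :: "nat \<Rightarrow> nat"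
  proof -
    from that obtain K D K' D' where 1: "\<And>B. f B \<le> K * (B + 1) ^ D" "\<And>B. g B \<le> K' * (B + 1) ^ D'"
      by blast
    have "f B + g B \<le> (K + K') * (B + 1) ^ (D + D')" for B
    proof -
      have "K * (B + 1) ^ D \<le> K * (B + 1) ^ (D + D')" "K' * (B + 1) ^ D' \<le> K' * (B + 1) ^ (D + D')"
        by (auto intro!: mult_left_mono power_increasing)
      then show ?thesis unfolding distrib_right using 1[of B] by linarith
    qed
    then show ?thesis by blast
  qed
  have mul: "\<exists>K D. \<forall>B. B * f B \<le> K * (B + 1) ^ D"
    if "\<exists>K D. \<forall>B. f B \<le> K * (B + 1) ^ D" for f :: "nat \<Rightarrow> nat"
  proof -
    from that obtain K D where 1: "\<And>B. f B \<le> K * (B + 1) ^ D"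
      by blast
    have "B * f B \<le> K * (B + 1) ^ (D + 1)" for B
    proof -
      have "B * f B \<le> (B + 1) * (K * (B + 1) ^ D)" by (rule mult_mono) (use 1 in auto)
      then show ?thesis by (simp add: algebra_simps)
    qed
    then show ?thesis by blast
  qed
  have const: "\<exists>K D. \<forall>B. c \<le> K * (B + 1) ^ D" for c :: nat
    by (rule exI[of _ c], rule exI[of _ 0]) auto
  {
    case (Var x) then show ?case by (simp add: const[simplified])
  next case (Num x) then show ?case by (simp add: const[simplified])
  next case (AddE e1 e2) then show ?case unfolding steps_bound.simps by (intro add const)
  next case (SubE e1 e2) then show ?case unfolding steps_bound.simps by (intro add const)
  next case (RdE e) then show ?case unfolding steps_bound.simps by (intro add const)
  next case (PairE e1 e2) then show ?case unfolding steps_bound.simps by (intro add const)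
  next case (FstE e) then show ?case unfolding steps_bound.simps by (intro add const)
  next case (SndE e) then show ?case unfolding steps_bound.simps by (intro add const)
  next case (IfE e1 e2 e3) then show ?case unfolding steps_bound.simps by (intro add const)
  next case (LetE e1 e2) then show ?case unfolding steps_bound.simps by (intro add const)
  next case (CallE e1 e2) then show ?case unfolding steps_bound.simps by (intro add const)
  next case (ForE e1 e2 e3) then show ?case unfolding steps_bound.simps by (intro add const mul)
  next case (FoldE e1 e2 e3) then show ?case unfolding steps_bound.simps by (intro add const mul)
  }
qed


section \<open>Execution of code fragments inside a program\<close>

definition code_at :: "program \<Rightarrow> nat \<Rightarrow> instr list \<Rightarrow> bool" where
  "code_at Pr p c \<longleftrightarrow> (\<forall>i<length c. p + i < length Pr \<and> Pr ! (p + i) = c ! i)"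

lemma code_at_Nil [simp]: "code_at Pr p []"
  by (simp add: code_at_def)

lemma code_at_Cons [simp]:
  "code_at Pr p (x # c) \<longleftrightarrow> p < length Pr \<and> Pr ! p = x \<and> code_at Pr (Suc p) c"
proof -
  have "(\<forall>i<length (x # c). Q i) \<longleftrightarrow> Q 0 \<and> (\<forall>i<length c. Q (Suc i))" for Q
    by (auto simp: less_Suc_eq_0_disj)
  then show ?thesis
    unfolding code_at_def by auto
qed

lemma code_at_append [simp]:
  "code_at Pr p (a @ b) \<longleftrightarrow> code_at Pr p a \<and> code_at Pr (p + length a) b"
  by (induction a arbitrary: p) auto

text \<open>Bounding the number of steps instead of fixing it lets branches of different length
  share one bound.\<close>

definition reach :: "nat list \<Rightarrow> program \<Rightarrow> nat \<Rightarrow> config \<Rightarrow> config \<Rightarrow> bool" where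
  "reach xs Pr T s s' \<longleftrightarrow> (\<exists>k\<le>T. (step Pr xs ^^ k) s = s')"

lemma reach_refl: "reach xs Pr T s s"
  unfolding reach_def by (rule exI[of _ 0]) auto

lemma reach_trans: "reach xs Pr T s s' \<Longrightarrow> reach xs Pr T' s' s'' \<Longrightarrow> reach xs Pr (T + T') s s''"
  unfolding reach_def
proof (elim exE conjE)
  fix k k' assume "k \<le> T" "(step Pr xs ^^ k) s = s'" "k' \<le> T'" "(step Pr xs ^^ k') s' = s''"
  then show "\<exists>k\<le>T + T'. (step Pr xs ^^ k) s = s''"
    by (intro exI[of _ "k' + k"]) (auto simp: funpow_add)
qed

lemma reach_mono: "reach xs Pr T s s' \<Longrightarrow> T \<le> T' \<Longrightarrow> reach xs Pr T' s s'"
  unfolding reach_def by (elim exE conjE) (metis order_trans)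

fun straight :: "instr \<Rightarrow> bool" where
  "straight (JumpPos i l) = False" | "straight _ = True"

primrec exec_list :: "nat list \<Rightarrow> instr list \<Rightarrow> (nat \<Rightarrow> nat) \<Rightarrow> (nat \<Rightarrow> nat)" where
  "exec_list xs [] R = R" | "exec_list xs (i # c) R = exec_list xs c (snd (exec_instr xs i (0, R)))"

lemma exec_list_append: "exec_list xs (a @ b) R = exec_list xs b (exec_list xs a R)"
  by (induction a arbitrary: R) auto

text \<open>Without jumps the effect on the registers does not depend on the position of the code,
  so it can be computed by rewriting with \<open>exec_list\<close>.\<close>

lemma reach_straight:
  "code_at Pr p c \<Longrightarrow> \<forall>i\<in>set c. straight i \<Longrightarrow> reach xs Pr (length c) (p, R) (p + length c, exec_list xs c R)"
proof (induction c arbitrary: p R)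
  case Nil then show ?case by (simp add: reach_refl)
next
  case (Cons i c)
  have "straight i" using Cons.prems by auto
  then have "exec_instr xs i (p, R) = (Suc p, snd (exec_instr xs i (0, R)))"
    by (cases i) auto
  then have "reach xs Pr 1 (p, R) (Suc p, snd (exec_instr xs i (0, R)))"
    unfolding reach_def using Cons.prems by (intro exI[of _ 1]) (auto simp: step_def halted_def)
  from reach_trans[OF this Cons.IH] show ?case using Cons.prems by auto
qed

lemma reach_straight_len:
  "code_at Pr p c \<Longrightarrow> \<forall>i\<in>set c. straight i \<Longrightarrow> length c = k \<Longrightarrow> reach xs Pr k (p, R) (p + k, exec_list xs c R)"
  using reach_straight by blast

lemma reach_jump:
  "code_at Pr p [JumpPos i l] \<Longrightarrow> reach xs Pr 1 (p, R) (if R i > 0 then l else Suc p, R)"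
  unfolding reach_def by (intro exI[of _ 1]) (auto simp: step_def halted_def)

lemma reach_Jump:
  "code_at Pr p (jump l) \<Longrightarrow> reach xs Pr 2 (p, R) (l, R(2 := 1))"
proof -
  assume a: "code_at Pr p (jump l)"
  have "reach xs Pr 1 (p, R) (Suc p, R(2 := 1))"
    using reach_straight[of Pr p "[Const 2 1]" xs R] a by (auto simp: jump_def)
  moreover have "reach xs Pr 1 (Suc p, R(2 := 1)) (l, R(2 := 1))"
    using reach_jump[of Pr "Suc p" 2 l xs "R(2 := 1)"] a by (auto simp: jump_def)
  ultimately show ?thesis using reach_trans[of xs Pr 1 _ _ 1] by (metis one_add_one)
qed

section \<open>Values on the heap\<close>

primrec rep :: "nat \<Rightarrow> nat \<Rightarrow> (nat \<Rightarrow> nat) \<Rightarrow> nat \<Rightarrow> val \<Rightarrow> bool" where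
  "rep W h R a (NV k) = (W \<le> a \<and> a + 3 \<le> h \<and> R a = k \<and> R (a + 1) = W \<and> R (a + 2) = W)"
| "rep W h R a (PV u w) =
     (W \<le> a \<and> a + 3 \<le> h \<and> R a = 1 \<and> rep W h R (R (a + 1)) u \<and> rep W h R (R (a + 2)) w)"

definition heap_ok :: "nat \<Rightarrow> nat \<Rightarrow> (nat \<Rightarrow> nat) \<Rightarrow> bool" where
  "heap_ok W h R \<longleftrightarrow> 6 \<le> W \<and> R 1 = h \<and> rep W h R W (NV 0)"

definition env_ok :: "nat \<Rightarrow> nat \<Rightarrow> (nat \<Rightarrow> nat) \<Rightarrow> nat list \<Rightarrow> val list \<Rightarrow> nat \<Rightarrow> bool" where
  "env_ok W h R \<rho> env t \<longleftrightarrow> length \<rho> = length env \<and>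
     (\<forall>i<length \<rho>. 6 \<le> \<rho> ! i \<and> \<rho> ! i < t \<and> rep W h R (R (\<rho> ! i)) (env ! i))"

text \<open>The frame condition of compiled code. Heap cells are never overwritten, so every value
  represented before is still represented afterwards, and sharing of cells is safe.\<close>

definition keeps :: "nat \<Rightarrow> nat \<Rightarrow> nat \<Rightarrow> (nat \<Rightarrow> nat) \<Rightarrow> nat \<Rightarrow> (nat \<Rightarrow> nat) \<Rightarrow> bool" where
  "keeps W t h R h' R' \<longleftrightarrow> h \<le> h' \<and> heap_ok W h' R' \<and>
     (\<forall>r. 6 \<le> r \<longrightarrow> r < t \<longrightarrow> R' r = R r) \<and> (\<forall>a. W \<le> a \<longrightarrow> a < h \<longrightarrow> R' a = R a)"

lemma rep_mono:
  "rep W h R a v \<Longrightarrow> h \<le> h' \<Longrightarrow> (\<And>a. W \<le> a \<Longrightarrow> a < h \<Longrightarrow> R' a = R a) \<Longrightarrow> rep W h' R' a v"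
proof (induction v arbitrary: a)
  case (PV u w)
  then have "R' a = R a" "R' (a + 1) = R (a + 1)" "R' (a + 2) = R (a + 2)" by auto
  then show ?case using PV by auto
qed auto

lemma rep_range: "rep W h R a v \<Longrightarrow> W \<le> a \<and> a + 3 \<le> h"
  by (cases v) auto

lemma rep_nv: "rep W h R a v \<Longrightarrow> R a = nv v"
  by (cases v) auto

lemma rep_fstv: "rep W h R W (NV 0) \<Longrightarrow> rep W h R a v \<Longrightarrow> rep W h R (R (a + 1)) (fstv v)"
  by (cases v) simp_all

lemma rep_sndv: "rep W h R W (NV 0) \<Longrightarrow> rep W h R a v \<Longrightarrow> rep W h R (R (a + 2)) (sndv v)"
  by (cases v) simp_all

lemma keeps_rep: "keeps W t h R h' R' \<Longrightarrow> rep W h R a v \<Longrightarrow> rep W h' R' a v"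
  unfolding keeps_def by (auto intro: rep_mono)

lemma keeps_reg: "keeps W t h R h' R' \<Longrightarrow> 6 \<le> r \<Longrightarrow> r < t \<Longrightarrow> R' r = R r"
  unfolding keeps_def by auto

lemma keeps_heap_ok: "keeps W t h R h' R' \<Longrightarrow> heap_ok W h' R'"
  unfolding keeps_def by auto

lemma keeps_env_ok: "keeps W t' h R h' R' \<Longrightarrow> t \<le> t' \<Longrightarrow> env_ok W h R \<rho> env t \<Longrightarrow> env_ok W h' R' \<rho> env t"
  unfolding env_ok_def using keeps_rep keeps_reg by fastforce

lemma keeps_trans:
  "keeps W t1 h R h' R' \<Longrightarrow> keeps W t2 h' R' h'' R'' \<Longrightarrow> t \<le> t1 \<Longrightarrow> t \<le> t2 \<Longrightarrow> keeps W t h R h'' R''"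
  unfolding keeps_def by auto

lemma keeps_upd:
  "heap_ok W h R \<Longrightarrow> (\<And>r. 6 \<le> r \<Longrightarrow> r < t \<Longrightarrow> R' r = R r) \<Longrightarrow> (\<And>a. W \<le> a \<Longrightarrow> a < h \<Longrightarrow> R' a = R a) \<Longrightarrow>
    R' 1 = R 1 \<Longrightarrow> keeps W t h R h R'"
  unfolding keeps_def heap_ok_def using rep_mono[of W h R W "NV 0" h R'] by auto

lemma env_ok_snoc:
  "env_ok W h R \<rho> env t \<Longrightarrow> t \<le> r \<Longrightarrow> r < t' \<Longrightarrow> 6 \<le> r \<Longrightarrow> rep W h R (R r) v \<Longrightarrow>
    env_ok W h R (\<rho> @ [r]) (env @ [v]) t'"
  unfolding env_ok_def by (auto simp: nth_append less_Suc_eq)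

lemma alloc_correct:
  fixes xs
  assumes "heap_ok W h R" "6 \<le> t" "t < W"
  defines "R' \<equiv> exec_list xs (alloc t) R"
  shows "keeps W t h R (h + 3) R'" "R' t = h" "R' h = R 3" "R' (h + 1) = R 4" "R' (h + 2) = R 5"
    "\<And>r. 6 \<le> r \<Longrightarrow> r \<noteq> t \<Longrightarrow> r < W \<Longrightarrow> R' r = R r" "R' 1 = h + 3"
proof -
  have h: "R 1 = h" "W + 3 \<le> h" "6 \<le> W" and z: "R W = 0" "R (W + 1) = W" "R (W + 2) = W"
    using assms(1) by (auto simp: heap_ok_def)
  \<comment> \<open>The pointer has been advanced by three; subtracting 3 recovers the address of
    the new cell.\<close>
  have R': "R' = R(h := R 3, h + 1 := R 4, h + 2 := R 5, 1 := h + 3, 2 := 3, t := h)"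
    unfolding R'_def alloc_def using h assms(2,3) by (auto simp: fun_eq_iff)
  show "R' t = h" "R' h = R 3" "R' (h + 1) = R 4" "R' (h + 2) = R 5"
    "\<And>r. 6 \<le> r \<Longrightarrow> r \<noteq> t \<Longrightarrow> r < W \<Longrightarrow> R' r = R r" "R' 1 = h + 3"
    unfolding R' using h assms(2,3) by auto
  show "keeps W t h R (h + 3) R'"
    unfolding keeps_def heap_ok_def R' using h z assms(2,3) by auto
qed


lemma length_alloc [simp]: "length (alloc t) = 9"
  by (simp add: alloc_def)

lemma straight_alloc: "\<forall>i\<in>set (alloc t). straight i"
  by (simp add: alloc_def)

declare rep.simps [simp del]

lemma regs_pos: "0 < regs e"
  by (induction e) auto

lemma reach_move:
  assumes "code_at Pr p (move i j)" "heap_ok W h R" "6 \<le> i" "i < W" "6 \<le> j"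
  obtains R' where "reach xs Pr 2 (p, R) (p + 2, R')" "keeps W i h R h R'" "R' i = R j"
    "\<And>r. 6 \<le> r \<Longrightarrow> r \<noteq> i \<Longrightarrow> R' r = R r"
proof
  let ?R = "exec_list xs (move i j) R"
  show "reach xs Pr 2 (p, R) (p + 2, ?R)"
    using reach_straight[OF assms(1), of xs R] by (simp add: move_def numeral_2_eq_2)
  show "keeps W i h R h ?R"
    using assms by (intro keeps_upd) (auto simp: move_def)
  show "?R i = R j" "\<And>r. 6 \<le> r \<Longrightarrow> r \<noteq> i \<Longrightarrow> ?R r = R r"
    using assms by (auto simp: move_def)
qed

lemma reach_alloc_num:
  assumes c: "code_at Pr p (c @ alloc t)" and st: "\<forall>i\<in>set c. straight i" and m: "heap_ok W h R"
    and t: "6 \<le> t" "t < W" and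
    R1: "\<And>r. r \<notin> {2,3,4,5} \<Longrightarrow> exec_list xs c R r = R r" and
    k: "exec_list xs c R 3 = k" "exec_list xs c R 4 = W" "exec_list xs c R 5 = W"
  obtains R' where "reach xs Pr (length c + 9) (p, R) (p + length c + 9, R')"
    "keeps W t h R (h + 3) R'" "rep W (h + 3) R' (R' t) (NV k)"
    "\<And>r. 6 \<le> r \<Longrightarrow> r \<noteq> t \<Longrightarrow> r < W \<Longrightarrow> R' r = R r"
proof -
  let ?R1 = "exec_list xs c R"
  have W: "6 \<le> W" "W + 3 \<le> h" using m rep_range by (auto simp: heap_ok_def)
  have k1: "keeps W t h R h ?R1"
    using m W R1 by (intro keeps_upd) auto
  note al = alloc_correct[OF keeps_heap_ok[OF k1] t, where xs = xs]
  show ?thesis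
  proof
    show "reach xs Pr (length c + 9) (p, R) (p + length c + 9, exec_list xs (c @ alloc t) R)"
      using reach_straight[OF c, of xs R] st straight_alloc by (auto simp: add.assoc)
    show "keeps W t h R (h + 3) (exec_list xs (c @ alloc t) R)"
      using keeps_trans[OF k1 al(1)] by (simp add: exec_list_append)
    show "rep W (h + 3) (exec_list xs (c @ alloc t) R) (exec_list xs (c @ alloc t) R t) (NV k)"
      using al(2-5) k W by (simp add: exec_list_append rep.simps)
    show "exec_list xs (c @ alloc t) R r = R r" if "6 \<le> r" "r \<noteq> t" "r < W" for r
      using al(6)[of r] that R1[of r] by (simp add: exec_list_append)
  qed
qed

text \<open>Time bound, frame condition and result are proved together, since the result of one
  subexpression must survive the evaluation of the next one. Each loop needs an inner induction on
  the rounds that are left.\<close>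

lemma comp_code_correct:
  "code_at Pr p (comp_code W e \<rho> t p) \<Longrightarrow> heap_ok W h R \<Longrightarrow> env_ok W h R \<rho> env t \<Longrightarrow> 6 \<le> t \<Longrightarrow>
   t + regs e \<le> W \<Longrightarrow> scoped (length env) e \<Longrightarrow> bounded_loops e B xs env \<Longrightarrow>
   \<exists>h' R'. reach xs Pr (steps_bound B e) (p, R) (p + code_len e, R') \<and> keeps W t h R h' R' \<and>
     rep W h' R' (R' t) (eval e xs env)"
proof (induction e arbitrary: p \<rho> t h R env)
  case (Var i)
  from Var.prems have i: "i < length \<rho>" "6 \<le> \<rho> ! i" "rep W h R (R (\<rho> ! i)) (env ! i)"
    by (auto simp: env_ok_def)
  from Var.prems have "code_at Pr p (move t (\<rho> ! i))" by simp
  from reach_move[OF this Var.prems(2,4) _ i(2)] Var.prems(5) obtain R' where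
    "reach xs Pr 2 (p, R) (p + 2, R')" "keeps W t h R h R'" "R' t = R (\<rho> ! i)"
    by (metis less_eq_Suc_le Suc_eq_plus1 regs.simps(1))
  then show ?case using i keeps_rep by fastforce
next
  case (Num c)
  have "code_at Pr p ([Const 3 c, Const 4 W, Const 5 W] @ alloc t)" using Num.prems by simp
  from reach_alloc_num[OF this _ Num.prems(2,4), of xs c] Num.prems(5) obtain R' where
    "reach xs Pr (3 + 9) (p, R) (p + 3 + 9, R')" "keeps W t h R (h + 3) R'" "rep W (h + 3) R' (R' t) (NV c)"
    by (auto simp: numeral_eq_Suc)
  then show ?case by (auto simp: add.assoc)
next
  case (RdE a)
  from RdE.prems have pr: "code_at Pr p (comp_code W a \<rho> t p)" "t + regs a \<le> W" "scoped (length env) a" "bounded_loops a B xs env" by auto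
  from RdE.IH[OF pr(1) RdE.prems(2-4) pr(2-4)] obtain h1 R1 where
    1: "reach xs Pr (steps_bound B a) (p, R) (p + code_len a, R1)" "keeps W t h R h1 R1"
     "rep W h1 R1 (R1 t) (eval a xs env)" by blast
  have W: "6 \<le> W" "t < W" using keeps_heap_ok[OF 1(2)] RdE.prems(5) regs_pos[of a] by (auto simp: heap_ok_def)
  have c: "code_at Pr (p + code_len a) ([Load 3 t, Read 3 3, Const 4 W, Const 5 W] @ alloc t)"
    using RdE.prems(1) by simp
  have "exec_list xs [Load 3 t, Read 3 3, Const 4 W, Const 5 W] R1 3 = read_at xs (nv (eval a xs env))"
    using rep_nv[OF 1(3)] RdE.prems(4) by (simp add: read_at_def)
  from reach_alloc_num[OF c _ keeps_heap_ok[OF 1(2)] RdE.prems(4) W(2) _ this] obtain R2 where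
    2: "reach xs Pr (4 + 9) (p + code_len a, R1) (p + code_len a + 4 + 9, R2)" "keeps W t h1 R1 (h1 + 3) R2"
    "rep W (h1 + 3) R2 (R2 t) (eval (RdE a) xs env)"
    by (auto simp: numeral_eq_Suc)
  show ?case using reach_trans[OF 1(1) 2(1)] keeps_trans[OF 1(2) 2(2)] 2(3) by (auto simp: add.assoc)
next
  case (FstE a)
  from FstE.prems have pr: "code_at Pr p (comp_code W a \<rho> t p)" "t + regs a \<le> W" "scoped (length env) a" "bounded_loops a B xs env" by auto
  from FstE.IH[OF pr(1) FstE.prems(2-4) pr(2-4)] obtain h1 R1 where
    1: "reach xs Pr (steps_bound B a) (p, R) (p + code_len a, R1)" "keeps W t h R h1 R1"
     "rep W h1 R1 (R1 t) (eval a xs env)" by blast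
  have W: "6 \<le> W" "t < W" and z: "rep W h1 R1 W (NV 0)"
    using keeps_heap_ok[OF 1(2)] FstE.prems(5) regs_pos[of a] by (auto simp: heap_ok_def)
  let ?c = "[Const 2 1, Add 2 t 2, Load t 2]"
  let ?R = "exec_list xs ?c R1"
  have c: "code_at Pr (p + code_len a) ?c"
    using FstE.prems(1) by simp
  have r: "reach xs Pr 3 (p + code_len a, R1) (p + code_len a + 3, ?R)"
    by (rule reach_straight_len[OF c]) auto
  have k: "keeps W t h1 R1 h1 ?R"
    using W FstE.prems(4) keeps_heap_ok[OF 1(2)] by (intro keeps_upd) auto
  have "?R t = R1 (R1 t + 1)" using FstE.prems(4) rep_range[OF 1(3)] W by auto
  then have "rep W h1 ?R (?R t) (eval (FstE a) xs env)"
    using keeps_rep[OF k rep_fstv[OF z 1(3)]] by simp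
  then show ?case using reach_trans[OF 1(1) r] keeps_trans[OF 1(2) k order_refl order_refl]
    by (intro exI[of _ h1] exI[of _ ?R]) (simp add: add.assoc del: exec_list.simps)
next
  case (SndE a)
  from SndE.prems have pr: "code_at Pr p (comp_code W a \<rho> t p)" "t + regs a \<le> W" "scoped (length env) a" "bounded_loops a B xs env" by auto
  from SndE.IH[OF pr(1) SndE.prems(2-4) pr(2-4)] obtain h1 R1 where
    1: "reach xs Pr (steps_bound B a) (p, R) (p + code_len a, R1)" "keeps W t h R h1 R1"
     "rep W h1 R1 (R1 t) (eval a xs env)" by blast
  have W: "6 \<le> W" "t < W" and z: "rep W h1 R1 W (NV 0)"
    using keeps_heap_ok[OF 1(2)] SndE.prems(5) regs_pos[of a] by (auto simp: heap_ok_def)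
  let ?c = "[Const 2 2, Add 2 t 2, Load t 2]"
  let ?R = "exec_list xs ?c R1"
  have c: "code_at Pr (p + code_len a) ?c"
    using SndE.prems(1) by simp
  have r: "reach xs Pr 3 (p + code_len a, R1) (p + code_len a + 3, ?R)"
    by (rule reach_straight_len[OF c]) auto
  have k: "keeps W t h1 R1 h1 ?R"
    using W SndE.prems(4) keeps_heap_ok[OF 1(2)] by (intro keeps_upd) auto
  have "?R t = R1 (R1 t + 2)" using SndE.prems(4) rep_range[OF 1(3)] W by auto
  then have "rep W h1 ?R (?R t) (eval (SndE a) xs env)"
    using keeps_rep[OF k rep_sndv[OF z 1(3)]] by simp
  then show ?case using reach_trans[OF 1(1) r] keeps_trans[OF 1(2) k order_refl order_refl]
    by (intro exI[of _ h1] exI[of _ ?R]) (simp add: add.assoc del: exec_list.simps)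
next
  case (AddE a b)
  from AddE.prems have pr: "code_at Pr p (comp_code W a \<rho> t p)" "t + regs a \<le> W" "scoped (length env) a" "bounded_loops a B xs env"
    "code_at Pr (p + code_len a) (comp_code W b \<rho> (t + 1) (p + code_len a))" "t + 1 + regs b \<le> W" "scoped (length env) b" "bounded_loops b B xs env" by auto
  from AddE.IH(1)[OF pr(1) AddE.prems(2-4) pr(2-4)] obtain h1 R1 where
    1: "reach xs Pr (steps_bound B a) (p, R) (p + code_len a, R1)" "keeps W t h R h1 R1"
     "rep W h1 R1 (R1 t) (eval a xs env)" by blast
  have e1: "env_ok W h1 R1 \<rho> env (t + 1)"
    using keeps_env_ok[OF 1(2) order_refl AddE.prems(3)] by (auto simp: env_ok_def less_Suc_eq)
  from AddE.IH(2)[OF pr(5) keeps_heap_ok[OF 1(2)] e1 _ pr(6-8)] AddE.prems(4) obtain h2 R2 where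
    2: "reach xs Pr (steps_bound B b) (p + code_len a, R1) (p + code_len a + code_len b, R2)" "keeps W (t + 1) h1 R1 h2 R2"
     "rep W h2 R2 (R2 (t + 1)) (eval b xs env)" by auto
  have a2: "rep W h2 R2 (R2 t) (eval a xs env)"
    using keeps_rep[OF 2(2) 1(3)] keeps_reg[OF 2(2)] AddE.prems(4) by simp
  have W: "6 \<le> W" "t < W" using keeps_heap_ok[OF 1(2)] AddE.prems(5) by (auto simp: heap_ok_def)
  let ?c = "[Load 3 t, Load 4 (t + 1), Add 3 3 4, Const 4 W, Const 5 W]"
  have c: "code_at Pr (p + code_len a + code_len b) (?c @ alloc t)"
    using AddE.prems(1) by (simp add: add.assoc)
  have "exec_list xs ?c R2 3 = nv (eval a xs env) + nv (eval b xs env)"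
    using rep_nv[OF a2] rep_nv[OF 2(3)] rep_range[OF 2(3)] W AddE.prems(4) by simp
  from reach_alloc_num[OF c _ keeps_heap_ok[OF 2(2)] AddE.prems(4) W(2) _ this] obtain R3 where
    3: "reach xs Pr (5 + 9) (p + code_len a + code_len b, R2) (p + code_len a + code_len b + 5 + 9, R3)" "keeps W t h2 R2 (h2 + 3) R3"
    "rep W (h2 + 3) R3 (R3 t) (eval (AddE a b) xs env)"
    by (auto simp: numeral_eq_Suc)
  show ?case using reach_trans[OF reach_trans[OF 1(1) 2(1)] 3(1)]
     keeps_trans[OF keeps_trans[OF 1(2) 2(2)] 3(2), of t t] 3(3) by (auto simp: add.assoc)
next
  case (SubE a b)
  from SubE.prems have pr: "code_at Pr p (comp_code W a \<rho> t p)" "t + regs a \<le> W" "scoped (length env) a" "bounded_loops a B xs env"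
    "code_at Pr (p + code_len a) (comp_code W b \<rho> (t + 1) (p + code_len a))" "t + 1 + regs b \<le> W" "scoped (length env) b" "bounded_loops b B xs env" by auto
  from SubE.IH(1)[OF pr(1) SubE.prems(2-4) pr(2-4)] obtain h1 R1 where
    1: "reach xs Pr (steps_bound B a) (p, R) (p + code_len a, R1)" "keeps W t h R h1 R1"
     "rep W h1 R1 (R1 t) (eval a xs env)" by blast
  have e1: "env_ok W h1 R1 \<rho> env (t + 1)"
    using keeps_env_ok[OF 1(2) order_refl SubE.prems(3)] by (auto simp: env_ok_def less_Suc_eq)
  from SubE.IH(2)[OF pr(5) keeps_heap_ok[OF 1(2)] e1 _ pr(6-8)] SubE.prems(4) obtain h2 R2 where
    2: "reach xs Pr (steps_bound B b) (p + code_len a, R1) (p + code_len a + code_len b, R2)" "keeps W (t + 1) h1 R1 h2 R2"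
     "rep W h2 R2 (R2 (t + 1)) (eval b xs env)" by auto
  have a2: "rep W h2 R2 (R2 t) (eval a xs env)"
    using keeps_rep[OF 2(2) 1(3)] keeps_reg[OF 2(2)] SubE.prems(4) by simp
  have W: "6 \<le> W" "t < W" using keeps_heap_ok[OF 1(2)] SubE.prems(5) by (auto simp: heap_ok_def)
  let ?c = "[Load 3 t, Load 4 (t + 1), Sub 3 3 4, Const 4 W, Const 5 W]"
  have c: "code_at Pr (p + code_len a + code_len b) (?c @ alloc t)"
    using SubE.prems(1) by (simp add: add.assoc)
  have "exec_list xs ?c R2 3 = nv (eval a xs env) - nv (eval b xs env)"
    using rep_nv[OF a2] rep_nv[OF 2(3)] rep_range[OF 2(3)] W SubE.prems(4) by simp
  from reach_alloc_num[OF c _ keeps_heap_ok[OF 2(2)] SubE.prems(4) W(2) _ this] obtain R3 where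
    3: "reach xs Pr (5 + 9) (p + code_len a + code_len b, R2) (p + code_len a + code_len b + 5 + 9, R3)" "keeps W t h2 R2 (h2 + 3) R3"
    "rep W (h2 + 3) R3 (R3 t) (eval (SubE a b) xs env)"
    by (auto simp: numeral_eq_Suc)
  show ?case using reach_trans[OF reach_trans[OF 1(1) 2(1)] 3(1)]
     keeps_trans[OF keeps_trans[OF 1(2) 2(2)] 3(2), of t t] 3(3) by (auto simp: add.assoc)
next
  case (PairE a b)
  from PairE.prems have pr: "code_at Pr p (comp_code W a \<rho> t p)" "t + regs a \<le> W" "scoped (length env) a" "bounded_loops a B xs env"
    "code_at Pr (p + code_len a) (comp_code W b \<rho> (t + 1) (p + code_len a))" "t + 1 + regs b \<le> W" "scoped (length env) b" "bounded_loops b B xs env" by auto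
  from PairE.IH(1)[OF pr(1) PairE.prems(2-4) pr(2-4)] obtain h1 R1 where
    1: "reach xs Pr (steps_bound B a) (p, R) (p + code_len a, R1)" "keeps W t h R h1 R1"
     "rep W h1 R1 (R1 t) (eval a xs env)" by blast
  have e1: "env_ok W h1 R1 \<rho> env (t + 1)"
    using keeps_env_ok[OF 1(2) order_refl PairE.prems(3)] by (auto simp: env_ok_def less_Suc_eq)
  from PairE.IH(2)[OF pr(5) keeps_heap_ok[OF 1(2)] e1 _ pr(6-8)] PairE.prems(4) obtain h2 R2 where
    2: "reach xs Pr (steps_bound B b) (p + code_len a, R1) (p + code_len a + code_len b, R2)" "keeps W (t + 1) h1 R1 h2 R2"
     "rep W h2 R2 (R2 (t + 1)) (eval b xs env)" by auto
  have a2: "rep W h2 R2 (R2 t) (eval a xs env)"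
    using keeps_rep[OF 2(2) 1(3)] keeps_reg[OF 2(2)] PairE.prems(4) by simp
  have m2: "heap_ok W h2 R2" using keeps_heap_ok[OF 2(2)] .
  have W: "6 \<le> W" "t < W" "W + 3 \<le> h2" using m2 PairE.prems(5) rep_range by (auto simp: heap_ok_def)
  let ?c = "[Const 3 1, Const 2 0, Add 4 t 2, Add 5 (t + 1) 2, Const 2 0]"
  let ?R = "exec_list xs ?c R2"
  have c: "code_at Pr (p + code_len a + code_len b) (?c @ alloc t)"
    using PairE.prems(1) by (simp add: add.assoc)
  have k3: "keeps W t h2 R2 h2 ?R"
    using W PairE.prems(4) m2 by (intro keeps_upd) auto
  have v: "?R 3 = 1" "?R 4 = R2 t" "?R 5 = R2 (t + 1)" using PairE.prems(4) by auto
  note al = alloc_correct[OF keeps_heap_ok[OF k3] PairE.prems(4) W(2), where xs = xs]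
  let ?R4 = "exec_list xs (?c @ alloc t) R2"
  have k4: "keeps W t h2 R2 (h2 + 3) ?R4"
    using keeps_trans[OF k3 al(1), of t] by (simp only: exec_list_append)
  have r: "reach xs Pr 14 (p + code_len a + code_len b, R2) (p + code_len a + code_len b + 14, ?R4)"
    using reach_straight[OF c, of xs R2] straight_alloc by (auto simp: add.assoc)
  have "rep W (h2 + 3) ?R4 (?R4 t) (eval (PairE a b) xs env)"
    using al(2-5) v keeps_rep[OF k4 a2] keeps_rep[OF k4 2(3)] W
    unfolding exec_list_append[of xs ?c] by (simp add: rep.simps del: exec_list.simps)
  then show ?case using reach_trans[OF reach_trans[OF 1(1) 2(1)] r]
     keeps_trans[OF keeps_trans[OF 1(2) 2(2)] k4, of t t]
    by (intro exI[of _ "h2 + 3"] exI[of _ ?R4]) (simp add: add.assoc del: exec_list.simps)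
next
  case (IfE c a b)
  have L: "code_len c + (2 + (code_len b + (2 + code_len a))) = code_len (IfE c a b)" by simp
  from IfE.prems have pr: "code_at Pr p (comp_code W c \<rho> t p)" "t + regs c \<le> W" "scoped (length env) c" "bounded_loops c B xs env"
    "code_at Pr (p + code_len c) [Load 2 t]"
    "code_at Pr (p + code_len c + 1) [JumpPos 2 (p + code_len c + code_len b + 4)]"
    "code_at Pr (p + code_len c + 2) (comp_code W b \<rho> t (p + code_len c + 2))" "t + regs b \<le> W" "scoped (length env) b"
    "code_at Pr (p + code_len c + code_len b + 4) (comp_code W a \<rho> t (p + code_len c + code_len b + 4))" "t + regs a \<le> W" "scoped (length env) a"
    "code_at Pr (p + code_len c + 2 + code_len b) (jump (p + code_len c + code_len b + 4 + code_len a))"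
    by (auto simp: add_ac jump_def numeral_eq_Suc)
  from IfE.IH(1)[OF pr(1) IfE.prems(2-4) pr(2-4)] obtain h1 R1 where
    1: "reach xs Pr (steps_bound B c) (p, R) (p + code_len c, R1)" "keeps W t h R h1 R1"
     "rep W h1 R1 (R1 t) (eval c xs env)" by blast
  let ?R2 = "R1(2 := nv (eval c xs env))"
  have "reach xs Pr 1 (p + code_len c, R1) (p + code_len c + 1, ?R2)"
    using reach_straight[OF pr(5), of xs R1] rep_nv[OF 1(3)] by simp
  from reach_trans[OF this reach_jump[OF pr(6)]]
  have 2: "reach xs Pr 2 (p + code_len c, R1) (if nv (eval c xs env) > 0 then p + code_len c + code_len b + 4
     else p + code_len c + 2, ?R2)" by (auto simp: numeral_2_eq_2 split: if_splits)
  have W: "6 \<le> W" using keeps_heap_ok[OF 1(2)] by (auto simp: heap_ok_def)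
  have k2: "keeps W t h1 R1 h1 ?R2" using keeps_heap_ok[OF 1(2)] W by (intro keeps_upd) auto
  note k12 = keeps_trans[OF 1(2) k2 order_refl order_refl]
  note e2 = keeps_env_ok[OF k12 order_refl IfE.prems(3)]
  show ?case
  proof (cases "nv (eval c xs env) > 0")
    case True
    with IfE.prems have "bounded_loops a B xs env" by simp
    from IfE.IH(2)[OF pr(10) keeps_heap_ok[OF k2] e2 IfE.prems(4) pr(11,12) this] obtain h3 R3 where
      3: "reach xs Pr (steps_bound B a) (p + code_len c + code_len b + 4, ?R2) (p + code_len c + code_len b + 4 + code_len a, R3)"
      "keeps W t h1 ?R2 h3 R3" "rep W h3 R3 (R3 t) (eval a xs env)" by blast
    have "reach xs Pr (steps_bound B c + 2 + steps_bound B a) (p, R) (p + code_len c + code_len b + 4 + code_len a, R3)"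
      using reach_trans[OF reach_trans[OF 1(1) 2] , of "steps_bound B a"] 3(1) True by simp
    then have "reach xs Pr (steps_bound B (IfE c a b)) (p, R) (p + code_len (IfE c a b), R3)"
      by (rule reach_mono[THEN subst[of _ _ "\<lambda>q. reach xs Pr _ (p, R) (q, R3)", rotated]]) auto
    then show ?thesis using keeps_trans[OF k12 3(2)] 3(3) True by auto
  next
    case False
    with IfE.prems have "bounded_loops b B xs env" by simp
    from IfE.IH(3)[OF pr(7) keeps_heap_ok[OF k2] e2 IfE.prems(4) pr(8,9) this] obtain h3 R3 where
      3: "reach xs Pr (steps_bound B b) (p + code_len c + 2, ?R2) (p + code_len c + 2 + code_len b, R3)"
      "keeps W t h1 ?R2 h3 R3" "rep W h3 R3 (R3 t) (eval b xs env)" by blast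
    let ?R4 = "R3(2 := 1)"
    have k4: "keeps W t h3 R3 h3 ?R4" using keeps_heap_ok[OF 3(2)] W by (intro keeps_upd) auto
    have "reach xs Pr (steps_bound B c + 2 + steps_bound B b + 2) (p, R) (p + code_len c + code_len b + 4 + code_len a, ?R4)"
      using reach_trans[OF reach_trans[OF reach_trans[OF 1(1) 2], of "steps_bound B b"] reach_Jump[OF pr(13)]] 3(1) False by simp
    then have "reach xs Pr (steps_bound B (IfE c a b)) (p, R) (p + code_len (IfE c a b), ?R4)"
      by (rule reach_mono[THEN subst[of _ _ "\<lambda>q. reach xs Pr _ (p, R) (q, ?R4)", rotated]]) auto
    moreover have "?R4 t = R3 t" using IfE.prems(4) by simp
    moreover have "keeps W t h R h3 ?R4" using keeps_trans[OF keeps_trans[OF k12 3(2)] k4, of t t] by simp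
    moreover have "rep W h3 ?R4 (R3 t) (eval (IfE c a b) xs env)" using keeps_rep[OF k4 3(3)] False by simp
    ultimately show ?thesis by metis
  qed
next
  case (LetE a b)
  from LetE.prems have pr: "code_at Pr p (comp_code W a \<rho> t p)" "t + regs a \<le> W" "scoped (length env) a" "bounded_loops a B xs env"
    "code_at Pr (p + code_len a) (comp_code W b (\<rho> @ [t]) (t + 1) (p + code_len a))" "t + 1 + regs b \<le> W"
    "scoped (length (env @ [eval a xs env])) b" "bounded_loops b B xs (env @ [eval a xs env])"
    "code_at Pr (p + code_len a + code_len b) (move t (t + 1))" by (auto simp: add.assoc)
  from LetE.IH(1)[OF pr(1) LetE.prems(2-4) pr(2-4)] obtain h1 R1 where
    1: "reach xs Pr (steps_bound B a) (p, R) (p + code_len a, R1)" "keeps W t h R h1 R1"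
     "rep W h1 R1 (R1 t) (eval a xs env)" by blast
  have e1: "env_ok W h1 R1 (\<rho> @ [t]) (env @ [eval a xs env]) (t + 1)"
    using env_ok_snoc[OF keeps_env_ok[OF 1(2) order_refl LetE.prems(3)] order_refl _ LetE.prems(4) 1(3)] by simp
  from LetE.IH(2)[OF pr(5) keeps_heap_ok[OF 1(2)] e1 _ pr(6-8)] LetE.prems(4) obtain h2 R2 where
    2: "reach xs Pr (steps_bound B b) (p + code_len a, R1) (p + code_len a + code_len b, R2)" "keeps W (t + 1) h1 R1 h2 R2"
     "rep W h2 R2 (R2 (t + 1)) (eval (LetE a b) xs env)" by auto
  have W: "t < W" using LetE.prems(5) by simp
  have 6: "6 \<le> t + 1" using LetE.prems(4) by simp
  from reach_move[OF pr(9) keeps_heap_ok[OF 2(2)] LetE.prems(4) W 6] obtain R3 where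
    3: "reach xs Pr 2 (p + code_len a + code_len b, R2) (p + code_len a + code_len b + 2, R3)" "keeps W t h2 R2 h2 R3" "R3 t = R2 (t + 1)"
    by metis
  show ?case using reach_trans[OF reach_trans[OF 1(1) 2(1)] 3(1)]
     keeps_trans[OF keeps_trans[OF 1(2) 2(2)] 3(2), of t t] keeps_rep[OF 3(2) 2(3)] 3(3)
    by (intro exI[of _ h2] exI[of _ R3]) (simp add: add.assoc)
next
  case (CallE f a)
  from CallE.prems have pr: "code_at Pr p (comp_code W a \<rho> t p)" "t + regs a \<le> W" "scoped (length env) a" "bounded_loops a B xs env"
    "code_at Pr (p + code_len a) (comp_code W f [t] (t + 1) (p + code_len a))" "t + 1 + regs f \<le> W"
    "scoped (length [eval a xs env]) f" "bounded_loops f B xs [eval a xs env]"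
    "code_at Pr (p + code_len a + code_len f) (move t (t + 1))" by (auto simp: add.assoc)
  from CallE.IH(2)[OF pr(1) CallE.prems(2-4) pr(2-4)] obtain h1 R1 where
    1: "reach xs Pr (steps_bound B a) (p, R) (p + code_len a, R1)" "keeps W t h R h1 R1"
     "rep W h1 R1 (R1 t) (eval a xs env)" by blast
  have e1: "env_ok W h1 R1 [t] [eval a xs env] (t + 1)"
    using 1(3) CallE.prems(4) by (simp add: env_ok_def)
  from CallE.IH(1)[OF pr(5) keeps_heap_ok[OF 1(2)] e1 _ pr(6-8)] CallE.prems(4) obtain h2 R2 where
    2: "reach xs Pr (steps_bound B f) (p + code_len a, R1) (p + code_len a + code_len f, R2)" "keeps W (t + 1) h1 R1 h2 R2"
     "rep W h2 R2 (R2 (t + 1)) (eval (CallE f a) xs env)" by auto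
  have W: "t < W" using CallE.prems(5) by simp
  have 6: "6 \<le> t + 1" using CallE.prems(4) by simp
  from reach_move[OF pr(9) keeps_heap_ok[OF 2(2)] CallE.prems(4) W 6] obtain R3 where
    3: "reach xs Pr 2 (p + code_len a + code_len f, R2) (p + code_len a + code_len f + 2, R3)" "keeps W t h2 R2 h2 R3" "R3 t = R2 (t + 1)"
    by metis
  show ?case using reach_trans[OF reach_trans[OF 1(1) 2(1)] 3(1)]
     keeps_trans[OF keeps_trans[OF 1(2) 2(2)] 3(2), of t t] keeps_rep[OF 3(2) 2(3)] 3(3)
    by (intro exI[of _ h2] exI[of _ R3]) (simp add: add.assoc)
next
  case (ForE n i b)
  define q where "q = p + code_len n + code_len i + 2"
  define f where "f = (\<lambda>acc k. eval b xs (env @ [acc, NV k]))"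
  define g where "g = (\<lambda>acc k. bounded_loops b B xs (env @ [acc, NV k]))"
  from ForE.prems have pr: "code_at Pr p (comp_code W n \<rho> t p)" "t + regs n \<le> W" "scoped (length env) n" "bounded_loops n B xs env"
    "code_at Pr (p + code_len n) [Load t t]"
    "code_at Pr (p + code_len n + 1) (comp_code W i \<rho> (t + 1) (p + code_len n + 1))" "t + 1 + regs i \<le> W" "scoped (length env) i" "bounded_loops i B xs env"
    "code_at Pr (p + code_len n + 1 + code_len i) [Const (t + 3) 0]" by auto
  from ForE.prems have cb: "code_at Pr q [JumpPos t (q + 3)]" "code_at Pr (q + 1) (jump (q + code_len b + 23))"
    "code_at Pr (q + 3) ([Const 2 0, Add 3 (t + 3) 2, Const 4 W, Const 5 W] @ alloc (t + 2))"
    "code_at Pr (q + 16) (comp_code W b (\<rho> @ [t + 1, t + 2]) (t + 4) (q + 16))"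
    "code_at Pr (q + 16 + code_len b) (move (t + 1) (t + 4))"
    "code_at Pr (q + 18 + code_len b) [Const 2 1, Sub t t 2, Add (t + 3) (t + 3) 2]"
    "code_at Pr (q + 21 + code_len b) (jump q)"
    "code_at Pr (q + 23 + code_len b) (move t (t + 1))"
    by (auto simp: add_ac q_def jump_def move_def numeral_eq_Suc)
  have tW: "t + 4 + regs b \<le> W" "t < W" "t + 1 < W" "t + 2 < W" "t + 3 < W" using ForE.prems(5) by auto
  have t6: "6 \<le> t" "6 \<le> t + 1" "6 \<le> t + 2" "6 \<le> t + 4" using ForE.prems(4) by auto
  \<comment> \<open>The invariant holds at the loop head \<open>q\<close>. A round costs 1 + 13 + 2
    + 5 = 21 steps besides the body: test, boxing of the index, move of the accumulator, update and
    jump back. Leaving the loop costs 5.\<close>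
  have loop: "\<exists>h' R'. reach xs Pr (c * (steps_bound B b + 21) + 5) (q, R) (q + code_len b + 25, R') \<and>
     keeps W t h R h' R' \<and> rep W h' R' (R' t) (foldl f acc [k..<k + c])"
    if "heap_ok W h R" "env_ok W h R \<rho> env t" "R t = c" "R (t + 3) = k" "rep W h R (R (t + 1)) acc"
      "fold_all g f acc [k..<k + c]" for c k acc h R
    using that
  proof (induction c arbitrary: k acc h R)
    case 0
    have "reach xs Pr 1 (q, R) (q + 1, R)" using reach_jump[OF cb(1), of xs R] 0 by simp
    from reach_trans[OF this reach_Jump[OF cb(2)]]
    have r1: "reach xs Pr 3 (q, R) (q + code_len b + 23, R(2 := 1))" by (simp add: numeral_3_eq_3)
    have k1: "keeps W t h R h (R(2 := 1))" using 0 by (intro keeps_upd) (auto simp: heap_ok_def)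
    have "code_at Pr (q + code_len b + 23) (move t (t + 1))" using cb(8) by (simp add: add_ac)
    from reach_move[OF this keeps_heap_ok[OF k1] t6(1) tW(2) t6(2)] obtain R2 where
      2: "reach xs Pr 2 (q + code_len b + 23, R(2 := 1)) (q + code_len b + 23 + 2, R2)"
        "keeps W t h (R(2 := 1)) h R2" "R2 t = (R(2 := 1)) (t + 1)" by metis
    have k2: "keeps W t h R h R2" using keeps_trans[OF k1 2(2)] by simp
    have "R2 t = R (t + 1)" using 2(3) t6 by simp
    then have "rep W h R2 (R2 t) acc" using keeps_rep[OF k2 0(5)] by simp
    then show ?case using reach_trans[OF r1 2(1)] k2 by (auto simp: add_ac)
  next
    case (Suc c)
    have up: "[k..<k + Suc c] = k # [Suc k..<Suc k + c]" by (simp add: upt_conv_Cons del: upt_Suc)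
    have W6: "6 \<le> W" using Suc.prems(1) by (simp add: heap_ok_def)
    have r1: "reach xs Pr 1 (q, R) (q + 3, R)" using reach_jump[OF cb(1), of xs R] Suc.prems by simp
    let ?c = "[Const 2 0, Add 3 (t + 3) 2, Const 4 W, Const 5 W]"
    have "exec_list xs ?c R 3 = k" using Suc.prems(4) t6 by simp
    from reach_alloc_num[OF cb(3) _ Suc.prems(1) t6(3) tW(4) _ this] obtain R2 where
      2: "reach xs Pr (4 + 9) (q + 3, R) (q + 3 + 4 + 9, R2)" "keeps W (t + 2) h R (h + 3) R2"
       "rep W (h + 3) R2 (R2 (t + 2)) (NV k)" "\<And>r. 6 \<le> r \<Longrightarrow> r \<noteq> t + 2 \<Longrightarrow> r < W \<Longrightarrow> R2 r = R r"
      by (auto simp: numeral_eq_Suc)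
    have v2: "R2 t = Suc c" "R2 (t + 1) = R (t + 1)" "R2 (t + 3) = k"
      using 2(4)[of t] 2(4)[of "t+1"] 2(4)[of "t+3"] Suc.prems t6 tW by auto
    have a2: "rep W (h + 3) R2 (R2 (t + 1)) acc" using keeps_rep[OF 2(2) Suc.prems(5)] v2 by simp
    have "env_ok W (h + 3) R2 \<rho> env t" by (rule keeps_env_ok[OF 2(2) _ Suc.prems(2)]) simp
    from env_ok_snoc[OF this _ _ _ a2, of "t + 2"] t6
    have "env_ok W (h + 3) R2 (\<rho> @ [t + 1]) (env @ [acc]) (t + 2)" by simp
    from env_ok_snoc[OF this order_refl _ _ 2(3), of "t + 4"] t6
    have e2: "env_ok W (h + 3) R2 (\<rho> @ [t + 1, t + 2]) (env @ [acc, NV k]) (t + 4)" by simp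
    have "bounded_loops b B xs (env @ [acc, NV k])" using Suc.prems(6) unfolding up by (simp add: g_def)
    from ForE.IH(3)[OF cb(4) keeps_heap_ok[OF 2(2)] e2 t6(4) tW(1) _ this] ForE.prems(6) obtain h3 R3 where
      3: "reach xs Pr (steps_bound B b) (q + 16, R2) (q + 16 + code_len b, R3)" "keeps W (t + 4) (h + 3) R2 h3 R3"
       "rep W h3 R3 (R3 (t + 4)) (f acc k)" by (auto simp: f_def)
    have v3: "R3 t = Suc c" "R3 (t + 3) = k" using keeps_reg[OF 3(2), of t] keeps_reg[OF 3(2), of "t+3"] v2 t6 by auto
    from reach_move[OF cb(5) keeps_heap_ok[OF 3(2)] t6(2) tW(3) t6(4)] obtain R4 where
      4: "reach xs Pr 2 (q + 16 + code_len b, R3) (q + 16 + code_len b + 2, R4)"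
        "keeps W (t + 1) h3 R3 h3 R4" "R4 (t + 1) = R3 (t + 4)" "\<And>r. 6 \<le> r \<Longrightarrow> r \<noteq> t + 1 \<Longrightarrow> R4 r = R3 r" by metis
    have v4: "R4 t = Suc c" "R4 (t + 3) = k" using 4(4)[of t] 4(4)[of "t+3"] v3 t6 by auto
    let ?d = "[Const 2 1, Sub t t 2, Add (t + 3) (t + 3) 2]"
    let ?R5 = "(exec_list xs ?d R4)(2 := 1)"
    have r5: "reach xs Pr 3 (q + 18 + code_len b, R4) (q + 18 + code_len b + 3, exec_list xs ?d R4)"
      by (rule reach_straight_len[OF cb(6)]) auto
    have "q + 18 + code_len b + 3 = q + 21 + code_len b" by simp
    from reach_trans[OF r5[unfolded this] reach_Jump[OF cb(7)]]
    have r5: "reach xs Pr 5 (q + 18 + code_len b, R4) (q, ?R5)" by simp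
    have v5: "?R5 t = c" "?R5 (t + 3) = Suc k" "?R5 (t + 1) = R4 (t + 1)" using v4 t6 by auto
    have k5: "keeps W t h3 R4 h3 ?R5" using keeps_heap_ok[OF 4(2)] W6 t6 tW by (intro keeps_upd) auto
    have a5: "rep W h3 ?R5 (?R5 (t + 1)) (f acc k)"
      using keeps_rep[OF k5 keeps_rep[OF 4(2) 3(3)]] v5 4(3) by simp
    have k15: "keeps W t h R h3 ?R5"
      using keeps_trans[OF keeps_trans[OF keeps_trans[OF 2(2) 3(2), of t] 4(2), of t] k5, of t] by simp
    have "fold_all g f (f acc k) [Suc k..<Suc k + c]" using Suc.prems(6) unfolding up by simp
    from Suc.IH[OF keeps_heap_ok[OF k15] keeps_env_ok[OF k15 order_refl Suc.prems(2)] v5(1,2) a5 this]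
    obtain h6 R6 where 6: "reach xs Pr (c * (steps_bound B b + 21) + 5) (q, ?R5) (q + code_len b + 25, R6)"
       "keeps W t h3 ?R5 h6 R6" "rep W h6 R6 (R6 t) (foldl f (f acc k) [Suc k..<Suc k + c])" by blast
    have "q + 3 + 4 + 9 = q + 16" "q + 16 + code_len b + 2 = q + 18 + code_len b" by auto
    note eqs = this
    have "reach xs Pr (1 + (4 + 9) + steps_bound B b + 2 + 5 + (c * (steps_bound B b + 21) + 5)) (q, R) (q + code_len b + 25, R6)"
      by (rule reach_trans[OF reach_trans[OF reach_trans[OF reach_trans[OF reach_trans[OF r1 2(1)[unfolded eqs]] 3(1)] 4(1)[unfolded eqs]] r5] 6(1)])
    then have "reach xs Pr (Suc c * (steps_bound B b + 21) + 5) (q, R) (q + code_len b + 25, R6)"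
      by (rule reach_mono) simp
    then show ?case using keeps_trans[OF k15 6(2), of t] 6(3) unfolding up
      by (intro exI[of _ h6] exI[of _ R6]) simp
  qed
  from ForE.IH(1)[OF pr(1) ForE.prems(2-4) pr(2-4)] obtain h1 R1 where
    1: "reach xs Pr (steps_bound B n) (p, R) (p + code_len n, R1)" "keeps W t h R h1 R1"
     "rep W h1 R1 (R1 t) (eval n xs env)" by blast
  let ?R2 = "R1(t := nv (eval n xs env))"
  have r2: "reach xs Pr 1 (p + code_len n, R1) (p + code_len n + 1, ?R2)"
    using reach_straight[OF pr(5), of xs R1] rep_nv[OF 1(3)] by simp
  have k2: "keeps W t h1 R1 h1 ?R2" using keeps_heap_ok[OF 1(2)] tW t6 by (intro keeps_upd) auto
  have k12: "keeps W t h R h1 ?R2" using keeps_trans[OF 1(2) k2] by simp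
  have e2: "env_ok W h1 ?R2 \<rho> env (t + 1)"
    using keeps_env_ok[OF k12 order_refl ForE.prems(3)] by (auto simp: env_ok_def less_Suc_eq)
  from ForE.IH(2)[OF pr(6) keeps_heap_ok[OF k2] e2 t6(2) pr(7-9)] obtain h3 R3 where
    3: "reach xs Pr (steps_bound B i) (p + code_len n + 1, ?R2) (p + code_len n + 1 + code_len i, R3)" "keeps W (t + 1) h1 ?R2 h3 R3"
     "rep W h3 R3 (R3 (t + 1)) (eval i xs env)" by blast
  have v3: "R3 t = nv (eval n xs env)" using keeps_reg[OF 3(2), of t] t6 by simp
  let ?R4 = "R3(t + 3 := 0)"
  have "p + code_len n + 1 + code_len i + 1 = q" by (simp add: q_def)
  then have r4: "reach xs Pr 1 (p + code_len n + 1 + code_len i, R3) (q, ?R4)"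
    using reach_straight[OF pr(10), of xs R3] by simp
  have k4: "keeps W (t + 1) h3 R3 h3 ?R4" using keeps_heap_ok[OF 3(2)] tW t6 by (intro keeps_upd) auto
  have k14: "keeps W t h R h3 ?R4"
    using keeps_trans[OF keeps_trans[OF k12 3(2), of t] k4, of t] by simp
  have a4: "rep W h3 ?R4 (?R4 (t + 1)) (eval i xs env)" using keeps_rep[OF k4 3(3)] by simp
  let ?c = "nv (eval n xs env)"
  have B: "?c \<le> B" "fold_all g f (eval i xs env) [0..<0 + ?c]"
    using ForE.prems(7) by (auto simp: f_def g_def)
  from loop[OF keeps_heap_ok[OF k14] keeps_env_ok[OF k14 order_refl ForE.prems(3)] _ _ a4 B(2)] v3
  obtain h5 R5 where 5: "reach xs Pr (?c * (steps_bound B b + 21) + 5) (q, ?R4) (q + code_len b + 25, R5)"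
    "keeps W t h3 ?R4 h5 R5" "rep W h5 R5 (R5 t) (foldl f (eval i xs env) [0..<0 + ?c])" by auto
  have "reach xs Pr (steps_bound B n + 1 + steps_bound B i + 1 + (?c * (steps_bound B b + 21) + 5)) (p, R) (q + code_len b + 25, R5)"
    by (rule reach_trans[OF reach_trans[OF reach_trans[OF reach_trans[OF 1(1) r2] 3(1)] r4] 5(1)])
  moreover have "?c * (steps_bound B b + 21) \<le> B * (steps_bound B b + 21)" using B(1) by (rule mult_right_mono) simp
  moreover have "q + code_len b + 25 = p + code_len (ForE n i b)" by (simp add: q_def)
  ultimately have "reach xs Pr (steps_bound B (ForE n i b)) (p, R) (p + code_len (ForE n i b), R5)"
    using reach_mono[of xs Pr _ _ _ "steps_bound B (ForE n i b)"] by (simp del: code_len.simps)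
  moreover have "eval (ForE n i b) xs env = foldl f (eval i xs env) [0..<0 + ?c]" by (simp add: f_def)
  ultimately show ?case using keeps_trans[OF k14 5(2), of t] 5(3) by (metis order_refl)
next
  case (FoldE l i b)
  define q where "q = p + code_len l + code_len i"
  define f where "f = (\<lambda>acc x. eval b xs (env @ [acc, x]))"
  define g where "g = (\<lambda>acc x. bounded_loops b B xs (env @ [acc, x]))"
  from FoldE.prems have pr: "code_at Pr p (comp_code W l \<rho> t p)" "t + regs l \<le> W" "scoped (length env) l" "bounded_loops l B xs env"
    "code_at Pr (p + code_len l) (comp_code W i \<rho> (t + 1) (p + code_len l))" "t + 1 + regs i \<le> W" "scoped (length env) i" "bounded_loops i B xs env"
    by auto
  from FoldE.prems have cb: "code_at Pr q [Load 2 t]" "code_at Pr (q + 1) [JumpPos 2 (q + 4)]"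
    "code_at Pr (q + 2) (jump (q + code_len b + 14))"
    "code_at Pr (q + 4) [Const 2 1, Add 2 t 2, Load (t + 2) 2]"
    "code_at Pr (q + 7) (comp_code W b (\<rho> @ [t + 1, t + 2]) (t + 3) (q + 7))"
    "code_at Pr (q + 7 + code_len b) (move (t + 1) (t + 3))"
    "code_at Pr (q + 9 + code_len b) [Const 2 2, Add 2 t 2, Load t 2]"
    "code_at Pr (q + 12 + code_len b) (jump q)"
    "code_at Pr (q + 14 + code_len b) (move t (t + 1))"
    by (auto simp: add_ac q_def jump_def move_def numeral_eq_Suc)
  have tW: "t + 3 + regs b \<le> W" "t < W" "t + 1 < W" "t + 2 < W" using FoldE.prems(5) by auto
  have t6: "6 \<le> t" "6 \<le> t + 1" "6 \<le> t + 2" "6 \<le> t + 3" using FoldE.prems(4) by auto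
  \<comment> \<open>The rest of the list is itself the value in register \<open>t\<close>. A round
    costs 2 + 3 + 2 + 5 = 12 steps besides the body: test, access to the head, move of the
    accumulator, step to the tail and jump back. Leaving the loop costs 6.\<close>
  have loop: "\<exists>h' R'. reach xs Pr (length vs * (steps_bound B b + 12) + 6) (q, R) (q + code_len b + 16, R') \<and>
     keeps W t h R h' R' \<and> rep W h' R' (R' t) (foldl f acc vs)"
    if "heap_ok W h R" "env_ok W h R \<rho> env t" "vs = vlist v" "rep W h R (R t) v" "rep W h R (R (t + 1)) acc"
      "fold_all g f acc vs" for vs v acc h R
    using that
  proof (induction vs arbitrary: v acc h R)
    case Nil
    have v0: "nv v = 0" using Nil(3) vlist_unfold[of v] by (auto split: if_splits)
    have "reach xs Pr 1 (q, R) (q + 1, R(2 := 0))"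
      using reach_straight[OF cb(1), of xs R] rep_nv[OF Nil(4)] v0 by simp
    from reach_trans[OF this reach_jump[OF cb(2), of xs "R(2 := 0)"]]
    have "reach xs Pr 2 (q, R) (q + 2, R(2 := 0))" by (simp add: numeral_2_eq_2)
    from reach_trans[OF this reach_Jump[OF cb(3)]]
    have r1: "reach xs Pr 4 (q, R) (q + code_len b + 14, R(2 := 1))" by simp
    have k1: "keeps W t h R h (R(2 := 1))" using Nil by (intro keeps_upd) (auto simp: heap_ok_def)
    have "code_at Pr (q + code_len b + 14) (move t (t + 1))" using cb(9) by (simp add: add_ac)
    from reach_move[OF this keeps_heap_ok[OF k1] t6(1) tW(2) t6(2)] obtain R2 where
      2: "reach xs Pr 2 (q + code_len b + 14, R(2 := 1)) (q + code_len b + 14 + 2, R2)"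
        "keeps W t h (R(2 := 1)) h R2" "R2 t = (R(2 := 1)) (t + 1)" by metis
    have k2: "keeps W t h R h R2" using keeps_trans[OF k1 2(2)] by simp
    have "R2 t = R (t + 1)" using 2(3) t6 by simp
    then have "rep W h R2 (R2 t) acc" using keeps_rep[OF k2 Nil(5)] by simp
    then show ?case using reach_trans[OF r1 2(1)] k2 by (auto simp: add_ac)
  next
    case (Cons x vs)
    have v0: "nv v > 0" "x = fstv v" "vs = vlist (sndv v)"
      using Cons.prems(3) vlist_unfold[of v] by (auto split: if_splits)
    have W6: "6 \<le> W" and z: "rep W h R W (NV 0)" using Cons.prems(1) by (auto simp: heap_ok_def)
    have "reach xs Pr 1 (q, R) (q + 1, R(2 := nv v))"
      using reach_straight[OF cb(1), of xs R] rep_nv[OF Cons.prems(4)] by simp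
    from reach_trans[OF this reach_jump[OF cb(2), of xs "R(2 := nv v)"]]
    have r1: "reach xs Pr 2 (q, R) (q + 4, R(2 := nv v))" using v0 by (simp add: numeral_2_eq_2)
    let ?c = "[Const 2 1, Add 2 t 2, Load (t + 2) 2]"
    let ?R2 = "exec_list xs ?c (R(2 := nv v))"
    have r2: "reach xs Pr 3 (q + 4, R(2 := nv v)) (q + 7, ?R2)"
      using reach_straight_len[OF cb(4), of 3 xs "R(2 := nv v)"] by (simp add: add.assoc del: exec_list.simps)
    have k2: "keeps W (t + 2) h R h ?R2" using Cons.prems(1) W6 t6 tW by (intro keeps_upd) auto
    have v2: "?R2 t = R t" "?R2 (t + 1) = R (t + 1)" "?R2 (t + 2) = R (R t + 1)"
      using t6 W6 rep_range[OF Cons.prems(4)] by auto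
    have x2: "rep W h ?R2 (?R2 (t + 2)) x" using keeps_rep[OF k2 rep_fstv[OF z Cons.prems(4)]] v2 v0 by simp
    have a2: "rep W h ?R2 (?R2 (t + 1)) acc" using keeps_rep[OF k2 Cons.prems(5)] v2 by simp
    have l2: "rep W h ?R2 (?R2 t) v" using keeps_rep[OF k2 Cons.prems(4)] v2 by simp
    have "env_ok W h ?R2 \<rho> env t" by (rule keeps_env_ok[OF k2 _ Cons.prems(2)]) simp
    from env_ok_snoc[OF this _ _ _ a2, of "t + 2"] t6
    have "env_ok W h ?R2 (\<rho> @ [t + 1]) (env @ [acc]) (t + 2)" by simp
    from env_ok_snoc[OF this order_refl _ _ x2, of "t + 3"] t6
    have e2: "env_ok W h ?R2 (\<rho> @ [t + 1, t + 2]) (env @ [acc, x]) (t + 3)" by simp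
    have "scoped (length (env @ [acc, x])) b" "bounded_loops b B xs (env @ [acc, x])"
      using FoldE.prems(6) Cons.prems(6) by (simp_all add: g_def)
    from FoldE.IH(3)[OF cb(5) keeps_heap_ok[OF k2] e2 t6(4) tW(1) this] obtain h3 R3 where
      3: "reach xs Pr (steps_bound B b) (q + 7, ?R2) (q + 7 + code_len b, R3)" "keeps W (t + 3) h ?R2 h3 R3"
       "rep W h3 R3 (R3 (t + 3)) (f acc x)" unfolding f_def by blast
    have "R3 t = ?R2 t" using keeps_reg[OF 3(2), of t] t6 by auto
    then have l3: "rep W h3 R3 (R3 t) v" using keeps_rep[OF 3(2) l2] by simp
    from reach_move[OF cb(6) keeps_heap_ok[OF 3(2)] t6(2) tW(3) t6(4)] obtain R4 where
      4: "reach xs Pr 2 (q + 7 + code_len b, R3) (q + 7 + code_len b + 2, R4)"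
        "keeps W (t + 1) h3 R3 h3 R4" "R4 (t + 1) = R3 (t + 3)" "\<And>r. 6 \<le> r \<Longrightarrow> r \<noteq> t + 1 \<Longrightarrow> R4 r = R3 r" by metis
    have "R4 t = R3 t" using 4(4)[of t] t6 by auto
    then have l4: "rep W h3 R4 (R4 t) v" using keeps_rep[OF 4(2) l3] by simp
    have z4: "rep W h3 R4 W (NV 0)" using keeps_heap_ok[OF 4(2)] by (simp add: heap_ok_def)
    let ?d = "[Const 2 2, Add 2 t 2, Load t 2]"
    let ?R5 = "(exec_list xs ?d R4)(2 := 1)"
    have r5: "reach xs Pr 3 (q + 9 + code_len b, R4) (q + 9 + code_len b + 3, exec_list xs ?d R4)"
      by (rule reach_straight_len[OF cb(7)]) auto
    have "q + 9 + code_len b + 3 = q + 12 + code_len b" by simp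
    from reach_trans[OF r5[unfolded this] reach_Jump[OF cb(8)]]
    have r5: "reach xs Pr 5 (q + 9 + code_len b, R4) (q, ?R5)" by simp
    have v5: "?R5 t = R4 (R4 t + 2)" "?R5 (t + 1) = R4 (t + 1)"
      using t6 W6 rep_range[OF l4] by auto
    have k5: "keeps W t h3 R4 h3 ?R5" using keeps_heap_ok[OF 4(2)] W6 t6 tW by (intro keeps_upd) auto
    have a5: "rep W h3 ?R5 (?R5 (t + 1)) (f acc x)"
      using keeps_rep[OF k5 keeps_rep[OF 4(2) 3(3)]] v5 4(3) by simp
    have l5: "rep W h3 ?R5 (?R5 t) (sndv v)" using keeps_rep[OF k5 rep_sndv[OF z4 l4]] v5 by simp
    have k15: "keeps W t h R h3 ?R5"
      using keeps_trans[OF keeps_trans[OF keeps_trans[OF k2 3(2), of t] 4(2), of t] k5, of t] by simp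
    have "fold_all g f (f acc x) vs" using Cons.prems(6) by simp
    from Cons.IH[OF keeps_heap_ok[OF k15] keeps_env_ok[OF k15 order_refl Cons.prems(2)] v0(3) l5 a5 this]
    obtain h6 R6 where 6: "reach xs Pr (length vs * (steps_bound B b + 12) + 6) (q, ?R5) (q + code_len b + 16, R6)"
       "keeps W t h3 ?R5 h6 R6" "rep W h6 R6 (R6 t) (foldl f (f acc x) vs)" by blast
    have eqs: "q + 7 + code_len b + 2 = q + 9 + code_len b" by auto
    have "reach xs Pr (2 + 3 + steps_bound B b + 2 + 5 + (length vs * (steps_bound B b + 12) + 6)) (q, R) (q + code_len b + 16, R6)"
      by (rule reach_trans[OF reach_trans[OF reach_trans[OF reach_trans[OF reach_trans[OF r1 r2] 3(1)] 4(1)[unfolded eqs]] r5] 6(1)])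
    then have "reach xs Pr (length (x # vs) * (steps_bound B b + 12) + 6) (q, R) (q + code_len b + 16, R6)"
      by (rule reach_mono) simp
    then show ?case using keeps_trans[OF k15 6(2), of t] 6(3)
      by (intro exI[of _ h6] exI[of _ R6]) simp
  qed
  from FoldE.IH(1)[OF pr(1) FoldE.prems(2-4) pr(2-4)] obtain h1 R1 where
    1: "reach xs Pr (steps_bound B l) (p, R) (p + code_len l, R1)" "keeps W t h R h1 R1"
     "rep W h1 R1 (R1 t) (eval l xs env)" by blast
  have e2: "env_ok W h1 R1 \<rho> env (t + 1)"
    using keeps_env_ok[OF 1(2) order_refl FoldE.prems(3)] by (auto simp: env_ok_def less_Suc_eq)
  from FoldE.IH(2)[OF pr(5) keeps_heap_ok[OF 1(2)] e2 t6(2) pr(6-8)] obtain h3 R3 where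
    3: "reach xs Pr (steps_bound B i) (p + code_len l, R1) (q, R3)" "keeps W (t + 1) h1 R1 h3 R3"
     "rep W h3 R3 (R3 (t + 1)) (eval i xs env)" by (auto simp: q_def)
  have "R3 t = R1 t" using keeps_reg[OF 3(2), of t] t6 by simp
  then have l3: "rep W h3 R3 (R3 t) (eval l xs env)" using keeps_rep[OF 3(2) 1(3)] by simp
  have k13: "keeps W t h R h3 R3" using keeps_trans[OF 1(2) 3(2), of t] by simp
  let ?vs = "vlist (eval l xs env)"
  have B: "length ?vs \<le> B" "fold_all g f (eval i xs env) ?vs"
    using FoldE.prems(7) by (auto simp: f_def g_def)
  from loop[OF keeps_heap_ok[OF k13] keeps_env_ok[OF k13 order_refl FoldE.prems(3)] refl l3 3(3) B(2)]
  obtain h5 R5 where 5: "reach xs Pr (length ?vs * (steps_bound B b + 12) + 6) (q, R3) (q + code_len b + 16, R5)"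
    "keeps W t h3 R3 h5 R5" "rep W h5 R5 (R5 t) (foldl f (eval i xs env) ?vs)" by auto
  have "reach xs Pr (steps_bound B l + steps_bound B i + (length ?vs * (steps_bound B b + 12) + 6)) (p, R) (q + code_len b + 16, R5)"
    by (rule reach_trans[OF reach_trans[OF 1(1) 3(1)] 5(1)])
  moreover have "length ?vs * (steps_bound B b + 12) \<le> B * (steps_bound B b + 12)" using B(1) by (rule mult_right_mono) simp
  moreover have "q + code_len b + 16 = p + code_len (FoldE l i b)" by (simp add: q_def)
  ultimately have "reach xs Pr (steps_bound B (FoldE l i b)) (p, R) (p + code_len (FoldE l i b), R5)"
    using reach_mono[of xs Pr _ _ _ "steps_bound B (FoldE l i b)"] by (simp del: code_len.simps)
  moreover have "eval (FoldE l i b) xs env = foldl f (eval i xs env) ?vs" by (simp add: f_def)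
  ultimately show ?case using keeps_trans[OF k13 5(2), of t] 5(3) by (metis order_refl)
qed

text \<open>The prologue has 4 + 9 = 13 instructions, hence the code position 13. It sets the heap
  pointer and allocates the cell of \<open>NV 0\<close> at \<open>W\<close>; register 6 is then free
  to be overwritten by the result.\<close>

definition compile :: "exp \<Rightarrow> program" where
  "compile e = (let W = 6 + regs e in
     [Const 1 W, Const 3 0, Const 4 W, Const 5 W] @ alloc 6 @ comp_code W e [] 6 13 @ [Load 0 6])"

lemma compile_correct:
  assumes "scoped 0 e" "bounded_loops e B xs []"
  shows "\<exists>t\<le>steps_bound B e + 14. halted (compile e) (run (compile e) xs t) \<and>
    snd (run (compile e) xs t) 0 = nv (eval e xs [])"
proof -
  define W where "W = 6 + regs e"
  define Pr where "Pr = compile e"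
  have Pr: "Pr = ([Const 1 W, Const 3 0, Const 4 W, Const 5 W] @ alloc 6) @ comp_code W e [] 6 13 @ [Load 0 6]"
    unfolding Pr_def compile_def W_def Let_def by simp
  have self: "code_at Pr 0 Pr" by (simp add: code_at_def)
  let ?c = "[Const 1 W, Const 3 0, Const 4 W, Const 5 W] @ alloc 6"
  let ?R1 = "exec_list xs ?c (\<lambda>_. 0)"
  have c: "code_at Pr 0 ?c" "code_at Pr 13 (comp_code W e [] 6 13)" "code_at Pr (13 + code_len e) [Load 0 6]"
    using self[unfolded code_at_append[of Pr 0 ?c, folded Pr] Pr[symmetric]]
    by (subst (asm) (2) Pr, simp)+
  have r1: "reach xs Pr 13 (0, \<lambda>_. 0) (13, ?R1)"
    using reach_straight[OF c(1), of xs "\<lambda>_. 0"] straight_alloc by auto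
  have W6: "6 < W" using regs_pos[of e] by (simp add: W_def)
  have m1: "heap_ok W (W + 3) ?R1" using W6 unfolding heap_ok_def by (simp add: alloc_def rep.simps)
  from comp_code_correct[OF c(2) m1, of "[]" B xs] assms obtain h' R' where
    2: "reach xs Pr (steps_bound B e) (13, ?R1) (13 + code_len e, R')"
      "rep W h' R' (R' 6) (eval e xs [])" by (auto simp: env_ok_def W_def)
  let ?R3 = "R'(0 := nv (eval e xs []))"
  have r3: "reach xs Pr 1 (13 + code_len e, R') (13 + code_len e + 1, ?R3)"
    using reach_straight[OF c(3), of xs R'] rep_nv[OF 2(2)] by simp
  have "reach xs Pr (13 + steps_bound B e + 1) (0, \<lambda>_. 0) (13 + code_len e + 1, ?R3)"
    by (rule reach_trans[OF reach_trans[OF r1 2(1)] r3])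
  then obtain t where t: "t \<le> steps_bound B e + 14" "run Pr xs t = (13 + code_len e + 1, ?R3)"
    unfolding reach_def run_def by (auto simp: add.commute)
  have "length Pr = 13 + code_len e + 1" unfolding Pr by simp
  then show ?thesis using t unfolding Pr_def[symmetric] halted_def by (intro exI[of _ t]) auto
qed

section \<open>The algorithm\<close>

text \<open>A group is given by the position \<open>z\<close> of its table on the input tape \<open>xs\<close>: 1 for \<open>G\<close> and \<open>offH xs\<close> for \<open>H\<close>.
  A map on \<open>{..<n}\<close> is the list of its values. At level \<open>i\<close>, the list \<open>Y\<close> consists of pairs \<open>(y, h)\<close>, where the
  \<open>y\<close> generate \<open>G\<^sub>i\<^sub>+\<^sub>1\<close> modulo \<open>G\<^sub>i\<close> and \<open>h\<close> is the intended image of \<open>y\<close>, and \<open>W\<close> of pairs \<open>(w(y), w(h))\<close> for words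
  \<open>w\<close> such that the \<open>w(y)\<close> represent the cosets of \<open>G\<^sub>i\<close>. The caps on the lengths of lists are never
  reached on valid inputs; they make the loop bounds independent of correctness.\<close>

abbreviation "nn xs \<equiv> read_at xs 0"

definition tmul :: "nat list \<Rightarrow> nat \<Rightarrow> nat \<Rightarrow> nat \<Rightarrow> nat" where
  "tmul xs z a b = read_at xs (z + (nn xs * a + b))"

text \<open>\<open>nn xs * nn xs\<close> skips the table, and the extra 1 skips the entry with the
  length of the series.\<close>

definition tmemv :: "nat list \<Rightarrow> nat \<Rightarrow> nat \<Rightarrow> nat \<Rightarrow> nat" where
  "tmemv xs z j x = read_at xs (z + (nn xs * nn xs + (1 + (nn xs * j + x))))"

abbreviation tmem :: "nat list \<Rightarrow> nat \<Rightarrow> nat \<Rightarrow> nat \<Rightarrow> bool" where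
  "tmem xs z j x \<equiv> 0 < tmemv xs z j x"

definition app :: "nat list \<Rightarrow> nat \<Rightarrow> nat" where
  "app l x = (if x < length l then l ! x else 0)"

text \<open>The quotient of \<open>a\<close> by \<open>b\<close> on the right. Inverses are not part
  of the input, so the equation is solved by search.\<close>

definition tdiv :: "nat list \<Rightarrow> nat \<Rightarrow> nat \<Rightarrow> nat \<Rightarrow> nat" where
  "tdiv xs z a b = foldl (\<lambda>acc x. if tmul xs z x b = a then x else acc) 0 [0..<nn xs]"

text \<open>The identity is the only member of the first term of the series.\<close>

definition one_of :: "nat list \<Rightarrow> nat \<Rightarrow> nat" where
  "one_of xs z = foldl (\<lambda>acc x. if tmem xs z 0 x then x else acc) 0 [0..<nn xs]"

text \<open>Membership in one of the right cosets \<open>G_i w\<close>. Only first components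
  matter, and they always belong to \<open>G\<close>, whose table is at 1.\<close>

definition covered :: "nat list \<Rightarrow> nat \<Rightarrow> (nat \<times> nat) list \<Rightarrow> nat \<Rightarrow> bool" where
  "covered xs i W x \<longleftrightarrow> (\<exists>w\<in>set W. tmem xs 1 i (tdiv xs 1 x (fst w)))"

definition coset_rep :: "nat list \<Rightarrow> nat \<Rightarrow> (nat \<times> nat) list \<Rightarrow> nat \<Rightarrow> nat \<times> nat" where
  "coset_rep xs i W x = foldl (\<lambda>acc w. if tmem xs 1 i (tdiv xs 1 x (fst w)) then w else acc) (0, 0) W"

definition add_word :: "nat list \<Rightarrow> nat \<Rightarrow> nat \<Rightarrow> nat \<times> nat \<Rightarrow> (nat \<times> nat) list \<Rightarrow> nat \<times> nat \<Rightarrow> (nat \<times> nat) list" where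
  "add_word xs z i w W y = (if covered xs i W (tmul xs 1 (fst w) (fst y)) \<or> nn xs \<le> length W then W
     else W @ [(tmul xs 1 (fst w) (fst y), tmul xs z (snd w) (snd y))])"

text \<open>A Schreier transversal by breadth-first search: the list grows while it is traversed,
  and the second components replay the same words in the intended images. There are at most
  \<open>nn xs\<close> cosets, so \<open>nn xs\<close> rounds reach the end of the list.\<close>

definition coset_words :: "nat list \<Rightarrow> nat \<Rightarrow> nat \<Rightarrow> (nat \<times> nat) list \<Rightarrow> (nat \<times> nat) list" where
  "coset_words xs z i Y = foldl (\<lambda>W k. if k < length W then foldl (add_word xs z i (W ! k)) W Y else W)
     [(one_of xs 1, one_of xs z)] [0..<nn xs]"

definition zip_gens :: "nat list \<Rightarrow> nat list \<Rightarrow> (nat \<times> nat) list" where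
  "zip_gens ys hs = map (\<lambda>k. (app ys k, app hs k)) [0..<length ys]"

text \<open>The greedy choice: an element is added only if it lies outside the subgroup generated so
  far, which therefore at least doubles.\<close>

definition coset_gens :: "nat list \<Rightarrow> nat \<Rightarrow> nat list" where
  "coset_gens xs i = foldl (\<lambda>ys x. if tmem xs 1 (Suc i) x \<and> \<not> covered xs i (coset_words xs 1 i (zip_gens ys ys)) x
     then ys @ [x] else ys) [] [0..<nn xs]"

text \<open>A Schreier generator \<open>w y r^-1\<close> of \<open>G_i\<close>, paired with the
  value that an extension of a map on \<open>G_i\<close> would force on it.\<close>

definition relator :: "nat list \<Rightarrow> nat \<Rightarrow> nat \<Rightarrow> (nat \<times> nat) list \<Rightarrow> nat \<times> nat \<Rightarrow> nat \<times> nat \<Rightarrow> nat \<times> nat" where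
  "relator xs z i W w y = (let a = tmul xs 1 (fst w) (fst y); r = coset_rep xs i W a
     in (tdiv xs 1 a (fst r), tdiv xs z (tmul xs z (snd w) (snd y)) (snd r)))"

definition relators :: "nat list \<Rightarrow> nat \<Rightarrow> nat \<Rightarrow> (nat \<times> nat) list \<Rightarrow> (nat \<times> nat) list \<Rightarrow> (nat \<times> nat) list" where
  "relators xs z i Y W = foldl (\<lambda>acc w. foldl (\<lambda>acc y. relator xs z i W w y # acc) acc Y) [] W"

text \<open>The equation \<open>\<phi>(y x y^-1) = h \<phi>(x) h^-1\<close>, multiplied out on the
  right by \<open>h\<close>.\<close>

definition commutes :: "nat list \<Rightarrow> nat \<Rightarrow> (nat \<times> nat) list \<Rightarrow> nat list \<Rightarrow> nat \<Rightarrow> bool" where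
  "commutes xs z Y \<phi> j \<longleftrightarrow> (\<forall>x<nn xs. tmem xs 1 j x \<longrightarrow> (\<forall>y\<in>set Y.
     tmul xs z (app \<phi> (tdiv xs 1 (tmul xs 1 (fst y) x) (fst y))) (snd y) = tmul xs z (snd y) (app \<phi> x)))"

definition count_lead :: "bool \<times> nat \<Rightarrow> bool \<Rightarrow> bool \<times> nat" where
  "count_lead s b = (if fst s \<and> b then (True, Suc (snd s)) else (False, snd s))"

definition depth :: "nat list \<Rightarrow> nat \<Rightarrow> nat \<Rightarrow> (nat \<times> nat) list \<Rightarrow> (nat \<times> nat) list \<Rightarrow> nat list \<Rightarrow> nat" where
  "depth xs z i Y Q \<phi> = snd (foldl (\<lambda>s p. count_lead s (app \<phi> (fst p) = snd p))
     (foldl (\<lambda>s j. count_lead s (commutes xs z Y \<phi> j)) (True, 0) [0..<Suc i]) Q)"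

definition comp_map :: "nat list \<Rightarrow> nat list \<Rightarrow> nat list \<Rightarrow> nat list" where
  "comp_map xs \<phi> \<tau> = map (\<lambda>x. app \<phi> (app \<tau> x)) [0..<nn xs]"

definition inv_map :: "nat list \<Rightarrow> nat list \<Rightarrow> nat list" where
  "inv_map xs \<phi> = map (\<lambda>z. foldl (\<lambda>a x. if app \<phi> x = z then x else a) 0 [0..<nn xs]) [0..<nn xs]"

text \<open>\<open>depth\<close> counts the leading conditions of the tower that \<open>\<phi>\<close> satisfies: first that it intertwines the
  conjugations on \<open>G\<^sub>0, \<dots>, G\<^sub>i\<close>, then the points in \<open>Q\<close>.\<close>

definition sift_step :: "nat list \<Rightarrow> nat \<Rightarrow> nat \<Rightarrow> (nat \<times> nat) list \<Rightarrow> (nat \<times> nat) list \<Rightarrow> nat list \<Rightarrow> nat list \<Rightarrow> nat list" where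
  "sift_step xs z i Y Q \<phi> \<tau> = (if depth xs z i Y Q \<phi> < depth xs z i Y Q (comp_map xs \<phi> \<tau>) then comp_map xs \<phi> \<tau> else \<phi>)"

definition sift :: "nat list \<Rightarrow> nat \<Rightarrow> nat \<Rightarrow> (nat \<times> nat) list \<Rightarrow> (nat \<times> nat) list \<Rightarrow> nat list list \<Rightarrow> nat list \<Rightarrow> nat list" where
  "sift xs z i Y Q T \<phi> =
     foldl (\<lambda>\<phi> k. foldl (sift_step xs z i Y Q) \<phi> T) \<phi> [0..<Suc i + length Q]"

text \<open>Sifting multiplies on the right. If \<open>e\<close> is the residue of the inverse of
  \<open>\<phi>\<close>, then \<open>\<phi>\<close> is a product of table elements followed by the
  inverse of \<open>e\<close>, so inserting that inverse is exactly what gives \<open>\<phi>\<close>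
  a normal form.\<close>

definition sift_insert :: "nat list \<Rightarrow> nat \<Rightarrow> (nat \<times> nat) list \<Rightarrow> (nat \<times> nat) list \<Rightarrow> nat \<Rightarrow> nat list list \<Rightarrow> nat list \<Rightarrow> nat list list" where
  "sift_insert xs i Y Q F T \<phi> = (let e = sift xs 1 i Y Q T (inv_map xs \<phi>) in
     if depth xs 1 i Y Q e < Suc i + length Q \<and> length T < F then T @ [inv_map xs e] else T)"

definition sift_insert2 :: "nat list \<Rightarrow> nat \<Rightarrow> (nat \<times> nat) list \<Rightarrow> (nat \<times> nat) list \<Rightarrow> nat \<Rightarrow> nat list \<Rightarrow> nat list list \<Rightarrow> nat list \<Rightarrow> nat list list" where
  "sift_insert2 xs i Y Q F a T b = sift_insert xs i Y Q F (sift_insert xs i Y Q F T (comp_map xs a b)) (comp_map xs b a)"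

text \<open>The closure step of Furst, Hopcroft and Luks: products of all pairs of table elements,
  in both orders, are sifted until nothing new appears.\<close>

definition saturate :: "nat list \<Rightarrow> nat \<Rightarrow> (nat \<times> nat) list \<Rightarrow> (nat \<times> nat) list \<Rightarrow> nat \<Rightarrow> nat list list \<Rightarrow> nat list list" where
  "saturate xs i Y Q F gs =
     foldl (\<lambda>T k. if k < length T then foldl (sift_insert2 xs i Y Q F (T ! k)) T T else T)
       (foldl (sift_insert xs i Y Q F) [] gs) [0..<F]"

text \<open>An element \<open>n r\<close>, with \<open>r\<close> the chosen representative of its
  coset, goes to \<open>\<phi>(n)\<close> times the image of \<open>r\<close>. Points outside
  \<open>G_{i+1}\<close> are fixed, so that an automorphism has only one list of values.\<close>

definition extend :: "nat list \<Rightarrow> nat \<Rightarrow> nat \<Rightarrow> (nat \<times> nat) list \<Rightarrow> nat list \<Rightarrow> nat list" where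
  "extend xs z i W \<phi> = map (\<lambda>x. if tmem xs 1 (Suc i) x
     then tmul xs z (app \<phi> (tdiv xs 1 x (fst (coset_rep xs i W x)))) (snd (coset_rep xs i W x)) else x) [0..<nn xs]"

text \<open>A wrong guess still produces some candidate map, so every candidate is tested in full.
  Soundness is then immediate, and the group theory serves completeness and the time bound.\<close>

definition iso_test :: "nat list \<Rightarrow> nat \<Rightarrow> nat \<Rightarrow> nat list \<Rightarrow> bool" where
  "iso_test xs z i \<phi> \<longleftrightarrow>
     (\<forall>x<nn xs. tmem xs 1 i x \<longrightarrow> app \<phi> x < nn xs \<and>
        (\<forall>y<nn xs. tmem xs 1 i y \<longrightarrow> app \<phi> (tmul xs 1 x y) = tmul xs z (app \<phi> x) (app \<phi> y)) \<and>
        (\<forall>j<Suc i. tmem xs 1 j x = tmem xs z j (app \<phi> x))) \<and>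
     (\<forall>u<nn xs. tmem xs z i u \<longrightarrow> (\<exists>x<nn xs. tmem xs 1 i x \<and> app \<phi> x = u))"

definition tuples :: "nat list \<Rightarrow> nat \<Rightarrow> nat list list" where
  "tuples xs s = foldl (\<lambda>ts k. foldl (\<lambda>acc t. foldl (\<lambda>acc a. (a # t) # acc) acc [0..<nn xs]) [] ts) [[]] [0..<s]"

definition candidate :: "nat list \<Rightarrow> nat \<Rightarrow> nat \<Rightarrow> nat list list \<Rightarrow> nat list \<Rightarrow> nat list \<Rightarrow> nat list \<Rightarrow> nat list" where
  "candidate xs z i T \<phi> ys hs = (let Y = zip_gens ys hs; W = coset_words xs z i Y
     in extend xs z i W (sift xs z i Y (relators xs z i Y W) T \<phi>))"

definition keep_iso :: "nat list \<Rightarrow> nat \<Rightarrow> nat \<Rightarrow> nat list list \<Rightarrow> nat list \<Rightarrow> nat list list" where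
  "keep_iso xs z i acc \<psi> = (if iso_test xs z (Suc i) \<psi> then \<psi> # acc else acc)"

definition search :: "nat list \<Rightarrow> nat \<Rightarrow> nat \<Rightarrow> nat list list \<Rightarrow> nat list \<Rightarrow> nat list \<Rightarrow> nat list list \<Rightarrow> nat list list" where
  "search xs z i T \<phi> ys acc0 =
     foldl (\<lambda>acc hs. keep_iso xs z i acc (candidate xs z i T \<phi> ys hs)) acc0 (tuples xs (length ys))"

text \<open>Table elements that satisfy all relator conditions pass the test, and whatever passes is
  an automorphism of the next term in any case.\<close>

definition lifts :: "nat list \<Rightarrow> nat \<Rightarrow> (nat \<times> nat) list \<Rightarrow> nat list list \<Rightarrow> nat list list" where
  "lifts xs i W T = foldl (\<lambda>acc \<tau>. keep_iso xs 1 i acc (extend xs 1 i W \<tau>)) [] T"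

text \<open>The pairs \<open>(x, x)\<close> continue the tower below the relators down to the
  trivial group: sifting needs that only the identity has full depth.\<close>

definition all_relators :: "nat list \<Rightarrow> nat \<Rightarrow> (nat \<times> nat) list \<Rightarrow> (nat \<times> nat) list \<Rightarrow> (nat \<times> nat) list" where
  "all_relators xs i Y W = relators xs 1 i Y W @ map (\<lambda>x. (x, x)) [0..<nn xs]"

definition hd_default :: "nat list list \<Rightarrow> nat list" where
  "hd_default l = (if l = [] then [] else hd l)"

text \<open>Automorphisms of \<open>G_{i+1}\<close> are generated by one of them for each attainable
  tuple of images of \<open>ys\<close>, together with the lifts, which generate those that fix
  \<open>ys\<close> pointwise.\<close>

definition climb :: "nat list \<Rightarrow> nat \<Rightarrow> nat \<Rightarrow> nat list list \<times> nat list list \<Rightarrow> nat \<Rightarrow> nat list list \<times> nat list list" where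
  "climb xs F z st i = (let ys = coset_gens xs i; Y = zip_gens ys ys; W = coset_words xs 1 i Y;
     T = saturate xs i Y (all_relators xs i Y W) F (fst st)
     in (search xs 1 i T [0..<nn xs] ys (lifts xs i W T), search xs z i T (hd_default (snd st)) ys []))"

definition Lmax :: "nat list \<Rightarrow> nat \<Rightarrow> nat" where
  "Lmax xs m = foldl (\<lambda>a i. if a < length (coset_gens xs i) then length (coset_gens xs i) else a) 0 [0..<m]"

definition lenS :: "nat list \<Rightarrow> nat" where
  "lenS xs = read_at xs (1 + nn xs * nn xs)"

definition offH :: "nat list \<Rightarrow> nat" where
  "offH xs = 1 + (nn xs * nn xs + (1 + nn xs * lenS xs))"

text \<open>Serves both as the cap on the sifting table and as a bound on the number of image tuples
  to be tried.\<close>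

definition fuel :: "nat list \<Rightarrow> nat" where
  "fuel xs = nn xs ^ (Lmax xs (lenS xs - 1) * Lmax xs (lenS xs - 1) + 6)"

text \<open>The start is the level \<open>G_0 = 1\<close>: its only automorphism is the identity, so
  the list of generators is empty, and the constant map to the identity of \<open>H\<close> is an
  isomorphism of trivial groups.\<close>

definition iso_alg :: "nat list \<Rightarrow> bool" where
  "iso_alg xs \<longleftrightarrow> lenS xs = read_at xs (offH xs + nn xs * nn xs) \<and>
     snd (foldl (climb xs (fuel xs) (offH xs)) ([], [map (\<lambda>x. one_of xs (offH xs)) [0..<nn xs]])
       [0..<lenS xs - 1]) \<noteq> []"

declare One_nat_def [simp del]

section \<open>Towers of subgroups\<close>

lemma foldl_pick:
  assumes "x \<in> set l" "Q x"
  shows "foldl (\<lambda>acc x. if Q x then x else acc) d l \<in> set l"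
    "Q (foldl (\<lambda>acc x. if Q x then x else acc) d l)"
  using assms by (induction l rule: rev_induct) (auto split: if_splits)

text \<open>A loop over a list that it extends itself. What has been achieved for a position
  survives appending, and the cap \<open>F\<close> on the length ensures that \<open>F\<close>
  rounds treat every position.\<close>

lemma worklist:
  fixes g :: "'a list \<Rightarrow> nat \<Rightarrow> 'a list"
  assumes app: "\<And>W k. \<exists>E. g W k = W @ E"
    and mono: "\<And>W E k. k < length W \<Longrightarrow> Cl W k \<Longrightarrow> Cl (W @ E) k"
    and step: "\<And>W k. J W \<Longrightarrow> k < length W \<Longrightarrow> Cl (g W k) k \<and> J (g W k)"
    and J0: "J W0" and len: "\<And>W. J W \<Longrightarrow> length W \<le> F"
  defines "W \<equiv> foldl (\<lambda>W k. if k < length W then g W k else W) W0 [0..<F]"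
  shows "J W \<and> (\<forall>k<length W. Cl W k)"
proof -
  have "J (foldl (\<lambda>W k. if k < length W then g W k else W) W0 [0..<n]) \<and>
     (\<forall>k<min n (length (foldl (\<lambda>W k. if k < length W then g W k else W) W0 [0..<n])).
        Cl (foldl (\<lambda>W k. if k < length W then g W k else W) W0 [0..<n]) k)" for n
  proof (induction n)
    case (Suc n)
    let ?W = "foldl (\<lambda>W k. if k < length W then g W k else W) W0 [0..<n]"
    show ?case
    proof (cases "n < length ?W")
      case True
      from app obtain E where E: "g ?W n = ?W @ E" by blast
      have "Cl (g ?W n) k" if "k < Suc n" for k
      proof (cases "k = n")
        case True then show ?thesis using step[of ?W n] Suc \<open>n < length ?W\<close> by auto
      next
        case False
        then show ?thesis using that Suc True mono[of k ?W E] E by auto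
      qed
      then show ?thesis using step[of ?W n] Suc True by auto
    qed (use Suc in auto)
  qed (use J0 in auto)
  from this[of F] have *: "J W \<and> (\<forall>k<min F (length W). Cl W k)" unfolding W_def .
  then have "min F (length W) = length W" using len[of W] by simp
  with * show ?thesis by metis
qed

text \<open>A round over \<open>T\<close> either raises \<open>d\<close> or changes nothing; in the
  latter case no element of \<open>T\<close> improves the map, now or in later rounds. If every
  round raises \<open>d\<close>, it is at least \<open>R\<close> after \<open>R\<close>
  rounds.\<close>

lemma sift_stuck:
  fixes d :: "'a \<Rightarrow> nat" and mul :: "'a \<Rightarrow> 'b \<Rightarrow> 'a" and T :: "'b list"
  defines "st \<equiv> (\<lambda>a t. if d a < d (mul a t) then mul a t else a)"
  defines "res \<equiv> (\<lambda>R a. foldl (\<lambda>a k. foldl st a T) a [0..<R])"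
  shows "R \<le> d (res R a) \<or> (\<forall>t\<in>set T. \<not> d (res R a) < d (mul (res R a) t))"
proof -
  have mono: "d a \<le> d (foldl st a l)" for a l
  proof (induction l arbitrary: a)
    case (Cons t l)
    have "d a \<le> d (st a t)" by (simp add: st_def)
    also have "\<dots> \<le> d (foldl st (st a t) l)" by (rule Cons)
    finally show ?case by simp
  qed simp
  have fix1: "\<forall>t\<in>set l. \<not> d a < d (mul a t)" if "d (foldl st a l) = d a" for a l
    using that
  proof (induction l arbitrary: a)
    case (Cons t l)
    have "d a \<le> d (st a t)" by (simp add: st_def)
    moreover have "d (st a t) \<le> d (foldl st (st a t) l)" by (rule mono)
    ultimately have "d (st a t) = d a" using Cons.prems by simp
    then have e: "st a t = a" "\<not> d a < d (mul a t)" by (auto simp: st_def split: if_splits)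
    then show ?case using Cons by auto
  qed simp
  have fix2: "foldl st a l = a" if "\<forall>t\<in>set l. \<not> d a < d (mul a t)" for a l
    using that by (induction l) (auto simp: st_def)
  show ?thesis
  proof (induction R)
    case (Suc R)
    let ?b = "res R a"
    have b: "res (Suc R) a = foldl st ?b T" by (simp add: res_def)
    show ?case
    proof (cases "\<forall>t\<in>set T. \<not> d ?b < d (mul ?b t)")
      case True then show ?thesis using fix2[of T ?b] by (simp add: b)
    next
      case False
      then have "d (foldl st ?b T) \<noteq> d ?b" using fix1 by blast
      then have "d ?b < d (foldl st ?b T)" using mono[of ?b T] by simp
      then show ?thesis using Suc False by (auto simp: b)
    qed
  qed simp
qed

lemma foldl_inv: "I a \<Longrightarrow> (\<And>a x. x \<in> set l \<Longrightarrow> I a \<Longrightarrow> I (f a x)) \<Longrightarrow> I (foldl f a l)"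
  by (induction l arbitrary: a) auto

lemma foldl_count_lead: "snd (foldl count_lead (True, c) bs) = c + length (takeWhile id bs)"
proof -
  have f: "foldl count_lead (False, c) bs = (False, c)" for c bs
    by (induction bs) (auto simp: count_lead_def)
  show ?thesis by (induction bs arbitrary: c) (auto simp: count_lead_def f)
qed

lemma le_takeWhile: "k \<le> length bs \<Longrightarrow> k \<le> length (takeWhile id bs) \<longleftrightarrow> (\<forall>j<k. bs ! j)"
proof (induction bs arbitrary: k)
  case (Cons b bs)
  then show ?case by (cases k) (auto simp: less_Suc_eq_0_disj)
qed simp

definition cond_at :: "nat list \<Rightarrow> nat \<Rightarrow> nat \<Rightarrow> (nat \<times> nat) list \<Rightarrow> (nat \<times> nat) list \<Rightarrow> nat list \<Rightarrow> nat \<Rightarrow> bool" where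
  "cond_at xs z i Y Q \<phi> k \<longleftrightarrow> (if k \<le> i then commutes xs z Y \<phi> k else app \<phi> (fst (Q ! (k - Suc i))) = snd (Q ! (k - Suc i)))"

lemma depth_eq: "depth xs z i Y Q \<phi> =
   length (takeWhile id (map (commutes xs z Y \<phi>) [0..<Suc i] @ map (\<lambda>p. app \<phi> (fst p) = snd p) Q))"
proof -
  have "depth xs z i Y Q \<phi> = snd (foldl count_lead (True, 0) (map (commutes xs z Y \<phi>) [0..<Suc i] @ map (\<lambda>p. app \<phi> (fst p) = snd p) Q))"
    unfolding depth_def foldl_append foldl_map ..
  then show ?thesis by (simp only: foldl_count_lead)
qed

lemma depth_le: "depth xs z i Y Q \<phi> \<le> Suc i + length Q"
proof -
  have "length (takeWhile id bs) \<le> length bs" for bs by (rule length_takeWhile_le)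
  from this[of "map (commutes xs z Y \<phi>) [0..<Suc i] @ map (\<lambda>p. app \<phi> (fst p) = snd p) Q"]
  show ?thesis unfolding depth_eq by (simp del: takeWhile_append)
qed

lemma depth_ge: "k \<le> Suc i + length Q \<Longrightarrow> k \<le> depth xs z i Y Q \<phi> \<longleftrightarrow> (\<forall>j<k. cond_at xs z i Y Q \<phi> j)"
proof -
  assume k: "k \<le> Suc i + length Q"
  let ?bs = "map (commutes xs z Y \<phi>) [0..<Suc i] @ map (\<lambda>p. app \<phi> (fst p) = snd p) Q"
  have "?bs ! j = cond_at xs z i Y Q \<phi> j" if "j < k" for j
    using that k by (auto simp: cond_at_def nth_append simp del: upt_Suc)
  then show ?thesis unfolding depth_eq using k by (subst le_takeWhile) auto
qed

section \<open>Normal forms in a group with a descending chain of subgroups\<close>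

text \<open>By \<open>d_mult\<close> and \<open>d_inv\<close> the elements of depth at least
  \<open>k\<close> form a subgroup for every \<open>k\<close>; this chain descends to the trivial
  group at \<open>k = r\<close>.\<close>

locale depth_group = group A for A (structure) +
  fixes d :: "'a \<Rightarrow> nat" and r :: nat
  assumes d_mult: "x \<in> carrier A \<Longrightarrow> y \<in> carrier A \<Longrightarrow> min (d x) (d y) \<le> d (x \<otimes> y)"
    and d_inv: "x \<in> carrier A \<Longrightarrow> d (inv x) = d x"
    and d_le: "x \<in> carrier A \<Longrightarrow> d x \<le> r"
    and d_one: "d \<one> = r"
    and d_eq: "x \<in> carrier A \<Longrightarrow> d x = r \<Longrightarrow> x = \<one>"
begin

text \<open>Normal forms: products of table elements of strictly increasing depth, that is, of coset
  representatives down the chain.\<close>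

inductive fac :: "'a set \<Rightarrow> 'a \<Rightarrow> bool" for T where
  one: "fac T \<one>"
| mult: "\<tau> \<in> T \<Longrightarrow> fac T \<phi> \<Longrightarrow> d \<tau> < d \<phi> \<Longrightarrow> fac T (\<tau> \<otimes> \<phi>)"

lemma fac_carrier: "fac T \<phi> \<Longrightarrow> T \<subseteq> carrier A \<Longrightarrow> \<phi> \<in> carrier A"
  by (induction rule: fac.induct) auto

lemma fac_mono: "fac T \<phi> \<Longrightarrow> T \<subseteq> T' \<Longrightarrow> fac T' \<phi>"
  by (induction rule: fac.induct) (auto intro: fac.intros)

text \<open>As for an ultrametric: recovering \<open>x\<close> from the product and the deeper
  \<open>y\<close> bounds the depth of the product from above.\<close>

lemma d_mult_less:
  assumes "x \<in> carrier A" "y \<in> carrier A" "d x < d y"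
  shows "d (x \<otimes> y) = d x"
proof -
  have "x = (x \<otimes> y) \<otimes> inv y" using assms by (simp add: m_assoc)
  then have "min (d (x \<otimes> y)) (d y) \<le> d x"
    using d_mult[of "x \<otimes> y" "inv y"] d_inv[of y] assms by simp
  then show ?thesis using d_mult[OF assms(1,2)] assms(3) by auto
qed

lemma fac_single: "\<tau> \<in> T \<Longrightarrow> T \<subseteq> carrier A \<Longrightarrow> fac T \<tau>"
proof -
  assume t: "\<tau> \<in> T" "T \<subseteq> carrier A"
  show ?thesis
  proof (cases "d \<tau> < r")
    case True
    from fac.mult[OF t(1) fac.one] True have "fac T (\<tau> \<otimes> \<one>)" by (simp add: d_one)
    moreover have "\<tau> \<otimes> \<one> = \<tau>" using t by (intro r_one) auto
    ultimately show ?thesis by simp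
  next
    case False
    then have "\<tau> = \<one>" using t d_le[of \<tau>] d_eq[of \<tau>] by force
    then show ?thesis by (simp add: fac.one)
  qed
qed

lemma fac_split:
  assumes "fac T \<phi>" "\<phi> \<noteq> \<one>" "T \<subseteq> carrier A"
  obtains \<tau> \<phi>' where "\<tau> \<in> T" "fac T \<phi>'" "\<phi> = \<tau> \<otimes> \<phi>'" "d \<tau> = d \<phi>" "d \<phi> < d \<phi>'"
  using assms(1)
proof cases
  case (mult \<tau> \<phi>')
  then have "d \<tau> = d \<phi>" using d_mult_less[of \<tau> \<phi>'] fac_carrier[of T \<phi>'] assms(3) by auto
  then show ?thesis using that[OF mult(2,3,1)] mult(4) by simp
qed (use assms in auto)

text \<open>The core of the sifting method, by induction on a bound \<open>n\<close> for the codepth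
  \<open>r - d\<close>. In \<open>a \<otimes> (\<tau> \<otimes> \<phi>')\<close> the pair
  \<open>a \<otimes> \<tau>\<close> is replaced by its normal form
  \<open>\<tau>2 \<otimes> \<phi>2\<close>. Then \<open>\<phi>2\<close> and \<open>\<phi>'\<close>
  are both deeper, and the induction hypothesis multiplies them.\<close>

lemma fac_mult_left:
  assumes T: "T \<subseteq> carrier A" and cl: "\<And>a b. a \<in> T \<Longrightarrow> b \<in> T \<Longrightarrow> fac T (a \<otimes> b)"
  shows "a \<in> T \<Longrightarrow> fac T \<phi> \<Longrightarrow> r - d a \<le> n \<Longrightarrow> r - d \<phi> \<le> n \<Longrightarrow> fac T (a \<otimes> \<phi>)"
proof (induction n arbitrary: a \<phi>)
  case 0
  have a: "a \<in> carrier A" "\<phi> \<in> carrier A" using 0 T fac_carrier by auto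
  then have "a = \<one>" using 0 d_le[of a] d_eq[of a] by force
  then show ?case using 0 a by simp
next
  case (Suc n)
  note c = fac_carrier[OF _ T]
  \<comment> \<open>Normal forms of codepth at most \<open>n\<close> are closed under
    multiplication: the factors of the left one are moved into the right one, one after the
    other.\<close>
  have mulF: "fac T (\<psi> \<otimes> \<chi>)" if "fac T \<psi>" "r - d \<psi> \<le> n" "fac T \<chi>" "r - d \<chi> \<le> n" for \<psi> \<chi>
    using that
  proof (induction rule: fac.induct)
    case one then show ?case using c by simp
  next
    case (mult \<tau> \<phi>)
    have tc: "\<tau> \<in> carrier A" "\<phi> \<in> carrier A" "\<chi> \<in> carrier A" using mult c T by auto
    have "d (\<tau> \<otimes> \<phi>) = d \<tau>" using d_mult_less tc mult by auto
    then have dt: "r - d \<tau> \<le> n" "r - d \<phi> \<le> n" using mult by auto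
    have f: "fac T (\<phi> \<otimes> \<chi>)" using mult dt by simp
    have "min (d \<phi>) (d \<chi>) \<le> d (\<phi> \<otimes> \<chi>)" using d_mult tc by simp
    then have "r - d (\<phi> \<otimes> \<chi>) \<le> n" using dt mult.prems by auto
    from Suc.IH[OF mult.hyps(1) f dt(1) this] show ?case using tc by (simp add: m_assoc)
  qed
  have ac: "a \<in> carrier A" "\<phi> \<in> carrier A" using Suc.prems T c by auto
  show ?case
  proof (cases "r - d \<phi> \<le> n")
    case True
    show ?thesis
    proof (cases "r - d a \<le> n")
      case True' : True
      show ?thesis by (rule Suc.IH) (use Suc.prems True True' in auto)
    next
      case False
      \<comment> \<open>Here \<open>a \<otimes> \<phi>\<close> is a normal form as it
        stands.\<close>
      then have "d a < d \<phi>" using True by auto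
      then show ?thesis using Suc.prems fac.mult by blast
    qed
  next
    case False
    then have dphi: "r - d \<phi> = Suc n" using Suc.prems by simp
    then have "\<phi> \<noteq> \<one>" using d_one by auto
    from fac_split[OF Suc.prems(2) this T] obtain \<tau> \<phi>' where
      t: "\<tau> \<in> T" "fac T \<phi>'" "\<phi> = \<tau> \<otimes> \<phi>'" "d \<tau> = d \<phi>" "d \<phi> < d \<phi>'" by blast
    have p': "r - d \<phi>' \<le> n" using t dphi by auto
    have tc: "\<tau> \<in> carrier A" "\<phi>' \<in> carrier A" using t c T by auto
    have e: "a \<otimes> \<phi> = (a \<otimes> \<tau>) \<otimes> \<phi>'" using t ac tc by (simp add: m_assoc)
    have f: "fac T (a \<otimes> \<tau>)" using cl Suc.prems t by auto
    have "min (d a) (d \<tau>) \<le> d (a \<otimes> \<tau>)" using d_mult ac tc by auto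
    then have dat: "r - d (a \<otimes> \<tau>) \<le> Suc n" using Suc.prems t dphi by auto
    show ?thesis
    proof (cases "r - d (a \<otimes> \<tau>) \<le> n")
      case True show ?thesis unfolding e by (rule mulF[OF f True t(2) p'])
    next
      case False
      then have "a \<otimes> \<tau> \<noteq> \<one>" using d_one by auto
      from fac_split[OF f this T] obtain \<tau>2 \<phi>2 where
        t2: "\<tau>2 \<in> T" "fac T \<phi>2" "a \<otimes> \<tau> = \<tau>2 \<otimes> \<phi>2" "d \<tau>2 = d (a \<otimes> \<tau>)" "d (a \<otimes> \<tau>) < d \<phi>2" by blast
      have tc2: "\<tau>2 \<in> carrier A" "\<phi>2 \<in> carrier A" using t2 c T by auto
      have "r - d \<phi>2 \<le> n" using t2 dat False by auto
      from mulF[OF t2(2) this t(2) p'] have f2: "fac T (\<phi>2 \<otimes> \<phi>')" .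
      have "min (d \<phi>2) (d \<phi>') \<le> d (\<phi>2 \<otimes> \<phi>')" using d_mult tc tc2 by auto
      then have "d \<tau>2 < d (\<phi>2 \<otimes> \<phi>')" using t2 t False dat dphi by auto
      from fac.mult[OF t2(1) f2 this] show ?thesis unfolding e t2(3) using tc tc2 by (simp add: m_assoc)
    qed
  qed
qed

lemma fac_left:
  assumes "T \<subseteq> carrier A" "\<And>a b. a \<in> T \<Longrightarrow> b \<in> T \<Longrightarrow> fac T (a \<otimes> b)" "a \<in> T" "fac T \<phi>"
  shows "fac T (a \<otimes> \<phi>)"
  by (rule fac_mult_left[OF assms(1,2,3,4), of r]) auto

lemma fac_fac:
  assumes "T \<subseteq> carrier A" "\<And>a b. a \<in> T \<Longrightarrow> b \<in> T \<Longrightarrow> fac T (a \<otimes> b)" "fac T \<psi>" "fac T \<phi>"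
  shows "fac T (\<psi> \<otimes> \<phi>)"
  using assms(3)
proof (induction rule: fac.induct)
  case one then show ?case using fac_carrier[OF assms(4,1)] assms(4) by simp
next
  case (mult \<tau> \<chi>)
  have "\<tau> \<otimes> \<chi> \<otimes> \<phi> = \<tau> \<otimes> (\<chi> \<otimes> \<phi>)"
    using mult assms(1) fac_carrier[OF assms(4,1)] fac_carrier[OF mult(2) assms(1)] by (auto intro: m_assoc)
  then show ?case using fac_left[OF assms(1,2) mult(1) mult.IH] by simp
qed

end


section \<open>Finite groups and series read from the tape\<close>

locale vser = group G for G :: "nat monoid" (structure) +
  fixes xs :: "nat list" and z m :: nat and S :: "nat set list"
  assumes car: "carrier G = {..<nn xs}" and len: "length S = m" "0 < m"
    and S0: "S ! 0 = {\<one>}" and Sm: "S ! (m - 1) = carrier G"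
    and nrm: "\<And>i. Suc i < m \<Longrightarrow> S ! i \<lhd> G\<lparr>carrier := S ! Suc i\<rparr>"
    and tmul: "\<And>a b. a < nn xs \<Longrightarrow> b < nn xs \<Longrightarrow> tmul xs z a b = a \<otimes> b"
    and tmem: "\<And>j x. j < m \<Longrightarrow> x < nn xs \<Longrightarrow> tmem xs z j x \<longleftrightarrow> x \<in> S ! j"
begin

text \<open>Each term is given as normal in the next one only, so the induction descends from the
  whole group.\<close>

lemma sub: "j < m \<Longrightarrow> subgroup (S ! j) G"
proof -
  have "subgroup (S ! (m - 1 - k)) G" if "k \<le> m - 1" for k
    using that
  proof (induction k)
    case 0 then show ?case using Sm subgroup_self by simp
  next
    case (Suc k)
    then have e: "Suc (m - 1 - Suc k) = m - 1 - k" "Suc (m - 1 - Suc k) < m" by auto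
    from nrm[OF e(2)] have "subgroup (S ! (m - 1 - Suc k)) (G\<lparr>carrier := S ! (m - 1 - k)\<rparr>)"
      unfolding e by (rule normal_imp_subgroup)
    then show ?case using Suc incl_subgroup by auto
  qed
  from this[of "m - 1 - j"] show "j < m \<Longrightarrow> subgroup (S ! j) G" by simp
qed

lemma step_incl: "Suc i < m \<Longrightarrow> S ! i \<subseteq> S ! Suc i"
  using normal_imp_subgroup[OF nrm] subgroup.subset by fastforce

lemma chain: "j \<le> k \<Longrightarrow> k < m \<Longrightarrow> S ! j \<subseteq> S ! k"
proof (induction k)
  case (Suc k)
  then show ?case using step_incl[of k] by (cases "j = Suc k") auto
qed simp

lemma inC: "j < m \<Longrightarrow> x \<in> S ! j \<Longrightarrow> x \<in> carrier G"
  using subgroup.subset[OF sub] by blast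

lemma inN: "j < m \<Longrightarrow> x \<in> S ! j \<Longrightarrow> x < nn xs"
  using inC car by auto

lemma clo [simp]:
  "j < m \<Longrightarrow> x \<in> S ! j \<Longrightarrow> y \<in> S ! j \<Longrightarrow> x \<otimes> y \<in> S ! j"
  "j < m \<Longrightarrow> x \<in> S ! j \<Longrightarrow> inv x \<in> S ! j"
  "j < m \<Longrightarrow> \<one> \<in> S ! j"
  using sub subgroup.m_closed subgroup.m_inv_closed subgroup.one_closed by metis+

lemma nconj: "Suc i < m \<Longrightarrow> x \<in> S ! Suc i \<Longrightarrow> a \<in> S ! i \<Longrightarrow> x \<otimes> a \<otimes> inv x \<in> S ! i"
  using normal.inv_op_closed2[OF nrm, of i x a] m_inv_consistent[OF sub, of "Suc i" x] by simp

lemma carN: "x \<in> carrier G \<longleftrightarrow> x < nn xs"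
  using car by auto

lemma tdiv_eq: "a < nn xs \<Longrightarrow> b < nn xs \<Longrightarrow> tdiv xs z a b = a \<otimes> inv b"
proof -
  assume ab: "a < nn xs" "b < nn xs"
  then have c: "a \<in> carrier G" "b \<in> carrier G" by (auto simp: car)
  let ?x = "a \<otimes> inv b"
  have x: "?x \<in> carrier G" using c by simp
  have "?x \<otimes> b = a" using c by (simp add: m_assoc)
  then have "?x \<in> set [0..<nn xs]" "tmul xs z ?x b = a"
    using x ab tmul[of ?x b] carN by auto
  from foldl_pick[of ?x "[0..<nn xs]" "\<lambda>x. tmul xs z x b = a" 0, OF this]
  have 1: "tdiv xs z a b < nn xs" "tmul xs z (tdiv xs z a b) b = a" unfolding tdiv_def by auto
  then have d: "tdiv xs z a b \<in> carrier G" "tdiv xs z a b \<otimes> b = a" using ab by (auto simp: car tmul)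
  then show ?thesis using c by (metis inv_solve_right)
qed

lemma muC: "a \<in> carrier G \<Longrightarrow> b \<in> carrier G \<Longrightarrow> tmul xs z a b = a \<otimes> b"
  by (simp add: tmul carN)

lemma dvC: "a \<in> carrier G \<Longrightarrow> b \<in> carrier G \<Longrightarrow> tdiv xs z a b = a \<otimes> inv b"
  by (simp add: tdiv_eq carN)

lemma meC: "j < m \<Longrightarrow> x \<in> carrier G \<Longrightarrow> tmem xs z j x \<longleftrightarrow> x \<in> S ! j"
  by (simp add: tmem carN)

lemma one_eq: "one_of xs z = \<one>"
proof -
  have o: "\<one> < nn xs" using one_closed car by auto
  then have "\<one> \<in> set [0..<nn xs]" "tmem xs z 0 \<one>" using tmem[of 0 "\<one>"] len S0 by auto
  from foldl_pick[of "\<one>" "[0..<nn xs]" "\<lambda>x. tmem xs z 0 x" 0, OF this]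
  have "one_of xs z < nn xs" "tmem xs z 0 (one_of xs z)" unfolding one_of_def by auto
  then show ?thesis using tmem[of 0] len S0 by auto
qed

end

section \<open>Coset representatives as words in generators\<close>

lemma zip_gens_zip: "length ys = length hs \<Longrightarrow> zip_gens ys hs = zip ys hs"
  by (rule nth_equalityI) (auto simp: zip_gens_def app_def)

lemma app_nth: "x < length l \<Longrightarrow> app l x = l ! x"
  by (simp add: app_def)

lemma app_map_upt [simp]: "x < n \<Longrightarrow> app (map g [0..<n]) x = g x"
  by (simp add: app_def)

lemma app_upt [simp]: "x < n \<Longrightarrow> app [0..<n] x = x"
  by (simp add: app_def)

lemma prefix_foldl: "(\<And>W x. \<exists>E. g W x = W @ E) \<Longrightarrow> \<exists>E. foldl g W l = W @ E"
proof (induction l arbitrary: W)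
  case (Cons x l)
  from Cons.prems obtain E where "g W x = W @ E" by blast
  then show ?case using Cons.IH[OF Cons.prems, of "W @ E"] by auto
qed simp

lemma add_word_app: "\<exists>E. add_word xs z i w W y = W @ E"
  by (auto simp: add_word_def)

lemma covered_append: "covered xs i W x \<Longrightarrow> covered xs i (W @ E) x"
  by (auto simp: covered_def)

lemma covered_fst: "covered xs i W x \<longleftrightarrow> (\<exists>a\<in>set (map fst W). tmem xs 1 i (tdiv xs 1 x a))"
  by (auto simp: covered_def)

lemma add_word_fst: "map fst W = map fst W' \<Longrightarrow> fst w = fst w' \<Longrightarrow> fst y = fst y' \<Longrightarrow>
   map fst (add_word xs z i w W y) = map fst (add_word xs z' i w' W' y')"
  using map_eq_imp_length_eq[of fst W fst W'] by (auto simp: add_word_def covered_fst)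

lemma foldl_add_word_fst: "map fst Y = map fst Y' \<Longrightarrow> map fst W = map fst W' \<Longrightarrow> fst w = fst w' \<Longrightarrow>
   map fst (foldl (add_word xs z i w) W Y) = map fst (foldl (add_word xs z' i w') W' Y')"
proof (induction Y arbitrary: Y' W W')
  case (Cons y Y)
  then obtain y' Y2 where Y': "Y' = y' # Y2" "fst y = fst y'" "map fst Y = map fst Y2" by (cases Y') auto
  show ?case unfolding Y' foldl.simps
    by (rule Cons.IH[OF Y'(3) add_word_fst[OF Cons.prems(2,3) Y'(2)] Cons.prems(3)])
qed simp

text \<open>All decisions look at first components only, so the same words are chosen whatever the
  intended images are. This makes towers for different guesses comparable.\<close>

lemma coset_words_fst:
  assumes "map fst Y = map fst Y'"
  shows "map fst (coset_words xs z i Y) = map fst (coset_words xs z' i Y')"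
proof -
  have "map fst (foldl (\<lambda>W k. if k < length W then foldl (add_word xs z i (W ! k)) W Y else W) W ks) =
     map fst (foldl (\<lambda>W k. if k < length W then foldl (add_word xs z' i (W ! k)) W Y' else W) W' ks)"
    if "map fst W = map fst W'" for W W' ks
    using that
  proof (induction ks arbitrary: W W')
    case (Cons k ks)
    have l: "length W = length W'" using map_eq_imp_length_eq[OF Cons.prems] .
    show ?case unfolding foldl.simps
    proof (rule Cons.IH)
      have "fst (W ! k) = fst (W' ! k)" if "k < length W'"
        using that l Cons.prems by (metis nth_map)
      then show "map fst (if k < length W then foldl (add_word xs z i (W ! k)) W Y else W) =
         map fst (if k < length W' then foldl (add_word xs z' i (W' ! k)) W' Y' else W')"
        using foldl_add_word_fst[OF assms Cons.prems] l Cons.prems by simp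
    qed
  qed simp
  then show ?thesis unfolding coset_words_def by simp
qed

text \<open>Used with the two given groups, and with \<open>H = G\<close> for automorphisms.\<close>

locale pair = G: vser G xs 1 m S + H: vser H xs z m T for G H xs z m S T
begin

text \<open>One word evaluated in the generators and in their intended images. The images may be a
  wrong guess, so this need not be the graph of a function.\<close>

inductive_set gp :: "(nat \<times> nat) list \<Rightarrow> (nat \<times> nat) set" for Y where
  one: "(\<one>\<^bsub>G\<^esub>, \<one>\<^bsub>H\<^esub>) \<in> gp Y"
| mul: "w \<in> gp Y \<Longrightarrow> y \<in> set Y \<Longrightarrow> (fst w \<otimes>\<^bsub>G\<^esub> fst y, snd w \<otimes>\<^bsub>H\<^esub> snd y) \<in> gp Y"

end

locale level = pair +
  fixes i :: nat and ys hs :: "nat list"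
  assumes i: "Suc i < m" and ys: "set ys \<subseteq> S ! Suc i" and hs: "set hs \<subseteq> {..<nn xs}"
    and lhs: "length hs = length ys"
begin

abbreviation "Y \<equiv> zip_gens ys hs"
abbreviation "W \<equiv> coset_words xs z i Y"

lemma Yzip: "Y = zip ys hs"
  using lhs by (simp add: zip_gens_zip)

lemma inY: "y \<in> set Y \<Longrightarrow> fst y \<in> S ! Suc i \<and> fst y \<in> carrier G \<and> snd y \<in> carrier H"
  using ys hs G.inC[OF i] H.carN unfolding Yzip by (cases y) (auto dest: set_zip_leftD set_zip_rightD)

lemma im: "i < m" using i by simp

lemma gp_in: "w \<in> gp Y \<Longrightarrow> fst w \<in> S ! Suc i \<and> fst w \<in> carrier G \<and> snd w \<in> carrier H"
  by (induction rule: gp.induct) (use i inY in \<open>auto\<close>)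

lemma N_in [simp]: "a \<in> S ! i \<Longrightarrow> a \<in> carrier G" "a \<in> S ! Suc i \<Longrightarrow> a \<in> carrier G"
  using G.inC i im by blast+

lemma covered_iff: "x \<in> carrier G \<Longrightarrow> set V \<subseteq> gp Y \<Longrightarrow>
    covered xs i V x \<longleftrightarrow> (\<exists>w\<in>set V. x \<otimes>\<^bsub>G\<^esub> inv\<^bsub>G\<^esub> fst w \<in> S ! i)"
proof -
  assume x: "x \<in> carrier G" and V: "set V \<subseteq> gp Y"
  have "tmem xs 1 i (tdiv xs 1 x (fst w)) \<longleftrightarrow> x \<otimes>\<^bsub>G\<^esub> inv\<^bsub>G\<^esub> fst w \<in> S ! i" if "w \<in> set V" for w
  proof -
    have w: "fst w \<in> carrier G" using that V gp_in by blast
    have "x \<otimes>\<^bsub>G\<^esub> inv\<^bsub>G\<^esub> fst w \<in> carrier G" using x w by simp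
    then show ?thesis using x w G.dvC[of x "fst w"] G.meC[OF im] by simp
  qed
  then show ?thesis unfolding covered_def by auto
qed

definition JW :: "(nat \<times> nat) list \<Rightarrow> bool" where
  "JW V \<longleftrightarrow> V \<noteq> [] \<and> V ! 0 = (\<one>\<^bsub>G\<^esub>, \<one>\<^bsub>H\<^esub>) \<and> set V \<subseteq> gp Y \<and>
     (\<forall>p q. p < q \<longrightarrow> q < length V \<longrightarrow> fst (V ! q) \<otimes>\<^bsub>G\<^esub> inv\<^bsub>G\<^esub> fst (V ! p) \<notin> S ! i)"

lemma JW_distinct: "JW V \<Longrightarrow> distinct (map fst V) \<and> set (map fst V) \<subseteq> {..<nn xs}"
proof -
  assume J: "JW V"
  have "fst (V ! p) \<noteq> fst (V ! q)" if "p < q" "q < length V" for p q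
  proof
    assume e: "fst (V ! p) = fst (V ! q)"
    have "fst (V ! q) \<in> carrier G" using J that gp_in unfolding JW_def by (meson nth_mem subsetD)
    then have "fst (V ! q) \<otimes>\<^bsub>G\<^esub> inv\<^bsub>G\<^esub> fst (V ! p) = \<one>\<^bsub>G\<^esub>" using e by simp
    then show False using J that G.clo(3)[OF im] unfolding JW_def by metis
  qed
  then have "distinct (map fst V)" unfolding distinct_conv_nth by (metis length_map nat_neq_iff nth_map)
  moreover have "set (map fst V) \<subseteq> {..<nn xs}" using J gp_in unfolding JW_def by (auto simp: G.carN[symmetric])
  ultimately show ?thesis by blast
qed

lemma JW_length: "JW V \<Longrightarrow> length V \<le> nn xs"
  using JW_distinct[of V] distinct_card[of "map fst V"] card_mono[of "{..<nn xs}" "set (map fst V)"] by auto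

lemma add_word_JW:
  assumes J: "JW V" and w: "w \<in> gp Y" and y: "y \<in> set Y"
  shows "JW (add_word xs z i w V y) \<and> covered xs i (add_word xs z i w V y) (fst w \<otimes>\<^bsub>G\<^esub> fst y)"
proof -
  have wy: "fst w \<in> carrier G" "snd w \<in> carrier H" "fst y \<in> carrier G" "snd y \<in> carrier H"
    using gp_in[OF w] inY[OF y] by auto
  then have e: "tmul xs 1 (fst w) (fst y) = fst w \<otimes>\<^bsub>G\<^esub> fst y" "tmul xs z (snd w) (snd y) = snd w \<otimes>\<^bsub>H\<^esub> snd y"
    by (auto simp: G.muC H.muC)
  let ?x = "fst w \<otimes>\<^bsub>G\<^esub> fst y" let ?p = "(fst w \<otimes>\<^bsub>G\<^esub> fst y, snd w \<otimes>\<^bsub>H\<^esub> snd y)"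
  have x: "?x \<in> carrier G" using wy by simp
  have V: "set V \<subseteq> gp Y" using J by (simp add: JW_def)
  show ?thesis
  proof (cases "covered xs i V ?x")
    case True then show ?thesis using J by (simp add: add_word_def e)
  next
    case False
    then have nc: "?x \<otimes>\<^bsub>G\<^esub> inv\<^bsub>G\<^esub> fst v \<notin> S ! i" if "v \<in> set V" for v
      using covered_iff[OF x V] that by auto
    have J': "JW (V @ [?p])"
      unfolding JW_def
    proof (intro conjI allI impI)
      show "set (V @ [?p]) \<subseteq> gp Y" using V gp.mul[OF w y] by auto
      show "(V @ [?p]) ! 0 = (\<one>\<^bsub>G\<^esub>, \<one>\<^bsub>H\<^esub>)" using J by (auto simp: JW_def nth_append)
      fix p q assume pq: "p < q" "q < length (V @ [?p])"
      show "fst ((V @ [?p]) ! q) \<otimes>\<^bsub>G\<^esub> inv\<^bsub>G\<^esub> fst ((V @ [?p]) ! p) \<notin> S ! i"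
      proof (cases "q < length V")
        case True then show ?thesis using J pq by (auto simp: JW_def nth_append)
      next
        case False
        then have "q = length V" using pq by simp
        then show ?thesis using nc[of "V ! p"] pq by (auto simp: nth_append)
      qed
    qed auto
    \<comment> \<open>The cap in \<open>add_word\<close> is not reached, since even the longer list
      has distinct first components below \<open>nn xs\<close>.\<close>
    have "length V < nn xs" using JW_length[OF J'] by simp
    then have s: "add_word xs z i w V y = V @ [?p]" using False by (simp add: add_word_def e)
    have "?x \<otimes>\<^bsub>G\<^esub> inv\<^bsub>G\<^esub> ?x \<in> S ! i" using x G.clo(3)[OF im] by simp
    then have "covered xs i (V @ [?p]) ?x" using J' by (subst covered_iff[OF x]) (auto simp: JW_def)
    then show ?thesis using J' s by simp
  qed
qed

lemma foldl_add_word_JW: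
  assumes w: "w \<in> gp Y"
  shows "JW V \<Longrightarrow> set Y' \<subseteq> set Y \<Longrightarrow> JW (foldl (add_word xs z i w) V Y') \<and>
    (\<forall>y\<in>set Y'. covered xs i (foldl (add_word xs z i w) V Y') (fst w \<otimes>\<^bsub>G\<^esub> fst y))"
proof (induction Y' arbitrary: V)
  case (Cons y Y')
  have 1: "JW (add_word xs z i w V y)" "covered xs i (add_word xs z i w V y) (fst w \<otimes>\<^bsub>G\<^esub> fst y)"
    using add_word_JW[OF Cons.prems(1) w] Cons.prems(2) by auto
  obtain E where E: "foldl (add_word xs z i w) (add_word xs z i w V y) Y' = add_word xs z i w V y @ E"
    using prefix_foldl[of "add_word xs z i w" "add_word xs z i w V y" Y'] add_word_app by blast
  show ?case using Cons.IH[OF 1(1)] Cons.prems(2) covered_append[OF 1(2), of E] E by auto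
qed simp

lemma W_JW: "JW W" and W_closed: "w \<in> set W \<Longrightarrow> y \<in> set Y \<Longrightarrow> covered xs i W (fst w \<otimes>\<^bsub>G\<^esub> fst y)"
proof -
  have "JW W \<and> (\<forall>k<length W. (\<forall>y\<in>set Y. covered xs i W (fst (W ! k) \<otimes>\<^bsub>G\<^esub> fst y)))"
    unfolding coset_words_def
  proof (rule worklist)
    fix V k
    show "\<exists>E. foldl (add_word xs z i (V ! k)) V Y = V @ E" using prefix_foldl add_word_app by blast
    show "length V \<le> nn xs" if "JW V" using that by (rule JW_length)
    assume "JW V" "k < length V"
    moreover from this have "V ! k \<in> gp Y" unfolding JW_def by auto
    moreover have "\<exists>E. foldl (add_word xs z i (V ! k)) V Y = V @ E" using prefix_foldl add_word_app by blast
    ultimately show "(\<forall>y\<in>set Y. covered xs i (foldl (add_word xs z i (V ! k)) V Y)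
       (fst (foldl (add_word xs z i (V ! k)) V Y ! k) \<otimes>\<^bsub>G\<^esub> fst y)) \<and> JW (foldl (add_word xs z i (V ! k)) V Y)"
      using foldl_add_word_JW[of "V ! k" V Y] by (auto simp: nth_append)
  next
    show "JW [(one_of xs 1, one_of xs z)]" unfolding G.one_eq H.one_eq JW_def by (auto intro: gp.one)
  qed (auto simp: nth_append intro: covered_append)
  then show "JW W" "w \<in> set W \<Longrightarrow> y \<in> set Y \<Longrightarrow> covered xs i W (fst w \<otimes>\<^bsub>G\<^esub> fst y)"
    by (auto simp: in_set_conv_nth[of w])
qed

lemma W_gp: "w \<in> set W \<Longrightarrow> w \<in> gp Y"
  using W_JW by (auto simp: JW_def)

lemma W_one: "(\<one>\<^bsub>G\<^esub>, \<one>\<^bsub>H\<^esub>) \<in> set W"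
  using W_JW unfolding JW_def by (metis length_greater_0_conv nth_mem)

lemma W_covI: "x \<in> carrier G \<Longrightarrow> w \<in> set W \<Longrightarrow> x \<otimes>\<^bsub>G\<^esub> inv\<^bsub>G\<^esub> fst w \<in> S ! i \<Longrightarrow> covered xs i W x"
  using covered_iff[of x W] W_gp by blast

lemma W_covD: "x \<in> carrier G \<Longrightarrow> covered xs i W x \<Longrightarrow>
    \<exists>n\<in>S ! i. \<exists>w\<in>set W. x = n \<otimes>\<^bsub>G\<^esub> fst w"
proof -
  assume x: "x \<in> carrier G" "covered xs i W x"
  then obtain w where w: "w \<in> set W" "x \<otimes>\<^bsub>G\<^esub> inv\<^bsub>G\<^esub> fst w \<in> S ! i"
    using covered_iff[of x W] W_gp by blast
  have "x = (x \<otimes>\<^bsub>G\<^esub> inv\<^bsub>G\<^esub> fst w) \<otimes>\<^bsub>G\<^esub> fst w"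
    using x gp_in[OF W_gp[OF w(1)]] by (simp add: G.m_assoc)
  then show ?thesis using w by blast
qed

lemma W_covered_mult: "n \<in> S ! i \<Longrightarrow> w \<in> set W \<Longrightarrow> covered xs i W (n \<otimes>\<^bsub>G\<^esub> fst w)"
  using gp_in[OF W_gp[of w]] by (intro W_covI[of _ w]) (auto simp: G.m_assoc)

lemma W_unique:
  assumes "w \<in> set W" "w' \<in> set W" "n \<in> S ! i" "n' \<in> S ! i" "n \<otimes>\<^bsub>G\<^esub> fst w = n' \<otimes>\<^bsub>G\<^esub> fst w'"
  shows "w = w' \<and> n = n'"
proof -
  obtain p q where p: "p < length W" "W ! p = w" and q: "q < length W" "W ! q = w'"
    using assms by (auto simp: in_set_conv_nth)
  have c: "fst w \<in> carrier G" "fst w' \<in> carrier G" using gp_in W_gp assms by auto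
  have nc: "n \<in> carrier G" "n' \<in> carrier G" using assms by auto
  have "fst w \<otimes>\<^bsub>G\<^esub> inv\<^bsub>G\<^esub> fst w' = inv\<^bsub>G\<^esub> n \<otimes>\<^bsub>G\<^esub> (n \<otimes>\<^bsub>G\<^esub> fst w) \<otimes>\<^bsub>G\<^esub> inv\<^bsub>G\<^esub> fst w'"
    using c nc by (simp add: G.m_assoc[symmetric])
  also have "\<dots> = inv\<^bsub>G\<^esub> n \<otimes>\<^bsub>G\<^esub> n'" unfolding assms(5) using c nc by (simp add: G.m_assoc)
  finally have 1: "fst w \<otimes>\<^bsub>G\<^esub> inv\<^bsub>G\<^esub> fst w' \<in> S ! i" using assms G.clo im by simp
  then have "inv\<^bsub>G\<^esub> (fst w \<otimes>\<^bsub>G\<^esub> inv\<^bsub>G\<^esub> fst w') \<in> S ! i" using im by simp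
  then have 2: "fst w' \<otimes>\<^bsub>G\<^esub> inv\<^bsub>G\<^esub> fst w \<in> S ! i" using c by (simp add: G.inv_mult_group)
  have "p = q" using W_JW 1 2 p q unfolding JW_def by (metis nat_neq_iff)
  then have "w = w'" using p q by simp
  then show ?thesis using assms c nc by auto
qed

lemma coset_rep_eq: "n \<in> S ! i \<Longrightarrow> w \<in> set W \<Longrightarrow> coset_rep xs i W (n \<otimes>\<^bsub>G\<^esub> fst w) = w"
proof -
  assume nw: "n \<in> S ! i" "w \<in> set W"
  let ?x = "n \<otimes>\<^bsub>G\<^esub> fst w"
  have c: "fst v \<in> carrier G" if "v \<in> set W" for v using gp_in W_gp that by auto
  have x: "?x \<in> carrier G" using nw c by auto
  have q: "tmem xs 1 i (tdiv xs 1 ?x (fst v)) \<longleftrightarrow> ?x \<otimes>\<^bsub>G\<^esub> inv\<^bsub>G\<^esub> fst v \<in> S ! i" if "v \<in> set W" for v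
    using G.dvC[of ?x "fst v"] G.meC[OF im, of "?x \<otimes>\<^bsub>G\<^esub> inv\<^bsub>G\<^esub> fst v"] x c[OF that] by simp
  have "tmem xs 1 i (tdiv xs 1 ?x (fst w))" using q[OF nw(2)] nw c by (simp add: G.m_assoc)
  from foldl_pick[of w W "\<lambda>w. tmem xs 1 i (tdiv xs 1 ?x (fst w))" "(0,0)", OF nw(2) this]
  have r: "coset_rep xs i W ?x \<in> set W" "tmem xs 1 i (tdiv xs 1 ?x (fst (coset_rep xs i W ?x)))"
    unfolding coset_rep_def by auto
  let ?r = "coset_rep xs i W ?x"
  have "?x \<otimes>\<^bsub>G\<^esub> inv\<^bsub>G\<^esub> fst ?r \<in> S ! i" using q r by simp
  moreover have "(?x \<otimes>\<^bsub>G\<^esub> inv\<^bsub>G\<^esub> fst ?r) \<otimes>\<^bsub>G\<^esub> fst ?r = n \<otimes>\<^bsub>G\<^esub> fst w" using x c[OF r(1)] by (simp add: G.m_assoc)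
  ultimately show ?thesis using W_unique[OF r(1) nw(2) _ nw(1)] by blast
qed

text \<open>The covered elements contain the identity and are closed under right multiplication by
  generators: for \<open>ys\<close> because the worklist is closed, for \<open>G_i\<close> because
  it is normal in \<open>G_{i+1}\<close> and can be moved past a representative.\<close>

lemma covered_generate: "x \<in> carrier G \<Longrightarrow> covered xs i W x \<longleftrightarrow> x \<in> generate G (S ! i \<union> set ys)"
proof
  have sub: "S ! i \<union> set ys \<subseteq> carrier G" using ys G.inC i im by blast
  have gpg: "fst w \<in> generate G (S ! i \<union> set ys)" if "w \<in> gp Y" for w
    using that
  proof (induction rule: gp.induct)
    case one then show ?case by (simp add: generate.one)
  next
    case (mul w y)
    have "fst y \<in> set ys" using set_zip_leftD[of "fst y" "snd y" ys hs] mul(2) unfolding Yzip by simp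
    then show ?case using mul by (auto intro: generate.eng generate.incl)
  qed
  assume x: "x \<in> carrier G"
  {
    assume "covered xs i W x"
    from W_covD[OF x this] obtain n w where "n \<in> S ! i" "w \<in> set W" "x = n \<otimes>\<^bsub>G\<^esub> fst w" by blast
    then show "x \<in> generate G (S ! i \<union> set ys)" using gpg[OF W_gp[of w]] by (auto intro: generate.eng generate.incl)
  }
  let ?E = "{x \<in> carrier G. covered xs i W x}"
  have fin: "finite ?E" using G.car by simp
  have r1: "e \<otimes>\<^bsub>G\<^esub> g \<in> ?E" if g: "g \<in> S ! i \<union> set ys" and e: "e \<in> ?E" for e g
  proof -
    from e W_covD obtain n w where nw: "n \<in> S ! i" "w \<in> set W" "e = n \<otimes>\<^bsub>G\<^esub> fst w" by blast
    have c: "fst w \<in> carrier G" "fst w \<in> S ! Suc i" using gp_in W_gp nw by auto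
    have gc: "g \<in> carrier G" using g sub by auto
    have "covered xs i W (e \<otimes>\<^bsub>G\<^esub> g)"
    proof (cases "g \<in> S ! i")
      case True
      have "e \<otimes>\<^bsub>G\<^esub> g = (n \<otimes>\<^bsub>G\<^esub> (fst w \<otimes>\<^bsub>G\<^esub> g \<otimes>\<^bsub>G\<^esub> inv\<^bsub>G\<^esub> fst w)) \<otimes>\<^bsub>G\<^esub> fst w"
        using nw c gc by (simp add: G.m_assoc)
      moreover have "n \<otimes>\<^bsub>G\<^esub> (fst w \<otimes>\<^bsub>G\<^esub> g \<otimes>\<^bsub>G\<^esub> inv\<^bsub>G\<^esub> fst w) \<in> S ! i"
        using G.nconj[OF i c(2) True] nw im by simp
      ultimately show ?thesis using W_covered_mult nw by simp
    next
      case False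
      then obtain k where "k < length ys" "ys ! k = g" using g by (auto simp: in_set_conv_nth)
      then have "(g, hs ! k) \<in> set Y" unfolding Yzip set_zip using lhs by auto
      then obtain y where y: "y \<in> set Y" "fst y = g" by force
      from W_covD[OF _ W_closed[OF nw(2) y(1)]] obtain n' w' where
        n': "n' \<in> S ! i" "w' \<in> set W" "fst w \<otimes>\<^bsub>G\<^esub> g = n' \<otimes>\<^bsub>G\<^esub> fst w'" using c gc y by auto
      have "e \<otimes>\<^bsub>G\<^esub> g = n \<otimes>\<^bsub>G\<^esub> (fst w \<otimes>\<^bsub>G\<^esub> g)" using nw c gc by (simp add: G.m_assoc)
      also have "\<dots> = (n \<otimes>\<^bsub>G\<^esub> n') \<otimes>\<^bsub>G\<^esub> fst w'" unfolding n'(3)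
        using nw n' gp_in[OF W_gp[OF n'(2)]] by (simp add: G.m_assoc)
      finally show ?thesis using W_covered_mult[of "n \<otimes>\<^bsub>G\<^esub> n'" w'] n' nw im by simp
    qed
    then show ?thesis using e gc by auto
  qed
  \<comment> \<open>Right translation by \<open>g\<close> is an injection of the finite set
    \<open>?E\<close> into itself, hence onto; this supplies inverses.\<close>
  have r2: "e \<otimes>\<^bsub>G\<^esub> inv\<^bsub>G\<^esub> g \<in> ?E" if g: "g \<in> S ! i \<union> set ys" and e: "e \<in> ?E" for e g
  proof -
    have gc: "g \<in> carrier G" using g sub by auto
    have "inj_on (\<lambda>e. e \<otimes>\<^bsub>G\<^esub> g) ?E" using gc by (auto intro!: inj_onI)
    moreover have "(\<lambda>e. e \<otimes>\<^bsub>G\<^esub> g) ` ?E \<subseteq> ?E" using r1[OF g] by blast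
    ultimately have "(\<lambda>e. e \<otimes>\<^bsub>G\<^esub> g) ` ?E = ?E" using fin by (meson endo_inj_surj)
    then obtain e' where e': "e' \<in> ?E" "e = e' \<otimes>\<^bsub>G\<^esub> g" using e by auto
    then have "e \<otimes>\<^bsub>G\<^esub> inv\<^bsub>G\<^esub> g = e'" using gc by (auto simp: G.m_assoc)
    then show ?thesis using e' by simp
  qed
  have r3: "\<forall>e\<in>?E. e \<otimes>\<^bsub>G\<^esub> g \<in> ?E" if "g \<in> generate G (S ! i \<union> set ys)" for g
    using that
  proof (induction rule: generate.induct)
    case (eng h1 h2)
    have "h1 \<in> carrier G" "h2 \<in> carrier G" using eng G.generate_in_carrier[OF sub] by auto
    then show ?case using eng by (auto simp: G.m_assoc[symmetric])
  qed (use r1 r2 in auto)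
  have "covered xs i W (\<one>\<^bsub>G\<^esub> \<otimes>\<^bsub>G\<^esub> fst (\<one>\<^bsub>G\<^esub>, \<one>\<^bsub>H\<^esub>))" by (rule W_covered_mult) (use W_one im in auto)
  then have "\<one>\<^bsub>G\<^esub> \<in> ?E" by simp
  then show "x \<in> generate G (S ! i \<union> set ys) \<Longrightarrow> covered xs i W x" using r3[of x] x by auto
qed

end


text \<open>A coset of \<open>K\<close> by an element of \<open>K'\<close> outside \<open>K\<close>
  is disjoint from \<open>K\<close> and has the same size.\<close>

lemma (in group) card_double:
  assumes "subgroup K G" "subgroup K' G" "K \<subset> K'" "finite K'"
  shows "2 * card K \<le> card K'"
proof -
  obtain x where x: "x \<in> K'" "x \<notin> K" using assms(3) by auto
  have c: "K \<subseteq> carrier G" "K' \<subseteq> carrier G" using assms subgroup.subset by auto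
  let ?L = "(\<lambda>k. k \<otimes> x) ` K"
  have i: "inj_on (\<lambda>k. k \<otimes> x) K" using c x by (intro inj_onI) (metis right_cancel subsetD)
  have d: "K \<inter> ?L = {}"
  proof (rule ccontr)
    assume "K \<inter> ?L \<noteq> {}"
    then obtain k where k: "k \<in> K" "k \<otimes> x \<in> K" by auto
    then have "inv k \<otimes> (k \<otimes> x) \<in> K" using subgroup.m_closed[OF assms(1)] subgroup.m_inv_closed[OF assms(1)] by blast
    moreover have "inv k \<otimes> (k \<otimes> x) = x"
      using k c x by (metis inv_solve_left m_closed subsetD)
    ultimately show False using x by simp
  qed
  have f: "finite K" using assms(3,4) finite_subset by blast
  have "K \<union> ?L \<subseteq> K'" using assms(3) x subgroup.m_closed[OF assms(2)] by auto
  then have "card (K \<union> ?L) \<le> card K'" using assms(4) card_mono by blast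
  moreover have "card (K \<union> ?L) = card K + card K" using card_Un_disjoint[of K ?L] d f card_image[OF i] by simp
  ultimately show ?thesis by simp
qed

context pair
begin

lemma GG: "pair G G xs 1 m S S"
  by unfold_locales

text \<open>Repeated doubling gives the last claim, which is why the number of generators is at most
  the binary logarithm of the order of the factor.\<close>

lemma coset_gens_props:
  assumes i: "Suc i < m"
  shows "set (coset_gens xs i) \<subseteq> S ! Suc i" "generate G (S ! i \<union> set (coset_gens xs i)) = S ! Suc i"
    "2 ^ length (coset_gens xs i) * card (S ! i) \<le> card (S ! Suc i)"
proof -
  let ?f = "\<lambda>ys x. if tmem xs 1 (Suc i) x \<and> \<not> covered xs i (coset_words xs 1 i (zip_gens ys ys)) x then ys @ [x] else ys"
  have im: "i < m" using i by simp
  have sub: "S ! i \<union> set ys \<subseteq> carrier G" if "set ys \<subseteq> S ! Suc i" for ys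
    using that G.inC[OF i] G.inC[OF im] by blast
  have inv: "set (foldl ?f [] [0..<k]) \<subseteq> S ! Suc i \<and>
      2 ^ length (foldl ?f [] [0..<k]) * card (S ! i) \<le> card (generate G (S ! i \<union> set (foldl ?f [] [0..<k]))) \<and>
      (\<forall>x<k. x \<in> S ! Suc i \<longrightarrow> x \<in> generate G (S ! i \<union> set (foldl ?f [] [0..<k])))" if "k \<le> nn xs" for k
    using that
  proof (induction k)
    case 0
    have "card (S ! i) \<le> card (generate G (S ! i))"
      using generate.incl G.generate_in_carrier[of "S ! i"] sub[of "[]"] G.car
      by (intro card_mono) (auto intro: finite_subset[of _ "carrier G"])
    then show ?case by simp
  next
    case (Suc k)
    let ?ys = "foldl ?f [] [0..<k]"
    have IH: "set ?ys \<subseteq> S ! Suc i" "2 ^ length ?ys * card (S ! i) \<le> card (generate G (S ! i \<union> set ?ys))"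
      "\<And>x. x < k \<Longrightarrow> x \<in> S ! Suc i \<Longrightarrow> x \<in> generate G (S ! i \<union> set ?ys)"
      using Suc by auto
    interpret L: level G G xs 1 m S S i ?ys ?ys
      by unfold_locales (use i IH(1) G.inN[OF i] in auto)
    have kc: "k \<in> carrier G" using Suc.prems by (simp add: G.carN)
    have mk: "tmem xs 1 (Suc i) k \<longleftrightarrow> k \<in> S ! Suc i" using G.meC[OF i kc] .
    have ck: "covered xs i (coset_words xs 1 i (zip_gens ?ys ?ys)) k \<longleftrightarrow> k \<in> generate G (S ! i \<union> set ?ys)"
      using L.covered_generate[OF kc] .
    show ?case
    proof (cases "k \<in> S ! Suc i \<and> k \<notin> generate G (S ! i \<union> set ?ys)")
      case True
      then have e: "foldl ?f [] [0..<Suc k] = ?ys @ [k]" using mk ck by simp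
      let ?g = "generate G (S ! i \<union> set ?ys)" let ?g' = "generate G (S ! i \<union> set (?ys @ [k]))"
      have s': "set (?ys @ [k]) \<subseteq> S ! Suc i" using IH True by auto
      have "?g \<subseteq> ?g'" by (rule G.mono_generate) auto
      moreover have kg: "k \<in> ?g'" by (rule generate.incl) simp
      ultimately have "?g \<subset> ?g'" using True by blast
      then have "2 * card ?g \<le> card ?g'"
        using G.generate_is_subgroup[OF sub[OF IH(1)]] G.generate_is_subgroup[OF sub[OF s']]
          G.generate_in_carrier[OF sub[OF s']] G.car
        by (intro G.card_double) (auto intro: finite_subset[of _ "carrier G"])
      then have "2 ^ length (?ys @ [k]) * card (S ! i) \<le> card ?g'" using IH(2) by simp
      then show ?thesis unfolding e using s' IH(3) \<open>?g \<subseteq> ?g'\<close> kg by (auto simp: less_Suc_eq)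
    next
      case False
      then have e: "foldl ?f [] [0..<Suc k] = ?ys" using mk ck by auto
      show ?thesis unfolding e using IH False by (auto simp: less_Suc_eq)
    qed
  qed
  from inv[of "nn xs"] have I: "set (coset_gens xs i) \<subseteq> S ! Suc i"
     "2 ^ length (coset_gens xs i) * card (S ! i) \<le> card (generate G (S ! i \<union> set (coset_gens xs i)))"
     "\<And>x. x < nn xs \<Longrightarrow> x \<in> S ! Suc i \<Longrightarrow> x \<in> generate G (S ! i \<union> set (coset_gens xs i))"
    unfolding coset_gens_def by auto
  have "generate G (S ! i \<union> set (coset_gens xs i)) \<subseteq> S ! Suc i"
    by (rule G.generate_subgroup_incl) (use I(1) G.step_incl[OF i] G.sub[OF i] in auto)
  moreover have "S ! Suc i \<subseteq> generate G (S ! i \<union> set (coset_gens xs i))" using I(3) G.inN[OF i] by auto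
  ultimately show g: "generate G (S ! i \<union> set (coset_gens xs i)) = S ! Suc i" by auto
  show "set (coset_gens xs i) \<subseteq> S ! Suc i" "2 ^ length (coset_gens xs i) * card (S ! i) \<le> card (S ! Suc i)"
    using I g by auto
qed

end

section \<open>Isomorphisms and automorphisms of initial segments of a series\<close>

text \<open>Injectivity comes from the membership condition for \<open>j = 0\<close>: the preimage
  of the trivial group is trivial.\<close>

definition ser_iso :: "nat monoid \<Rightarrow> nat set list \<Rightarrow> nat monoid \<Rightarrow> nat set list \<Rightarrow> nat \<Rightarrow> (nat \<Rightarrow> nat) \<Rightarrow> bool" where
  "ser_iso G S H T i f \<longleftrightarrow> (\<forall>x\<in>S ! i. f x \<in> carrier H) \<and>
     (\<forall>x\<in>S ! i. \<forall>y\<in>S ! i. f (x \<otimes>\<^bsub>G\<^esub> y) = f x \<otimes>\<^bsub>H\<^esub> f y) \<and>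
     (\<forall>x\<in>S ! i. \<forall>j\<le>i. x \<in> S ! j \<longleftrightarrow> f x \<in> T ! j) \<and> T ! i \<subseteq> f ` (S ! i)"

lemma ser_iso_cong: "(\<And>x. x \<in> S ! i \<Longrightarrow> f x = g x) \<Longrightarrow>
   (\<And>x y. x \<in> S ! i \<Longrightarrow> y \<in> S ! i \<Longrightarrow> x \<otimes>\<^bsub>G\<^esub> y \<in> S ! i) \<Longrightarrow> ser_iso G S H T i f \<longleftrightarrow> ser_iso G S H T i g"
  unfolding ser_iso_def by (simp cong: image_cong_simp)

text \<open>Fixing the points outside \<open>S ! i\<close> gives each automorphism exactly one list,
  so the lists form a group with \<open>comp_map\<close> as product and \<open>[0..<nn xs]\<close>
  as identity.\<close>

definition Aut :: "nat list \<Rightarrow> nat monoid \<Rightarrow> nat set list \<Rightarrow> nat \<Rightarrow> nat list set" where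
  "Aut xs G S i = {\<phi>. length \<phi> = nn xs \<and> ser_iso G S G S i (app \<phi>) \<and> (\<forall>x<nn xs. x \<notin> S ! i \<longrightarrow> app \<phi> x = x)}"

definition AG :: "nat list \<Rightarrow> nat monoid \<Rightarrow> nat set list \<Rightarrow> nat \<Rightarrow> nat list monoid" where
  "AG xs G S i = \<lparr>carrier = Aut xs G S i, mult = comp_map xs, one = [0..<nn xs]\<rparr>"

lemma AG_simps [simp]: "carrier (AG xs G S i) = Aut xs G S i" "mult (AG xs G S i) = comp_map xs" "one (AG xs G S i) = [0..<nn xs]"
  by (simp_all add: AG_def)

lemma app_comp_map: "x < nn xs \<Longrightarrow> app (comp_map xs \<phi> \<tau>) x = app \<phi> (app \<tau> x)"
  by (simp add: comp_map_def)

lemma len_comp_map [simp]: "length (comp_map xs \<phi> \<tau>) = nn xs"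
  by (simp add: comp_map_def)

lemma len_inv_map [simp]: "length (inv_map xs \<phi>) = nn xs"
  by (simp add: inv_map_def)

lemma app_eqI: "length \<phi> = n \<Longrightarrow> length \<psi> = n \<Longrightarrow> (\<And>x. x < n \<Longrightarrow> app \<phi> x = app \<psi> x) \<Longrightarrow> \<phi> = \<psi>"
  by (metis app_nth nth_equalityI)

context pair
begin

lemma iso_test_ser_iso: 
  assumes i: "i < m"
  shows "iso_test xs z i \<phi> \<longleftrightarrow> ser_iso G S H T i (app \<phi>)"
proof -
  have S: "x < nn xs \<and> tmem xs 1 i x \<longleftrightarrow> x \<in> S ! i" for x using G.tmem[OF i, of x] G.inN[OF i] by auto
  have T: "u < nn xs \<and> tmem xs z i u \<longleftrightarrow> u \<in> T ! i" for u using H.tmem[OF i, of u] H.inN[OF i] by auto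
  have 1: "iso_test xs z i \<phi> \<longleftrightarrow> (\<forall>x\<in>S ! i. app \<phi> x < nn xs \<and>
        (\<forall>y\<in>S ! i. app \<phi> (tmul xs 1 x y) = tmul xs z (app \<phi> x) (app \<phi> y)) \<and>
        (\<forall>j<Suc i. tmem xs 1 j x = tmem xs z j (app \<phi> x))) \<and>
     (\<forall>u\<in>T ! i. (\<exists>x\<in>S ! i. app \<phi> x = u))"
    by (simp only: iso_test_def Ball_def Bex_def S[symmetric] T[symmetric] imp_conjL conj_assoc)
  have 2: "tmul xs 1 x y = x \<otimes>\<^bsub>G\<^esub> y" if "x \<in> S ! i" "y \<in> S ! i" for x y
    using that G.tmul G.inN[OF i] by auto
  have 3: "tmem xs 1 j x \<longleftrightarrow> x \<in> S ! j" if "x \<in> S ! i" "j \<le> i" for x j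
    using that G.tmem[of j x] G.inN[OF i] i by auto
  show ?thesis
  proof (cases "\<forall>x\<in>S ! i. app \<phi> x < nn xs")
    case True
    have 4: "tmul xs z (app \<phi> x) (app \<phi> y) = app \<phi> x \<otimes>\<^bsub>H\<^esub> app \<phi> y" if "x \<in> S ! i" "y \<in> S ! i" for x y
      using that True H.tmul by auto
    have 5: "tmem xs z j (app \<phi> x) \<longleftrightarrow> app \<phi> x \<in> T ! j" if "x \<in> S ! i" "j \<le> i" for x j
      using that True H.tmem[of j] i by auto
    show ?thesis unfolding 1 ser_iso_def using 2 3 4 5 True H.carN by (auto simp: less_Suc_eq_le)
  next
    case False
    then show ?thesis unfolding 1 ser_iso_def using H.carN by auto
  qed
qed

context
  fixes i f
  assumes i: "i < m" and f: "ser_iso G S H T i f"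
begin

lemma ser_iso_in: "x \<in> S ! i \<Longrightarrow> f x \<in> carrier H" "x \<in> S ! i \<Longrightarrow> f x \<in> T ! i"
  using f by (auto simp: ser_iso_def)

lemma ser_iso_mult: "x \<in> S ! i \<Longrightarrow> y \<in> S ! i \<Longrightarrow> f (x \<otimes>\<^bsub>G\<^esub> y) = f x \<otimes>\<^bsub>H\<^esub> f y"
  using f by (auto simp: ser_iso_def)

lemma ser_iso_mem: "x \<in> S ! i \<Longrightarrow> j \<le> i \<Longrightarrow> f x \<in> T ! j \<longleftrightarrow> x \<in> S ! j"
  using f by (auto simp: ser_iso_def)

lemma ser_iso_one: "f \<one>\<^bsub>G\<^esub> = \<one>\<^bsub>H\<^esub>"
  using ser_iso_mem[of "\<one>\<^bsub>G\<^esub>" 0] G.S0 H.S0 G.clo(3)[OF i] by simp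

lemma ser_iso_inv: "x \<in> S ! i \<Longrightarrow> f (inv\<^bsub>G\<^esub> x) = inv\<^bsub>H\<^esub> (f x)"
proof -
  assume x: "x \<in> S ! i"
  have "f x \<otimes>\<^bsub>H\<^esub> f (inv\<^bsub>G\<^esub> x) = \<one>\<^bsub>H\<^esub>"
    using ser_iso_mult[of x "inv\<^bsub>G\<^esub> x"] x G.clo(2)[OF i] ser_iso_one G.inC[OF i] by simp
  then show ?thesis using ser_iso_in x G.clo(2)[OF i] by (metis H.inv_equality H.inv_comm)
qed

lemma ser_iso_inj: "inj_on f (S ! i)"
proof (rule inj_onI)
  fix x y assume xy: "x \<in> S ! i" "y \<in> S ! i" "f x = f y"
  have "f (x \<otimes>\<^bsub>G\<^esub> inv\<^bsub>G\<^esub> y) = f x \<otimes>\<^bsub>H\<^esub> inv\<^bsub>H\<^esub> f y"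
    using xy ser_iso_mult ser_iso_inv G.clo(2)[OF i] by simp
  also have "\<dots> = \<one>\<^bsub>H\<^esub>" using xy ser_iso_in by simp
  finally have "f (x \<otimes>\<^bsub>G\<^esub> inv\<^bsub>G\<^esub> y) \<in> T ! 0" using H.S0 by simp
  then have "x \<otimes>\<^bsub>G\<^esub> inv\<^bsub>G\<^esub> y \<in> S ! 0" using ser_iso_mem[of "x \<otimes>\<^bsub>G\<^esub> inv\<^bsub>G\<^esub> y" 0] xy G.clo[OF i] by simp
  then show "x = y" using G.S0 xy G.inC[OF i] by (metis G.inv_equality G.inv_inv G.inv_closed singletonD)
qed

lemma ser_iso_img: "j \<le> i \<Longrightarrow> f ` (S ! j) = T ! j"
proof -
  assume j: "j \<le> i"
  have s: "S ! j \<subseteq> S ! i" "T ! j \<subseteq> T ! i" using G.chain[OF j i] H.chain[OF j i] by auto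
  have "T ! i \<subseteq> f ` (S ! i)" using f by (simp add: ser_iso_def)
  then show ?thesis using s ser_iso_mem[OF _ j] by (auto; blast)
qed

lemma ser_iso_comp: "ser_iso G S G S i g \<Longrightarrow> ser_iso G S H T i (\<lambda>x. f (g x))"
proof -
  assume g: "ser_iso G S G S i g"
  interpret P: pair G G xs 1 m S S by (rule GG)
  note gi = P.ser_iso_in[OF i g] P.ser_iso_mult[OF i g] P.ser_iso_mem[OF i g] P.ser_iso_img[OF i g, of i]
  show ?thesis unfolding ser_iso_def
  proof (intro conjI ballI allI impI)
    show "T ! i \<subseteq> (\<lambda>x. f (g x)) ` (S ! i)" using ser_iso_img[of i] gi(5) by (metis image_image order_refl)
  qed (use gi ser_iso_in ser_iso_mult ser_iso_mem in auto)
qed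

end

end

context vser
begin

context
  fixes i assumes z1: "z = 1" and i: "i < m"
begin

lemma GGp: "pair G G xs 1 m S S"
  using vser_axioms unfolding z1 pair_def by simp

lemma Aut_ser_iso: "\<phi> \<in> Aut xs G S i \<Longrightarrow> ser_iso G S G S i (app \<phi>)"
  by (simp add: Aut_def)

lemma Aut_inS: "\<phi> \<in> Aut xs G S i \<Longrightarrow> x < nn xs \<Longrightarrow> app \<phi> x \<in> S ! i \<longleftrightarrow> x \<in> S ! i"
  using pair.ser_iso_in(2)[OF GGp i Aut_ser_iso] by (cases "x \<in> S ! i") (auto simp: Aut_def)

lemma Aut_lt: "\<phi> \<in> Aut xs G S i \<Longrightarrow> x < nn xs \<Longrightarrow> app \<phi> x < nn xs"
  using pair.ser_iso_in(1)[OF GGp i Aut_ser_iso] carN by (cases "x \<in> S ! i") (auto simp: Aut_def)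

lemma Aut_inj: "\<phi> \<in> Aut xs G S i \<Longrightarrow> inj_on (app \<phi>) {..<nn xs}"
proof (rule inj_onI)
  fix x y assume p: "\<phi> \<in> Aut xs G S i" and xy: "x \<in> {..<nn xs}" "y \<in> {..<nn xs}" "app \<phi> x = app \<phi> y"
  then have "x \<in> S ! i \<longleftrightarrow> y \<in> S ! i" using Aut_inS by (metis lessThan_iff)
  then show "x = y" using pair.ser_iso_inj[OF GGp i Aut_ser_iso[OF p]] xy p
    by (cases "x \<in> S ! i") (auto simp: Aut_def inj_on_def)
qed

lemma Aut_bij: "\<phi> \<in> Aut xs G S i \<Longrightarrow> app \<phi> ` {..<nn xs} = {..<nn xs}"
  using Aut_inj[of \<phi>] Aut_lt[of \<phi>] by (intro endo_inj_surj) auto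

lemma app_inv_map:
  assumes p: "\<phi> \<in> Aut xs G S i" and x: "x < nn xs"
  shows "app (inv_map xs \<phi>) x < nn xs" "app \<phi> (app (inv_map xs \<phi>) x) = x" "app (inv_map xs \<phi>) (app \<phi> x) = x"
proof -
  have *: "app (inv_map xs \<phi>) x < nn xs \<and> app \<phi> (app (inv_map xs \<phi>) x) = x" if x: "x < nn xs" for x
  proof -
    have "x \<in> app \<phi> ` {..<nn xs}" using Aut_bij[OF p] x by simp
    then obtain u where u: "u < nn xs" "app \<phi> u = x" by auto
    have e: "app (inv_map xs \<phi>) x = foldl (\<lambda>a u. if app \<phi> u = x then u else a) 0 [0..<nn xs]"
      using x by (simp add: inv_map_def)
    show ?thesis unfolding e using foldl_pick[of u "[0..<nn xs]" "\<lambda>u. app \<phi> u = x" 0] u by auto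
  qed
  from *[OF x] show "app (inv_map xs \<phi>) x < nn xs" "app \<phi> (app (inv_map xs \<phi>) x) = x" by auto
  from *[OF Aut_lt[OF p x]] have "app (inv_map xs \<phi>) (app \<phi> x) < nn xs" "app \<phi> (app (inv_map xs \<phi>) (app \<phi> x)) = app \<phi> x" by auto
  then show "app (inv_map xs \<phi>) (app \<phi> x) = x" using Aut_inj[OF p] x by (auto dest: inj_onD)
qed

lemma Aut_inv_map: assumes p: "\<phi> \<in> Aut xs G S i" shows "inv_map xs \<phi> \<in> Aut xs G S i"
proof -
  note ni = app_inv_map[OF p]
  interpret P: pair G G xs 1 m S S by (rule GGp)
  note s = Aut_ser_iso[OF p]
  have im: "app \<phi> ` (S ! i) = S ! i" using P.ser_iso_img[OF i s] by simp
  have ex: "\<exists>u\<in>S ! i. x = app \<phi> u \<and> app (inv_map xs \<phi>) x = u" if "x \<in> S ! i" for x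
  proof -
    have "x \<in> app \<phi> ` (S ! i)" using im that by simp
    then obtain u where "u \<in> S ! i" "x = app \<phi> u" by blast
    then show ?thesis using ni(3) inN[OF i] by auto
  qed
  have "ser_iso G S G S i (app (inv_map xs \<phi>))"
    unfolding ser_iso_def
  proof (intro conjI ballI allI impI)
    fix x y assume "x \<in> S ! i" "y \<in> S ! i"
    then obtain u v where uv: "u \<in> S ! i" "x = app \<phi> u" "v \<in> S ! i" "y = app \<phi> v" using ex by meson
    then have "x \<otimes> y = app \<phi> (u \<otimes> v)" using P.ser_iso_mult[OF i s] by simp
    then show "app (inv_map xs \<phi>) (x \<otimes> y) = app (inv_map xs \<phi>) x \<otimes> app (inv_map xs \<phi>) y"
      using uv ni(3) inN[OF i] clo(1)[OF i] by simp
  next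
    fix x assume "x \<in> S ! i"
    with ex obtain u where u: "u \<in> S ! i" "x = app \<phi> u" "app (inv_map xs \<phi>) x = u" by blast
    then show "app (inv_map xs \<phi>) x \<in> carrier G" using inC[OF i] by simp
    fix j assume "j \<le> i"
    then show "x \<in> S ! j \<longleftrightarrow> app (inv_map xs \<phi>) x \<in> S ! j" using P.ser_iso_mem[OF i s] u by simp
  next
    show "S ! i \<subseteq> app (inv_map xs \<phi>) ` (S ! i)"
    proof
      fix u assume u: "u \<in> S ! i"
      then have "app \<phi> u \<in> S ! i" "app (inv_map xs \<phi>) (app \<phi> u) = u" using im ni(3) inN[OF i] by auto
      then show "u \<in> app (inv_map xs \<phi>) ` (S ! i)" by (metis imageI)
    qed
  qed
  moreover have "app (inv_map xs \<phi>) x = x" if "x < nn xs" "x \<notin> S ! i" for x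
    using ni(3)[OF that(1)] p that by (simp add: Aut_def)
  ultimately show ?thesis by (simp add: Aut_def)
qed

lemma Aut_comp_map: assumes "\<phi> \<in> Aut xs G S i" "\<tau> \<in> Aut xs G S i" shows "comp_map xs \<phi> \<tau> \<in> Aut xs G S i"
proof -
  have "ser_iso G S G S i (\<lambda>x. app \<phi> (app \<tau> x))"
    by (rule pair.ser_iso_comp[OF GGp i Aut_ser_iso Aut_ser_iso]) (use assms in auto)
  then have "ser_iso G S G S i (app (comp_map xs \<phi> \<tau>))"
    using ser_iso_cong[of S i "app (comp_map xs \<phi> \<tau>)" "\<lambda>x. app \<phi> (app \<tau> x)"] app_comp_map inN[OF i] clo(1)[OF i] by auto
  moreover have "app \<phi> (app \<tau> x) = x" if "x < nn xs" "x \<notin> S ! i" for x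
    using assms that by (auto simp: Aut_def)
  ultimately show ?thesis by (simp add: Aut_def app_comp_map)
qed

lemma Aut_id: "[0..<nn xs] \<in> Aut xs G S i"
proof -
  have "app [0..<nn xs] x = x" if "x < nn xs" for x using that by simp
  then have "ser_iso G S G S i (app [0..<nn xs])" unfolding ser_iso_def using inN[OF i] clo(1)[OF i] inC[OF i] by (auto simp: image_iff)
  then show ?thesis by (simp add: Aut_def)
qed

lemma AG_group: "group (AG xs G S i)"
proof (rule groupI)
  fix x y w assume a: "x \<in> carrier (AG xs G S i)" "y \<in> carrier (AG xs G S i)" "w \<in> carrier (AG xs G S i)"
  then show "x \<otimes>\<^bsub>AG xs G S i\<^esub> y \<in> carrier (AG xs G S i)" using Aut_comp_map by simp
  show "x \<otimes>\<^bsub>AG xs G S i\<^esub> y \<otimes>\<^bsub>AG xs G S i\<^esub> w = x \<otimes>\<^bsub>AG xs G S i\<^esub> (y \<otimes>\<^bsub>AG xs G S i\<^esub> w)"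
    using a Aut_lt by (intro app_eqI[of _ "nn xs"]) (auto simp: app_comp_map)
next
  fix x assume a: "x \<in> carrier (AG xs G S i)"
  then show "\<one>\<^bsub>AG xs G S i\<^esub> \<otimes>\<^bsub>AG xs G S i\<^esub> x = x"
    using Aut_lt by (intro app_eqI[of _ "nn xs"]) (auto simp: app_comp_map Aut_def)
  show "\<exists>y\<in>carrier (AG xs G S i). y \<otimes>\<^bsub>AG xs G S i\<^esub> x = \<one>\<^bsub>AG xs G S i\<^esub>"
    using a Aut_inv_map app_inv_map by (intro bexI[of _ "inv_map xs x"] app_eqI[of _ "nn xs"]) (auto simp: app_comp_map)
qed (use Aut_id in simp)

lemma AG_inv: "\<phi> \<in> Aut xs G S i \<Longrightarrow> inv\<^bsub>AG xs G S i\<^esub> \<phi> = inv_map xs \<phi>"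
proof -
  assume p: "\<phi> \<in> Aut xs G S i"
  have "comp_map xs (inv_map xs \<phi>) \<phi> = [0..<nn xs]"
    using p app_inv_map by (intro app_eqI[of _ "nn xs"]) (auto simp: app_comp_map)
  then show ?thesis using group.inv_equality[OF AG_group, of "inv_map xs \<phi>" \<phi>] p Aut_inv_map by simp
qed

end

end

section \<open>Relators and the tower of conditions\<close>

lemma foldl_Cons_rev: "foldl (\<lambda>a x. g x # a) b l = rev (map g l) @ b"
  by (induction l arbitrary: b) auto

lemma relators_eq: "relators xs z i Y W = rev (concat (map (\<lambda>w. map (relator xs z i W w) Y) W))"
proof -
  have "foldl (\<lambda>acc w. foldl (\<lambda>acc y. relator xs z i V w y # acc) acc Y) b W =
     rev (concat (map (\<lambda>w. map (relator xs z i V w) Y) W)) @ b" for V b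
    by (induction W arbitrary: b) (auto simp: foldl_Cons_rev)
  then show ?thesis by (simp add: relators_def)
qed

lemma coset_rep_fst: "fst (coset_rep xs i W x) =
   foldl (\<lambda>acc a. if tmem xs 1 i (tdiv xs 1 x a) then a else acc) 0 (map fst W)"
proof -
  have "fst (foldl (\<lambda>acc w. if tmem xs 1 i (tdiv xs 1 x (fst w)) then w else acc) (p :: nat \<times> nat) W) =
     foldl (\<lambda>acc a. if tmem xs 1 i (tdiv xs 1 x a) then a else acc) (fst p) (map fst W)" for p
    by (induction W arbitrary: p) auto
  from this[of "(0, 0)"] show ?thesis by (simp add: coset_rep_def)
qed

text \<open>The points constrained by relators depend on \<open>ys\<close> alone; only the values
  prescribed there depend on the guessed images.\<close>

lemma relators_fst:
  assumes "map fst Y = map fst Y'" "map fst W = map fst W'"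
  shows "map fst (relators xs z i Y W) = map fst (relators xs z' i Y' W')"
proof -
  define g where "g = (\<lambda>a b. tdiv xs 1 (tmul xs 1 a b)
    (foldl (\<lambda>acc c. if tmem xs 1 i (tdiv xs 1 (tmul xs 1 a b) c) then c else acc) 0 (map fst W)))"
  have g: "fst (relator xs z i W w y) = g (fst w) (fst y)" "fst (relator xs z' i W' w y) = g (fst w) (fst y)" for z z' w y
    using assms(2) by (auto simp: relator_def Let_def coset_rep_fst g_def)
  have c: "map fst (concat (map (\<lambda>w. map (h w) Y) V)) = concat (map (\<lambda>a. map (g a) (map fst Y)) (map fst V))"
    if "\<And>w y. fst (h w y) = g (fst w) (fst y)" for h :: "nat \<times> nat \<Rightarrow> nat \<times> nat \<Rightarrow> nat \<times> nat" and V Y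
    using that by (induction V) auto
  have "map fst (relators xs z i Y W) = rev (concat (map (\<lambda>a. map (g a) (map fst Y)) (map fst W)))"
    unfolding relators_eq using c[of "relator xs z i W", OF g(1)] by (simp add: rev_map[symmetric] del: map_map)
  moreover have "map fst (relators xs z' i Y' W') = rev (concat (map (\<lambda>a. map (g a) (map fst Y')) (map fst W')))"
    unfolding relators_eq using c[of "relator xs z' i W'", OF g(2)] by (simp add: rev_map[symmetric] del: map_map)
  ultimately show ?thesis using assms by simp
qed

context level
begin

definition CC :: "(nat \<Rightarrow> nat) \<Rightarrow> nat \<Rightarrow> bool" where
  "CC f j \<longleftrightarrow> (\<forall>x\<in>S ! j. \<forall>y\<in>set Y.
     f (fst y \<otimes>\<^bsub>G\<^esub> x \<otimes>\<^bsub>G\<^esub> inv\<^bsub>G\<^esub> fst y) \<otimes>\<^bsub>H\<^esub> snd y = snd y \<otimes>\<^bsub>H\<^esub> f x)"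

text \<open>The homogeneous form of \<open>CC\<close>: the condition for an automorphism when every
  \<open>y\<close> is its own image. It cuts out the subgroup of which the solutions of
  \<open>CC\<close> form a coset.\<close>

definition DD :: "(nat \<Rightarrow> nat) \<Rightarrow> nat \<Rightarrow> bool" where
  "DD k j \<longleftrightarrow> (\<forall>x\<in>S ! j. \<forall>y\<in>set ys.
     k (y \<otimes>\<^bsub>G\<^esub> x \<otimes>\<^bsub>G\<^esub> inv\<^bsub>G\<^esub> y) = y \<otimes>\<^bsub>G\<^esub> k x \<otimes>\<^bsub>G\<^esub> inv\<^bsub>G\<^esub> y)"

lemma fstY: "y \<in> set Y \<Longrightarrow> fst y \<in> set ys"
  using set_zip_leftD[of "fst y" "snd y" ys hs] unfolding Yzip by simp

lemma exY: "a \<in> set ys \<Longrightarrow> \<exists>y\<in>set Y. fst y = a"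
proof -
  assume "a \<in> set ys"
  then obtain k where "k < length ys" "ys ! k = a" by (auto simp: in_set_conv_nth)
  then have "(a, hs ! k) \<in> set Y" unfolding Yzip set_zip using lhs by auto
  then show ?thesis by force
qed

lemma chn: "j \<le> i \<Longrightarrow> x \<in> S ! j \<Longrightarrow> x \<in> S ! i"
  using G.chain[OF _ im] by blast

lemma ysM: "y \<in> set ys \<Longrightarrow> y \<in> S ! Suc i"
  using ys by blast

lemma conj_in: "y \<in> set ys \<Longrightarrow> x \<in> S ! i \<Longrightarrow> y \<otimes>\<^bsub>G\<^esub> x \<otimes>\<^bsub>G\<^esub> inv\<^bsub>G\<^esub> y \<in> S ! i"
  using G.nconj[OF i ysM] .

lemma commutes_iff:
  assumes f: "ser_iso G S H T i (app \<phi>)" and j: "j \<le> i"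
  shows "commutes xs z Y \<phi> j \<longleftrightarrow> CC (app \<phi>) j"
proof -
  have jm: "j < m" using j im by simp
  have S: "x < nn xs \<and> tmem xs 1 j x \<longleftrightarrow> x \<in> S ! j" for x using G.tmem[OF jm, of x] G.inN[OF jm] by auto
  have e: "tmul xs z (app \<phi> (tdiv xs 1 (tmul xs 1 (fst y) x) (fst y))) (snd y) =
     app \<phi> (fst y \<otimes>\<^bsub>G\<^esub> x \<otimes>\<^bsub>G\<^esub> inv\<^bsub>G\<^esub> fst y) \<otimes>\<^bsub>H\<^esub> snd y \<and>
     tmul xs z (snd y) (app \<phi> x) = snd y \<otimes>\<^bsub>H\<^esub> app \<phi> x" if x: "x \<in> S ! j" and y: "y \<in> set Y" for x y
  proof -
    have xi: "x \<in> S ! i" using chn[OF j x] .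
    have c: "fst y \<in> carrier G" "snd y \<in> carrier H" "x \<in> carrier G" using inY[OF y] xi by auto
    have "fst y \<otimes>\<^bsub>G\<^esub> x \<otimes>\<^bsub>G\<^esub> inv\<^bsub>G\<^esub> fst y \<in> S ! i" using conj_in[OF fstY[OF y] xi] .
    then show ?thesis using c xi ser_iso_in(1)[OF im f] by (simp add: G.muC G.dvC H.muC)
  qed
  have "commutes xs z Y \<phi> j \<longleftrightarrow> (\<forall>x\<in>S ! j. \<forall>y\<in>set Y.
     tmul xs z (app \<phi> (tdiv xs 1 (tmul xs 1 (fst y) x) (fst y))) (snd y) = tmul xs z (snd y) (app \<phi> x))"
    by (simp only: commutes_def Ball_def S[symmetric] imp_conjL)
  then show ?thesis unfolding CC_def using e by simp
qed

text \<open>An automorphism maps each \<open>S ! j\<close> onto itself, so conditions on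
  \<open>S ! j\<close> can be composed. The second claim cancels \<open>f\<close>, which is
  injective on \<open>S ! i\<close>, and \<open>S ! i\<close> contains the conjugates even if
  \<open>S ! j\<close> does not.\<close>

lemma CC_comp:
  assumes f: "ser_iso G S H T i f" and k: "ser_iso G S G S i k" and j: "j \<le> i"
  shows "CC f j \<Longrightarrow> DD k j \<Longrightarrow> CC (\<lambda>x. f (k x)) j"
    "CC f j \<Longrightarrow> CC (\<lambda>x. f (k x)) j \<Longrightarrow> DD k j"
    "CC (\<lambda>x. f (k x)) j \<Longrightarrow> DD k j \<Longrightarrow> CC f j"
proof -
  interpret P: pair G G xs 1 m S S by (rule GG)
  have kj: "k x \<in> S ! j" if "x \<in> S ! j" for x using P.ser_iso_mem[OF im k chn[OF j that] j] that by simp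
  show "CC f j \<Longrightarrow> DD k j \<Longrightarrow> CC (\<lambda>x. f (k x)) j"
    unfolding CC_def DD_def using kj fstY by simp
  show "DD k j" if "CC f j" "CC (\<lambda>x. f (k x)) j"
    unfolding DD_def
  proof (intro ballI)
    fix x a assume x: "x \<in> S ! j" and a: "a \<in> set ys"
    from exY[OF a] obtain y where y: "y \<in> set Y" "fst y = a" by blast
    have 1: "a \<otimes>\<^bsub>G\<^esub> k x \<otimes>\<^bsub>G\<^esub> inv\<^bsub>G\<^esub> a \<in> S ! i" "k (a \<otimes>\<^bsub>G\<^esub> x \<otimes>\<^bsub>G\<^esub> inv\<^bsub>G\<^esub> a) \<in> S ! i"
      using conj_in[OF a] chn[OF j] kj x P.ser_iso_in(2)[OF im k] by auto
    have "f (k (a \<otimes>\<^bsub>G\<^esub> x \<otimes>\<^bsub>G\<^esub> inv\<^bsub>G\<^esub> a)) \<otimes>\<^bsub>H\<^esub> snd y = f (a \<otimes>\<^bsub>G\<^esub> k x \<otimes>\<^bsub>G\<^esub> inv\<^bsub>G\<^esub> a) \<otimes>\<^bsub>H\<^esub> snd y"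
      using that x y kj unfolding CC_def by auto
    then have "f (k (a \<otimes>\<^bsub>G\<^esub> x \<otimes>\<^bsub>G\<^esub> inv\<^bsub>G\<^esub> a)) = f (a \<otimes>\<^bsub>G\<^esub> k x \<otimes>\<^bsub>G\<^esub> inv\<^bsub>G\<^esub> a)"
      using 1 ser_iso_in(1)[OF im f] inY[OF y(1)] by (simp add: H.right_cancel)
    then show "k (a \<otimes>\<^bsub>G\<^esub> x \<otimes>\<^bsub>G\<^esub> inv\<^bsub>G\<^esub> a) = a \<otimes>\<^bsub>G\<^esub> k x \<otimes>\<^bsub>G\<^esub> inv\<^bsub>G\<^esub> a"
      using ser_iso_inj[OF im f] 1 by (auto dest: inj_onD)
  qed
  show "CC f j" if c: "CC (\<lambda>x. f (k x)) j" and d: "DD k j"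
    unfolding CC_def
  proof (intro ballI)
    fix x y assume x: "x \<in> S ! j" and y: "y \<in> set Y"
    have "x \<in> k ` (S ! j)" using P.ser_iso_img[OF im k j] x by simp
    then obtain u where u: "u \<in> S ! j" "x = k u" by blast
    show "f (fst y \<otimes>\<^bsub>G\<^esub> x \<otimes>\<^bsub>G\<^esub> inv\<^bsub>G\<^esub> fst y) \<otimes>\<^bsub>H\<^esub> snd y = snd y \<otimes>\<^bsub>H\<^esub> f x"
      using c d u y fstY[OF y] unfolding CC_def DD_def by metis
  qed
qed

text \<open>The tower of automorphism subgroups is the special case in which every \<open>y\<close>
  is its own intended image.\<close>

lemma level0: "level G G xs 1 m S S i ys ys"
  by unfold_locales (use i ys G.inN[OF i] in auto)

abbreviation "Y0 \<equiv> zip_gens ys ys"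
abbreviation "W0 \<equiv> coset_words xs 1 i Y0"
abbreviation "Q \<equiv> relators xs z i Y W"
abbreviation "Q0 \<equiv> all_relators xs i Y0 W0"

lemma CC0_DD:
  assumes k: "ser_iso G S G S i k" and j: "j \<le> i"
  shows "level.CC G G S ys ys k j \<longleftrightarrow> DD k j"
proof -
  interpret L: level G G xs 1 m S S i ys ys by (rule level0)
  have "set Y0 = {(y, y) |y. y \<in> set ys}" unfolding L.Yzip set_zip by (auto simp: in_set_conv_nth)
  then have "L.CC k j \<longleftrightarrow> (\<forall>x\<in>S ! j. \<forall>y\<in>set ys. k (y \<otimes>\<^bsub>G\<^esub> x \<otimes>\<^bsub>G\<^esub> inv\<^bsub>G\<^esub> y) \<otimes>\<^bsub>G\<^esub> y = y \<otimes>\<^bsub>G\<^esub> k x)"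
    unfolding L.CC_def by auto
  also have "\<dots> \<longleftrightarrow> DD k j"
  proof -
    have "k (y \<otimes>\<^bsub>G\<^esub> x \<otimes>\<^bsub>G\<^esub> inv\<^bsub>G\<^esub> y) \<otimes>\<^bsub>G\<^esub> y = y \<otimes>\<^bsub>G\<^esub> k x \<longleftrightarrow>
      k (y \<otimes>\<^bsub>G\<^esub> x \<otimes>\<^bsub>G\<^esub> inv\<^bsub>G\<^esub> y) = y \<otimes>\<^bsub>G\<^esub> k x \<otimes>\<^bsub>G\<^esub> inv\<^bsub>G\<^esub> y" if "x \<in> S ! j" "y \<in> set ys" for x y
    proof -
      have "k (y \<otimes>\<^bsub>G\<^esub> x \<otimes>\<^bsub>G\<^esub> inv\<^bsub>G\<^esub> y) \<in> carrier G" "y \<in> carrier G" "k x \<in> carrier G"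
        using L.ser_iso_in(1)[OF im k] conj_in[OF that(2)] chn[OF j that(1)] ysM[OF that(2)] by auto
      then show ?thesis by (metis G.inv_solve_right G.m_closed)
    qed
    then show ?thesis unfolding DD_def by simp
  qed
  finally show ?thesis .
qed

lemma fstY_eq: "map fst Y = map fst Y0"
proof -
  interpret L: level G G xs 1 m S S i ys ys by (rule level0)
  show ?thesis unfolding Yzip L.Yzip using lhs by simp
qed

lemma Qfst: "map fst Q = map fst (relators xs 1 i Y0 W0)"
  by (rule relators_fst[OF fstY_eq coset_words_fst[OF fstY_eq]])

text \<open>\<open>W_closed\<close> puts \<open>w y\<close> into the coset of some representative
  \<open>r\<close>, and by \<open>coset_rep_eq\<close> the search finds this
  \<open>r\<close>.\<close>

lemma relator_props:
  assumes "w \<in> set W" "y \<in> set Y"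
  obtains n r where "n \<in> S ! i" "r \<in> set W" "fst w \<otimes>\<^bsub>G\<^esub> fst y = n \<otimes>\<^bsub>G\<^esub> fst r"
    "relator xs z i W w y = (n, (snd w \<otimes>\<^bsub>H\<^esub> snd y) \<otimes>\<^bsub>H\<^esub> inv\<^bsub>H\<^esub> snd r)"
proof -
  have c: "fst w \<in> carrier G" "fst y \<in> carrier G" "snd w \<in> carrier H" "snd y \<in> carrier H"
    using gp_in[OF W_gp[OF assms(1)]] inY[OF assms(2)] by auto
  from W_covD[OF _ W_closed[OF assms]] c obtain n r where
    nr: "n \<in> S ! i" "r \<in> set W" "fst w \<otimes>\<^bsub>G\<^esub> fst y = n \<otimes>\<^bsub>G\<^esub> fst r" by auto
  have rc: "fst r \<in> carrier G" "snd r \<in> carrier H" "n \<in> carrier G" using gp_in[OF W_gp[OF nr(2)]] nr by auto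
  have "tdiv xs 1 (n \<otimes>\<^bsub>G\<^esub> fst r) (fst r) = n" using rc by (simp add: G.dvC G.m_assoc)
  then have "relator xs z i W w y = (n, (snd w \<otimes>\<^bsub>H\<^esub> snd y) \<otimes>\<^bsub>H\<^esub> inv\<^bsub>H\<^esub> snd r)"
    using c rc nr coset_rep_eq[OF nr(1,2)] by (simp add: relator_def Let_def G.muC H.muC H.dvC)
  with nr show ?thesis using that by blast
qed

lemma setQ: "set Q = {relator xs z i W w y |w y. w \<in> set W \<and> y \<in> set Y}"
  unfolding relators_eq by auto

lemma Q_in: "p \<in> set Q \<Longrightarrow> fst p \<in> S ! i"
  unfolding setQ using relator_props by (force)

lemma gp0: assumes "w \<in> pair.gp G G Y0" shows "fst w = snd w"
proof -
  interpret L: level G G xs 1 m S S i ys ys by (rule level0)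
  have "set Y0 = {(y, y) |y. y \<in> set ys}" unfolding L.Yzip set_zip by (auto simp: in_set_conv_nth)
  with assms show ?thesis by (induction rule: L.gp.induct) auto
qed

text \<open>With every \<open>y\<close> as its own image, a relator prescribes its own value: the
  conditions ask for fixed points, as is needed for subgroups.\<close>

lemma Q0_diag: "p \<in> set Q0 \<Longrightarrow> fst p = snd p \<and> fst p < nn xs"
proof -
  interpret L: level G G xs 1 m S S i ys ys by (rule level0)
  assume "p \<in> set Q0"
  then consider "p \<in> set L.Q" | x where "x < nn xs" "p = (x, x)" by (auto simp: all_relators_def)
  then show ?thesis
  proof cases
    case 1
    then obtain w y where wy: "w \<in> set W0" "y \<in> set Y0" "p = relator xs 1 i W0 w y" unfolding L.setQ by blast
    from L.relator_props[OF wy(1,2)] obtain n r where nr: "n \<in> S ! i" "r \<in> set W0" "fst w \<otimes>\<^bsub>G\<^esub> fst y = n \<otimes>\<^bsub>G\<^esub> fst r"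
      "p = (n, (snd w \<otimes>\<^bsub>G\<^esub> snd y) \<otimes>\<^bsub>G\<^esub> inv\<^bsub>G\<^esub> snd r)" unfolding wy(3) by blast
    have "set Y0 = {(y, y) |y. y \<in> set ys}" unfolding L.Yzip set_zip by (auto simp: in_set_conv_nth)
    then have "fst y = snd y" using wy by auto
    moreover have "fst w = snd w" "fst r = snd r" using gp0 L.W_gp wy nr by auto
    moreover have "fst r \<in> carrier G" "n \<in> carrier G" using L.gp_in[OF L.W_gp[OF nr(2)]] nr by auto
    ultimately have "snd p = n" using nr by (metis G.inv_solve_right' G.m_closed snd_conv)
    then show ?thesis using nr G.inN[OF im] by simp
  qed simp
qed

lemma lenQ: "length Q \<le> length Q0"
  using map_eq_imp_length_eq[OF Qfst] by (simp add: all_relators_def)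

lemma Q_nth: "k < length Q \<Longrightarrow> fst (Q0 ! k) = fst (Q ! k)"
proof -
  assume k: "k < length Q"
  have l: "length Q = length (relators xs 1 i Y0 W0)" using map_eq_imp_length_eq[OF Qfst] .
  then have "fst (Q0 ! k) = map fst (relators xs 1 i Y0 W0) ! k" using k by (simp add: all_relators_def nth_append)
  then show ?thesis unfolding Qfst[symmetric] using k by simp
qed

text \<open>Any two of the conditions on \<open>\<phi>\<close>, on \<open>\<kappa>\<close> and on \<open>\<phi> \<circ> \<kappa>\<close> imply the third. This makes the automorphisms
  of depth at least \<open>k\<close> a subgroup, and the isomorphisms of depth at least \<open>k\<close> a coset of it.\<close>

lemma cond_at_comp:
  assumes f: "ser_iso G S H T i (app \<phi>)" and k: "\<kappa> \<in> Aut xs G S i"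
    and Q': "Q' = Q \<or> (z = 1 \<and> H = G \<and> T = S \<and> Q' = Q0 \<and> \<phi> \<in> Aut xs G S i)"
    and kk: "k < Suc i + length Q'"
  shows "cond_at xs z i Y Q' \<phi> k \<Longrightarrow> cond_at xs 1 i Y0 Q0 \<kappa> k \<Longrightarrow> cond_at xs z i Y Q' (comp_map xs \<phi> \<kappa>) k"
    "cond_at xs z i Y Q' \<phi> k \<Longrightarrow> cond_at xs z i Y Q' (comp_map xs \<phi> \<kappa>) k \<Longrightarrow> cond_at xs 1 i Y0 Q0 \<kappa> k"
    "cond_at xs z i Y Q' (comp_map xs \<phi> \<kappa>) k \<Longrightarrow> cond_at xs 1 i Y0 Q0 \<kappa> k \<Longrightarrow> cond_at xs z i Y Q' \<phi> k"
proof -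
  interpret L: level G G xs 1 m S S i ys ys by (rule level0)
  have sk: "ser_iso G S G S i (app \<kappa>)" using k by (simp add: Aut_def)
  have sercmp: "ser_iso G S H T i (\<lambda>x. app \<phi> (app \<kappa> x))" using ser_iso_comp[OF im f sk] .
  have ce: "app (comp_map xs \<phi> \<kappa>) x = app \<phi> (app \<kappa> x)" if "x \<in> S ! i" for x using app_comp_map G.inN[OF im that] by simp
  have sercmp': "ser_iso G S H T i (app (comp_map xs \<phi> \<kappa>))"
    using ser_iso_cong[of S i "app (comp_map xs \<phi> \<kappa>)" "\<lambda>x. app \<phi> (app \<kappa> x)"] sercmp ce G.clo(1)[OF im] by auto
  have "(cond_at xs z i Y Q' \<phi> k \<longrightarrow> cond_at xs 1 i Y0 Q0 \<kappa> k \<longrightarrow> cond_at xs z i Y Q' (comp_map xs \<phi> \<kappa>) k) \<and>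
    (cond_at xs z i Y Q' \<phi> k \<longrightarrow> cond_at xs z i Y Q' (comp_map xs \<phi> \<kappa>) k \<longrightarrow> cond_at xs 1 i Y0 Q0 \<kappa> k) \<and>
    (cond_at xs z i Y Q' (comp_map xs \<phi> \<kappa>) k \<longrightarrow> cond_at xs 1 i Y0 Q0 \<kappa> k \<longrightarrow> cond_at xs z i Y Q' \<phi> k)"
  proof (cases "k \<le> i")
    case True
    have "CC (app (comp_map xs \<phi> \<kappa>)) k \<longleftrightarrow> CC (\<lambda>x. app \<phi> (app \<kappa> x)) k"
      unfolding CC_def using ce chn[OF True] conj_in fstY by simp
    moreover have "commutes xs 1 Y0 \<kappa> k \<longleftrightarrow> DD (app \<kappa>) k" using L.commutes_iff[OF sk True] CC0_DD[OF sk True] by simp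
    ultimately show ?thesis
      using True CC_comp[OF f sk True] commutes_iff[OF f True] commutes_iff[OF sercmp' True] by (auto simp: cond_at_def)
  next
    case False
    define p where "p = Q' ! (k - Suc i)"
    define p0 where "p0 = Q0 ! (k - Suc i)"
    have kl: "k - Suc i < length Q'" "k - Suc i < length Q0" using kk False Q' lenQ by auto
    have p0: "fst p0 = fst p" "snd p0 = fst p" "fst p < nn xs"
      using Q_nth Q0_diag[of p0] nth_mem[OF kl(2)] Q' kl(1) by (auto simp: p_def p0_def)
    \<comment> \<open>Cancelling \<open>\<phi>\<close> needs injectivity at the point. Relator
      points lie in \<open>S ! i\<close>; the further points \<open>(x, x)\<close> arise only if
      \<open>\<phi>\<close> is an automorphism list, which is injective on all of
      \<open>{..<nn xs}\<close>.\<close>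
    have inj: "app \<kappa> (fst p) = fst p" if e: "app \<phi> (app \<kappa> (fst p)) = app \<phi> (fst p)"
      using Q'
    proof
      assume "Q' = Q"
      then have "fst p \<in> S ! i" using Q_in kl by (auto simp: p_def)
      then show ?thesis using ser_iso_inj[OF im f] e G.Aut_inS[OF refl im k p0(3)] by (auto dest: inj_onD)
    next
      assume "z = 1 \<and> H = G \<and> T = S \<and> Q' = Q0 \<and> \<phi> \<in> Aut xs G S i"
      then show ?thesis using G.Aut_inj[OF refl im, of \<phi>] e p0(3) G.Aut_lt[OF refl im k p0(3)] by (auto dest: inj_onD)
    qed
    show ?thesis using False p0 inj by (auto simp: cond_at_def p_def[symmetric] p0_def[symmetric] app_comp_map)
  qed
  then show "cond_at xs z i Y Q' \<phi> k \<Longrightarrow> cond_at xs 1 i Y0 Q0 \<kappa> k \<Longrightarrow> cond_at xs z i Y Q' (comp_map xs \<phi> \<kappa>) k"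
    "cond_at xs z i Y Q' \<phi> k \<Longrightarrow> cond_at xs z i Y Q' (comp_map xs \<phi> \<kappa>) k \<Longrightarrow> cond_at xs 1 i Y0 Q0 \<kappa> k"
    "cond_at xs z i Y Q' (comp_map xs \<phi> \<kappa>) k \<Longrightarrow> cond_at xs 1 i Y0 Q0 \<kappa> k \<Longrightarrow> cond_at xs z i Y Q' \<phi> k"
    by blast+
qed

abbreviation "dd \<equiv> depth xs 1 i Y0 Q0"
abbreviation "rr \<equiv> Suc i + length Q0"

lemma cond_at_id: "k < rr \<Longrightarrow> cond_at xs 1 i Y0 Q0 [0..<nn xs] k"
proof -
  interpret L: level G G xs 1 m S S i ys ys by (rule level0)
  assume k: "k < rr"
  have s: "ser_iso G S G S i (app [0..<nn xs])" using G.Aut_id[OF refl im] by (simp add: Aut_def)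
  show ?thesis
  proof (cases "k \<le> i")
    case True
    have "DD (app [0..<nn xs]) k" unfolding DD_def using conj_in chn[OF True] G.inN[OF im] by simp
    then show ?thesis using True L.commutes_iff[OF s True] CC0_DD[OF s True] by (simp add: cond_at_def)
  next
    case False
    then have "Q0 ! (k - Suc i) \<in> set Q0" using k by (intro nth_mem) auto
    from Q0_diag[OF this] show ?thesis using False by (simp add: cond_at_def)
  qed
qed

text \<open>The axioms on products and inverses are instances of the two-out-of-three property; that
  full depth forces the identity is the purpose of the points \<open>(x, x)\<close>.\<close>

lemma depth_AG: "depth_group (AG xs G S i) dd rr"
proof -
  interpret L: level G G xs 1 m S S i ys ys by (rule level0)
  interpret A: group "AG xs G S i" by (rule G.AG_group[OF refl im])
  have com: "cond_at xs 1 i Y0 Q0 x k \<Longrightarrow> cond_at xs 1 i Y0 Q0 y k \<Longrightarrow> cond_at xs 1 i Y0 Q0 (comp_map xs x y) k"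
    "cond_at xs 1 i Y0 Q0 x k \<Longrightarrow> cond_at xs 1 i Y0 Q0 (comp_map xs x y) k \<Longrightarrow> cond_at xs 1 i Y0 Q0 y k"
    if "x \<in> Aut xs G S i" "y \<in> Aut xs G S i" "k < rr" for x y k
    using L.cond_at_comp(1,2)[of x y Q0 k] that by (auto simp: Aut_def)
  show ?thesis
  proof
    fix x y assume "x \<in> carrier (AG xs G S i)" "y \<in> carrier (AG xs G S i)"
    then have a: "x \<in> Aut xs G S i" "y \<in> Aut xs G S i" by auto
    let ?k = "min (dd x) (dd y)"
    have k: "?k \<le> rr" using depth_le[of xs 1 i Y0 Q0 x] by auto
    have "\<forall>j<?k. cond_at xs 1 i Y0 Q0 x j" "\<forall>j<?k. cond_at xs 1 i Y0 Q0 y j"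
      using depth_ge[OF k, of xs 1 Y0 x] depth_ge[OF k, of xs 1 Y0 y] by auto
    then show "?k \<le> dd (x \<otimes>\<^bsub>AG xs G S i\<^esub> y)" using com(1)[OF a] k by (subst depth_ge[OF k]) auto
  next
    fix x assume "x \<in> carrier (AG xs G S i)"
    then have a: "x \<in> Aut xs G S i" by auto
    have *: "dd x \<le> dd (inv_map xs x)" if a: "x \<in> Aut xs G S i" for x
    proof -
      have k: "dd x \<le> rr" by (rule depth_le)
      have e: "comp_map xs x (inv_map xs x) = [0..<nn xs]"
        using A.r_inv[of x] G.AG_inv[OF refl im a] a by simp
      have "\<forall>j<dd x. cond_at xs 1 i Y0 Q0 x j" using depth_ge[OF k, of xs 1 Y0 x] by auto
      then show ?thesis using com(2)[OF a G.Aut_inv_map[OF refl im a]] k cond_at_id unfolding e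
        by (subst depth_ge[OF k]) auto
    qed
    have "inv_map xs (inv_map xs x) = x"
      using A.inv_inv[of x] G.AG_inv[OF refl im] a G.Aut_inv_map[OF refl im a] by simp
    then show "dd (inv\<^bsub>AG xs G S i\<^esub> x) = dd x"
      using *[OF a] *[OF G.Aut_inv_map[OF refl im a]] G.AG_inv[OF refl im a] by simp
    show "dd x \<le> rr" by (rule depth_le)
    assume r: "dd x = rr"
    have l: "length x = nn xs" using a by (simp add: Aut_def)
    show "x = \<one>\<^bsub>AG xs G S i\<^esub>"
    proof (simp, rule app_eqI[of _ "nn xs"])
      fix v assume v: "v < nn xs"
      \<comment> \<open>The position of the condition that fixes \<open>v\<close>, after the
        intertwining conditions and the relators.\<close>
      let ?k = "Suc i + (length (relators xs 1 i Y0 W0) + v)"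
      have k: "?k < rr" using v by (simp add: all_relators_def)
      have "rr \<le> dd x" using r by simp
      then have "cond_at xs 1 i Y0 Q0 x ?k" using k depth_ge[of rr i Q0 xs 1 Y0 x] by blast
      moreover have "Q0 ! (?k - Suc i) = (v, v)" using v by (simp add: all_relators_def nth_append)
      ultimately show "app x v = app [0..<nn xs] v" using v by (simp add: cond_at_def)
    qed (use l in auto)
  next
    have "rr \<le> dd [0..<nn xs]" using cond_at_id by (subst depth_ge) auto
    then show "dd \<one>\<^bsub>AG xs G S i\<^esub> = rr" using depth_le[of xs 1 i Y0 Q0 "[0..<nn xs]"] by simp
  qed
qed

end

section \<open>Extension of isomorphisms to the next term\<close>

lemma (in pair) ser_iso_down:
  assumes i: "Suc i < m" and f: "ser_iso G S H T (Suc i) f"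
  shows "ser_iso G S H T i f"
proof -
  have s: "S ! i \<subseteq> S ! Suc i" using G.step_incl[OF i] .
  have "T ! i \<subseteq> f ` (S ! i)" using ser_iso_img[OF i f, of i] by simp
  then show ?thesis using f s unfolding ser_iso_def by (auto; blast)
qed

locale glevel = level +
  assumes gen: "generate G (S ! i \<union> set ys) = S ! Suc i"
begin

lemma dec: "x \<in> S ! Suc i \<Longrightarrow> \<exists>n\<in>S ! i. \<exists>w\<in>set W. x = n \<otimes>\<^bsub>G\<^esub> fst w"
  using W_covD[of x] covered_generate[of x] gen by simp

lemma NM: "n \<in> S ! i \<Longrightarrow> n \<in> S ! Suc i"
  using G.step_incl[OF i] by blast

context
  fixes fs
  assumes fs: "ser_iso G S H T (Suc i) fs" and fy: "\<And>y. y \<in> set Y \<Longrightarrow> fs (fst y) = snd y"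
begin

text \<open>\<open>fs\<close> is a hypothetical isomorphism that realises the guess. This lemma and
  the next two show that it satisfies every condition of the tower on \<open>G_i\<close>, so a right
  guess has a solution.\<close>

lemma fs_gp: "w \<in> gp Y \<Longrightarrow> fs (fst w) = snd w"
proof (induction rule: gp.induct)
  case one then show ?case using ser_iso_one[OF i fs] by simp
next
  case (mul w y)
  then show ?case using ser_iso_mult[OF i fs] gp_in[OF mul(1)] inY[OF mul(2)] fy by simp
qed

lemma fs_CC: "j \<le> i \<Longrightarrow> CC fs j"
  unfolding CC_def
proof (intro ballI)
  fix x y assume j: "j \<le> i" and x: "x \<in> S ! j" and y: "y \<in> set Y"
  have xi: "x \<in> S ! i" using chn[OF j x] .
  have a: "fst y \<in> S ! Suc i" "snd y \<in> carrier H" "x \<in> S ! Suc i" using inY[OF y] NM[OF xi] by auto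
  have "fs (fst y \<otimes>\<^bsub>G\<^esub> x \<otimes>\<^bsub>G\<^esub> inv\<^bsub>G\<^esub> fst y) = snd y \<otimes>\<^bsub>H\<^esub> fs x \<otimes>\<^bsub>H\<^esub> inv\<^bsub>H\<^esub> snd y"
    using a ser_iso_mult[OF i fs] ser_iso_inv[OF i fs] fy[OF y] G.clo[OF i] by simp
  then show "fs (fst y \<otimes>\<^bsub>G\<^esub> x \<otimes>\<^bsub>G\<^esub> inv\<^bsub>G\<^esub> fst y) \<otimes>\<^bsub>H\<^esub> snd y = snd y \<otimes>\<^bsub>H\<^esub> fs x"
    using a ser_iso_in(1)[OF i fs] by (simp add: H.m_assoc)
qed

lemma fs_relators: "p \<in> set Q \<Longrightarrow> fs (fst p) = snd p"
proof -
  assume "p \<in> set Q"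
  then obtain w y where wy: "w \<in> set W" "y \<in> set Y" "p = relator xs z i W w y" unfolding setQ by blast
  from relator_props[OF wy(1,2)] obtain n r where nr: "n \<in> S ! i" "r \<in> set W"
    "fst w \<otimes>\<^bsub>G\<^esub> fst y = n \<otimes>\<^bsub>G\<^esub> fst r" "p = (n, (snd w \<otimes>\<^bsub>H\<^esub> snd y) \<otimes>\<^bsub>H\<^esub> inv\<^bsub>H\<^esub> snd r)" unfolding wy(3) by blast
  have c: "fst w \<in> S ! Suc i" "fst y \<in> S ! Suc i" "fst r \<in> S ! Suc i" "snd r \<in> carrier H" "n \<in> S ! Suc i"
    using gp_in[OF W_gp[OF wy(1)]] gp_in[OF W_gp[OF nr(2)]] inY[OF wy(2)] NM[OF nr(1)] by auto
  have "snd w \<otimes>\<^bsub>H\<^esub> snd y = fs (fst w \<otimes>\<^bsub>G\<^esub> fst y)"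
    using c ser_iso_mult[OF i fs] fs_gp[OF W_gp[OF wy(1)]] fy[OF wy(2)] by simp
  also have "\<dots> = fs n \<otimes>\<^bsub>H\<^esub> snd r" unfolding nr(3) using c ser_iso_mult[OF i fs] fs_gp[OF W_gp[OF nr(2)]] by simp
  finally show ?thesis using nr(4) c ser_iso_in(1)[OF i fs] by (simp add: H.m_assoc)
qed

context
  fixes \<phi>
  assumes f: "ser_iso G S H T i (app \<phi>)" and cc: "CC (app \<phi>) i" and pp: "\<And>p. p \<in> set Q \<Longrightarrow> app \<phi> (fst p) = snd p"
begin

abbreviation "E \<equiv> app (extend xs z i W \<phi>)"

lemma E_eq: "n \<in> S ! i \<Longrightarrow> w \<in> set W \<Longrightarrow> E (n \<otimes>\<^bsub>G\<^esub> fst w) = app \<phi> n \<otimes>\<^bsub>H\<^esub> snd w"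
proof -
  assume n: "n \<in> S ! i" and w: "w \<in> set W"
  have c: "fst w \<in> carrier G" "fst w \<in> S ! Suc i" "snd w \<in> carrier H" "n \<in> carrier G" using gp_in[OF W_gp[OF w]] n by auto
  have x: "n \<otimes>\<^bsub>G\<^esub> fst w \<in> S ! Suc i" using NM[OF n] c i by simp
  have "tdiv xs 1 (n \<otimes>\<^bsub>G\<^esub> fst w) (fst w) = n" using c by (simp add: G.dvC G.m_assoc)
  then show ?thesis using x G.inN[OF i x] G.tmem[OF i G.inN[OF i x]] coset_rep_eq[OF n w] c ser_iso_in(1)[OF im f n]
    by (simp add: extend_def H.muC)
qed

lemma E_N: "n \<in> S ! i \<Longrightarrow> E n = app \<phi> n"
  using E_eq[OF _ W_one, of n] ser_iso_in(1)[OF im f, of n] by simp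

lemma E_in: "x \<in> S ! Suc i \<Longrightarrow> E x \<in> carrier H"
proof -
  assume "x \<in> S ! Suc i"
  then obtain n w where nw: "n \<in> S ! i" "w \<in> set W" "x = n \<otimes>\<^bsub>G\<^esub> fst w" using dec by blast
  then show ?thesis using E_eq[OF nw(1,2)] ser_iso_in(1)[OF im f nw(1)] gp_in[OF W_gp[OF nw(2)]] by simp
qed

text \<open>Intertwining passes from the generators to all words, as conjugations compose.
  \<open>n\<close> must be general: the induction hypothesis is applied to the conjugate of
  \<open>n\<close> by \<open>y\<close>.\<close>

lemma E_conj: "w \<in> gp Y \<Longrightarrow> n \<in> S ! i \<Longrightarrow>
   app \<phi> (fst w \<otimes>\<^bsub>G\<^esub> n \<otimes>\<^bsub>G\<^esub> inv\<^bsub>G\<^esub> fst w) = snd w \<otimes>\<^bsub>H\<^esub> app \<phi> n \<otimes>\<^bsub>H\<^esub> inv\<^bsub>H\<^esub> snd w"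
proof (induction arbitrary: n rule: gp.induct)
  case one then show ?case using ser_iso_in(1)[OF im f] by simp
next
  case (mul w y)
  have c: "fst w \<in> carrier G" "snd w \<in> carrier H" "fst y \<in> carrier G" "snd y \<in> carrier H" "n \<in> carrier G" "app \<phi> n \<in> carrier H"
    using gp_in[OF mul(1)] inY[OF mul(2)] mul(4) ser_iso_in(1)[OF im f] by auto
  let ?n = "fst y \<otimes>\<^bsub>G\<^esub> n \<otimes>\<^bsub>G\<^esub> inv\<^bsub>G\<^esub> fst y"
  have n: "?n \<in> S ! i" using conj_in[OF fstY[OF mul(2)] mul(4)] .
  have "app \<phi> ?n \<otimes>\<^bsub>H\<^esub> snd y = snd y \<otimes>\<^bsub>H\<^esub> app \<phi> n" using cc mul(2,4) unfolding CC_def by blast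
  then have 1: "app \<phi> ?n = snd y \<otimes>\<^bsub>H\<^esub> app \<phi> n \<otimes>\<^bsub>H\<^esub> inv\<^bsub>H\<^esub> snd y"
    using c ser_iso_in(1)[OF im f n] by (metis H.inv_solve_right H.m_closed)
  have "fst w \<otimes>\<^bsub>G\<^esub> fst y \<otimes>\<^bsub>G\<^esub> n \<otimes>\<^bsub>G\<^esub> inv\<^bsub>G\<^esub> (fst w \<otimes>\<^bsub>G\<^esub> fst y) = fst w \<otimes>\<^bsub>G\<^esub> ?n \<otimes>\<^bsub>G\<^esub> inv\<^bsub>G\<^esub> fst w"
    using c by (simp add: G.m_assoc G.inv_mult_group)
  moreover have "snd w \<otimes>\<^bsub>H\<^esub> snd y \<otimes>\<^bsub>H\<^esub> app \<phi> n \<otimes>\<^bsub>H\<^esub> inv\<^bsub>H\<^esub> (snd w \<otimes>\<^bsub>H\<^esub> snd y) =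
     snd w \<otimes>\<^bsub>H\<^esub> (snd y \<otimes>\<^bsub>H\<^esub> app \<phi> n \<otimes>\<^bsub>H\<^esub> inv\<^bsub>H\<^esub> snd y) \<otimes>\<^bsub>H\<^esub> inv\<^bsub>H\<^esub> snd w"
    using c by (simp add: H.m_assoc H.inv_mult_group)
  ultimately show ?case using mul.IH[OF n] 1 by simp
qed

text \<open>Writing \<open>w y = k r\<close> moves the product to another representative; the
  discrepancy is \<open>\<phi>(k)\<close>, which is just what the relator condition
  prescribes.\<close>

lemma E_y: "x \<in> S ! Suc i \<Longrightarrow> y \<in> set Y \<Longrightarrow> E (x \<otimes>\<^bsub>G\<^esub> fst y) = E x \<otimes>\<^bsub>H\<^esub> snd y"
proof -
  assume "x \<in> S ! Suc i" and y: "y \<in> set Y"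
  then obtain n w where nw: "n \<in> S ! i" "w \<in> set W" "x = n \<otimes>\<^bsub>G\<^esub> fst w" using dec by blast
  from relator_props[OF nw(2) y] obtain k r where kr: "k \<in> S ! i" "r \<in> set W"
    "fst w \<otimes>\<^bsub>G\<^esub> fst y = k \<otimes>\<^bsub>G\<^esub> fst r" "relator xs z i W w y = (k, (snd w \<otimes>\<^bsub>H\<^esub> snd y) \<otimes>\<^bsub>H\<^esub> inv\<^bsub>H\<^esub> snd r)" by blast
  have "relator xs z i W w y \<in> set Q" unfolding setQ using nw y by blast
  from pp[OF this] kr have k: "app \<phi> k = (snd w \<otimes>\<^bsub>H\<^esub> snd y) \<otimes>\<^bsub>H\<^esub> inv\<^bsub>H\<^esub> snd r" by simp
  have c: "fst w \<in> carrier G" "snd w \<in> carrier H" "fst y \<in> carrier G" "snd y \<in> carrier H"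
     "fst r \<in> carrier G" "snd r \<in> carrier H" "n \<in> carrier G" "k \<in> carrier G" "app \<phi> n \<in> carrier H"
    using gp_in[OF W_gp[OF nw(2)]] gp_in[OF W_gp[OF kr(2)]] inY[OF y] nw kr ser_iso_in(1)[OF im f] by auto
  have "x \<otimes>\<^bsub>G\<^esub> fst y = n \<otimes>\<^bsub>G\<^esub> (fst w \<otimes>\<^bsub>G\<^esub> fst y)" using nw c by (simp add: G.m_assoc)
  also have "\<dots> = (n \<otimes>\<^bsub>G\<^esub> k) \<otimes>\<^bsub>G\<^esub> fst r" unfolding kr(3) using c by (simp add: G.m_assoc)
  finally have "E (x \<otimes>\<^bsub>G\<^esub> fst y) = app \<phi> (n \<otimes>\<^bsub>G\<^esub> k) \<otimes>\<^bsub>H\<^esub> snd r" using E_eq[of "n \<otimes>\<^bsub>G\<^esub> k" r] nw kr im by simp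
  also have "\<dots> = app \<phi> n \<otimes>\<^bsub>H\<^esub> (app \<phi> k \<otimes>\<^bsub>H\<^esub> snd r)" using ser_iso_mult[OF im f] nw kr c ser_iso_in(1)[OF im f] by (simp add: H.m_assoc)
  also have "app \<phi> k \<otimes>\<^bsub>H\<^esub> snd r = snd w \<otimes>\<^bsub>H\<^esub> snd y" unfolding k using c by (simp add: H.m_assoc)
  also have "app \<phi> n \<otimes>\<^bsub>H\<^esub> (snd w \<otimes>\<^bsub>H\<^esub> snd y) = E x \<otimes>\<^bsub>H\<^esub> snd y" using E_eq[OF nw(1,2)] nw(3) c by (simp add: H.m_assoc)
  finally show ?thesis .
qed

lemma E_gp: "w \<in> gp Y \<Longrightarrow> x \<in> S ! Suc i \<Longrightarrow> E (x \<otimes>\<^bsub>G\<^esub> fst w) = E x \<otimes>\<^bsub>H\<^esub> snd w"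
proof (induction rule: gp.induct)
  case one then show ?case using E_in by simp
next
  case (mul w y)
  have c: "fst w \<in> S ! Suc i" "snd w \<in> carrier H" "fst y \<in> S ! Suc i" "snd y \<in> carrier H"
    using gp_in[OF mul(1)] inY[OF mul(2)] by auto
  have "E (x \<otimes>\<^bsub>G\<^esub> fst w \<otimes>\<^bsub>G\<^esub> fst y) = E (x \<otimes>\<^bsub>G\<^esub> fst w) \<otimes>\<^bsub>H\<^esub> snd y" using E_y[OF _ mul(2)] mul c i by simp
  then show ?case using mul c E_in[OF mul.prems] by (simp add: G.m_assoc H.m_assoc)
qed

text \<open>Normality moves \<open>n\<close> to the left of the representative, and
  \<open>E_conj\<close> says that the image moves along.\<close>

lemma E_n: "x \<in> S ! Suc i \<Longrightarrow> n \<in> S ! i \<Longrightarrow> E (x \<otimes>\<^bsub>G\<^esub> n) = E x \<otimes>\<^bsub>H\<^esub> app \<phi> n"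
proof -
  assume "x \<in> S ! Suc i" and n: "n \<in> S ! i"
  then obtain k w where kw: "k \<in> S ! i" "w \<in> set W" "x = k \<otimes>\<^bsub>G\<^esub> fst w" using dec by blast
  have c: "fst w \<in> S ! Suc i" "fst w \<in> carrier G" "snd w \<in> carrier H" "k \<in> carrier G" "app \<phi> k \<in> carrier H" "n \<in> carrier G" "app \<phi> n \<in> carrier H"
    using gp_in[OF W_gp[OF kw(2)]] kw n ser_iso_in(1)[OF im f] by auto
  let ?n = "fst w \<otimes>\<^bsub>G\<^esub> n \<otimes>\<^bsub>G\<^esub> inv\<^bsub>G\<^esub> fst w"
  have n': "?n \<in> S ! i" using G.nconj[OF i c(1) n] .
  have "x \<otimes>\<^bsub>G\<^esub> n = (k \<otimes>\<^bsub>G\<^esub> ?n) \<otimes>\<^bsub>G\<^esub> fst w" using c kw by (simp add: G.m_assoc)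
  then have "E (x \<otimes>\<^bsub>G\<^esub> n) = app \<phi> (k \<otimes>\<^bsub>G\<^esub> ?n) \<otimes>\<^bsub>H\<^esub> snd w" using E_eq[of "k \<otimes>\<^bsub>G\<^esub> ?n" w] kw n' im by simp
  also have "\<dots> = app \<phi> k \<otimes>\<^bsub>H\<^esub> app \<phi> ?n \<otimes>\<^bsub>H\<^esub> snd w" using ser_iso_mult[OF im f kw(1) n'] by simp
  also have "\<dots> = app \<phi> k \<otimes>\<^bsub>H\<^esub> snd w \<otimes>\<^bsub>H\<^esub> app \<phi> n" unfolding E_conj[OF W_gp[OF kw(2)] n]
    using c by (simp add: H.m_assoc)
  finally show ?thesis using E_eq[OF kw(1,2)] kw by simp
qed

lemma E_mult: "x \<in> S ! Suc i \<Longrightarrow> x' \<in> S ! Suc i \<Longrightarrow> E (x \<otimes>\<^bsub>G\<^esub> x') = E x \<otimes>\<^bsub>H\<^esub> E x'"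
proof -
  assume x: "x \<in> S ! Suc i" and "x' \<in> S ! Suc i"
  then obtain n w where nw: "n \<in> S ! i" "w \<in> set W" "x' = n \<otimes>\<^bsub>G\<^esub> fst w" using dec by blast
  have c: "fst w \<in> carrier G" "snd w \<in> carrier H" "app \<phi> n \<in> carrier H" "n \<in> carrier G" "x \<in> carrier G" "E x \<in> carrier H"
    using gp_in[OF W_gp[OF nw(2)]] nw x ser_iso_in(1)[OF im f] E_in by auto
  have xn: "x \<otimes>\<^bsub>G\<^esub> n \<in> S ! Suc i" using x NM[OF nw(1)] i by simp
  have "E (x \<otimes>\<^bsub>G\<^esub> x') = E (x \<otimes>\<^bsub>G\<^esub> n \<otimes>\<^bsub>G\<^esub> fst w)" using nw c by (simp add: G.m_assoc)
  also have "\<dots> = E x \<otimes>\<^bsub>H\<^esub> app \<phi> n \<otimes>\<^bsub>H\<^esub> snd w" using E_gp[OF W_gp[OF nw(2)] xn] E_n[OF x nw(1)] by simp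
  finally show ?thesis using E_eq[OF nw(1,2)] nw(3) c by (simp add: H.m_assoc)
qed

text \<open>\<open>E\<close> is multiplicative by the previous lemmas. It differs from
  \<open>fs\<close> by left factors in \<open>T ! i\<close>, so membership in \<open>T ! i\<close>
  and \<open>T ! Suc i\<close> is as for \<open>fs\<close>; in lower terms it is as for
  \<open>\<phi>\<close>. The kernel is then trivial, and counting gives surjectivity.\<close>

lemma extend_ser_iso: "ser_iso G S H T (Suc i) E"
proof -
  have rel: "\<exists>u\<in>T ! i. E x = u \<otimes>\<^bsub>H\<^esub> fs x" if x: "x \<in> S ! Suc i" for x
  proof -
    obtain n w where nw: "n \<in> S ! i" "w \<in> set W" "x = n \<otimes>\<^bsub>G\<^esub> fst w" using dec[OF x] by blast
    have c: "app \<phi> n \<in> T ! i" "fs n \<in> T ! i" "snd w \<in> carrier H" "fst w \<in> S ! Suc i"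
      using ser_iso_in(2)[OF im f] ser_iso_in(2)[OF im ser_iso_down[OF i fs]] nw gp_in[OF W_gp[OF nw(2)]] by auto
    have "fs x = fs n \<otimes>\<^bsub>H\<^esub> snd w" using ser_iso_mult[OF i fs NM[OF nw(1)] c(4)] fs_gp[OF W_gp[OF nw(2)]] nw by simp
    then have "E x = (app \<phi> n \<otimes>\<^bsub>H\<^esub> inv\<^bsub>H\<^esub> fs n) \<otimes>\<^bsub>H\<^esub> fs x"
      using E_eq[OF nw(1,2)] nw(3) c H.inC[OF im] by (simp add: H.m_assoc H.inv_solve_left)
    then show ?thesis using c im by (intro bexI[of _ "app \<phi> n \<otimes>\<^bsub>H\<^esub> inv\<^bsub>H\<^esub> fs n"]) auto
  qed
  have memi: "E x \<in> T ! j \<longleftrightarrow> fs x \<in> T ! j" if x: "x \<in> S ! Suc i" and j: "i \<le> j" "j \<le> Suc i" for x j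
  proof -
    obtain u where u: "u \<in> T ! i" "E x = u \<otimes>\<^bsub>H\<^esub> fs x" using rel[OF x] by blast
    have jm: "j < m" using j i by simp
    have uj: "u \<in> T ! j" using H.chain[OF j(1) jm] u by blast
    have c: "u \<in> carrier H" "fs x \<in> carrier H" using H.inC[OF jm uj] ser_iso_in(1)[OF i fs x] by auto
    have "fs x = inv\<^bsub>H\<^esub> u \<otimes>\<^bsub>H\<^esub> E x" unfolding u(2) using c by (simp add: H.m_assoc[symmetric])
    then show ?thesis using u uj H.clo[OF jm] by metis
  qed
  have mem: "x \<in> S ! j \<longleftrightarrow> E x \<in> T ! j" if x: "x \<in> S ! Suc i" and j: "j \<le> Suc i" for x j
  proof (cases "i \<le> j")
    case True
    then show ?thesis using memi[OF x True j] ser_iso_mem[OF i fs x j] by simp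
  next
    case False
    then have ji: "j \<le> i" by simp
    show ?thesis
    proof (cases "x \<in> S ! i")
      case True then show ?thesis using E_N ser_iso_mem[OF im f True ji] by simp
    next
      case False
      then have "E x \<notin> T ! i" using memi[OF x, of i] ser_iso_mem[OF i fs x, of i] by simp
      then show ?thesis using False chn[OF ji] H.chain[OF ji im] by blast
    qed
  qed
  have inj: "inj_on E (S ! Suc i)"
  proof (rule inj_onI)
    fix x y assume xy: "x \<in> S ! Suc i" "y \<in> S ! Suc i" "E x = E y"
    let ?d = "x \<otimes>\<^bsub>G\<^esub> inv\<^bsub>G\<^esub> y"
    have d: "?d \<in> S ! Suc i" using xy i by simp
    have "x = ?d \<otimes>\<^bsub>G\<^esub> y" using xy by (simp add: G.m_assoc)
    then have "E x = E ?d \<otimes>\<^bsub>H\<^esub> E y" using E_mult[OF d xy(2)] by simp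
    then have "E ?d = \<one>\<^bsub>H\<^esub>" using xy E_in d by (metis H.l_cancel_one' H.r_cancel_one')
    then have "E ?d \<in> T ! 0" using H.S0 by simp
    then have "?d = \<one>\<^bsub>G\<^esub>" using mem[OF d, of 0] G.S0 by simp
    then show "x = y" using xy by (metis N_in(2) G.inv_equality G.inv_inv G.inv_closed)
  qed
  have "E ` (S ! Suc i) \<subseteq> T ! Suc i" using mem[of _ "Suc i"] by auto
  moreover have "card (E ` (S ! Suc i)) = card (T ! Suc i)"
    using card_image[OF inj] card_image[OF ser_iso_inj[OF i fs]] ser_iso_img[OF i fs, of "Suc i"] by simp
  moreover have "finite (T ! Suc i)" using H.inN[OF i] by (auto intro: finite_subset[of _ "{..<nn xs}"])
  ultimately have "E ` (S ! Suc i) = T ! Suc i" by (simp add: card_subset_eq)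
  then show ?thesis unfolding ser_iso_def using E_in E_mult mem by auto
qed

lemma extend_Y: "y \<in> set Y \<Longrightarrow> E (fst y) = snd y"
  using E_y[of "\<one>\<^bsub>G\<^esub>" y] E_N[of "\<one>\<^bsub>G\<^esub>"] ser_iso_one[OF im f] inY im i by simp

end

text \<open>Suppose sifting stops at depth \<open>j\<close> short of all conditions. Some
  automorphism \<open>\<kappa>\<close> turns \<open>\<phi>\<close> into a solution, and it has depth
  exactly \<open>j\<close>. The first factor \<open>\<tau>\<close> of its normal form lies in the
  table, and the remaining factor is deeper; so \<open>\<phi>\<close> followed on the right by
  \<open>\<tau>\<close> already satisfies condition \<open>j\<close>, and sifting was not
  finished.\<close>

lemma search_full:
  assumes T: "set L \<subseteq> Aut xs G S i" and fac: "\<And>\<kappa>. \<kappa> \<in> Aut xs G S i \<Longrightarrow> depth_group.fac (AG xs G S i) dd (set L) \<kappa>"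
    and f0: "ser_iso G S H T i (app \<phi>0)"
  defines "\<phi> \<equiv> sift xs z i Y Q L \<phi>0"
  shows "ser_iso G S H T i (app \<phi>)" "CC (app \<phi>) i" "\<And>p. p \<in> set Q \<Longrightarrow> app \<phi> (fst p) = snd p"
proof -
  interpret D: depth_group "AG xs G S i" dd rr by (rule depth_AG)
  let ?d = "depth xs z i Y Q" let ?R = "Suc i + length Q"
  have sercmp: "ser_iso G S H T i (app (comp_map xs a t))" if "ser_iso G S H T i (app a)" "t \<in> Aut xs G S i" for a t
  proof -
    have "ser_iso G S H T i (\<lambda>x. app a (app t x))" using ser_iso_comp[OF im that(1)] that(2) by (simp add: Aut_def)
    then show ?thesis using ser_iso_cong[of S i "app (comp_map xs a t)" "\<lambda>x. app a (app t x)"]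
      app_comp_map G.inN[OF im] G.clo(1)[OF im] by auto
  qed
  show s: "ser_iso G S H T i (app \<phi>)"
    unfolding \<phi>_def sift_def
    by (rule foldl_inv, rule f0, rule foldl_inv) (use T sercmp in \<open>auto simp: sift_step_def\<close>)
  have s1: "sift_step xs z i Y Q = (\<lambda>a t. if ?d a < ?d (comp_map xs a t) then comp_map xs a t else a)"
    by (intro ext) (simp add: sift_step_def)
  have stuck: "?R \<le> ?d \<phi> \<or> (\<forall>t\<in>set L. \<not> ?d \<phi> < ?d (comp_map xs \<phi> t))"
    unfolding \<phi>_def sift_def s1 by (rule sift_stuck)
  have full: "?d \<phi> = ?R"
  proof (rule ccontr)
    assume ne: "?d \<phi> \<noteq> ?R"
    let ?j = "?d \<phi>"
    have j: "?j < ?R" using ne depth_le[of xs z i Y Q \<phi>] by simp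
    then have st: "\<not> ?j < ?d (comp_map xs \<phi> t)" if "t \<in> set L" for t using stuck that by auto
    have fi: "ser_iso G S H T i fs" using ser_iso_down[OF i fs] .
    have im1: "app \<phi> ` (S ! i) = T ! i" using ser_iso_img[OF im s, of i] by simp
    \<comment> \<open>The inverse of \<open>\<phi>\<close> after \<open>fs\<close>, so that
      \<open>\<phi>\<close> composed with it is the solution \<open>fs\<close> on
      \<open>G_i\<close>.\<close>
    define kf where "kf = (\<lambda>x. inv_into (S ! i) (app \<phi>) (fs x))"
    have kf: "kf x \<in> S ! i" "app \<phi> (kf x) = fs x" if "x \<in> S ! i" for x
    proof -
      have "fs x \<in> app \<phi> ` (S ! i)" using ser_iso_in(2)[OF im fi that] im1 by simp
      then show "kf x \<in> S ! i" "app \<phi> (kf x) = fs x" unfolding kf_def by (auto intro: inv_into_into f_inv_into_f)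
    qed
    have uniq: "a = b" if "a \<in> S ! i" "b \<in> S ! i" "app \<phi> a = app \<phi> b" for a b
      using ser_iso_inj[OF im s] that by (auto dest: inj_onD)
    define \<kappa> where "\<kappa> = map (\<lambda>x. if x \<in> S ! i then kf x else x) [0..<nn xs]"
    have k1: "app \<kappa> x = kf x" if "x \<in> S ! i" for x using that G.inN[OF im that] by (simp add: \<kappa>_def)
    have "ser_iso G S G S i kf"
      unfolding ser_iso_def
    proof (intro conjI ballI allI impI)
      fix x y assume xy: "x \<in> S ! i" "y \<in> S ! i"
      show "kf (x \<otimes>\<^bsub>G\<^esub> y) = kf x \<otimes>\<^bsub>G\<^esub> kf y"
        by (rule uniq) (use xy kf im ser_iso_mult[OF im fi] ser_iso_mult[OF im s] in auto)
    next
      fix x assume x: "x \<in> S ! i"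
      then show "kf x \<in> carrier G" using kf by simp
      fix j assume "j \<le> i"
      then show "x \<in> S ! j \<longleftrightarrow> kf x \<in> S ! j"
        using ser_iso_mem[OF im fi x] ser_iso_mem[OF im s kf(1)[OF x]] kf(2)[OF x] by simp
    next
      show "S ! i \<subseteq> kf ` (S ! i)"
      proof
        fix u assume u: "u \<in> S ! i"
        then have "app \<phi> u \<in> fs ` (S ! i)" using ser_iso_in(2)[OF im s] ser_iso_img[OF im fi, of i] by simp
        then obtain x where x: "x \<in> S ! i" "app \<phi> u = fs x" by blast
        then have "u = kf x" using uniq[OF u kf(1)[OF x(1)]] kf(2)[OF x(1)] by simp
        then show "u \<in> kf ` (S ! i)" using x by blast
      qed
    qed
    then have "ser_iso G S G S i (app \<kappa>)"
      using ser_iso_cong[of S i "app \<kappa>" kf] k1 G.clo(1)[OF im] by auto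
    then have kA: "\<kappa> \<in> Aut xs G S i" by (simp add: Aut_def \<kappa>_def)
    have ck: "cond_at xs z i Y Q (comp_map xs \<phi> \<kappa>) k" if k: "k < ?R" for k
    proof -
      have v: "app (comp_map xs \<phi> \<kappa>) x = fs x" if "x \<in> S ! i" for x
        using that k1 kf app_comp_map G.inN[OF im that] by simp
      show ?thesis
      proof (cases "k \<le> i")
        case True
        have "CC (app (comp_map xs \<phi> \<kappa>)) k \<longleftrightarrow> CC fs k"
          unfolding CC_def using v chn[OF True] conj_in fstY by simp
        then show ?thesis using True commutes_iff[OF sercmp[OF s kA] True] fs_CC[OF True] by (simp add: cond_at_def)
      next
        case False
        then have "Q ! (k - Suc i) \<in> set Q" using k by (intro nth_mem) auto
        then show ?thesis using False v Q_in fs_relators by (simp add: cond_at_def)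
      qed
    qed
    have jr: "?j < rr" using j lenQ by simp
    note cc = cond_at_comp[OF s kA disjI1[OF refl]]
    have cj: "\<forall>k<?j. cond_at xs z i Y Q \<phi> k" using depth_ge[of ?j i Q xs z Y \<phi>] j by simp
    \<comment> \<open>Below \<open>?j\<close> both \<open>\<phi>\<close> and its composite with
      \<open>\<kappa>\<close> satisfy the conditions, so \<open>\<kappa>\<close> does too. At
      \<open>?j\<close> it cannot, or \<open>\<phi>\<close> would.\<close>
    have 1: "?j \<le> dd \<kappa>" using cc(2) cj ck j jr by (subst depth_ge) auto
    have "\<not> Suc ?j \<le> dd \<kappa>"
    proof
      assume a: "Suc ?j \<le> dd \<kappa>"
      have "\<forall>k<Suc ?j. cond_at xs 1 i Y0 Q0 \<kappa> k" using depth_ge[of "Suc ?j" i Q0 xs 1 Y0 \<kappa>] jr a by simp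
      then have "\<forall>k<Suc ?j. cond_at xs z i Y Q \<phi> k" using cc(3) ck j by auto
      then have "Suc ?j \<le> ?j" using depth_ge[of "Suc ?j" i Q xs z Y \<phi>] j by simp
      then show False by simp
    qed
    then have dk: "dd \<kappa> = ?j" using 1 by simp
    then have ne: "\<kappa> \<noteq> \<one>\<^bsub>AG xs G S i\<^esub>" using D.d_one jr by auto
    have TA: "set L \<subseteq> carrier (AG xs G S i)" using T by simp
    obtain \<tau> \<kappa>' where t: "\<tau> \<in> set L" "D.fac (set L) \<kappa>'" "\<kappa> = comp_map xs \<tau> \<kappa>'" "dd \<kappa> < dd \<kappa>'"
      by (rule D.fac_split[OF fac[OF kA] ne TA]) (simp only: AG_simps)
    have tA: "\<tau> \<in> Aut xs G S i" using t T by auto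
    have k'A: "\<kappa>' \<in> Aut xs G S i" using D.fac_carrier[OF t(2)] T by simp
    \<comment> \<open>Regrouped so that the two-out-of-three property applies to the composite of
      \<open>\<phi>\<close> with \<open>\<tau>\<close>, with the deep factor
      \<open>\<kappa>'\<close> to be removed.\<close>
    have e: "comp_map xs \<phi> \<kappa> = comp_map xs (comp_map xs \<phi> \<tau>) \<kappa>'"
      unfolding t(3) using G.Aut_lt[OF refl im k'A] by (intro app_eqI[of _ "nn xs"]) (auto simp: app_comp_map)
    note cc' = cond_at_comp[OF sercmp[OF s tA] k'A disjI1[OF refl]]
    have "\<forall>k<Suc ?j. cond_at xs 1 i Y0 Q0 \<kappa>' k" using depth_ge[of "Suc ?j" i Q0 xs 1 Y0 \<kappa>'] jr t(4) dk by simp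
    then have "\<forall>k<Suc ?j. cond_at xs z i Y Q (comp_map xs \<phi> \<tau>) k" using cc'(3) ck j unfolding e by auto
    then have "Suc ?j \<le> ?d (comp_map xs \<phi> \<tau>)" using depth_ge[of "Suc ?j" i Q xs z Y "comp_map xs \<phi> \<tau>"] j by simp
    then show False using st[OF t(1)] by simp
  qed
  then have all: "\<forall>k<?R. cond_at xs z i Y Q \<phi> k" using depth_ge[of ?R i Q xs z Y \<phi>] by simp
  then show "CC (app \<phi>) i" using commutes_iff[OF s order_refl] by (auto simp: cond_at_def)
  fix p assume "p \<in> set Q"
  then obtain k where k: "k < length Q" "Q ! k = p" by (auto simp: in_set_conv_nth)
  have "cond_at xs z i Y Q \<phi> (Suc i + k)" using all k by simp
  then show "app \<phi> (fst p) = snd p" using k by (simp add: cond_at_def)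
qed

end

end

section \<open>Indices in the tower and the size of the sifting table\<close>

lemma concat_map_eq:
  "concat (map (\<lambda>y. map (f y) gs) ys) = concat (map (\<lambda>y. map (f' y) gs) ys) \<Longrightarrow> y \<in> set ys \<Longrightarrow> g \<in> set gs \<Longrightarrow> f y g = f' y g"
  by (induction ys) auto

text \<open>Products without inverses, built by multiplication from the left, as
  \<open>fac_fac\<close> requires.\<close>

inductive_set monoid_gen :: "nat list \<Rightarrow> nat list set \<Rightarrow> nat list set" for xs X where
  one: "[0..<nn xs] \<in> monoid_gen xs X"
| mul: "a \<in> X \<Longrightarrow> \<phi> \<in> monoid_gen xs X \<Longrightarrow> comp_map xs a \<phi> \<in> monoid_gen xs X"

context level
begin

text \<open>Automorphisms of equal depth and equal label lie in the same coset of the next subgroup of the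
  tower, so the number of labels bounds its index.\<close>

definition label :: "nat list \<Rightarrow> nat \<Rightarrow> nat list" where
  "label t j = (if j \<le> i then concat (map (\<lambda>y. map (\<lambda>g. app t (y \<otimes>\<^bsub>G\<^esub> app (inv_map xs t) g \<otimes>\<^bsub>G\<^esub> inv\<^bsub>G\<^esub> y)) (coset_gens xs (j - 1))) ys)
     else [app t (fst (Q0 ! (j - Suc i)))])"

lemma Aut_cond_at_DD: "t \<in> Aut xs G S i \<Longrightarrow> j \<le> i \<Longrightarrow> cond_at xs 1 i Y0 Q0 t j \<longleftrightarrow> DD (app t) j"
proof -
  interpret L: level G G xs 1 m S S i ys ys by (rule level0)
  assume t: "t \<in> Aut xs G S i" and j: "j \<le> i"
  have s: "ser_iso G S G S i (app t)" using t by (simp add: Aut_def)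
  show ?thesis using j L.commutes_iff[OF s j] CC0_DD[OF s j] by (simp add: cond_at_def)
qed

text \<open>For \<open>j \<le> i\<close> put \<open>h u = u c_y u^-1\<close> with \<open>c_y\<close>
  conjugation by \<open>y\<close>. This is multiplicative on \<open>S ! i\<close> and agrees with
  \<open>c_y\<close> on \<open>S ! (j - 1)\<close> when \<open>u\<close> has depth \<open>j\<close>.
  Equal labels then make \<open>h t\<close> and \<open>h t'\<close> agree on \<open>S ! j\<close>,
  which says that \<open>t'^-1 t\<close> commutes with \<open>c_y\<close> there.\<close>

lemma label_sep:
  assumes t: "t \<in> Aut xs G S i" "t' \<in> Aut xs G S i" and d: "dd t = j" "dd t' = j" "j < rr" and l: "label t j = label t' j"
  shows "j < dd (comp_map xs (inv_map xs t') t)"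
proof -
  interpret D: depth_group "AG xs G S i" dd rr by (rule depth_AG)
  interpret P: pair G G xs 1 m S S by (rule GG)
  let ?k = "comp_map xs (inv_map xs t') t"
  have it: "inv_map xs t' \<in> Aut xs G S i" "inv_map xs t \<in> Aut xs G S i" using G.Aut_inv_map[OF refl im] t by auto
  have kA: "?k \<in> Aut xs G S i" using G.Aut_comp_map[OF refl im it(1) t(1)] .
  have "dd (inv_map xs t') = j" using D.d_inv[of t'] G.AG_inv[OF refl im t(2)] t d by simp
  then have "j \<le> dd ?k" using D.d_mult[of "inv_map xs t'" t] it t d by simp
  then have low: "\<forall>k<j. cond_at xs 1 i Y0 Q0 ?k k" using depth_ge[of j i Q0 xs 1 Y0 ?k] d(3) by simp
  have lowt: "\<forall>k<j. cond_at xs 1 i Y0 Q0 t k" "\<forall>k<j. cond_at xs 1 i Y0 Q0 t' k"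
    using depth_ge[of j i Q0 xs 1 Y0 t] depth_ge[of j i Q0 xs 1 Y0 t'] d by auto
  have "cond_at xs 1 i Y0 Q0 ?k j"
  proof (cases "j \<le> i")
    case False
    define p where "p = Q0 ! (j - Suc i)"
    have "p \<in> set Q0" unfolding p_def using False d(3) by (intro nth_mem) auto
    then have p: "snd p = fst p" "fst p < nn xs" using Q0_diag[of p] by auto
    have "app t (fst p) = app t' (fst p)" using l False by (simp add: label_def p_def)
    then have "app ?k (fst p) = fst p" using p G.app_inv_map(3)[OF refl im t(2) p(2)] by (simp add: app_comp_map)
    then show ?thesis using False p by (simp add: cond_at_def p_def)
  next
    case True
    have st: "ser_iso G S G S i (app t)" "ser_iso G S G S i (app t')" "ser_iso G S G S i (app (inv_map xs t))" "ser_iso G S G S i (app (inv_map xs t'))"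
      using t it by (auto simp: Aut_def)
    have "j \<noteq> 0"
    proof
      assume "j = 0"
      then have "\<not> cond_at xs 1 i Y0 Q0 t 0" using depth_ge[of "Suc 0" i Q0 xs 1 Y0 t] d by auto
      moreover have "DD (app t) 0" unfolding DD_def using G.S0 P.ser_iso_one[OF im st(1)] ysM by simp
      ultimately show False using Aut_cond_at_DD[OF t(1), of 0] by simp
    qed
    then obtain j' where j': "j = Suc j'" by (cases j) auto
    have j'm: "Suc j' < m" "j' \<le> i" using True im j' by auto
    note gp = coset_gens_props[OF j'm(1)]
    have gsub: "S ! j' \<union> set (coset_gens xs j') \<subseteq> S ! j" using gp(1) G.step_incl[OF j'm(1)] j' by auto
    have ji: "x \<in> S ! i" if "x \<in> S ! j" for x using chn[OF True that] .
    have iv: "app (inv_map xs u) x \<in> S ! k \<and> app u (app (inv_map xs u) x) = x" if "u \<in> Aut xs G S i" "x \<in> S ! k" "k \<le> i" for u x k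
    proof -
      have s: "ser_iso G S G S i (app (inv_map xs u))" using G.Aut_inv_map[OF refl im that(1)] by (simp add: Aut_def)
      show ?thesis using P.ser_iso_mem[OF im s chn[OF that(3,2)] that(3)] that
        G.app_inv_map(2)[OF refl im that(1) G.inN[OF im chn[OF that(3,2)]]] by simp
    qed
    have main: "app t (y \<otimes>\<^bsub>G\<^esub> app (inv_map xs t) x \<otimes>\<^bsub>G\<^esub> inv\<^bsub>G\<^esub> y) = app t' (y \<otimes>\<^bsub>G\<^esub> app (inv_map xs t') x \<otimes>\<^bsub>G\<^esub> inv\<^bsub>G\<^esub> y)"
      if y: "y \<in> set ys" and x: "x \<in> S ! j" for x y
    proof -
      define h where "h = (\<lambda>u x. app u (y \<otimes>\<^bsub>G\<^esub> app (inv_map xs u) x \<otimes>\<^bsub>G\<^esub> inv\<^bsub>G\<^esub> y))"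
      have yc: "y \<in> carrier G" using ysM[OF y] by simp
      have cin: "y \<otimes>\<^bsub>G\<^esub> app (inv_map xs u) a \<otimes>\<^bsub>G\<^esub> inv\<^bsub>G\<^esub> y \<in> S ! i" if "u \<in> Aut xs G S i" "a \<in> S ! i" for u a
        using conj_in[OF y] iv[OF that(1,2)] by simp
      have hm: "h u (a \<otimes>\<^bsub>G\<^esub> b) = h u a \<otimes>\<^bsub>G\<^esub> h u b" if u: "u \<in> Aut xs G S i" and ab: "a \<in> S ! i" "b \<in> S ! i" for u a b
      proof -
        have su: "ser_iso G S G S i (app u)" "ser_iso G S G S i (app (inv_map xs u))" using u G.Aut_inv_map[OF refl im u] by (auto simp: Aut_def)
        have c: "app (inv_map xs u) a \<in> carrier G" "app (inv_map xs u) b \<in> carrier G" using P.ser_iso_in(1)[OF im su(2)] ab by auto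
        have "y \<otimes>\<^bsub>G\<^esub> app (inv_map xs u) (a \<otimes>\<^bsub>G\<^esub> b) \<otimes>\<^bsub>G\<^esub> inv\<^bsub>G\<^esub> y =
          (y \<otimes>\<^bsub>G\<^esub> app (inv_map xs u) a \<otimes>\<^bsub>G\<^esub> inv\<^bsub>G\<^esub> y) \<otimes>\<^bsub>G\<^esub> (y \<otimes>\<^bsub>G\<^esub> app (inv_map xs u) b \<otimes>\<^bsub>G\<^esub> inv\<^bsub>G\<^esub> y)"
        proof -
          have "inv\<^bsub>G\<^esub> y \<otimes>\<^bsub>G\<^esub> (y \<otimes>\<^bsub>G\<^esub> v) = v" if "v \<in> carrier G" for v
            using that yc by (simp add: G.m_assoc[symmetric])
          then show ?thesis unfolding P.ser_iso_mult[OF im su(2) ab] using c yc by (simp add: G.m_assoc)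
        qed
        then show ?thesis unfolding h_def using P.ser_iso_mult[OF im su(1) cin[OF u ab(1)] cin[OF u ab(2)]] by simp
      qed
      have hc: "h u a \<in> carrier G" if "u \<in> Aut xs G S i" "a \<in> S ! i" for u a
      proof -
        have su: "ser_iso G S G S i (app u)" using that by (simp add: Aut_def)
        show ?thesis unfolding h_def using P.ser_iso_in(1)[OF im su cin[OF that]] .
      qed
      have h1: "h u \<one>\<^bsub>G\<^esub> = \<one>\<^bsub>G\<^esub>" if "u \<in> Aut xs G S i" for u
        using hm[OF that, of "\<one>\<^bsub>G\<^esub>" "\<one>\<^bsub>G\<^esub>"] hc[OF that, of "\<one>\<^bsub>G\<^esub>"] G.clo(3)[OF im] by (simp add: G.l_cancel_one)
      have hinv: "h u (inv\<^bsub>G\<^esub> a) = inv\<^bsub>G\<^esub> (h u a)" if u: "u \<in> Aut xs G S i" and a: "a \<in> S ! i" for u a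
      proof -
        have "h u (inv\<^bsub>G\<^esub> a) \<otimes>\<^bsub>G\<^esub> h u a = \<one>\<^bsub>G\<^esub>"
          using hm[OF u, of "inv\<^bsub>G\<^esub> a" a] h1[OF u] a im by simp
        then show ?thesis using hc[OF u a] hc[OF u, of "inv\<^bsub>G\<^esub> a"] a im by (simp add: G.inv_equality)
      qed
      \<comment> \<open>On the previous term \<open>u\<close> commutes with \<open>c_y\<close>, so
        \<open>h u\<close> is \<open>c_y\<close> itself and carries no information about
        \<open>u\<close>.\<close>
      have low': "h u a = y \<otimes>\<^bsub>G\<^esub> a \<otimes>\<^bsub>G\<^esub> inv\<^bsub>G\<^esub> y" if u: "u \<in> Aut xs G S i" "\<forall>k<j. cond_at xs 1 i Y0 Q0 u k" and a: "a \<in> S ! j'" for u a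
      proof -
        have "DD (app u) j'" using u(2) Aut_cond_at_DD[OF u(1) j'm(2)] j' by simp
        then show ?thesis unfolding h_def DD_def using iv[OF u(1) a j'm(2)] y by simp
      qed
      have gs: "h t g = h t' g" if "g \<in> set (coset_gens xs j')" for g
        using concat_map_eq[OF l[unfolded label_def if_P[OF True]] y, of g] that j' unfolding h_def by simp
      have "x \<in> generate G (S ! j' \<union> set (coset_gens xs j'))" using gp(2) x j' by simp
      \<comment> \<open>Membership is carried along because \<open>h\<close> is known to be
        multiplicative only inside \<open>S ! i\<close>.\<close>
      then have "x \<in> S ! j \<and> h t x = h t' x"
      proof (induction rule: generate.induct)
        case one then show ?case using h1 t True im by simp
      next
        case (incl x) then show ?case using gsub low'[OF t(1) lowt(1)] low'[OF t(2) lowt(2)] gs by auto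
      next
        case (inv x)
        then have "x \<in> S ! j" "h t x = h t' x" using gsub low'[OF t(1) lowt(1)] low'[OF t(2) lowt(2)] gs by auto
        then show ?case using hinv t ji True im by simp
      next
        case (eng a b) then show ?case using hm t ji True im by simp
      qed
      then show ?thesis unfolding h_def by simp
    qed
    have "DD (app ?k) j"
      unfolding DD_def
    proof (intro ballI)
      fix x y assume x: "x \<in> S ! j" and y: "y \<in> set ys"
      have xi: "x \<in> S ! i" using ji[OF x] .
      have tx: "app t x \<in> S ! j" using P.ser_iso_mem[OF im st(1) xi True] x by simp
      have cx: "y \<otimes>\<^bsub>G\<^esub> x \<otimes>\<^bsub>G\<^esub> inv\<^bsub>G\<^esub> y \<in> S ! i" using conj_in[OF y xi] .
      have kx: "app ?k x = app (inv_map xs t') (app t x)" using app_comp_map G.inN[OF im xi] by simp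
      have kc: "y \<otimes>\<^bsub>G\<^esub> app (inv_map xs t') (app t x) \<otimes>\<^bsub>G\<^esub> inv\<^bsub>G\<^esub> y \<in> S ! i"
        using conj_in[OF y] iv[OF t(2) ji[OF tx]] by simp
      have "app t (y \<otimes>\<^bsub>G\<^esub> x \<otimes>\<^bsub>G\<^esub> inv\<^bsub>G\<^esub> y) = app t' (y \<otimes>\<^bsub>G\<^esub> app (inv_map xs t') (app t x) \<otimes>\<^bsub>G\<^esub> inv\<^bsub>G\<^esub> y)"
        using main[OF y tx] G.app_inv_map(3)[OF refl im t(1) G.inN[OF im xi]] by simp
      then have "app (inv_map xs t') (app t (y \<otimes>\<^bsub>G\<^esub> x \<otimes>\<^bsub>G\<^esub> inv\<^bsub>G\<^esub> y)) = y \<otimes>\<^bsub>G\<^esub> app (inv_map xs t') (app t x) \<otimes>\<^bsub>G\<^esub> inv\<^bsub>G\<^esub> y"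
        using G.app_inv_map(3)[OF refl im t(2) G.inN[OF im kc]] by simp
      then show "app ?k (y \<otimes>\<^bsub>G\<^esub> x \<otimes>\<^bsub>G\<^esub> inv\<^bsub>G\<^esub> y) = y \<otimes>\<^bsub>G\<^esub> app ?k x \<otimes>\<^bsub>G\<^esub> inv\<^bsub>G\<^esub> y"
        using kx app_comp_map G.inN[OF im cx] by simp
    qed
    then show ?thesis using Aut_cond_at_DD[OF kA True] by simp
  qed
  with low have "\<forall>k<Suc j. cond_at xs 1 i Y0 Q0 ?k k" by (auto simp: less_Suc_eq)
  then have "Suc j \<le> dd ?k" using depth_ge[of "Suc j" i Q0 xs 1 Y0 ?k] d(3) by simp
  then show ?thesis by simp
qed

text \<open>Among entries of equal depth no two lie in the same left coset of the next subgroup; by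
  \<open>label_sep\<close> their labels differ.\<close>

definition DT :: "nat list list \<Rightarrow> bool" where
  "DT L \<longleftrightarrow> set L \<subseteq> Aut xs G S i \<and> (\<forall>q<length L. dd (L ! q) < rr \<and>
     (\<forall>p<q. \<not> dd (L ! q) < dd (comp_map xs (inv_map xs (L ! q)) (L ! p))))"

text \<open>Depth and label together determine the position in the table. A label has at most
  \<open>K * K\<close> entries for an intertwining condition, one image for each pair of generators,
  and a single entry for a point.\<close>

lemma DT_count:
  assumes D: "DT L" and K: "length ys \<le> K" "\<And>j. Suc j < m \<Longrightarrow> length (coset_gens xs j) \<le> K" and n: "1 \<le> nn xs"
  shows "length L \<le> rr * nn xs ^ (K * K + 1)"
proof -
  define len where "len = (\<lambda>j. if j \<le> i then length ys * length (coset_gens xs (j - 1)) else 1)"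
  have llen: "length (label t j) = len j" for t j
  proof -
    have "sum_list (map (\<lambda>y. c) ys) = length ys * c" for c :: nat by (induction ys) auto
    then show ?thesis by (simp add: label_def len_def length_concat comp_def)
  qed
  have AutL: "L ! q \<in> Aut xs G S i" if "q < length L" for q using D that by (auto simp: DT_def)
  have lset: "set (label t j) \<subseteq> {..<nn xs}" if t: "t \<in> Aut xs G S i" and j: "j < rr" for t j
  proof (cases "j \<le> i")
    case True
    have "app t (y \<otimes>\<^bsub>G\<^esub> app (inv_map xs t) g \<otimes>\<^bsub>G\<^esub> inv\<^bsub>G\<^esub> y) < nn xs" if "y \<in> set ys" "g \<in> set (coset_gens xs (j - 1))" for y g
    proof -
      have "Suc (j - 1) < m" using True i by simp
      then have "g < nn xs" using coset_gens_props(1)[of "j - 1"] that G.inN by blast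
      then have "app (inv_map xs t) g \<in> carrier G" using G.app_inv_map(1)[OF refl im t] G.carN by simp
      then show ?thesis using ysM[OF that(1)] by (intro G.Aut_lt[OF refl im t]) (simp add: G.carN[symmetric])
    qed
    then show ?thesis using True by (auto simp: label_def)
  next
    case False
    have "Q0 ! (j - Suc i) \<in> set Q0" using j False by (intro nth_mem) auto
    then show ?thesis using False Q0_diag[of "Q0 ! (j - Suc i)"] G.Aut_lt[OF refl im t] by (auto simp: label_def)
  qed
  let ?f = "\<lambda>q. (dd (L ! q), label (L ! q) (dd (L ! q)))"
  let ?U = "SIGMA j:{..<rr}. {l. set l \<subseteq> {..<nn xs} \<and> length l = len j}"
  have sep: "?f p \<noteq> ?f q" if "p < q" "q < length L" for p q
    using label_sep[of "L ! p" "L ! q" "dd (L ! q)"] that AutL D by (auto simp: DT_def)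
  have inj: "inj_on ?f {..<length L}"
  proof (rule inj_onI)
    fix p q assume "p \<in> {..<length L}" "q \<in> {..<length L}" "?f p = ?f q"
    then show "p = q" using sep[of p q] sep[of q p] by (metis lessThan_iff nat_neq_iff)
  qed
  have "?f ` {..<length L} \<subseteq> ?U"
  proof
    fix v assume "v \<in> ?f ` {..<length L}"
    then obtain q where q: "q < length L" "v = ?f q" by blast
    have "dd (L ! q) < rr" using D q(1) by (simp add: DT_def)
    then show "v \<in> ?U" using lset[OF AutL[OF q(1)]] llen q(2) by blast
  qed
  moreover have fin: "finite {l. set l \<subseteq> {..<nn xs} \<and> length l = k}" for k
    using finite_lists_length_eq[of "{..<nn xs}" k] by simp
  ultimately have "card (?f ` {..<length L}) \<le> card ?U" by (intro card_mono) auto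
  then have "length L \<le> card ?U" using card_image[OF inj] by simp
  also have "card ?U = (\<Sum>j<rr. nn xs ^ len j)"
    using fin by (simp add: card_lists_length_eq)
  also have "\<dots> \<le> (\<Sum>j<rr. nn xs ^ (K * K + 1))"
  proof (rule sum_mono)
    fix j assume "j \<in> {..<rr}"
    have "len j \<le> K * K + 1"
    proof (cases "j \<le> i")
      case True
      then have "Suc (j - 1) < m" using i by simp
      then have "length ys * length (coset_gens xs (j - 1)) \<le> K * K" using K by (intro mult_mono) auto
      then show ?thesis using True by (simp add: len_def)
    qed (simp add: len_def)
    then show "nn xs ^ len j \<le> nn xs ^ (K * K + 1)" using n by (rule power_increasing)
  qed
  also have "\<dots> = rr * nn xs ^ (K * K + 1)" by simp
  finally show ?thesis .
qed

abbreviation "fc \<equiv> depth_group.fac (AG xs G S i) dd"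

text \<open>The strict bound \<open>F\<close> keeps the cap inactive. If the residue is the
  identity, then \<open>\<phi>\<close> already had a normal form; otherwise the inverse of the
  residue represents a new coset, because sifting got stuck.\<close>

lemma sift_insert_DT:
  assumes D: "DT L" and p: "\<phi> \<in> Aut xs G S i" and F: "\<And>L. DT L \<Longrightarrow> length L < F"
  shows "\<exists>E. sift_insert xs i Y0 Q0 F L \<phi> = L @ E \<and> DT (L @ E) \<and> fc (set (L @ E)) \<phi>"
proof -
  interpret A: depth_group "AG xs G S i" dd rr by (rule depth_AG)
  note Ainv = G.AG_inv[OF refl im] and Ai = G.Aut_inv_map[OF refl im] and Ac = G.Aut_comp_map[OF refl im]
  have L: "set L \<subseteq> Aut xs G S i" using D by (simp add: DT_def)
  have ii: "inv_map xs (inv_map xs a) = a" if "a \<in> Aut xs G S i" for a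
    using A.inv_inv[of a] Ainv[OF that] Ainv[OF Ai[OF that]] that by simp
  let ?e0 = "inv_map xs \<phi>"
  define e where "e = sift xs 1 i Y0 Q0 L ?e0"
  have e0: "?e0 \<in> Aut xs G S i" using Ai[OF p] .
  \<comment> \<open>The sifting steps are undone backwards: a normal form of the inverse of the
    current map gives one of the inverse of the start. All larger tables \<open>T'\<close> are
    allowed since the residue is inserted only later.\<close>
  define I where "I = (\<lambda>a. a \<in> Aut xs G S i \<and> (\<forall>T'. set L \<subseteq> T' \<longrightarrow> fc T' (inv_map xs a) \<longrightarrow> fc T' (inv_map xs ?e0)))"
  have step: "I (sift_step xs 1 i Y0 Q0 a t)" if a: "I a" and t: "t \<in> set L" for a t
  proof (cases "dd a < dd (comp_map xs a t)")
    case True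
    have aA: "a \<in> Aut xs G S i" "t \<in> Aut xs G S i" using a t L by (auto simp: I_def)
    let ?a1 = "comp_map xs a t"
    have a1A: "?a1 \<in> Aut xs G S i" using Ac[OF aA] .
    have "inv\<^bsub>AG xs G S i\<^esub> a \<otimes>\<^bsub>AG xs G S i\<^esub> (a \<otimes>\<^bsub>AG xs G S i\<^esub> t) = t"
      using A.m_assoc[of "inv\<^bsub>AG xs G S i\<^esub> a" a t] aA A.l_inv[of a] A.l_one[of t] A.inv_closed[of a] by simp
    then have e1: "comp_map xs (inv_map xs a) ?a1 = t" using Ainv[OF aA(1)] by simp
    have "dd (inv_map xs a) = dd a" using A.d_inv[of a] Ainv aA by simp
    \<comment> \<open>A step that raises the depth of \<open>a\<close> must use a \<open>t\<close>
      of the depth of \<open>a\<close>, which makes \<open>t\<close> a legal first factor.\<close>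
    then have dt: "dd t = dd a" using A.d_mult_less[of "inv_map xs a" ?a1] True aA(1) Ai a1A e1 by simp
    have d1: "dd (inv_map xs ?a1) = dd ?a1" using A.d_inv[of ?a1] Ainv[OF a1A] a1A by simp
    have "t \<otimes>\<^bsub>AG xs G S i\<^esub> inv\<^bsub>AG xs G S i\<^esub> (a \<otimes>\<^bsub>AG xs G S i\<^esub> t) = inv\<^bsub>AG xs G S i\<^esub> a"
      using aA A.inv_mult_group[of a t] A.m_assoc[of t "inv\<^bsub>AG xs G S i\<^esub> t" "inv\<^bsub>AG xs G S i\<^esub> a"]
        A.r_inv[of t] A.l_one[of "inv\<^bsub>AG xs G S i\<^esub> a"] A.inv_closed[of a] A.inv_closed[of t] by simp
    then have e2: "comp_map xs t (inv_map xs ?a1) = inv_map xs a" using Ainv[OF aA(1)] Ainv[OF a1A] by simp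
    have "fc T' (inv_map xs a)" if "set L \<subseteq> T'" "fc T' (inv_map xs ?a1)" for T'
    proof -
      have "t \<in> T'" using that t by auto
      from A.fac.mult[OF this that(2)] True d1 dt e2 show ?thesis by simp
    qed
    then have "I ?a1" using a a1A unfolding I_def by blast
    then show ?thesis using True by (simp add: sift_step_def)
  qed (use a in \<open>simp add: sift_step_def\<close>)
  have Ie: "I e"
    unfolding e_def sift_def
  proof (rule foldl_inv)
    show "I ?e0" using e0 by (simp add: I_def)
    fix a k assume "I a"
    then show "I (foldl (sift_step xs 1 i Y0 Q0) a L)" using step by (intro foldl_inv[where I = I]) auto
  qed
  have eA: "e \<in> Aut xs G S i" using Ie by (simp add: I_def)
  have s1: "sift_step xs 1 i Y0 Q0 = (\<lambda>a t. if dd a < dd (comp_map xs a t) then comp_map xs a t else a)"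
    by (intro ext) (simp add: sift_step_def)
  have stuck: "rr \<le> dd e \<or> (\<forall>t\<in>set L. \<not> dd e < dd (comp_map xs e t))"
    unfolding e_def sift_def s1 by (rule sift_stuck)
  have insert_eq: "sift_insert xs i Y0 Q0 F L \<phi> = (if dd e < rr then L @ [inv_map xs e] else L)"
    using F[OF D] by (simp add: sift_insert_def Let_def e_def)
  show ?thesis
  proof (cases "dd e < rr")
    case True
    let ?L = "L @ [inv_map xs e]"
    have dinv: "dd (inv_map xs e) = dd e" using A.d_inv[of e] Ainv eA by simp
    have D': "DT ?L"
      unfolding DT_def
    proof (intro conjI allI impI)
      show "set ?L \<subseteq> Aut xs G S i" using L Ai[OF eA] by simp
      fix q assume q: "q < length ?L"
      show "dd (?L ! q) < rr" using q D True dinv by (auto simp: DT_def nth_append less_Suc_eq)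
      fix p assume p: "p < q"
      show "\<not> dd (?L ! q) < dd (comp_map xs (inv_map xs (?L ! q)) (?L ! p))"
      proof (cases "q < length L")
        case True then show ?thesis using D p by (auto simp: DT_def nth_append)
      next
        case False
        then have "q = length L" using q by simp
        then show ?thesis using stuck True p dinv ii[OF eA] by (auto simp: nth_append)
      qed
    qed
    have "fc (set ?L) (inv_map xs e)" by (rule A.fac_single) (use L Ai[OF eA] in auto)
    then have "fc (set ?L) (inv_map xs ?e0)" using Ie[unfolded I_def, THEN conjunct2, rule_format, of "set ?L"] by (simp add: subset_insertI)
    then have "fc (set ?L) \<phi>" using ii[OF p] by simp
    then show ?thesis unfolding insert_eq using D' True by (intro exI[of _ "[inv_map xs e]"]) simp
  next
    case False
    then have "dd e = rr" using depth_le[of xs 1 i Y0 Q0 e] by simp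
    then have "e = \<one>\<^bsub>AG xs G S i\<^esub>" using A.d_eq[of e] eA by simp
    then have "inv_map xs e = \<one>\<^bsub>AG xs G S i\<^esub>" using A.inv_one Ainv[OF eA] by simp
    then have "fc (set L) (inv_map xs e)" using A.fac.one by simp
    then have "fc (set L) \<phi>" using Ie[unfolded I_def, THEN conjunct2, rule_format, of "set L"] ii[OF p] by simp
    then show ?thesis unfolding insert_eq using False D by (intro exI[of _ "[]"]) simp
  qed
qed

lemma sift_insert_app: "\<exists>E. sift_insert xs i Y0 Q0 F L \<phi> = L @ E"
  by (auto simp: sift_insert_def Let_def)

lemma sift_insert2_app: "\<exists>E. sift_insert2 xs i Y0 Q0 F a L b = L @ E"
proof -
  obtain E where E: "sift_insert xs i Y0 Q0 F L (comp_map xs a b) = L @ E" using sift_insert_app by blast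
  obtain E' where "sift_insert xs i Y0 Q0 F (L @ E) (comp_map xs b a) = (L @ E) @ E'" using sift_insert_app by blast
  then show ?thesis unfolding sift_insert2_def E by simp
qed

lemma fc_mono: "fc A \<phi> \<Longrightarrow> A \<subseteq> B \<Longrightarrow> fc B \<phi>"
  using depth_group.fac_mono[OF depth_AG] by blast

lemma foldl_sift_insert:
  assumes F: "\<And>L. DT L \<Longrightarrow> length L < F"
  shows "DT L \<Longrightarrow> set gs \<subseteq> Aut xs G S i \<Longrightarrow> DT (foldl (sift_insert xs i Y0 Q0 F) L gs) \<and>
    (\<forall>g\<in>set gs. fc (set (foldl (sift_insert xs i Y0 Q0 F) L gs)) g)"
proof (induction gs arbitrary: L)
  case (Cons g gs)
  let ?L = "sift_insert xs i Y0 Q0 F L g"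
  have 1: "DT ?L" "fc (set ?L) g" using sift_insert_DT[OF Cons.prems(1) _ F, of g] Cons.prems(2) by auto
  obtain E where "foldl (sift_insert xs i Y0 Q0 F) ?L gs = ?L @ E"
    using prefix_foldl[of "sift_insert xs i Y0 Q0 F" ?L gs] sift_insert_app by blast
  then have s: "set ?L \<subseteq> set (foldl (sift_insert xs i Y0 Q0 F) ?L gs)" by auto
  show ?case using Cons.IH[OF 1(1)] Cons.prems(2) fc_mono[OF 1(2) s] by simp
qed simp

lemma foldl_sift_insert2:
  assumes F: "\<And>L. DT L \<Longrightarrow> length L < F" and a: "a \<in> Aut xs G S i"
  shows "DT L \<Longrightarrow> set gs \<subseteq> Aut xs G S i \<Longrightarrow> DT (foldl (sift_insert2 xs i Y0 Q0 F a) L gs) \<and>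
    (\<forall>g\<in>set gs. fc (set (foldl (sift_insert2 xs i Y0 Q0 F a) L gs)) (comp_map xs a g) \<and>
      fc (set (foldl (sift_insert2 xs i Y0 Q0 F a) L gs)) (comp_map xs g a))"
proof (induction gs arbitrary: L)
  case (Cons g gs)
  have g: "g \<in> Aut xs G S i" using Cons.prems by simp
  note Ac = G.Aut_comp_map[OF refl im]
  let ?L1 = "sift_insert xs i Y0 Q0 F L (comp_map xs a g)"
  let ?L = "sift_insert2 xs i Y0 Q0 F a L g"
  have 1: "DT ?L1" "fc (set ?L1) (comp_map xs a g)" using sift_insert_DT[OF Cons.prems(1) Ac[OF a g] F] by auto
  have 2: "DT ?L" "fc (set ?L) (comp_map xs g a)" using sift_insert_DT[OF 1(1) Ac[OF g a] F] unfolding sift_insert2_def by auto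
  have "set ?L1 \<subseteq> set ?L" using sift_insert_app[of F ?L1 "comp_map xs g a"] unfolding sift_insert2_def by auto
  then have 3: "fc (set ?L) (comp_map xs a g)" using fc_mono[OF 1(2)] by simp
  obtain E where "foldl (sift_insert2 xs i Y0 Q0 F a) ?L gs = ?L @ E"
    using prefix_foldl[of "sift_insert2 xs i Y0 Q0 F a" ?L gs] sift_insert2_app by blast
  then have s: "set ?L \<subseteq> set (foldl (sift_insert2 xs i Y0 Q0 F a) ?L gs)" by auto
  show ?case using Cons.IH[OF 2(1)] Cons.prems(2) fc_mono[OF 2(2) s] fc_mono[OF 3 s] by simp
qed simp

text \<open>Once the products of all pairs have normal forms, \<open>fac_fac\<close> closes normal
  forms under multiplication, and the generators in \<open>gs\<close> had theirs from the initial
  insertions.\<close>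

lemma saturate_fac:
  assumes F: "\<And>L. DT L \<Longrightarrow> length L < F" and gs: "set gs \<subseteq> Aut xs G S i" "Aut xs G S i \<subseteq> monoid_gen xs (set gs)"
  defines "L \<equiv> saturate xs i Y0 Q0 F gs"
  shows "set L \<subseteq> Aut xs G S i" "\<kappa> \<in> Aut xs G S i \<Longrightarrow> fc (set L) \<kappa>"
proof -
  interpret A: depth_group "AG xs G S i" dd rr by (rule depth_AG)
  let ?J = "\<lambda>L. DT L \<and> (\<forall>g\<in>set gs. fc (set L) g)"
  \<comment> \<open>Position \<open>k\<close> takes care of its products with entries up to
    \<open>k\<close> in both orders; entries added later take care of their own products with
    \<open>k\<close>.\<close>
  let ?Cl = "\<lambda>L k. \<forall>k'\<le>k. fc (set L) (comp_map xs (L ! k) (L ! k')) \<and> fc (set L) (comp_map xs (L ! k') (L ! k))"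
  define g where "g = (\<lambda>V k. foldl (sift_insert2 xs i Y0 Q0 F (V ! k)) V V)"
  have ap: "\<exists>E. g V k = V @ E" for V k unfolding g_def by (rule prefix_foldl) (rule sift_insert2_app)
  have mono: "?Cl (V @ E) k" if V: "k < length V" "?Cl V k" for V E k
  proof (intro allI impI)
    fix k' assume k': "k' \<le> k"
    have s: "set V \<subseteq> set (V @ E)" by simp
    have e: "(V @ E) ! k' = V ! k'" "(V @ E) ! k = V ! k" using V(1) k' by (auto simp: nth_append)
    note Vk = V(2)[rule_format, OF k']
    from fc_mono[OF conjunct1[OF Vk] s] fc_mono[OF conjunct2[OF Vk] s]
    show "fc (set (V @ E)) (comp_map xs ((V @ E) ! k) ((V @ E) ! k')) \<and> fc (set (V @ E)) (comp_map xs ((V @ E) ! k') ((V @ E) ! k))"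
      unfolding e by (rule conjI)
  qed
  have step: "?Cl (g V k) k \<and> ?J (g V k)" if J: "?J V" and k: "k < length V" for V k
  proof -
    have VA: "set V \<subseteq> Aut xs G S i" and DV: "DT V" using J by (simp_all add: DT_def)
    have ka: "V ! k \<in> Aut xs G S i" using VA k nth_mem by blast
    obtain E where E: "g V k = V @ E" using ap by blast
    have Vs: "set V \<subseteq> set (g V k)" unfolding E by simp
    have nth: "g V k ! j = V ! j" if "j < length V" for j unfolding E using that by (simp add: nth_append)
    from foldl_sift_insert2[OF F ka DV VA] have V: "DT (g V k)"
      "\<forall>h\<in>set V. fc (set (g V k)) (comp_map xs (V ! k) h) \<and> fc (set (g V k)) (comp_map xs h (V ! k))"
      unfolding g_def by simp_all
    have 1: "\<forall>h\<in>set gs. fc (set (g V k)) h"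
    proof
      fix h assume "h \<in> set gs"
      then have "fc (set V) h" using J by simp
      then show "fc (set (g V k)) h" using Vs by (rule fc_mono)
    qed
    have 2: "?Cl (g V k) k"
    proof (intro allI impI)
      fix k' assume "k' \<le> k"
      then have k': "k' < length V" using k by simp
      show "fc (set (g V k)) (comp_map xs (g V k ! k) (g V k ! k')) \<and> fc (set (g V k)) (comp_map xs (g V k ! k') (g V k ! k))"
        unfolding nth[OF k] nth[OF k'] using V(2) nth_mem[OF k'] by (rule bspec)
    qed
    show ?thesis by (rule conjI[OF 2 conjI[OF V(1) 1]])
  qed
  have D0: "DT []" by (simp add: DT_def)
  have J0: "?J (foldl (sift_insert xs i Y0 Q0 F) [] gs)" by (rule foldl_sift_insert[OF F D0 gs(1)])
  have len: "length V \<le> F" if "?J V" for V using that F[of V] by simp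
  define J where "J = ?J"
  define Cl where "Cl = ?Cl"
  have Lg: "L = foldl (\<lambda>W k. if k < length W then g W k else W) (foldl (sift_insert xs i Y0 Q0 F) [] gs) [0..<F]"
    unfolding L_def saturate_def g_def by (rule refl)
  have "J L \<and> (\<forall>k<length L. Cl L k)"
    unfolding Lg
  proof (rule worklist)
    show "\<And>V k. \<exists>E. g V k = V @ E" by (rule ap)
    show "\<And>V E k. k < length V \<Longrightarrow> Cl V k \<Longrightarrow> Cl (V @ E) k" unfolding Cl_def by (rule mono)
    show "\<And>V k. J V \<Longrightarrow> k < length V \<Longrightarrow> Cl (g V k) k \<and> J (g V k)" unfolding Cl_def J_def by (rule step)
    show "J (foldl (sift_insert xs i Y0 Q0 F) [] gs)" unfolding J_def by (rule J0)
    show "\<And>V. J V \<Longrightarrow> length V \<le> F" unfolding J_def by (rule len)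
  qed
  note X = this
  have R: "?J L" using conjunct1[OF X] unfolding J_def .
  have cl: "?Cl L k" if "k < length L" for k using X[THEN conjunct2, rule_format, OF that] unfolding Cl_def .
  have L: "set L \<subseteq> Aut xs G S i" using conjunct1[OF R] unfolding DT_def by (rule conjunct1)
  have gg: "fc (set L) g" if "g \<in> set gs" for g using conjunct2[OF R] that by (rule bspec)
  show "set L \<subseteq> Aut xs G S i" by (rule L)
  have prod: "fc (set L) (a \<otimes>\<^bsub>AG xs G S i\<^esub> b)" if ab: "a \<in> set L" "b \<in> set L" for a b
  proof -
    obtain p where p: "p < length L \<and> L ! p = a" by (rule exE[OF iffD1[OF in_set_conv_nth ab(1)]])
    obtain q where q: "q < length L \<and> L ! q = b" by (rule exE[OF iffD1[OF in_set_conv_nth ab(2)]])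
    show ?thesis
    proof (cases "q \<le> p")
      case True
      from mp[OF spec[OF cl[OF conjunct1[OF p]], of q] True]
      show ?thesis unfolding conjunct2[OF p] conjunct2[OF q] AG_simps by (rule conjunct1)
    next
      case False
      then have "p \<le> q" by simp
      from mp[OF spec[OF cl[OF conjunct1[OF q]], of p] this]
      show ?thesis unfolding conjunct2[OF p] conjunct2[OF q] AG_simps by (rule conjunct2)
    qed
  qed
  have LC: "set L \<subseteq> carrier (AG xs G S i)" using L by simp
  assume "\<kappa> \<in> Aut xs G S i"
  then have "\<kappa> \<in> monoid_gen xs (set gs)" using gs by blast
  then show "fc (set L) \<kappa>"
  proof (induction rule: monoid_gen.induct)
    case one then show ?case using A.fac.one[of "set L"] by simp
  next
    case (mul a \<phi>)
    from A.fac_fac[OF LC prod gg[OF mul(1)] mul.IH] show ?case unfolding AG_simps .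
  qed
qed

end

section \<open>Implementation in the functional language\<close>

declare One_nat_def [simp]

lemma length_zip_gens [simp]: "length (zip_gens ys hs) = length ys"
  by (simp add: zip_gens_def)

lemma len_extend [simp]: "length (extend xs z i W \<phi>) = nn xs"
  by (simp add: extend_def)

section \<open>Encoding of data and evaluation of loops\<close>

fun eL :: "('a \<Rightarrow> val) \<Rightarrow> 'a list \<Rightarrow> val" where
  "eL f [] = NV 0" | "eL f (x # l) = PV (f x) (eL f l)"

abbreviation "eV \<equiv> eL NV"

definition eP :: "nat \<times> nat \<Rightarrow> val" where "eP p = PV (NV (fst p)) (NV (snd p))"

definition eB :: "bool \<Rightarrow> val" where "eB b = NV (if b then 1 else 0)"

lemma vlist_eL [simp]: "vlist (eL f l) = map f l"
  by (induction l) auto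

lemma nv_eL [simp]: "nv (eL f l) = (if l = [] then 0 else 1)"
  by (cases l) auto

lemma nv_eB [simp]: "0 < nv (eB b) \<longleftrightarrow> b"
  by (simp add: eB_def)

lemma eP_sel [simp]: "fstv (eP p) = NV (fst p)" "sndv (eP p) = NV (snd p)"
  by (simp_all add: eP_def)

definition ev :: "nat \<Rightarrow> nat list \<Rightarrow> exp \<Rightarrow> val list \<Rightarrow> val \<Rightarrow> bool" where
  "ev B xs e env v \<longleftrightarrow> eval e xs env = v \<and> bounded_loops e B xs env"

text \<open>Tests are read as positive or zero, since many of them are truncated differences and not
  0 or 1.\<close>

definition tev :: "nat \<Rightarrow> nat list \<Rightarrow> exp \<Rightarrow> val list \<Rightarrow> bool \<Rightarrow> bool" where
  "tev B xs e env b \<longleftrightarrow> (0 < nv (eval e xs env)) = b \<and> bounded_loops e B xs env"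

lemma evD [dest]: "ev B xs e env v \<Longrightarrow> eval e xs env = v" "ev B xs e env v \<Longrightarrow> bounded_loops e B xs env"
  by (auto simp: ev_def)

text \<open>The invariant \<open>I\<close> lives on the mathematical accumulator; it supplies the
  length bounds without which the loops in the body could not be bounded.\<close>

lemma foldl_enc:
  assumes "\<And>a x. x \<in> set l \<Longrightarrow> I a \<Longrightarrow> Q (enc a) (ex x) \<and> F (enc a) (ex x) = enc (f a x) \<and> I (f a x)" "I a0"
  shows "foldl F (enc a0) (map ex l) = enc (foldl f a0 l) \<and> fold_all Q F (enc a0) (map ex l)"
  using assms by (induction l arbitrary: a0) auto

lemma ev_fold:
  assumes "ev B xs l env (eL ex vs)" "length vs \<le> B" "ev B xs i env (enc a0)" "I a0"
    "\<And>a x. x \<in> set vs \<Longrightarrow> I a \<Longrightarrow> ev B xs b (env @ [enc a, ex x]) (enc (f a x)) \<and> I (f a x)"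
  shows "ev B xs (FoldE l i b) env (enc (foldl f a0 vs))"
proof -
  note * = foldl_enc[of vs I "\<lambda>acc x. bounded_loops b B xs (env @ [acc, x])" enc ex "\<lambda>acc x. eval b xs (env @ [acc, x])" f a0]
  have "foldl (\<lambda>acc x. eval b xs (env @ [acc, x])) (enc a0) (map ex vs) = enc (foldl f a0 vs) \<and>
     fold_all (\<lambda>acc x. bounded_loops b B xs (env @ [acc, x])) (\<lambda>acc x. eval b xs (env @ [acc, x])) (enc a0) (map ex vs)"
    by (rule *) (use assms(4,5) in \<open>auto simp: ev_def\<close>)
  then show ?thesis using assms(1-3) by (auto simp: ev_def)
qed

text \<open>The invariant may mention the index, which is needed for lists that grow with the
  rounds.\<close>

lemma ev_for_idx:
  assumes "ev B xs l env (NV m)" "m \<le> B" "ev B xs i env (enc a0)" "I 0 a0"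
    "\<And>a x. x < m \<Longrightarrow> I x a \<Longrightarrow> ev B xs b (env @ [enc a, NV x]) (enc (f a x)) \<and> I (Suc x) (f a x)"
  shows "ev B xs (ForE l i b) env (enc (foldl f a0 [0..<m]))"
proof -
  have fa: "fold_all Q F a (l1 @ [x]) \<longleftrightarrow> fold_all Q F a l1 \<and> Q (foldl F a l1) x"
    for Q :: "val \<Rightarrow> nat \<Rightarrow> bool" and F a l1 x
    by (induction l1 arbitrary: a) auto
  have "foldl (\<lambda>acc x. eval b xs (env @ [acc, NV x])) (enc a0) [0..<k] = enc (foldl f a0 [0..<k]) \<and>
     fold_all (\<lambda>acc x. bounded_loops b B xs (env @ [acc, NV x])) (\<lambda>acc x. eval b xs (env @ [acc, NV x])) (enc a0) [0..<k] \<and>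
     I k (foldl f a0 [0..<k])" if "k \<le> m" for k
    using that
  proof (induction k)
    case (Suc k)
    then show ?case using assms(5)[of k "foldl f a0 [0..<k]"] by (auto simp: fa ev_def)
  qed (use assms(4) in auto)
  from this[of m] show ?thesis using assms(1-3) by (auto simp: ev_def)
qed

lemma ev_for:
  assumes "ev B xs l env (NV m)" "m \<le> B" "ev B xs i env (enc a0)" "I a0"
    "\<And>a x. x < m \<Longrightarrow> I a \<Longrightarrow> ev B xs b (env @ [enc a, NV x]) (enc (f a x)) \<and> I (f a x)"
  shows "ev B xs (ForE l i b) env (enc (foldl f a0 [0..<m]))"
  by (rule ev_for_idx[where I = "\<lambda>_. I"]) (use assms in auto)

lemma ev_if: "tev B xs c env b \<Longrightarrow> (b \<Longrightarrow> ev B xs e env v) \<Longrightarrow> (\<not> b \<Longrightarrow> ev B xs e' env v') \<Longrightarrow>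
   ev B xs (IfE c e e') env (if b then v else v')"
  by (auto simp: ev_def tev_def)

lemma tev_if: "tev B xs c env b \<Longrightarrow> (b \<Longrightarrow> tev B xs e env v) \<Longrightarrow> (\<not> b \<Longrightarrow> tev B xs e' env v') \<Longrightarrow>
   tev B xs (IfE c e e') env (if b then v else v')"
  by (auto simp: ev_def tev_def)

lemma ev_let: "ev B xs a env u \<Longrightarrow> ev B xs b (env @ [u]) v \<Longrightarrow> ev B xs (LetE a b) env v"
  by (auto simp: ev_def)

lemma ev_snd: "ev B xs e env (PV u v) \<Longrightarrow> ev B xs (SndE e) env v"
  by (auto simp: ev_def)

text \<open>A function receives its arguments as one encoded list in \<open>Var 0\<close>; these
  select its members.\<close>

abbreviation "a0 \<equiv> FstE (Var 0)"
abbreviation "a1 \<equiv> FstE (SndE (Var 0))"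
abbreviation "a2 \<equiv> FstE (SndE (SndE (Var 0)))"
abbreviation "a3 \<equiv> FstE (SndE (SndE (SndE (Var 0))))"
abbreviation "a4 \<equiv> FstE (SndE (SndE (SndE (SndE (Var 0)))))"
abbreviation "a5 \<equiv> FstE (SndE (SndE (SndE (SndE (SndE (Var 0))))))"
abbreviation "a6 \<equiv> FstE (SndE (SndE (SndE (SndE (SndE (SndE (Var 0)))))))"

abbreviation call :: "exp \<Rightarrow> exp list \<Rightarrow> exp" where
  "call f es \<equiv> CallE f (foldr PairE es (Num 0))"

abbreviation args :: "val list \<Rightarrow> val list" where
  "args vs \<equiv> [eL (\<lambda>v. v) vs]"

text \<open>\<open>d\<close> is the length of the surrounding environment, so \<open>Var d\<close>
  is the accumulator and \<open>Var (d + 1)\<close> the loop variable.\<close>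

definition AllFor :: "nat \<Rightarrow> exp \<Rightarrow> exp \<Rightarrow> exp" where
  "AllFor d n q = ForE n (Num 1) (IfE q (Var d) (Num 0))"

definition AllFold :: "nat \<Rightarrow> exp \<Rightarrow> exp \<Rightarrow> exp" where
  "AllFold d n q = FoldE n (Num 1) (IfE q (Var d) (Num 0))"

definition ExFor :: "nat \<Rightarrow> exp \<Rightarrow> exp \<Rightarrow> exp" where
  "ExFor d n q = ForE n (Num 0) (IfE q (Num 1) (Var d))"

definition ExFold :: "nat \<Rightarrow> exp \<Rightarrow> exp \<Rightarrow> exp" where
  "ExFold d n q = FoldE n (Num 0) (IfE q (Num 1) (Var d))"

definition revE :: exp where "revE = FoldE a0 (Num 0) (PairE (Var 2) (Var 1))"

definition MapFor :: "nat \<Rightarrow> exp \<Rightarrow> exp \<Rightarrow> exp" where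
  "MapFor d n b = call revE [ForE n (Num 0) (PairE b (Var d))]"

lemma foldl_all: "foldl (\<lambda>a x. if Q x then a else False) b l = (b \<and> (\<forall>x\<in>set l. Q x))"
  by (induction l arbitrary: b) auto

lemma foldl_ex: "foldl (\<lambda>a x. if Q x then True else a) b l = (b \<or> (\<exists>x\<in>set l. Q x))"
  by (induction l arbitrary: b) auto

lemma ev_AllFor:
  assumes "ev B xs n env (NV m)" "m \<le> B" "length env = d"
    "\<And>a x. x < m \<Longrightarrow> tev B xs q (env @ [a, NV x]) (Q x)"
  shows "ev B xs (AllFor d n q) env (eB (\<forall>x<m. Q x))"
proof -
  have "ev B xs (AllFor d n q) env (eB (foldl (\<lambda>a x. if Q x then a else False) True [0..<m]))"
    unfolding AllFor_def
    by (rule ev_for[where I = "\<lambda>_. True"])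
      (use assms in \<open>auto simp: ev_def tev_def eB_def nth_append\<close>)
  then show ?thesis unfolding foldl_all by (simp add: Ball_def)
qed

lemma ev_ExFor:
  assumes "ev B xs n env (NV m)" "m \<le> B" "length env = d"
    "\<And>a x. x < m \<Longrightarrow> tev B xs q (env @ [a, NV x]) (Q x)"
  shows "ev B xs (ExFor d n q) env (eB (\<exists>x<m. Q x))"
proof -
  have "ev B xs (ExFor d n q) env (eB (foldl (\<lambda>a x. if Q x then True else a) False [0..<m]))"
    unfolding ExFor_def
    by (rule ev_for[where I = "\<lambda>_. True"])
      (use assms in \<open>auto simp: ev_def tev_def eB_def nth_append\<close>)
  then show ?thesis unfolding foldl_ex by (simp add: Bex_def)
qed

lemma ev_AllFold:
  assumes "ev B xs n env (eL ex vs)" "length vs \<le> B" "length env = d"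
    "\<And>a x. x \<in> set vs \<Longrightarrow> tev B xs q (env @ [a, ex x]) (Q x)"
  shows "ev B xs (AllFold d n q) env (eB (\<forall>x\<in>set vs. Q x))"
proof -
  have "ev B xs (AllFold d n q) env (eB (foldl (\<lambda>a x. if Q x then a else False) True vs))"
    unfolding AllFold_def
    by (rule ev_fold[where I = "\<lambda>_. True"])
      (use assms in \<open>auto simp: ev_def tev_def eB_def nth_append\<close>)
  then show ?thesis unfolding foldl_all by auto
qed

lemma ev_ExFold:
  assumes "ev B xs n env (eL ex vs)" "length vs \<le> B" "length env = d"
    "\<And>a x. x \<in> set vs \<Longrightarrow> tev B xs q (env @ [a, ex x]) (Q x)"
  shows "ev B xs (ExFold d n q) env (eB (\<exists>x\<in>set vs. Q x))"
proof -
  have "ev B xs (ExFold d n q) env (eB (foldl (\<lambda>a x. if Q x then True else a) False vs))"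
    unfolding ExFold_def
    by (rule ev_fold[where I = "\<lambda>_. True"])
      (use assms in \<open>auto simp: ev_def tev_def eB_def nth_append\<close>)
  then show ?thesis unfolding foldl_ex by auto
qed

lemma tev_ev: "ev B xs e env (eB b) \<Longrightarrow> tev B xs e env b"
  by (auto simp: ev_def tev_def)

lemma ev_revE: "length l \<le> B \<Longrightarrow> ev B xs revE (args [eL f l]) (eL f (rev l))"
proof -
  assume "length l \<le> B"
  then have "ev B xs revE (args [eL f l]) (eL f (foldl (\<lambda>a x. x # a) [] l))"
    unfolding revE_def
    by (intro ev_fold[where I = "\<lambda>_. True" and ex = f]) (auto simp: ev_def)
  then show ?thesis by (simp add: foldl_Cons_rev[where g = "\<lambda>x. x", simplified])
qed

lemma ev_MapFor:
  assumes "ev B xs n env (NV m)" "m \<le> B" "length env = d"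
    "\<And>a x. x < m \<Longrightarrow> ev B xs b (env @ [a, NV x]) (ex (g x))"
  shows "ev B xs (MapFor d n b) env (eL ex (map g [0..<m]))"
proof -
  have "ev B xs (ForE n (Num 0) (PairE b (Var d))) env (eL ex (foldl (\<lambda>a x. g x # a) [] [0..<m]))"
    by (rule ev_for[where I = "\<lambda>_. True"])
      (use assms in \<open>auto simp: ev_def eB_def nth_append\<close>)
  then have "ev B xs (ForE n (Num 0) (PairE b (Var d))) env (eL ex (rev (map g [0..<m])))"
    by (simp add: foldl_Cons_rev)
  moreover have "ev B xs revE (args [eL ex (rev (map g [0..<m]))]) (eL ex (map g [0..<m]))"
    using ev_revE[of "rev (map g [0..<m])" B xs ex] assms(2) by simp
  ultimately show ?thesis unfolding MapFor_def by (auto simp: ev_def)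
qed

definition appE :: exp where "appE = FoldE (call revE [a0]) a1 (PairE (Var 2) (Var 1))"
definition snocE :: exp where "snocE = call appE [a0, PairE a1 (Num 0)]"
definition lenE :: exp where "lenE = FoldE a0 (Num 0) (AddE (Var 1) (Num 1))"
definition eqE :: exp where "eqE = IfE (AddE (SubE a0 a1) (SubE a1 a0)) (Num 0) (Num 1)"
text \<open>The machine has no multiplication. The loop runs over the first factor, so it is the one
  that must stay below the loop bound; hence \<open>nnE\<close> comes first in address
  computations.\<close>

definition timesE :: exp where "timesE = ForE a0 (Num 0) (AddE (Var 1) a1)"
definition powE :: exp where "powE = ForE a1 (Num 1) (call timesE [a0, Var 1])"
text \<open>Lists have no random access, so a counter runs down from \<open>x + 1\<close> and the
  element met at counter 1 is kept. The default \<open>NV 0\<close> agrees with that of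
  \<open>app\<close>.\<close>

definition nthE :: exp where
  "nthE = SndE (FoldE a0 (PairE (AddE a1 (Num 1)) (Num 0))
     (PairE (SubE (FstE (Var 1)) (Num 1))
       (IfE (SubE (FstE (Var 1)) (Num 1)) (SndE (Var 1)) (IfE (FstE (Var 1)) (Var 2) (SndE (Var 1))))))"

lemma ev_appE: "length l \<le> B \<Longrightarrow> ev B xs appE (args [eL f l, eL f m]) (eL f (l @ m))"
proof -
  assume l: "length l \<le> B"
  have "ev B xs appE (args [eL f l, eL f m]) (eL f (foldl (\<lambda>a x. x # a) m (rev l)))"
    unfolding appE_def
    by (rule ev_fold[where I = "\<lambda>_. True" and ex = f]) (use l ev_revE[OF l] in \<open>auto simp: ev_def\<close>)
  then show ?thesis by (simp add: foldl_Cons_rev[where g = "\<lambda>x. x", simplified])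
qed

lemma ev_snocE: "length l \<le> B \<Longrightarrow> ev B xs snocE (args [eL f l, f x]) (eL f (l @ [x]))"
  using ev_appE[of l B xs f "[x]"] unfolding snocE_def by (auto simp: ev_def)

lemma foldl_len: "foldl (\<lambda>a x. Suc a) b l = b + length l"
  by (induction l arbitrary: b) auto

lemma ev_lenE: "length l \<le> B \<Longrightarrow> ev B xs lenE (args [eL f l]) (NV (length l))"
proof -
  assume l: "length l \<le> B"
  have "ev B xs lenE (args [eL f l]) (NV (foldl (\<lambda>a x. Suc a) 0 l))"
    unfolding lenE_def
    by (rule ev_fold[where I = "\<lambda>_. True" and ex = f]) (use l in \<open>auto simp: ev_def\<close>)
  then show ?thesis by (simp add: foldl_len)
qed

lemma ev_eqE: "ev B xs eqE (args [NV a, NV b]) (eB (a = b))"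
  by (auto simp: ev_def eqE_def eB_def)

lemma foldl_times: "foldl (\<lambda>a x. a + c) b [0..<m] = b + m * (c::nat)"
  by (induction m) auto

lemma ev_timesE: "a \<le> B \<Longrightarrow> ev B xs timesE (args [NV a, NV b]) (NV (a * b))"
proof -
  assume l: "a \<le> B"
  have "ev B xs timesE (args [NV a, NV b]) (NV (foldl (\<lambda>a x. a + b) 0 [0..<a]))"
    unfolding timesE_def
    by (rule ev_for[where I = "\<lambda>_. True"]) (use l in \<open>auto simp: ev_def\<close>)
  then show ?thesis by (simp add: foldl_times)
qed

lemma foldl_pow: "foldl (\<lambda>a x. c * a) (1::nat) [0..<m] = c ^ m"
  by (induction m) auto

lemma ev_powE: "a \<le> B \<Longrightarrow> b \<le> B \<Longrightarrow> ev B xs powE (args [NV a, NV b]) (NV (a ^ b))"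
proof -
  assume l: "a \<le> B" "b \<le> B"
  have "ev B xs powE (args [NV a, NV b]) (NV (foldl (\<lambda>acc x. a * acc) 1 [0..<b]))"
    unfolding powE_def
    by (rule ev_for[where I = "\<lambda>_. True"]) (use l ev_timesE[of a B xs] in \<open>auto simp: ev_def\<close>)
  then show ?thesis by (simp only: foldl_pow)
qed

lemma ev_nthE: "length l \<le> B \<Longrightarrow>
   ev B xs nthE (args [eL f l, NV x]) (if x < length l then f (l ! x) else NV 0)"
proof -
  assume l: "length l \<le> B"
  define g where "g = (\<lambda>(s :: nat \<times> val) y. (fst s - 1, if 1 < fst s then snd s else if fst s = 1 then y else snd s))"
  have g: "snd (foldl g (c, v) vs) = (if c = 0 \<or> length vs < c then v else vs ! (c - 1))" for c v vs
  proof (induction vs arbitrary: c v)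
    case (Cons a vs)
    then show ?case by (cases c; cases "c - 1") (auto simp: g_def nth_Cons')
  qed (auto simp: g_def)
  let ?enc = "\<lambda>s. PV (NV (fst s)) (snd s)"
  have "ev B xs (FoldE a0 (PairE (AddE a1 (Num 1)) (Num 0))
     (PairE (SubE (FstE (Var 1)) (Num 1))
       (IfE (SubE (FstE (Var 1)) (Num 1)) (SndE (Var 1)) (IfE (FstE (Var 1)) (Var 2) (SndE (Var 1))))))
     (args [eL f l, NV x]) (?enc (foldl g (x + 1, NV 0) (map f l)))"
    by (rule ev_fold[where I = "\<lambda>_. True" and ex = "\<lambda>v. v"])
      (use l in \<open>auto simp: ev_def g_def, (induction l; simp)+\<close>)
  then have "ev B xs nthE (args [eL f l, NV x]) (snd (foldl g (x + 1, NV 0) (map f l)))"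
    unfolding nthE_def by (auto simp: ev_def)
  then show ?thesis unfolding g by (cases "x < length l") auto
qed


section \<open>The algorithm as expressions\<close>

abbreviation "nnE \<equiv> RdE (Num 0)"

definition tmulE :: exp where "tmulE = RdE (AddE a0 (AddE (call timesE [nnE, a1]) a2))"
definition tmemE :: exp where "tmemE = RdE (AddE a0 (AddE (call timesE [nnE, nnE])
  (AddE (Num 1) (AddE (call timesE [nnE, a1]) a2))))"
definition tdivE :: exp where
  "tdivE = ForE nnE (Num 0) (IfE (call eqE [call tmulE [a0, Var 2, a2], a1]) (Var 2) (Var 1))"
definition one_ofE :: exp where
  "one_ofE = ForE nnE (Num 0) (IfE (call tmemE [a0, Num 0, Var 2]) (Var 2) (Var 1))"
definition coveredE :: exp where
  "coveredE = ExFold 1 a1 (call tmemE [Num 1, a0, call tdivE [Num 1, a2, FstE (Var 2)]])"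
definition coset_repE :: exp where
  "coset_repE = FoldE a1 (PairE (Num 0) (Num 0))
     (IfE (call tmemE [Num 1, a0, call tdivE [Num 1, a2, FstE (Var 2)]]) (Var 2) (Var 1))"
definition add_wordE :: exp where
  "add_wordE = LetE (call tmulE [Num 1, FstE a2, FstE a4])
     (IfE (AddE (call coveredE [a1, a3, Var 1]) (SubE (AddE (call lenE [a3]) (Num 1)) nnE)) a3
       (call snocE [a3, PairE (Var 1) (call tmulE [a0, SndE a2, SndE a4])]))"
definition coset_wordsE :: exp where
  "coset_wordsE = ForE nnE (PairE (PairE (call one_ofE [Num 1]) (call one_ofE [a0])) (Num 0))
     (IfE (SubE (call lenE [Var 1]) (Var 2))
       (LetE (call nthE [Var 1, Var 2]) (FoldE a2 (Var 1) (call add_wordE [a0, a1, Var 3, Var 4, Var 5])))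
       (Var 1))"
definition zip_gensE :: exp where
  "zip_gensE = MapFor 1 (call lenE [a0]) (PairE (call nthE [a0, Var 2]) (call nthE [a1, Var 2]))"
definition coset_gensE :: exp where
  "coset_gensE = ForE nnE (Num 0) (IfE (call tmemE [Num 1, AddE a0 (Num 1), Var 2])
     (IfE (call coveredE [a0, call coset_wordsE [Num 1, a0, call zip_gensE [Var 1, Var 1]], Var 2]) (Var 1)
       (call snocE [Var 1, Var 2])) (Var 1))"
definition relatorE :: exp where
  "relatorE = LetE (call tmulE [Num 1, FstE a3, FstE a4]) (LetE (call coset_repE [a1, a2, Var 1])
     (PairE (call tdivE [Num 1, Var 1, FstE (Var 2)])
       (call tdivE [a0, call tmulE [a0, SndE a3, SndE a4], SndE (Var 2)])))"
definition relatorsE :: exp where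
  "relatorsE = FoldE a3 (Num 0) (FoldE a2 (Var 1) (PairE (call relatorE [a0, a1, a3, Var 2, Var 4]) (Var 3)))"

definition commutesE :: exp where
  "commutesE = AllFor 1 nnE (IfE (call tmemE [Num 1, a3, Var 2])
     (AllFold 3 a1 (call eqE [call tmulE [a0, call nthE [a2,
         call tdivE [Num 1, call tmulE [Num 1, FstE (Var 4), Var 2], FstE (Var 4)]], SndE (Var 4)],
       call tmulE [a0, SndE (Var 4), call nthE [a2, Var 2]]])) (Num 1))"
definition count_leadE :: exp where
  "count_leadE = IfE (FstE a0) (IfE a1 (PairE (Num 1) (AddE (SndE a0) (Num 1))) (PairE (Num 0) (SndE a0)))
     (PairE (Num 0) (SndE a0))"
definition depthE :: exp where
  "depthE = SndE (FoldE a3 (ForE (AddE a1 (Num 1)) (PairE (Num 1) (Num 0))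
       (call count_leadE [Var 1, call commutesE [a0, a2, a4, Var 2]]))
     (call count_leadE [Var 1, call eqE [call nthE [a4, FstE (Var 2)], SndE (Var 2)]]))"
definition comp_mapE :: exp where
  "comp_mapE = MapFor 1 nnE (call nthE [a0, call nthE [a1, Var 2]])"
definition inv_mapE :: exp where
  "inv_mapE = MapFor 1 nnE
     (ForE nnE (Num 0) (IfE (call eqE [call nthE [a0, Var 4], Var 2]) (Var 4) (Var 3)))"
definition sift_stepE :: exp where
  "sift_stepE = LetE (call comp_mapE [a4, a5])
     (IfE (SubE (call depthE [a0, a1, a2, a3, Var 1]) (call depthE [a0, a1, a2, a3, a4])) (Var 1) a4)"
definition siftE :: exp where
  "siftE = ForE (AddE (AddE a1 (Num 1)) (call lenE [a3])) a5
     (FoldE a4 (Var 1) (call sift_stepE [a0, a1, a2, a3, Var 3, Var 4]))"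
definition sift_insertE :: exp where
  "sift_insertE = LetE (call siftE [Num 1, a0, a1, a2, a4, call inv_mapE [a5]])
     (IfE (SubE (AddE (AddE a0 (Num 1)) (call lenE [a2])) (call depthE [Num 1, a0, a1, a2, Var 1]))
       (IfE (SubE a3 (call lenE [a4])) (call snocE [a4, call inv_mapE [Var 1]]) a4) a4)"
definition sift_insert2E :: exp where
  "sift_insert2E = call sift_insertE [a0, a1, a2, a3, call sift_insertE [a0, a1, a2, a3, a5, call comp_mapE [a4, a6]],
     call comp_mapE [a6, a4]]"
definition saturateE :: exp where
  "saturateE = ForE a3 (FoldE a4 (Num 0) (call sift_insertE [a0, a1, a2, a3, Var 1, Var 2]))
     (IfE (SubE (call lenE [Var 1]) (Var 2))
       (LetE (call nthE [Var 1, Var 2])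
         (FoldE (Var 1) (Var 1) (call sift_insert2E [a0, a1, a2, a3, Var 3, Var 4, Var 5])))
       (Var 1))"
definition extendE :: exp where
  "extendE = MapFor 1 nnE (IfE (call tmemE [Num 1, AddE a1 (Num 1), Var 2])
     (LetE (call coset_repE [a1, a2, Var 2])
       (call tmulE [a0, call nthE [a3, call tdivE [Num 1, Var 2, FstE (Var 3)]], SndE (Var 3)])) (Var 2))"
definition iso_testE :: exp where
  "iso_testE = IfE
     (AllFor 1 nnE (IfE (call tmemE [Num 1, a1, Var 2])
       (IfE (SubE nnE (call nthE [a2, Var 2]))
         (IfE (AllFor 3 nnE (IfE (call tmemE [Num 1, a1, Var 4])
             (call eqE [call nthE [a2, call tmulE [Num 1, Var 2, Var 4]],
               call tmulE [a0, call nthE [a2, Var 2], call nthE [a2, Var 4]]]) (Num 1)))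
           (AllFor 3 (AddE a1 (Num 1)) (IfE (call tmemE [Num 1, Var 4, Var 2])
             (call tmemE [a0, Var 4, call nthE [a2, Var 2]])
             (IfE (call tmemE [a0, Var 4, call nthE [a2, Var 2]]) (Num 0) (Num 1)))) (Num 0)) (Num 0))
       (Num 1)))
     (AllFor 1 nnE (IfE (call tmemE [a0, a1, Var 2])
       (ExFor 3 nnE (IfE (call tmemE [Num 1, a1, Var 4]) (call eqE [call nthE [a2, Var 4], Var 2]) (Num 0)))
       (Num 1)))
     (Num 0)"
definition tuplesE :: exp where
  "tuplesE = ForE a0 (PairE (Num 0) (Num 0))
     (FoldE (Var 1) (Num 0) (ForE nnE (Var 3) (PairE (PairE (Var 6) (Var 4)) (Var 5))))"
definition candidateE :: exp where
  "candidateE = LetE (call zip_gensE [a4, a5]) (LetE (call coset_wordsE [a0, a1, Var 1])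
     (call extendE [a0, a1, Var 2, call siftE [a0, a1, Var 1, call relatorsE [a0, a1, Var 1, Var 2], a2, a3]]))"
definition keep_isoE :: exp where
  "keep_isoE = IfE (call iso_testE [a0, AddE a1 (Num 1), a3]) (PairE a3 a2) a2"
definition searchE :: exp where
  "searchE = FoldE (call tuplesE [call lenE [a4]]) a5
     (call keep_isoE [a0, a1, Var 1, call candidateE [a0, a1, a2, a3, a4, Var 2]])"
definition liftsE :: exp where
  "liftsE = FoldE a2 (Num 0) (call keep_isoE [Num 1, a0, Var 1, call extendE [Num 1, a0, a1, Var 2]])"
definition all_relatorsE :: exp where
  "all_relatorsE = call appE [call relatorsE [Num 1, a0, a1, a2], MapFor 1 nnE (PairE (Var 2) (Var 2))]"
definition climbE :: exp where
  "climbE = LetE (call coset_gensE [a3]) (LetE (call zip_gensE [Var 1, Var 1]) (LetE (call coset_wordsE [Num 1, a3, Var 2])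
     (LetE (call saturateE [a3, Var 2, call all_relatorsE [a3, Var 2, Var 3], a0, FstE a2])
       (PairE (call searchE [Num 1, a3, Var 4, MapFor 5 nnE (Var 6), Var 1, call liftsE [a3, Var 3, Var 4]])
         (call searchE [a1, a3, Var 4, FstE (SndE a2), Var 1, Num 0])))))"
definition LmaxE :: exp where
  "LmaxE = ForE a0 (Num 0) (LetE (call lenE [call coset_gensE [Var 2]])
     (IfE (SubE (Var 3) (Var 1)) (Var 3) (Var 1)))"
definition lenSE :: exp where "lenSE = RdE (AddE (Num 1) (call timesE [nnE, nnE]))"
definition offHE :: exp where
  "offHE = AddE (Num 1) (AddE (call timesE [nnE, nnE]) (AddE (Num 1) (call timesE [nnE, lenSE])))"
definition fuelE :: exp where
  "fuelE = call powE [nnE, AddE (call timesE [a0, a0]) (Num 6)]"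
definition mainE :: exp where
  "mainE = IfE (call eqE [lenSE, RdE (AddE offHE (call timesE [nnE, nnE]))])
     (IfE (SndE (LetE (call fuelE [call LmaxE [SubE lenSE (Num 1)]])
       (ForE (SubE lenSE (Num 1)) (PairE (Num 0) (PairE (MapFor 1 nnE (call one_ofE [offHE])) (Num 0)))
         (call climbE [Var 0, offHE, Var 1, Var 2]))))
       (Num 1) (Num 0)) (Num 0)"

section \<open>Lengths of lists and loop bounds\<close>

lemma length_coset_gens: "length (coset_gens xs i) \<le> nn xs"
proof -
  have "length (foldl (\<lambda>ys x. if Q ys x then ys @ [x] else ys) ys0 l) \<le> length ys0 + length l"
    for Q and ys0 l :: "nat list"
    by (induction l rule: rev_induct) auto
  from this[of _ "[]" "[0..<nn xs]"] show ?thesis unfolding coset_gens_def by simp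
qed

lemma length_relators: "length (relators xs z i Y W) = length W * length Y"
proof -
  have 1: "length (foldl (\<lambda>acc y. g y # acc) acc Y) = length acc + length Y" for g :: "nat \<times> nat \<Rightarrow> nat \<times> nat" and acc Y
    by (induction Y arbitrary: acc) auto
  have "length (foldl (\<lambda>acc w. foldl (\<lambda>acc y. relator xs z i W' w y # acc) acc Y) acc W) = length acc + length W * length Y" for acc W' W
    by (induction W arbitrary: acc) (auto simp: 1)
  then show ?thesis by (simp add: relators_def)
qed

lemma tuples_Suc: "tuples xs (Suc s) = foldl (\<lambda>acc t. foldl (\<lambda>acc a. (a # t) # acc) acc [0..<nn xs]) [] (tuples xs s)"
  by (simp add: tuples_def)

lemma tuples_eq: "foldl (\<lambda>acc t. foldl (\<lambda>acc a. (a # t) # acc) acc l) b ts = rev (concat (map (\<lambda>t. map (\<lambda>a. a # t) l) ts)) @ b"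
  by (induction ts arbitrary: b) (auto simp: foldl_Cons_rev)

lemma length_tuples: "length (tuples xs s) = nn xs ^ s"
proof (induction s)
  case (Suc s)
  have "sum_list (map (\<lambda>x. nn xs) l) = length l * nn xs" for l :: "nat list list"
    by (induction l) auto
  then show ?case using Suc by (simp add: tuples_Suc tuples_eq length_concat comp_def)
qed (simp add: tuples_def)

lemma set_tuples: "set (tuples xs s) = {t. length t = s \<and> set t \<subseteq> {..<nn xs}}"
proof (induction s)
  case (Suc s)
  have "set (tuples xs (Suc s)) = (\<Union>t\<in>set (tuples xs s). (\<lambda>a. a # t) ` {0..<nn xs})"
    unfolding tuples_Suc tuples_eq by simp
  then show ?case using Suc by (auto simp: length_Suc_conv image_iff)
qed (auto simp: tuples_def)

lemma set_foldl_keep: "set (foldl (\<lambda>acc h. keep_iso xs z i acc (g h)) acc l) =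
    set acc \<union> {g h |h. h \<in> set l \<and> iso_test xs z (Suc i) (g h)}"
  by (induction l arbitrary: acc) (auto simp: keep_iso_def)

lemma Lmax_le: "Lmax xs m \<le> nn xs"
  unfolding Lmax_def by (rule foldl_inv) (auto simp: length_coset_gens)

lemma Lmax_ge: "i < m \<Longrightarrow> length (coset_gens xs i) \<le> Lmax xs m"
proof (induction m)
  case (Suc m)
  then show ?case by (cases "i = m") (auto simp: Lmax_def)
qed simp

context
  fixes xs :: "nat list" and B :: nat
  assumes nB: "nn xs \<le> B" and B1: "1 \<le> B"
begin

lemma ev_tmulE: "ev B xs tmulE (args [NV z, NV a, NV b]) (NV (tmul xs z a b))"
  using ev_timesE[OF nB, of xs] by (auto simp: ev_def tmulE_def tmul_def)

lemma ev_tmemE: "ev B xs tmemE (args [NV z, NV j, NV x]) (NV (tmemv xs z j x))"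
  using ev_timesE[OF nB, of xs] by (auto simp: ev_def tmemE_def tmemv_def)

lemmas base = ev_tmulE[unfolded ev_def, simplified] ev_tmemE[unfolded ev_def, simplified]
  ev_eqE[unfolded ev_def, simplified]

lemma ev_tdivE: "ev B xs tdivE (args [NV z, NV a, NV b]) (NV (tdiv xs z a b))"
  unfolding tdivE_def tdiv_def
  by (rule ev_for[where I = "\<lambda>_. True"]) (use nB in \<open>auto simp: ev_def base\<close>)

lemma ev_one_ofE: "ev B xs one_ofE (args [NV z]) (NV (one_of xs z))"
  unfolding one_ofE_def one_of_def
  by (rule ev_for[where I = "\<lambda>_. True"]) (use nB in \<open>auto simp: ev_def base\<close>)

lemmas base2 = base ev_tdivE[unfolded ev_def, simplified] ev_one_ofE[unfolded ev_def, simplified]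

lemma ev_coveredE: "length W \<le> B \<Longrightarrow> ev B xs coveredE (args [NV i, eL eP W, NV x]) (eB (covered xs i W x))"
  unfolding coveredE_def covered_def
  by (rule ev_ExFold) (auto simp: ev_def tev_def base2)

lemma ev_coset_repE: "length W \<le> B \<Longrightarrow> ev B xs coset_repE (args [NV i, eL eP W, NV x]) (eP (coset_rep xs i W x))"
  unfolding coset_repE_def coset_rep_def
  by (rule ev_fold[where I = "\<lambda>_. True" and ex = eP]) (auto simp: ev_def base2 eP_def)

lemma ev_add_wordE: "length W \<le> B \<Longrightarrow>
   ev B xs add_wordE (args [NV z, NV i, eP w, eL eP W, eP y]) (eL eP (add_word xs z i w W y))"
proof -
  assume W: "length W \<le> B"
  show ?thesis
    using ev_coveredE[OF W, of i "tmul xs 1 (fst w) (fst y)"] ev_lenE[OF W, of xs eP]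
      ev_snocE[OF W, of xs eP "(tmul xs 1 (fst w) (fst y), tmul xs z (snd w) (snd y))"]
    unfolding add_wordE_def add_word_def
    by (auto simp: ev_def base2 eP_def eB_def)
qed

text \<open>The alternative \<open>\<le> 1\<close> is there because the initial list has one entry
  even if \<open>nn xs\<close> is 0.\<close>

lemma length_add_word: "length W \<le> nn xs \<or> length W \<le> 1 \<Longrightarrow>
   length (add_word xs z i w W y) \<le> nn xs \<or> length (add_word xs z i w W y) \<le> 1"
  by (auto simp: add_word_def)

lemma ev_coset_wordsE: 
  assumes Y: "length Y \<le> B"
  shows "ev B xs coset_wordsE (args [NV z, NV i, eL eP Y]) (eL eP (coset_words xs z i Y))"
  unfolding coset_wordsE_def coset_words_def
proof (rule ev_for[where I = "\<lambda>W. length W \<le> nn xs \<or> length W \<le> 1"])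
  fix W :: "(nat \<times> nat) list" and k assume W: "length W \<le> nn xs \<or> length W \<le> 1"
  then have WB: "length W \<le> B" using nB B1 by auto
  let ?env = "args [NV z, NV i, eL eP Y] @ [eL eP W, NV k]"
  have f: "length (foldl (add_word xs z i w) W l) \<le> nn xs \<or> length (foldl (add_word xs z i w) W l) \<le> 1" for w l
    by (induction l rule: rev_induct) (use W length_add_word in auto)
  have "ev B xs (IfE (SubE (call lenE [Var 1]) (Var 2))
       (LetE (call nthE [Var 1, Var 2]) (FoldE a2 (Var 1) (call add_wordE [a0, a1, Var 3, Var 4, Var 5])))
       (Var 1)) ?env (if k < length W then eL eP (foldl (add_word xs z i (W ! k)) W Y) else eL eP W)"
  proof (rule ev_if)
    show "tev B xs (SubE (call lenE [Var 1]) (Var 2)) ?env (k < length W)"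
      using ev_lenE[OF WB, of xs eP] by (auto simp: ev_def tev_def)
    assume k: "k < length W"
    show "ev B xs (LetE (call nthE [Var 1, Var 2]) (FoldE a2 (Var 1) (call add_wordE [a0, a1, Var 3, Var 4, Var 5]))) ?env
      (eL eP (foldl (add_word xs z i (W ! k)) W Y))"
    proof (rule ev_let[where u = "eP (W ! k)"])
      show "ev B xs (call nthE [Var 1, Var 2]) ?env (eP (W ! k))"
        using ev_nthE[OF WB, of xs eP k] k by (auto simp: ev_def)
      show "ev B xs (FoldE a2 (Var 1) (call add_wordE [a0, a1, Var 3, Var 4, Var 5])) (?env @ [eP (W ! k)])
        (eL eP (foldl (add_word xs z i (W ! k)) W Y))"
      proof (rule ev_fold[where I = "\<lambda>W. length W \<le> nn xs \<or> length W \<le> 1" and ex = eP])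
        fix W' :: "(nat \<times> nat) list" and y assume W': "length W' \<le> nn xs \<or> length W' \<le> 1"
        then have "length W' \<le> B" using nB B1 by auto
        from ev_add_wordE[OF this, of z i "W ! k" y] length_add_word[OF W']
        show "ev B xs (call add_wordE [a0, a1, Var 3, Var 4, Var 5])
             ((?env @ [eP (W ! k)]) @ [eL eP W', eP y]) (eL eP (add_word xs z i (W ! k) W' y)) \<and>
            (length (add_word xs z i (W ! k) W' y) \<le> nn xs \<or> length (add_word xs z i (W ! k) W' y) \<le> 1)"
          by (auto simp: ev_def)
      qed (use W Y in \<open>auto simp: ev_def\<close>)
    qed
  qed (auto simp: ev_def)
  then show "ev B xs (IfE (SubE (call lenE [Var 1]) (Var 2))
       (LetE (call nthE [Var 1, Var 2]) (FoldE a2 (Var 1) (call add_wordE [a0, a1, Var 3, Var 4, Var 5])))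
       (Var 1)) ?env (eL eP (if k < length W then foldl (add_word xs z i (W ! k)) W Y else W)) \<and>
     (length (if k < length W then foldl (add_word xs z i (W ! k)) W Y else W) \<le> nn xs \<or>
      length (if k < length W then foldl (add_word xs z i (W ! k)) W Y else W) \<le> 1)"
    using f W by (auto split: if_splits)
qed (use nB in \<open>auto simp: ev_def base2 eP_def\<close>)

lemma length_coset_words: "length (coset_words xs z i Y) \<le> nn xs \<or> length (coset_words xs z i Y) \<le> 1"
proof -
  have f: "length (foldl (add_word xs z i w) W l) \<le> nn xs \<or> length (foldl (add_word xs z i w) W l) \<le> 1"
    if "length W \<le> nn xs \<or> length W \<le> 1" for w l W
    by (induction l rule: rev_induct) (use that length_add_word in auto)
  have "length (foldl (\<lambda>W k. if k < length W then foldl (add_word xs z i (W ! k)) W Y else W) [w] l) \<le> nn xs \<or>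
     length (foldl (\<lambda>W k. if k < length W then foldl (add_word xs z i (W ! k)) W Y else W) [w] l) \<le> 1" for w l
  proof (induction l rule: rev_induct)
    case (snoc x l)
    then show ?case using f[OF snoc] by auto
  qed auto
  then show ?thesis unfolding coset_words_def .
qed

lemma length_coset_words_B: "length (coset_words xs z i Y) \<le> B"
  using length_coset_words[of z i Y] nB B1 by auto

lemma ev_nthV: "length l \<le> B \<Longrightarrow> ev B xs nthE (args [eV l, NV x]) (NV (app l x))"
  using ev_nthE[of l B xs NV x] by (auto simp: app_def ev_def)

lemma ev_zip_gensE:
  assumes "length ys \<le> B" "length hs \<le> B"
  shows "ev B xs zip_gensE (args [eV ys, eV hs]) (eL eP (zip_gens ys hs))"
  unfolding zip_gensE_def zip_gens_def
  by (rule ev_MapFor)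
    (use assms ev_lenE[OF assms(1), of xs NV] ev_nthV[OF assms(1)] ev_nthV[OF assms(2)] in
      \<open>auto simp: ev_def eP_def\<close>)

lemma ev_coset_gensE: "ev B xs coset_gensE (args [NV i]) (eV (coset_gens xs i))"
  unfolding coset_gensE_def coset_gens_def
proof (rule ev_for_idx[where I = "\<lambda>k ys. length ys \<le> k"])
  fix ys :: "nat list" and x assume x: "x < nn xs" and "length ys \<le> x"
  then have ys: "length ys \<le> B" using nB by auto
  have 1: "ev B xs zip_gensE (args [eV ys, eV ys]) (eL eP (zip_gens ys ys))" using ys ys by (rule ev_zip_gensE)
  have 2: "ev B xs coset_wordsE (args [NV 1, NV i, eL eP (zip_gens ys ys)]) (eL eP (coset_words xs 1 i (zip_gens ys ys)))"
    by (rule ev_coset_wordsE) (simp add: ys)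
  note 3 = ev_coveredE[OF length_coset_words_B, of i 1 i "zip_gens ys ys" x]
  show "ev B xs (IfE (call tmemE [Num 1, AddE a0 (Num 1), Var 2])
     (IfE (call coveredE [a0, call coset_wordsE [Num 1, a0, call zip_gensE [Var 1, Var 1]], Var 2]) (Var 1)
       (call snocE [Var 1, Var 2])) (Var 1)) (args [NV i] @ [eV ys, NV x])
     (eV (if tmem xs 1 (Suc i) x \<and> \<not> covered xs i (coset_words xs 1 i (zip_gens ys ys)) x then ys @ [x] else ys)) \<and>
     length (if tmem xs 1 (Suc i) x \<and> \<not> covered xs i (coset_words xs 1 i (zip_gens ys ys)) x then ys @ [x] else ys) \<le> Suc x"
    using 1 2 3 ev_snocE[OF ys, of xs NV x] \<open>length ys \<le> x\<close> by (auto simp: ev_def base2 eB_def)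
qed (use nB in \<open>auto simp: ev_def\<close>)

lemma ev_relatorE: "length W \<le> B \<Longrightarrow>
   ev B xs relatorE (args [NV z, NV i, eL eP W, eP w, eP y]) (eP (relator xs z i W w y))"
  unfolding relatorE_def relator_def using ev_coset_repE[of W i "tmul xs 1 (fst w) (fst y)"]
  by (auto simp: ev_def base2 Let_def eP_def)

lemma ev_relatorsE:
  assumes "length W \<le> B" "length Y \<le> B"
  shows "ev B xs relatorsE (args [NV z, NV i, eL eP Y, eL eP W]) (eL eP (relators xs z i Y W))"
  unfolding relatorsE_def relators_def
proof (rule ev_fold[where I = "\<lambda>_. True" and ex = eP])
  fix acc w
  have "ev B xs (FoldE a2 (Var 1) (PairE (call relatorE [a0, a1, a3, Var 2, Var 4]) (Var 3)))
     (args [NV z, NV i, eL eP Y, eL eP W] @ [eL eP acc, eP w])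
     (eL eP (foldl (\<lambda>acc y. relator xs z i W w y # acc) acc Y))"
    by (rule ev_fold[where I = "\<lambda>_. True" and ex = eP])
      (use assms ev_relatorE[OF assms(1), of z i w] in \<open>auto simp: ev_def\<close>)
  then show "ev B xs (FoldE a2 (Var 1) (PairE (call relatorE [a0, a1, a3, Var 2, Var 4]) (Var 3)))
     (args [NV z, NV i, eL eP Y, eL eP W] @ [eL eP acc, eP w])
     (eL eP (foldl (\<lambda>acc y. relator xs z i W w y # acc) acc Y)) \<and> True" by simp
qed (use assms in \<open>auto simp: ev_def\<close>)

lemma ev_commutesE:
  assumes "length Y \<le> B" "length \<phi> \<le> B"
  shows "ev B xs commutesE (args [NV z, eL eP Y, eV \<phi>, NV j]) (eB (commutes xs z Y \<phi> j))"
  unfolding commutesE_def commutes_def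
proof (rule ev_AllFor)
  fix acc x assume "x < nn xs"
  let ?env = "args [NV z, eL eP Y, eV \<phi>, NV j] @ [acc, NV x]"
  let ?Q = "\<lambda>y. tmul xs z (app \<phi> (tdiv xs 1 (tmul xs 1 (fst y) x) (fst y))) (snd y) = tmul xs z (snd y) (app \<phi> x)"
  have "ev B xs (AllFold 3 a1 (call eqE [call tmulE [a0, call nthE [a2,
         call tdivE [Num 1, call tmulE [Num 1, FstE (Var 4), Var 2], FstE (Var 4)]], SndE (Var 4)],
       call tmulE [a0, SndE (Var 4), call nthE [a2, Var 2]]])) ?env (eB (\<forall>y\<in>set Y. ?Q y))"
    by (rule ev_AllFold) (use assms ev_nthV[OF assms(2)] in \<open>auto simp: ev_def tev_def base2\<close>)
  then show "tev B xs (IfE (call tmemE [Num 1, a3, Var 2])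
     (AllFold 3 a1 (call eqE [call tmulE [a0, call nthE [a2,
         call tdivE [Num 1, call tmulE [Num 1, FstE (Var 4), Var 2], FstE (Var 4)]], SndE (Var 4)],
       call tmulE [a0, SndE (Var 4), call nthE [a2, Var 2]]])) (Num 1)) ?env
     (tmem xs 1 j x \<longrightarrow> (\<forall>y\<in>set Y. ?Q y))"
    by (auto simp: ev_def tev_def base2)
qed (use nB in \<open>auto simp: ev_def\<close>)

abbreviation (input) eSt :: "bool \<times> nat \<Rightarrow> val" where
  "eSt s \<equiv> PV (eB (fst s)) (NV (snd s))"

lemma ev_count_leadE: "ev B xs count_leadE (args [eSt s, eB b]) (eSt (count_lead s b))"
  by (auto simp: ev_def count_leadE_def count_lead_def eB_def)

lemma ev_depthE:
  assumes "length Y \<le> B" "length \<phi> \<le> B" "length Q \<le> B" "Suc i \<le> B"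
  shows "ev B xs depthE (args [NV z, NV i, eL eP Y, eL eP Q, eV \<phi>]) (NV (depth xs z i Y Q \<phi>))"
proof -
  let ?env = "args [NV z, NV i, eL eP Y, eL eP Q, eV \<phi>]"
  have 1: "ev B xs (ForE (AddE a1 (Num 1)) (PairE (Num 1) (Num 0))
       (call count_leadE [Var 1, call commutesE [a0, a2, a4, Var 2]])) ?env
     (eSt (foldl (\<lambda>s j. count_lead s (commutes xs z Y \<phi> j)) (True, 0) [0..<Suc i]))"
    by (rule ev_for[where enc = "\<lambda>s. eSt s" and I = "\<lambda>_. True"])
      (use assms ev_commutesE[OF assms(1,2)] ev_count_leadE in \<open>auto simp: ev_def eB_def\<close>)
  have 2: "ev B xs (FoldE a3 (ForE (AddE a1 (Num 1)) (PairE (Num 1) (Num 0))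
       (call count_leadE [Var 1, call commutesE [a0, a2, a4, Var 2]]))
     (call count_leadE [Var 1, call eqE [call nthE [a4, FstE (Var 2)], SndE (Var 2)]])) ?env
     (eSt (foldl (\<lambda>s p. count_lead s (app \<phi> (fst p) = snd p))
     (foldl (\<lambda>s j. count_lead s (commutes xs z Y \<phi> j)) (True, 0) [0..<Suc i]) Q))"
    by (rule ev_fold[where enc = "\<lambda>s. eSt s" and I = "\<lambda>_. True" and ex = eP])
      (use 1 assms(3) ev_nthV[OF assms(2)] ev_count_leadE in \<open>auto simp: ev_def base2\<close>)
  then show ?thesis unfolding depthE_def depth_def by (auto simp: ev_def)
qed

lemma ev_comp_mapE:
  assumes "length \<phi> \<le> B" "length \<tau> \<le> B"
  shows "ev B xs comp_mapE (args [eV \<phi>, eV \<tau>]) (eV (comp_map xs \<phi> \<tau>))"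
  unfolding comp_mapE_def comp_map_def
  by (rule ev_MapFor) (use nB ev_nthV[OF assms(1)] ev_nthV[OF assms(2)] in \<open>auto simp: ev_def\<close>)

lemma ev_inv_mapE:
  assumes "length \<phi> \<le> B"
  shows "ev B xs inv_mapE (args [eV \<phi>]) (eV (inv_map xs \<phi>))"
  unfolding inv_mapE_def inv_map_def
proof (rule ev_MapFor)
  fix a z assume "z < nn xs"
  show "ev B xs (ForE nnE (Num 0) (IfE (call eqE [call nthE [a0, Var 4], Var 2]) (Var 4) (Var 3)))
     (args [eV \<phi>] @ [a, NV z]) (NV (foldl (\<lambda>a x. if app \<phi> x = z then x else a) 0 [0..<nn xs]))"
    by (rule ev_for[where I = "\<lambda>_. True"]) (use nB ev_nthV[OF assms] in \<open>auto simp: ev_def base2\<close>)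
qed (use nB in \<open>auto simp: ev_def\<close>)

lemma ev_sift_stepE:
  assumes "length Y \<le> B" "length Q \<le> B" "Suc i \<le> B" "length \<phi> \<le> B" "length \<tau> \<le> B"
  shows "ev B xs sift_stepE (args [NV z, NV i, eL eP Y, eL eP Q, eV \<phi>, eV \<tau>]) (eV (sift_step xs z i Y Q \<phi> \<tau>))"
proof -
  have l: "length (comp_map xs \<phi> \<tau>) \<le> B" using nB by simp
  show ?thesis
    using ev_comp_mapE[OF assms(4,5)] ev_depthE[OF assms(1,4,2,3)] ev_depthE[OF assms(1) l assms(2,3)]
    unfolding sift_stepE_def sift_step_def by (auto simp: ev_def)
qed

lemma length_sift_step: "length \<phi> \<le> B \<Longrightarrow> length (sift_step xs z i Y Q \<phi> \<tau>) \<le> B"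
  using nB by (simp add: sift_step_def)

lemma ev_siftE:
  assumes "length Y \<le> B" "Suc i + length Q \<le> B" "length \<phi> \<le> B" "length T \<le> B" "\<forall>\<tau>\<in>set T. length \<tau> \<le> B"
  shows "ev B xs siftE (args [NV z, NV i, eL eP Y, eL eP Q, eL eV T, eV \<phi>]) (eV (sift xs z i Y Q T \<phi>))"
    (is ?A) and "length (sift xs z i Y Q T \<phi>) \<le> B" (is ?C)
proof -
  have l: "length Q \<le> B" "Suc i \<le> B" using assms by auto
  have s: "length (foldl (sift_step xs z i Y Q) \<phi> T') \<le> B" if "length \<phi> \<le> B" for \<phi> T'
    using that by (induction T' arbitrary: \<phi>) (auto intro: length_sift_step)
  show ?A
    unfolding siftE_def sift_def
  proof (rule ev_for[where I = "\<lambda>\<phi>. length \<phi> \<le> B"])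
    fix \<phi> :: "nat list" and k assume \<phi>: "length \<phi> \<le> B"
    have "ev B xs (FoldE a4 (Var 1) (call sift_stepE [a0, a1, a2, a3, Var 3, Var 4]))
      (args [NV z, NV i, eL eP Y, eL eP Q, eL eV T, eV \<phi>0] @ [eV \<phi>, NV k])
      (eV (foldl (sift_step xs z i Y Q) \<phi> T))" for \<phi>0
      by (rule ev_fold[where I = "\<lambda>\<phi>. length \<phi> \<le> B" and ex = eV])
        (use assms l \<phi> ev_sift_stepE length_sift_step in \<open>auto simp: ev_def\<close>)
    with s[OF \<phi>] show "ev B xs (FoldE a4 (Var 1) (call sift_stepE [a0, a1, a2, a3, Var 3, Var 4]))
      (args [NV z, NV i, eL eP Y, eL eP Q, eL eV T, eV \<phi>0] @ [eV \<phi>, NV k])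
      (eV (foldl (sift_step xs z i Y Q) \<phi> T)) \<and> length (foldl (sift_step xs z i Y Q) \<phi> T) \<le> B" for \<phi>0
      by simp
  qed (use assms l ev_lenE[OF l(1), of xs eP] in \<open>auto simp: ev_def\<close>)
  have "length (foldl (\<lambda>\<phi> k. foldl (sift_step xs z i Y Q) \<phi> T) \<phi> ks) \<le> B" if "length \<phi> \<le> B" for \<phi> and ks :: "nat list"
    using that by (induction ks arbitrary: \<phi>) (auto intro: s)
  then show ?C unfolding sift_def using assms(3) by blast
qed

definition vT :: "nat list list \<Rightarrow> bool" where "vT T \<longleftrightarrow> length T \<le> B \<and> (\<forall>\<tau>\<in>set T. length \<tau> \<le> B)"

lemma sift_insert_vT: "vT T \<Longrightarrow> F \<le> B \<Longrightarrow> vT (sift_insert xs i Y Q F T \<phi>)"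
  using nB by (auto simp: vT_def sift_insert_def Let_def)

lemma ev_sift_insertE:
  assumes "length Y \<le> B" "Suc i + length Q \<le> B" "length \<phi> \<le> B" "vT T"
  shows "ev B xs sift_insertE (args [NV i, eL eP Y, eL eP Q, NV F, eL eV T, eV \<phi>]) (eL eV (sift_insert xs i Y Q F T \<phi>))"
proof -
  have l: "length Q \<le> B" "Suc i \<le> B" "length (inv_map xs \<phi>) \<le> B" using assms nB by auto
  have T: "length T \<le> B" "\<forall>\<tau>\<in>set T. length \<tau> \<le> B" using assms(4) by (auto simp: vT_def)
  note s = ev_siftE[OF assms(1,2) l(3) T, of 1]
  show ?thesis
    using ev_inv_mapE[OF assms(3)] s(1) ev_depthE[OF assms(1) s(2) l(1,2), of 1] ev_lenE[OF l(1), of xs eP]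
      ev_lenE[OF T(1), of xs eV] ev_inv_mapE[OF s(2)] ev_snocE[OF T(1), of xs eV]
    unfolding sift_insertE_def sift_insert_def Let_def by (auto simp: ev_def)
qed

lemma ev_sift_insert2E:
  assumes "length Y \<le> B" "Suc i + length Q \<le> B" "length a \<le> B" "length b \<le> B" "vT T" "F \<le> B"
  shows "ev B xs sift_insert2E (args [NV i, eL eP Y, eL eP Q, NV F, eV a, eL eV T, eV b]) (eL eV (sift_insert2 xs i Y Q F a T b))"
proof -
  have l: "length (comp_map xs a b) \<le> B" "length (comp_map xs b a) \<le> B" using nB by auto
  show ?thesis
    using ev_comp_mapE[OF assms(3,4)] ev_comp_mapE[OF assms(4,3)] ev_sift_insertE[OF assms(1,2) l(1) assms(5), of F]
      ev_sift_insertE[OF assms(1,2) l(2) sift_insert_vT[OF assms(5,6)]]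
    unfolding sift_insert2E_def sift_insert2_def by (auto simp: ev_def)
qed

lemma sift_insert2_vT: "vT T \<Longrightarrow> F \<le> B \<Longrightarrow> vT (sift_insert2 xs i Y Q F a T \<phi>)"
  by (auto simp: sift_insert2_def intro!: sift_insert_vT)

lemma saturate_vT: "F \<le> B \<Longrightarrow> vT (saturate xs i Y Q F gs)"
  unfolding saturate_def
  by (rule foldl_inv, rule foldl_inv) (auto simp: vT_def[of "[]"] intro!: sift_insert_vT foldl_inv[where I = vT] sift_insert2_vT)

lemma ev_saturateE:
  assumes "length Y \<le> B" "Suc i + length Q \<le> B" "F \<le> B" "vT gs"
  shows "ev B xs saturateE (args [NV i, eL eP Y, eL eP Q, NV F, eL eV gs]) (eL eV (saturate xs i Y Q F gs))"
proof -
  let ?env = "args [NV i, eL eP Y, eL eP Q, NV F, eL eV gs]"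
  have gs: "length gs \<le> B" "\<And>g. g \<in> set gs \<Longrightarrow> length g \<le> B" using assms by (auto simp: vT_def)
  have 1: "ev B xs (FoldE a4 (Num 0) (call sift_insertE [a0, a1, a2, a3, Var 1, Var 2])) ?env
    (eL eV (foldl (sift_insert xs i Y Q F) [] gs))"
    by (rule ev_fold[where I = vT and ex = eV])
      (use assms gs ev_sift_insertE[OF assms(1,2)] sift_insert_vT in \<open>auto simp: ev_def vT_def[of "[]"]\<close>)
  have v1: "vT (foldl (sift_insert xs i Y Q F) [] gs)"
    by (rule foldl_inv) (use assms in \<open>auto simp: vT_def[of "[]"] intro!: sift_insert_vT\<close>)
  show ?thesis
    unfolding saturateE_def saturate_def
  proof (rule ev_for[where I = vT])
    fix T k assume v: "vT T"
    then have T: "length T \<le> B" "\<And>g. g \<in> set T \<Longrightarrow> length g \<le> B" by (auto simp: vT_def)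
    let ?env2 = "?env @ [eL eV T, NV k]"
    have "ev B xs (IfE (SubE (call lenE [Var 1]) (Var 2))
       (LetE (call nthE [Var 1, Var 2])
         (FoldE (Var 1) (Var 1) (call sift_insert2E [a0, a1, a2, a3, Var 3, Var 4, Var 5])))
       (Var 1)) ?env2 (if k < length T then eL eV (foldl (sift_insert2 xs i Y Q F (T ! k)) T T) else eL eV T)"
    proof (rule ev_if)
      show "tev B xs (SubE (call lenE [Var 1]) (Var 2)) ?env2 (k < length T)"
        using ev_lenE[OF T(1), of xs eV] by (auto simp: ev_def tev_def)
      assume k: "k < length T"
      then have a: "length (T ! k) \<le> B" using T by simp
      show "ev B xs (LetE (call nthE [Var 1, Var 2])
         (FoldE (Var 1) (Var 1) (call sift_insert2E [a0, a1, a2, a3, Var 3, Var 4, Var 5]))) ?env2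
        (eL eV (foldl (sift_insert2 xs i Y Q F (T ! k)) T T))"
      proof (rule ev_let[where u = "eV (T ! k)"])
        show "ev B xs (call nthE [Var 1, Var 2]) ?env2 (eV (T ! k))"
          using ev_nthE[OF T(1), of xs eV k] k by (auto simp: ev_def)
        show "ev B xs (FoldE (Var 1) (Var 1) (call sift_insert2E [a0, a1, a2, a3, Var 3, Var 4, Var 5]))
          (?env2 @ [eV (T ! k)]) (eL eV (foldl (sift_insert2 xs i Y Q F (T ! k)) T T))"
          by (rule ev_fold[where I = vT and ex = eV])
            (use T v a assms(3) ev_sift_insert2E[OF assms(1,2) a] sift_insert2_vT in \<open>auto simp: ev_def\<close>)
      qed
    qed (auto simp: ev_def)
    moreover have "vT (foldl (sift_insert2 xs i Y Q F (T ! k)) T T)"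
      by (rule foldl_inv) (use v assms(3) sift_insert2_vT in auto)
    ultimately show "ev B xs (IfE (SubE (call lenE [Var 1]) (Var 2))
       (LetE (call nthE [Var 1, Var 2])
         (FoldE (Var 1) (Var 1) (call sift_insert2E [a0, a1, a2, a3, Var 3, Var 4, Var 5])))
       (Var 1)) ?env2 (eL eV (if k < length T then foldl (sift_insert2 xs i Y Q F (T ! k)) T T else T)) \<and>
       vT (if k < length T then foldl (sift_insert2 xs i Y Q F (T ! k)) T T else T)"
      using v by (auto split: if_splits)
  qed (use 1 v1 assms in \<open>auto simp: ev_def\<close>)
qed

lemma ev_extendE:
  assumes "length W \<le> B" "length \<phi> \<le> B"
  shows "ev B xs extendE (args [NV z, NV i, eL eP W, eV \<phi>]) (eV (extend xs z i W \<phi>))"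
  unfolding extendE_def extend_def
  by (rule ev_MapFor)
    (use nB ev_nthV[OF assms(2)] ev_coset_repE[OF assms(1)] in \<open>auto simp: ev_def base2\<close>)

lemma ev_iso_testE:
  assumes "Suc i \<le> B" "length \<phi> \<le> B"
  shows "ev B xs iso_testE (args [NV z, NV i, eV \<phi>]) (eB (iso_test xs z i \<phi>))"
proof -
  let ?env = "args [NV z, NV i, eV \<phi>]"
  let ?q1 = "IfE (call tmemE [Num 1, a1, Var 4])
             (call eqE [call nthE [a2, call tmulE [Num 1, Var 2, Var 4]],
               call tmulE [a0, call nthE [a2, Var 2], call nthE [a2, Var 4]]]) (Num 1)"
  let ?q2 = "IfE (call tmemE [Num 1, Var 4, Var 2])
             (call tmemE [a0, Var 4, call nthE [a2, Var 2]])
             (IfE (call tmemE [a0, Var 4, call nthE [a2, Var 2]]) (Num 0) (Num 1))"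
  let ?q3 = "IfE (call tmemE [Num 1, a1, Var 4]) (call eqE [call nthE [a2, Var 4], Var 2]) (Num 0)"
  note nth = ev_nthV[OF assms(2), unfolded ev_def, simplified]
  have 1: "ev B xs (AllFor 3 nnE ?q1) (?env @ [a, NV x])
    (eB (\<forall>y<nn xs. tmem xs 1 i y \<longrightarrow> app \<phi> (tmul xs 1 x y) = tmul xs z (app \<phi> x) (app \<phi> y)))" for a x
    by (rule ev_AllFor) (use nB in \<open>auto simp: ev_def tev_def base2 nth\<close>)
  have 2: "ev B xs (AllFor 3 (AddE a1 (Num 1)) ?q2) (?env @ [a, NV x])
    (eB (\<forall>j<Suc i. tmem xs 1 j x = tmem xs z j (app \<phi> x)))" for a x
    by (rule ev_AllFor) (use assms in \<open>auto simp: ev_def tev_def base2 nth\<close>)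
  have 3: "ev B xs (ExFor 3 nnE ?q3) (?env @ [a, NV u])
    (eB (\<exists>x<nn xs. tmem xs 1 i x \<and> app \<phi> x = u))" for a u
    by (rule ev_ExFor) (use nB in \<open>auto simp: ev_def tev_def base2 nth\<close>)
  have 4: "ev B xs (AllFor 1 nnE (IfE (call tmemE [Num 1, a1, Var 2])
       (IfE (SubE nnE (call nthE [a2, Var 2])) (IfE (AllFor 3 nnE ?q1)
           (AllFor 3 (AddE a1 (Num 1)) ?q2) (Num 0)) (Num 0)) (Num 1))) ?env
    (eB (\<forall>x<nn xs. tmem xs 1 i x \<longrightarrow> app \<phi> x < nn xs \<and>
        (\<forall>y<nn xs. tmem xs 1 i y \<longrightarrow> app \<phi> (tmul xs 1 x y) = tmul xs z (app \<phi> x) (app \<phi> y)) \<and>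
        (\<forall>j<Suc i. tmem xs 1 j x = tmem xs z j (app \<phi> x))))"
  proof (rule ev_AllFor)
    fix a x
    have "tev B xs (IfE (call tmemE [Num 1, a1, Var 2])
       (IfE (SubE nnE (call nthE [a2, Var 2])) (IfE (AllFor 3 nnE ?q1)
           (AllFor 3 (AddE a1 (Num 1)) ?q2) (Num 0)) (Num 0)) (Num 1)) (?env @ [a, NV x])
       (if tmem xs 1 i x then if app \<phi> x < nn xs then
         if (\<forall>y<nn xs. tmem xs 1 i y \<longrightarrow> app \<phi> (tmul xs 1 x y) = tmul xs z (app \<phi> x) (app \<phi> y))
         then (\<forall>j<Suc i. tmem xs 1 j x = tmem xs z j (app \<phi> x)) else False else False else True)"
      by (intro tev_if tev_ev[OF 1] tev_ev[OF 2]) (auto simp: tev_def base2 nth)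
    then show "tev B xs (IfE (call tmemE [Num 1, a1, Var 2])
       (IfE (SubE nnE (call nthE [a2, Var 2])) (IfE (AllFor 3 nnE ?q1)
           (AllFor 3 (AddE a1 (Num 1)) ?q2) (Num 0)) (Num 0)) (Num 1)) (?env @ [a, NV x])
       (tmem xs 1 i x \<longrightarrow> app \<phi> x < nn xs \<and>
        (\<forall>y<nn xs. tmem xs 1 i y \<longrightarrow> app \<phi> (tmul xs 1 x y) = tmul xs z (app \<phi> x) (app \<phi> y)) \<and>
        (\<forall>j<Suc i. tmem xs 1 j x = tmem xs z j (app \<phi> x)))"
      by (rule back_subst) auto
  qed (use nB in \<open>auto simp: ev_def\<close>)
  have 5: "ev B xs (AllFor 1 nnE (IfE (call tmemE [a0, a1, Var 2]) (ExFor 3 nnE ?q3) (Num 1))) ?env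
    (eB (\<forall>u<nn xs. tmem xs z i u \<longrightarrow> (\<exists>x<nn xs. tmem xs 1 i x \<and> app \<phi> x = u)))"
  proof (rule ev_AllFor)
    fix a u
    have "tev B xs (IfE (call tmemE [a0, a1, Var 2]) (ExFor 3 nnE ?q3) (Num 1)) (?env @ [a, NV u])
      (if tmem xs z i u then \<exists>x<nn xs. tmem xs 1 i x \<and> app \<phi> x = u else True)"
      by (intro tev_if tev_ev[OF 3]) (auto simp: tev_def base2)
    then show "tev B xs (IfE (call tmemE [a0, a1, Var 2]) (ExFor 3 nnE ?q3) (Num 1)) (?env @ [a, NV u])
      (tmem xs z i u \<longrightarrow> (\<exists>x<nn xs. tmem xs 1 i x \<and> app \<phi> x = u))"
      by (rule back_subst) auto
  qed (use nB in \<open>auto simp: ev_def\<close>)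
  have "ev B xs iso_testE ?env (if
     (\<forall>x<nn xs. tmem xs 1 i x \<longrightarrow> app \<phi> x < nn xs \<and>
        (\<forall>y<nn xs. tmem xs 1 i y \<longrightarrow> app \<phi> (tmul xs 1 x y) = tmul xs z (app \<phi> x) (app \<phi> y)) \<and>
        (\<forall>j<Suc i. tmem xs 1 j x = tmem xs z j (app \<phi> x))) then
     (eB (\<forall>u<nn xs. tmem xs z i u \<longrightarrow> (\<exists>x<nn xs. tmem xs 1 i x \<and> app \<phi> x = u))) else NV 0)"
    unfolding iso_testE_def by (rule ev_if[OF tev_ev[OF 4] 5]) (auto simp: ev_def)
  then show ?thesis unfolding iso_test_def by (rule back_subst) (auto simp: eB_def)
qed

lemma ev_tuplesE:
  assumes "s \<le> B" "\<And>s'. s' \<le> s \<Longrightarrow> nn xs ^ s' \<le> B"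
  shows "ev B xs tuplesE (args [NV s]) (eL eV (tuples xs s))"
  unfolding tuplesE_def tuples_def
proof (rule ev_for_idx[where I = "\<lambda>k ts. ts = tuples xs k"])
  fix ts k assume k: "k < s" and ts: "ts = tuples xs k"
  let ?env = "args [NV s] @ [eL eV ts, NV k]"
  have "ev B xs (FoldE (Var 1) (Num 0) (ForE nnE (Var 3) (PairE (PairE (Var 6) (Var 4)) (Var 5)))) ?env
    (eL eV (foldl (\<lambda>acc t. foldl (\<lambda>acc a. (a # t) # acc) acc [0..<nn xs]) [] ts))"
  proof (rule ev_fold[where I = "\<lambda>_. True" and ex = eV])
    fix acc t
    have "ev B xs (ForE nnE (Var 3) (PairE (PairE (Var 6) (Var 4)) (Var 5))) (?env @ [eL eV acc, eV t])
      (eL eV (foldl (\<lambda>acc a. (a # t) # acc) acc [0..<nn xs]))"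
      by (rule ev_for[where I = "\<lambda>_. True"]) (use nB in \<open>auto simp: ev_def\<close>)
    then show "ev B xs (ForE nnE (Var 3) (PairE (PairE (Var 6) (Var 4)) (Var 5))) (?env @ [eL eV acc, eV t])
      (eL eV (foldl (\<lambda>acc a. (a # t) # acc) acc [0..<nn xs])) \<and> True" by simp
  qed (use ts k assms(2)[of k] in \<open>auto simp: ev_def length_tuples\<close>)
  then show "ev B xs (FoldE (Var 1) (Num 0) (ForE nnE (Var 3) (PairE (PairE (Var 6) (Var 4)) (Var 5)))) ?env
    (eL eV (foldl (\<lambda>acc t. foldl (\<lambda>acc a. (a # t) # acc) acc [0..<nn xs]) [] ts)) \<and>
    foldl (\<lambda>acc t. foldl (\<lambda>acc a. (a # t) # acc) acc [0..<nn xs]) [] ts = tuples xs (Suc k)"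
    by (simp add: ts tuples_Suc)
qed (use assms in \<open>auto simp: ev_def tuples_def\<close>)

text \<open>\<open>B0\<close> bounds the number of coset words more tightly than \<open>B\<close>,
  so that the number of relators, at most \<open>B0 * length ys\<close>, still fits below
  \<open>B\<close>.\<close>

lemma ev_candidateE:
  assumes "length ys \<le> B" "length hs \<le> B" "Suc i + B0 * length ys \<le> B" "nn xs \<le> B0" "1 \<le> B0"
    "vT T" "length \<phi> \<le> B"
  shows "ev B xs candidateE (args [NV z, NV i, eL eV T, eV \<phi>, eV ys, eV hs]) (eV (candidate xs z i T \<phi> ys hs))"
proof -
  let ?Y = "zip_gens ys hs" let ?W = "coset_words xs z i ?Y" let ?Q = "relators xs z i ?Y ?W"
  have Y: "length ?Y \<le> B" using assms by simp
  have "length ?W \<le> B0" using length_coset_words[of z i ?Y] assms(4,5) by auto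
  then have "length ?W * length ys \<le> B0 * length ys" by (rule mult_right_mono) simp
  then have Q: "Suc i + length ?Q \<le> B" using assms(3) unfolding length_relators length_zip_gens by linarith
  have T: "length T \<le> B" "\<forall>\<tau>\<in>set T. length \<tau> \<le> B" using assms(6) by (auto simp: vT_def)
  note W = length_coset_words_B[of z i ?Y]
  note s = ev_siftE[OF Y Q assms(7) T, of z]
  show ?thesis
    using ev_zip_gensE[OF assms(1,2)] ev_coset_wordsE[OF Y, of z i] ev_relatorsE[OF W Y, of z i] s(1) ev_extendE[OF W s(2), of z i]
    unfolding candidateE_def candidate_def Let_def by (auto simp: ev_def)
qed

lemma ev_keep_isoE:
  assumes "i + 2 \<le> B" "length \<psi> \<le> B"
  shows "ev B xs keep_isoE (args [NV z, NV i, eL eV acc, eV \<psi>]) (eL eV (keep_iso xs z i acc \<psi>))"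
proof -
  have "Suc (Suc i) \<le> B" using assms by simp
  from ev_iso_testE[OF this assms(2), of z] show ?thesis
    unfolding keep_isoE_def keep_iso_def by (auto simp: ev_def)
qed

lemma ev_searchE:
  assumes "length ys \<le> B" "\<And>s. s \<le> length ys \<Longrightarrow> nn xs ^ s \<le> B"
    "i + 2 + B0 * length ys \<le> B" "nn xs \<le> B0" "1 \<le> B0" "vT T" "length \<phi> \<le> B"
  shows "ev B xs searchE (args [NV z, NV i, eL eV T, eV \<phi>, eV ys, eL eV acc0]) (eL eV (search xs z i T \<phi> ys acc0))"
  unfolding searchE_def search_def
proof (rule ev_fold[where I = "\<lambda>_. True" and ex = eV])
  show "ev B xs (call tuplesE [call lenE [a4]]) (args [NV z, NV i, eL eV T, eV \<phi>, eV ys, eL eV acc0])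
     (eL eV (tuples xs (length ys)))"
    using ev_lenE[OF assms(1), of xs NV] ev_tuplesE[OF assms(1,2)] by (auto simp: ev_def)
  show "length (tuples xs (length ys)) \<le> B" using assms(2)[of "length ys"] by (simp add: length_tuples)
  fix acc hs assume "hs \<in> set (tuples xs (length ys))"
  then have hs: "length hs \<le> B" using assms(1) by (simp add: set_tuples)
  have i: "Suc i + B0 * length ys \<le> B" "i + 2 \<le> B" using assms(3) by auto
  have l: "length (candidate xs z i T \<phi> ys hs) \<le> B" using nB by (simp add: candidate_def Let_def)
  show "ev B xs (call keep_isoE [a0, a1, Var 1, call candidateE [a0, a1, a2, a3, a4, Var 2]])
     (args [NV z, NV i, eL eV T, eV \<phi>, eV ys, eL eV acc0] @ [eL eV acc, eV hs])
     (eL eV (keep_iso xs z i acc (candidate xs z i T \<phi> ys hs))) \<and> True"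
    using ev_candidateE[OF assms(1) hs i(1) assms(4-7), of z] ev_keep_isoE[OF i(2) l, of z acc]
    by (auto simp: ev_def)
qed (auto simp: ev_def)

lemma ev_liftsE:
  assumes "i + 2 \<le> B" "length W \<le> B" "vT T"
  shows "ev B xs liftsE (args [NV i, eL eP W, eL eV T]) (eL eV (lifts xs i W T))"
  unfolding liftsE_def lifts_def
proof (rule ev_fold[where I = "\<lambda>_. True" and ex = eV])
  fix acc \<tau> assume "\<tau> \<in> set T"
  then have t: "length \<tau> \<le> B" using assms(3) by (auto simp: vT_def)
  have l: "length (extend xs 1 i W \<tau>) \<le> B" using nB by simp
  show "ev B xs (call keep_isoE [Num 1, a0, Var 1, call extendE [Num 1, a0, a1, Var 2]])
    (args [NV i, eL eP W, eL eV T] @ [eL eV acc, eV \<tau>]) (eL eV (keep_iso xs 1 i acc (extend xs 1 i W \<tau>))) \<and> True"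
    using ev_extendE[OF assms(2) t, of 1 i] ev_keep_isoE[OF assms(1) l, of 1 acc] by (auto simp: ev_def)
qed (use assms in \<open>auto simp: ev_def vT_def\<close>)

lemma ev_all_relatorsE:
  assumes "length W \<le> B" "length Y \<le> B" "length W * length Y \<le> B"
  shows "ev B xs all_relatorsE (args [NV i, eL eP Y, eL eP W]) (eL eP (all_relators xs i Y W))"
proof -
  have 1: "length (relators xs 1 i Y W) \<le> B" using assms(3) by (simp add: length_relators)
  have "ev B xs (MapFor 1 nnE (PairE (Var 2) (Var 2))) (args [NV i, eL eP Y, eL eP W])
     (eL eP (map (\<lambda>x. (x, x)) [0..<nn xs]))"
    by (rule ev_MapFor) (use nB in \<open>auto simp: ev_def eP_def\<close>)
  then show ?thesis using ev_relatorsE[OF assms(1,2), of 1 i] ev_appE[OF 1, of xs eP]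
    unfolding all_relatorsE_def all_relators_def by (auto simp: ev_def)
qed

lemma length_saturate: "length (saturate xs i Y Q F gs) \<le> F"
proof -
  have 1: "length T \<le> F \<Longrightarrow> length (sift_insert xs i Y Q F T \<phi>) \<le> F" for T \<phi>
    by (simp add: sift_insert_def Let_def)
  then have 2: "length T \<le> F \<Longrightarrow> length (sift_insert2 xs i Y Q F a T b) \<le> F" for T a b
    by (simp add: sift_insert2_def)
  show ?thesis
    unfolding saturate_def
    by (rule foldl_inv[where I = "\<lambda>T. length T \<le> F"], rule foldl_inv[where I = "\<lambda>T. length T \<le> F"])
      (auto intro: 1 foldl_inv[where I = "\<lambda>T. length T \<le> F"] 2)
qed

lemma length_keep_iso: "length (keep_iso xs z i acc \<psi>) \<le> Suc (length acc)"
  by (simp add: keep_iso_def)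

lemma length_foldl_keep: "length (foldl (\<lambda>acc h. keep_iso xs z i acc (g h)) acc l) \<le> length acc + length l"
proof (induction l rule: rev_induct)
  case (snoc h l)
  then show ?case
    using length_keep_iso[of z i "foldl (\<lambda>acc h. keep_iso xs z i acc (g h)) acc l" "g h"] by simp
qed simp

lemma elem_search: "\<psi> \<in> set (search xs z i T \<phi> ys acc0) \<Longrightarrow> \<psi> \<in> set acc0 \<or> length \<psi> = nn xs"
  unfolding search_def set_foldl_keep by (auto simp: candidate_def Let_def)

lemma elem_lifts: "\<psi> \<in> set (lifts xs i W T) \<Longrightarrow> length \<psi> = nn xs"
  unfolding lifts_def set_foldl_keep by auto

definition vS :: "nat list list \<times> nat list list \<Rightarrow> bool" where
  "vS st \<longleftrightarrow> vT (fst st) \<and> (\<forall>\<sigma>\<in>set (snd st). length \<sigma> \<le> B)"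

definition eS :: "nat list list \<times> nat list list \<Rightarrow> val" where
  "eS st = PV (eL eV (fst st)) (eL eV (snd st))"

text \<open>The new list of generators can be twice as long as the table, whence
  \<open>2 * F \<le> B\<close>; the next level starts again from a table of at most \<open>F\<close>
  entries, so the lengths do not accumulate.\<close>

lemma ev_climbE:
  assumes n1: "1 \<le> nn xs" and i: "i + 2 + (nn xs * nn xs + nn xs) \<le> B" and F: "2 * F \<le> B"
    "nn xs ^ length (coset_gens xs i) \<le> F" and st: "vS st"
  shows "ev B xs climbE (args [NV F, NV z, eS st, NV i]) (eS (climb xs F z st i))" (is ?A)
    and "vS (climb xs F z st i)" (is ?C)
proof -
  let ?ys = "coset_gens xs i" let ?Y = "zip_gens ?ys ?ys" let ?W = "coset_words xs 1 i ?Y" let ?Q = "all_relators xs i ?Y ?W"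
  let ?T = "saturate xs i ?Y ?Q F (fst st)"
  have ys: "length ?ys \<le> B" using length_coset_gens[of xs i] nB by simp
  then have Y: "length ?Y \<le> B" by simp
  have W: "length ?W \<le> nn xs" "length ?W \<le> B" using length_coset_words[of 1 i ?Y] n1 nB by auto
  have WY: "length ?W * length ?Y \<le> nn xs * nn xs"
    using W(1) length_coset_gens[of xs i] by (auto intro: mult_mono)
  then have WYB: "length ?W * length ?Y \<le> B" using i by linarith
  have Q: "Suc i + length ?Q \<le> B" using WY i by (simp add: all_relators_def length_relators)
  have FB: "F \<le> B" using F by simp
  have vT: "vT ?T" using saturate_vT[OF FB] .
  have gs: "vT (fst st)" using st by (simp add: vS_def)
  have pw: "nn xs ^ s \<le> B" if "s \<le> length ?ys" for s
    using power_increasing[OF that n1] F by linarith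
  have "nn xs * length ?ys \<le> nn xs * nn xs" using length_coset_gens[of xs i] by simp
  then have i2: "i + 2 + nn xs * length ?ys \<le> B" "i + 2 \<le> B" using i by linarith+
  have id: "length [0..<nn xs] \<le> B" using nB by simp
  have hd: "length (hd_default (snd st)) \<le> B" using st by (auto simp: vS_def hd_default_def)
  have rng: "ev B xs (MapFor 5 nnE (Var 6)) [u0, u1, u2, u3, u4] (eV (map (\<lambda>x. x) [0..<nn xs]))" for u0 u1 u2 u3 u4
    by (rule ev_MapFor) (use nB in \<open>auto simp: ev_def\<close>)
  have hde: "fstv (eL eV l) = eV (hd_default l)" for l by (cases l) (auto simp: hd_default_def)
  let ?srch1 = "search xs 1 i ?T [0..<nn xs] ?ys (lifts xs i ?W ?T)"
  let ?srch2 = "search xs z i ?T (hd_default (snd st)) ?ys []"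
  note e = ev_coset_gensE[of i] ev_zip_gensE[OF ys ys] ev_coset_wordsE[OF Y, of 1 i] ev_all_relatorsE[OF W(2) Y WYB, of i]
    ev_saturateE[OF Y Q FB gs] rng ev_liftsE[OF i2(2) W(2) vT]
    ev_searchE[OF ys pw i2(1) order_refl n1 vT id, of 1 "lifts xs i ?W ?T"]
    ev_searchE[OF ys pw i2(1) order_refl n1 vT hd, of z "[]"]
  show ?A using e[unfolded ev_def, simplified] unfolding climbE_def climb_def Let_def eS_def
    by (simp add: ev_def hde)
  \<comment> \<open>At most one lift for each table element and at most one automorphism for each
    tuple of images.\<close>
  have "length ?srch1 \<le> F + F"
  proof -
    have "length ?srch1 \<le> length (lifts xs i ?W ?T) + length (tuples xs (length ?ys))"
      unfolding search_def by (rule length_foldl_keep)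
    moreover have "length (lifts xs i ?W ?T) \<le> length ?T" unfolding lifts_def using length_foldl_keep[of 1 i _ "[]"] by simp
    ultimately show ?thesis using F length_saturate[of i ?Y ?Q F "fst st"] by (simp add: length_tuples)
  qed
  then show ?C unfolding climb_def Let_def vS_def vT_def using F nB elem_search elem_lifts
    by (fastforce)
qed

lemma ev_LmaxE: "m \<le> B \<Longrightarrow> ev B xs LmaxE (args [NV m]) (NV (Lmax xs m))"
  unfolding LmaxE_def Lmax_def
proof (rule ev_for[where I = "\<lambda>_. True"])
  fix a i
  have "length (coset_gens xs i) \<le> B" using length_coset_gens[of xs i] nB by simp
  from ev_lenE[OF this, of xs NV] ev_coset_gensE[of i]
  show "ev B xs (LetE (call lenE [call coset_gensE [Var 2]]) (IfE (SubE (Var 3) (Var 1)) (Var 3) (Var 1)))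
      (args [NV m] @ [NV a, NV i]) (NV (if a < length (coset_gens xs i) then length (coset_gens xs i) else a)) \<and> True"
    by (auto simp: ev_def)
qed (auto simp: ev_def)

lemma ev_lenSE: "ev B xs lenSE env (NV (lenS xs))"
  using ev_timesE[OF nB, of xs] by (auto simp: ev_def lenSE_def lenS_def)

lemma ev_offHE: "ev B xs offHE env (NV (offH xs))"
  using ev_timesE[OF nB, of xs] ev_lenSE by (auto simp: ev_def offHE_def offH_def)

lemma ev_mainE:
  assumes n1: "1 \<le> nn xs" and m: "lenS xs + (nn xs * nn xs + nn xs) + 6 \<le> B" and F: "2 * fuel xs \<le> B"
  shows "ev B xs mainE [] (eB (iso_alg xs))"
proof -
  let ?m = "lenS xs - 1"
  let ?st0 = "([], [map (\<lambda>x. one_of xs (offH xs)) [0..<nn xs]])"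
  have mB: "?m \<le> B" using m by simp
  have L: "Lmax xs ?m \<le> nn xs" by (rule Lmax_le)
  have "Lmax xs ?m * Lmax xs ?m \<le> nn xs * nn xs" using L L by (rule mult_mono) auto
  then have LB: "Lmax xs ?m * Lmax xs ?m + 6 \<le> B" "Lmax xs ?m \<le> B" using m L nB by linarith+
  have fu: "ev B xs (call fuelE [call LmaxE [SubE lenSE (Num 1)]]) [] (NV (fuel xs))"
    using ev_LmaxE[OF mB] ev_timesE[OF LB(2), of xs "Lmax xs ?m"] ev_powE[OF nB LB(1), of xs] ev_lenSE
    by (simp add: ev_def fuelE_def fuel_def)
  have "ev B xs (MapFor 1 nnE (call one_ofE [offHE])) [v] (eV (map (\<lambda>x. one_of xs (offH xs)) [0..<nn xs]))" for v
    by (rule ev_MapFor) (use nB ev_one_ofE[of "offH xs"] ev_offHE in \<open>auto simp: ev_def\<close>)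
  then have i0: "ev B xs (PairE (Num 0) (PairE (MapFor 1 nnE (call one_ofE [offHE])) (Num 0))) [NV (fuel xs)] (eS ?st0)"
    by (simp add: ev_def eS_def)
  have loop: "ev B xs (ForE (SubE lenSE (Num 1)) (PairE (Num 0) (PairE (MapFor 1 nnE (call one_ofE [offHE])) (Num 0)))
         (call climbE [Var 0, offHE, Var 1, Var 2])) [NV (fuel xs)]
     (eS (foldl (climb xs (fuel xs) (offH xs)) ?st0 [0..<?m]))"
  proof (rule ev_for[where I = vS])
    show "vS ?st0" using nB B1 by (simp add: vS_def vT_def)
    show "ev B xs (SubE lenSE (Num 1)) [NV (fuel xs)] (NV ?m)"
      using ev_lenSE by (simp add: ev_def)
    fix st i assume i: "i < ?m" and st: "vS st"
    have i2: "i + 2 + (nn xs * nn xs + nn xs) \<le> B" using i m by linarith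
    \<comment> \<open>The exponent in \<open>fuel\<close> also dominates the number of generators,
      so \<open>fuel\<close> bounds the number of tuples.\<close>
    have "length (coset_gens xs i) \<le> Lmax xs ?m * Lmax xs ?m + 6"
      using Lmax_ge[OF i, of xs] le_square[of "Lmax xs ?m"] by linarith
    then have "nn xs ^ length (coset_gens xs i) \<le> fuel xs"
      unfolding fuel_def by (rule power_increasing) (rule n1)
    from ev_climbE[OF n1 i2 F this st, of "offH xs"] ev_offHE
    show "ev B xs (call climbE [Var 0, offHE, Var 1, Var 2]) ([NV (fuel xs)] @ [eS st, NV i])
        (eS (climb xs (fuel xs) (offH xs) st i)) \<and> vS (climb xs (fuel xs) (offH xs) st i)"
      by (auto simp: ev_def)
  qed (use mB i0 in auto)
  have eq: "ev B xs (call eqE [lenSE, RdE (AddE offHE (call timesE [nnE, nnE]))]) []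
     (eB (lenS xs = read_at xs (offH xs + nn xs * nn xs)))"
    using ev_timesE[OF nB, of xs] ev_lenSE ev_offHE ev_eqE by (auto simp: ev_def)
  have "ev B xs (SndE (LetE (call fuelE [call LmaxE [SubE lenSE (Num 1)]])
       (ForE (SubE lenSE (Num 1)) (PairE (Num 0) (PairE (MapFor 1 nnE (call one_ofE [offHE])) (Num 0)))
         (call climbE [Var 0, offHE, Var 1, Var 2])))) []
     (eL eV (snd (foldl (climb xs (fuel xs) (offH xs)) ?st0 [0..<?m])))"
    by (rule ev_snd, rule ev_let[OF fu], unfold append_Nil, rule loop[unfolded eS_def])
  then have t: "tev B xs (SndE (LetE (call fuelE [call LmaxE [SubE lenSE (Num 1)]])
       (ForE (SubE lenSE (Num 1)) (PairE (Num 0) (PairE (MapFor 1 nnE (call one_ofE [offHE])) (Num 0)))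
         (call climbE [Var 0, offHE, Var 1, Var 2])))) []
     (snd (foldl (climb xs (fuel xs) (offH xs)) ?st0 [0..<?m]) \<noteq> [])"
    by (simp add: ev_def tev_def)
  have "ev B xs mainE [] (if lenS xs = read_at xs (offH xs + nn xs * nn xs) then
     if snd (foldl (climb xs (fuel xs) (offH xs)) ?st0 [0..<?m]) \<noteq> [] then NV 1 else NV 0 else NV 0)"
    unfolding mainE_def by (intro ev_if tev_ev[OF eq] t) (auto simp: ev_def)
  then show ?thesis by (rule back_subst) (auto simp: iso_alg_def eB_def)
qed

end

lemmas exp_defs = mainE_def fuelE_def offHE_def lenSE_def LmaxE_def climbE_def all_relatorsE_def liftsE_def
  searchE_def keep_isoE_def candidateE_def tuplesE_def iso_testE_def extendE_def saturateE_def sift_insert2E_def sift_insertE_def siftE_def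
  sift_stepE_def inv_mapE_def comp_mapE_def depthE_def count_leadE_def commutesE_def relatorsE_def relatorE_def coset_gensE_def zip_gensE_def
  coset_wordsE_def add_wordE_def coset_repE_def coveredE_def one_ofE_def tdivE_def tmemE_def tmulE_def nthE_def powE_def
  timesE_def eqE_def lenE_def snocE_def appE_def MapFor_def revE_def ExFold_def ExFor_def
  AllFold_def AllFor_def

lemma scoped_mainE: "scoped 0 mainE"
  by (simp add: exp_defs)

declare One_nat_def [simp del]

section \<open>Climbing the series\<close>

lemma monoid_gen_mono: "\<phi> \<in> monoid_gen xs X \<Longrightarrow> X \<subseteq> X' \<Longrightarrow> \<phi> \<in> monoid_gen xs X'"
  by (induction rule: monoid_gen.induct) (auto intro: monoid_gen.intros)

context pair
begin

lemma extend_out: "Suc i < m \<Longrightarrow> x < nn xs \<Longrightarrow> x \<notin> S ! Suc i \<Longrightarrow> app (extend xs z' i W \<phi>) x = x"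
  using G.tmem[of "Suc i" x] by (simp add: extend_def)

end

locale stage = pair +
  fixes i K :: nat
  assumes i: "Suc i < m" and mn: "m \<le> nn xs" and K: "\<And>j. Suc j < m \<Longrightarrow> length (coset_gens xs j) \<le> K"
begin

abbreviation "ys \<equiv> coset_gens xs i"
abbreviation "F \<equiv> nn xs ^ (K * K + 6)"

lemma glevelI: "pair G H' xs z' m S T' \<Longrightarrow> set hs \<subseteq> {..<nn xs} \<Longrightarrow> length hs = length ys \<Longrightarrow>
   glevel G H' xs z' m S T' i ys hs"
  using coset_gens_props[OF i] i unfolding glevel_def level_def level_axioms_def glevel_axioms_def by simp

lemma L0: "glevel G G xs 1 m S S i ys ys"
  by (rule glevelI[OF GG]) (use coset_gens_props(1)[OF i] G.inN[OF i] in auto)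

text \<open>The exponent \<open>K * K + 6\<close> is the \<open>K * K + 1\<close> of
  \<open>DT_count\<close> plus 5: the tower has at most \<open>n * n + 2 * n\<close> conditions,
  which is below \<open>n ^ 5\<close> because a nontrivial step forces
  \<open>n \<ge> 2\<close>.\<close>

lemma DT_fuel:
  assumes D: "level.DT G xs S i ys L"
  shows "length L < F"
proof -
  interpret L0: glevel G G xs 1 m S S i ys ys by (rule L0)
  let ?n = "nn xs"
  have n: "2 \<le> ?n" using i mn by simp
  have "length L \<le> L0.rr * ?n ^ (K * K + 1)"
    by (rule L0.DT_count[OF D K[OF i] K]) (use n in auto)
  also have "L0.rr * ?n ^ (K * K + 1) < ?n ^ 5 * ?n ^ (K * K + 1)"
  proof (rule mult_strict_right_mono)
    have "length L0.W0 \<le> ?n" using L0.JW_length[OF L0.W_JW] .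
    then have "length L0.W0 * length ys \<le> ?n * ?n" using length_coset_gens[of xs i] by (intro mult_mono) auto
    then have "length L0.Q0 \<le> ?n * ?n + ?n" by (simp add: all_relators_def length_relators zip_gens_def)
    then have r: "L0.rr \<le> ?n * ?n + ?n + ?n" using i mn by linarith
    have a: "2 * ?n \<le> ?n * ?n" using n by (rule mult_le_mono1)
    have b: "2 * (?n * ?n) \<le> ?n ^ 3" using mult_le_mono1[OF n, of "?n * ?n"] unfolding power3_eq_cube mult.assoc .
    have "?n ^ 3 < ?n ^ 5" using n by (intro power_strict_increasing) auto
    then show "L0.rr < ?n ^ 5" using r a b by linarith
  qed (use n in simp)
  also have "?n ^ 5 * ?n ^ (K * K + 1) = F" unfolding power_add[symmetric] by (simp add: add.commute)
  finally show ?thesis .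
qed

context
  fixes gs :: "nat list list"
  assumes gs: "set gs \<subseteq> Aut xs G S i" "Aut xs G S i \<subseteq> monoid_gen xs (set gs)"
begin

abbreviation "Y0 \<equiv> zip_gens ys ys"
abbreviation "W0 \<equiv> coset_words xs 1 i Y0"
abbreviation "Q0 \<equiv> all_relators xs i Y0 W0"
abbreviation "L \<equiv> saturate xs i Y0 Q0 F gs"
abbreviation "dd \<equiv> depth xs 1 i Y0 Q0"

lemma L_Aut: "set L \<subseteq> Aut xs G S i"
  and L_fac: "\<kappa> \<in> Aut xs G S i \<Longrightarrow> depth_group.fac (AG xs G S i) dd (set L) \<kappa>"
proof -
  interpret L0: glevel G G xs 1 m S S i ys ys by (rule L0)
  show "set L \<subseteq> Aut xs G S i" by (rule L0.saturate_fac(1)[OF DT_fuel gs])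
  show "\<kappa> \<in> Aut xs G S i \<Longrightarrow> depth_group.fac (AG xs G S i) dd (set L) \<kappa>"
    by (rule L0.saturate_fac(2)[OF DT_fuel gs])
qed

text \<open>Completeness of the search: among the tuples is the one that \<open>fs\<close>
  prescribes. The map found for it need not be \<open>fs\<close>, but it agrees with
  \<open>fs\<close> on \<open>ys\<close>.\<close>

lemma candidate_OK:
  assumes P: "pair G H' xs z' m S T'" and s: "ser_iso G S H' T' i (app \<sigma>)" and fs: "ser_iso G S H' T' (Suc i) fs"
  shows "map fs ys \<in> set (tuples xs (length ys))" "iso_test xs z' (Suc i) (candidate xs z' i L \<sigma> ys (map fs ys))"
    "y \<in> set ys \<Longrightarrow> app (candidate xs z' i L \<sigma> ys (map fs ys)) y = fs y"
proof -
  interpret P: pair G H' xs z' m S T' by (rule P)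
  have hs: "set (map fs ys) \<subseteq> {..<nn xs}"
    using P.ser_iso_in(1)[OF i fs] coset_gens_props(1)[OF i] P.H.car by auto
  then show "map fs ys \<in> set (tuples xs (length ys))" by (simp add: set_tuples)
  interpret Lh: glevel G H' xs z' m S T' i ys "map fs ys" by (rule glevelI[OF P hs]) simp
  have fy: "fs (fst y) = snd y" if "y \<in> set (zip_gens ys (map fs ys))" for y
    using that unfolding Lh.Yzip by (auto simp: set_zip)
  let ?f = "sift xs z' i Lh.Y Lh.Q L \<sigma>"
  have sf1: "ser_iso G S H' T' i (app ?f)" by (rule Lh.search_full(1)[OF fs fy L_Aut L_fac s])
  have sf2: "Lh.CC (app ?f) i" by (rule Lh.search_full(2)[OF fs fy L_Aut L_fac s])
  note sf = sf1 sf2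
  have sp: "app ?f (fst p) = snd p" if "p \<in> set Lh.Q" for p by (rule Lh.search_full(3)[OF fs fy L_Aut L_fac s that])
  have E: "ser_iso G S H' T' (Suc i) (app (extend xs z' i Lh.W ?f))" by (rule Lh.extend_ser_iso[OF fs fy sf sp])
  have EY: "app (extend xs z' i Lh.W ?f) (fst p) = snd p" if "p \<in> set Lh.Y" for p by (rule Lh.extend_Y[OF fs fy sf sp that])
  show "iso_test xs z' (Suc i) (candidate xs z' i L \<sigma> ys (map fs ys))"
    unfolding P.iso_test_ser_iso[OF i] candidate_def Let_def by (rule E)
  assume "y \<in> set ys"
  then obtain p where p: "p \<in> set (zip_gens ys (map fs ys))" "fst p = y" using Lh.exY by blast
  show "app (candidate xs z' i L \<sigma> ys (map fs ys)) y = fs y"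
    unfolding candidate_def Let_def using EY[OF p(1)] fy[OF p(1)] p(2) by simp
qed

abbreviation "r1 \<equiv> Suc i + length (relators xs 1 i Y0 W0)"

text \<open>Depth \<open>r1\<close> means that all conditions but the extra fixed points hold, which
  is what extending with every \<open>y\<close> fixed requires.\<close>

lemma extend_facts:
  assumes t: "t \<in> Aut xs G S i" "r1 \<le> dd t"
  shows "extend xs 1 i W0 t \<in> Aut xs G S (Suc i)"
    "n \<in> S ! i \<Longrightarrow> w \<in> set W0 \<Longrightarrow> app (extend xs 1 i W0 t) (n \<otimes>\<^bsub>G\<^esub> fst w) = app t n \<otimes>\<^bsub>G\<^esub> fst w"
proof -
  interpret L0: glevel G G xs 1 m S S i ys ys by (rule L0)
  have st: "ser_iso G S G S i (app t)" using t by (simp add: Aut_def)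
  have rle: "r1 \<le> L0.rr" by (simp add: all_relators_def)
  have c: "\<forall>k<r1. cond_at xs 1 i Y0 Q0 t k" using t(2) depth_ge[OF rle, of xs 1 Y0 t] by simp
  have cc: "L0.CC (app t) i" using c L0.commutes_iff[OF st order_refl] by (auto simp: cond_at_def)
  have pp: "app t (fst p) = snd p" if p: "p \<in> set L0.Q" for p
  proof -
    obtain k where k: "k < length L0.Q" "L0.Q ! k = p" using p by (auto simp: in_set_conv_nth)
    have "cond_at xs 1 i Y0 Q0 t (Suc i + k)" using c k by simp
    then show ?thesis using k by (simp add: cond_at_def all_relators_def nth_append)
  qed
  \<comment> \<open>The identity realises the guess in which every \<open>y\<close> is its own
    image, so it can play the part of \<open>fs\<close>.\<close>
  have id: "ser_iso G S G S (Suc i) (app [0..<nn xs])" using G.Aut_id[OF refl i] by (simp add: Aut_def)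
  have fy: "app [0..<nn xs] (fst y) = snd y" if "y \<in> set Y0" for y
    using that L0.hs unfolding L0.Yzip by (auto simp: set_zip subset_iff)
  show "extend xs 1 i W0 t \<in> Aut xs G S (Suc i)"
    using L0.extend_ser_iso[OF id fy st cc pp] extend_out[OF i] by (simp add: Aut_def len_extend)
  assume "n \<in> S ! i" "w \<in> set W0"
  then show "app (extend xs 1 i W0 t) (n \<otimes>\<^bsub>G\<^esub> fst w) = app t n \<otimes>\<^bsub>G\<^esub> fst w"
    using L0.E_eq[OF id fy st cc pp] L0.gp0[OF L0.W_gp] by simp
qed

lemma Aut_eqI:
  assumes "a \<in> Aut xs G S (Suc i)" "b \<in> Aut xs G S (Suc i)"
    "\<And>n w. n \<in> S ! i \<Longrightarrow> w \<in> set W0 \<Longrightarrow> app a (n \<otimes>\<^bsub>G\<^esub> fst w) = app b (n \<otimes>\<^bsub>G\<^esub> fst w)"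
  shows "a = b"
proof -
  interpret L0: glevel G G xs 1 m S S i ys ys by (rule L0)
  show ?thesis
  proof (rule app_eqI[of _ "nn xs"])
    fix x assume x: "x < nn xs"
    show "app a x = app b x"
    proof (cases "x \<in> S ! Suc i")
      case True
      then show ?thesis using L0.dec assms(3) by blast
    qed (use assms x in \<open>auto simp: Aut_def\<close>)
  qed (use assms in \<open>auto simp: Aut_def\<close>)
qed

lemma set_lifts: "set (lifts xs i W0 L) = {extend xs 1 i W0 \<tau> |\<tau>. \<tau> \<in> set L \<and> iso_test xs 1 (Suc i) (extend xs 1 i W0 \<tau>)}"
  unfolding lifts_def set_foldl_keep by simp

text \<open>Extension is multiplicative. In a normal form of depth at least \<open>r1\<close> every
  factor has depth at least \<open>r1\<close>, because depths increase along it; so each factor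
  lifts separately.\<close>

lemma lift_monoid_gen:
  assumes "depth_group.fac (AG xs G S i) dd (set L) \<kappa>" "r1 \<le> dd \<kappa>"
  shows "extend xs 1 i W0 \<kappa> \<in> monoid_gen xs (set (lifts xs i W0 L))"
proof -
  interpret L0: glevel G G xs 1 m S S i ys ys by (rule L0)
  interpret A: depth_group "AG xs G S i" dd L0.rr by (rule L0.depth_AG)
  have im: "i < m" using i by simp
  have LC: "set L \<subseteq> carrier (AG xs G S i)" using L_Aut by simp
  show ?thesis using assms
  proof (induction rule: A.fac.induct)
    case one
    have id: "[0..<nn xs] \<in> Aut xs G S i" "[0..<nn xs] \<in> Aut xs G S (Suc i)"
      using G.Aut_id[OF refl im] G.Aut_id[OF refl i] by auto
    have "extend xs 1 i W0 [0..<nn xs] = [0..<nn xs]"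
    proof (rule Aut_eqI)
      fix n w assume nw: "n \<in> S ! i" "w \<in> set W0"
      have r: "r1 \<le> dd [0..<nn xs]" using one by simp
      have "n \<otimes>\<^bsub>G\<^esub> fst w \<in> carrier G" using L0.gp_in[OF L0.W_gp[OF nw(2)]] nw by simp
      then show "app (extend xs 1 i W0 [0..<nn xs]) (n \<otimes>\<^bsub>G\<^esub> fst w) = app [0..<nn xs] (n \<otimes>\<^bsub>G\<^esub> fst w)"
        using extend_facts(2)[OF id(1) r nw] G.inN[OF im nw(1)] by (simp add: G.carN)
    qed (use id one extend_facts(1)[OF id(1)] in auto)
    then show ?case using monoid_gen.one[of xs] by simp
  next
    case (mult \<tau> \<phi>)
    have tA: "\<tau> \<in> Aut xs G S i" "\<phi> \<in> Aut xs G S i" using mult L_Aut A.fac_carrier[OF mult(2) LC] by auto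
    have "dd (comp_map xs \<tau> \<phi>) = dd \<tau>" using A.d_mult_less[of \<tau> \<phi>] tA mult(3) by simp
    then have r: "r1 \<le> dd \<tau>" "r1 \<le> dd \<phi>" using mult by auto
    have rc: "r1 \<le> dd (comp_map xs \<tau> \<phi>)" using mult.prems by simp
    have cA: "comp_map xs \<tau> \<phi> \<in> Aut xs G S i" using G.Aut_comp_map[OF refl im tA] .
    note e = extend_facts[OF tA(1) r(1)] extend_facts[OF tA(2) r(2)] extend_facts[OF cA rc]
    have "extend xs 1 i W0 (comp_map xs \<tau> \<phi>) = comp_map xs (extend xs 1 i W0 \<tau>) (extend xs 1 i W0 \<phi>)"
    proof (rule Aut_eqI[OF e(5) G.Aut_comp_map[OF refl i e(1,3)]])
      fix n w assume nw: "n \<in> S ! i" "w \<in> set W0"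
      have c: "n \<otimes>\<^bsub>G\<^esub> fst w < nn xs" using L0.gp_in[OF L0.W_gp[OF nw(2)]] nw by (simp add: G.carN[symmetric])
      have "app \<phi> n \<in> S ! i" using G.Aut_inS[OF refl im tA(2) G.inN[OF im nw(1)]] nw by simp
      then show "app (extend xs 1 i W0 (comp_map xs \<tau> \<phi>)) (n \<otimes>\<^bsub>G\<^esub> fst w) =
         app (comp_map xs (extend xs 1 i W0 \<tau>) (extend xs 1 i W0 \<phi>)) (n \<otimes>\<^bsub>G\<^esub> fst w)"
        using e(6)[OF nw] e(4)[OF nw] e(2)[OF _ nw(2)] app_comp_map[OF c] app_comp_map[OF G.inN[OF im nw(1)]] by simp
    qed
    moreover have "extend xs 1 i W0 \<tau> \<in> set (lifts xs i W0 L)"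
      unfolding set_lifts using mult(1) e(1) L0.iso_test_ser_iso[OF i] by (auto simp: Aut_def)
    ultimately show ?case using mult.IH[OF r(2)] monoid_gen.mul by simp
  qed
qed

abbreviation "newL \<equiv> search xs 1 i L [0..<nn xs] ys (lifts xs i W0 L)"

lemma newL_Aut: "set newL \<subseteq> Aut xs G S (Suc i)"
proof -
  interpret P: pair G G xs 1 m S S by (rule GG)
  have "extend xs 1 i W \<phi> \<in> Aut xs G S (Suc i)" if "iso_test xs 1 (Suc i) (extend xs 1 i W \<phi>)" for W \<phi>
    using that P.iso_test_ser_iso[OF i] extend_out[OF i] by (simp add: Aut_def len_extend)
  then show ?thesis unfolding search_def set_foldl_keep set_lifts candidate_def Let_def by auto
qed

text \<open>Let \<open>h\<close> be the automorphism found for the images of \<open>ys\<close> under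
  \<open>\<psi>\<close>. Then \<open>\<chi> = h^-1 \<psi>\<close> fixes \<open>ys\<close>, so its
  restriction \<open>\<kappa>\<close> to \<open>G_i\<close> has depth at least \<open>r1\<close> and
  \<open>\<chi>\<close> is the lift of \<open>\<kappa>\<close>.\<close>

lemma newL_gen: "Aut xs G S (Suc i) \<subseteq> monoid_gen xs (set newL)"
proof
  fix \<psi> assume p: "\<psi> \<in> Aut xs G S (Suc i)"
  interpret L0: glevel G G xs 1 m S S i ys ys by (rule L0)
  interpret B: group "AG xs G S (Suc i)" by (rule G.AG_group[OF refl i])
  have im: "i < m" using i by simp
  have sp: "ser_iso G S G S (Suc i) (app \<psi>)" using p by (simp add: Aut_def)
  have idA: "ser_iso G S G S i (app [0..<nn xs])" using G.Aut_id[OF refl im] by (simp add: Aut_def)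
  define h where "h = candidate xs 1 i L [0..<nn xs] ys (map (app \<psi>) ys)"
  note c = candidate_OK[OF GG idA sp, folded h_def]
  have hn: "h \<in> set newL" unfolding search_def set_foldl_keep using c(1,2) unfolding h_def by blast
  have hA: "h \<in> Aut xs G S (Suc i)" using hn newL_Aut by blast
  define \<chi> where "\<chi> = comp_map xs (inv_map xs h) \<psi>"
  have xA: "\<chi> \<in> Aut xs G S (Suc i)" unfolding \<chi>_def by (rule G.Aut_comp_map[OF refl i G.Aut_inv_map[OF refl i hA] p])
  have sx: "ser_iso G S G S (Suc i) (app \<chi>)" using xA by (simp add: Aut_def)
  have "h \<otimes>\<^bsub>AG xs G S (Suc i)\<^esub> (inv\<^bsub>AG xs G S (Suc i)\<^esub> h \<otimes>\<^bsub>AG xs G S (Suc i)\<^esub> \<psi>) = \<psi>"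
    using B.m_assoc[of h "inv\<^bsub>AG xs G S (Suc i)\<^esub> h" \<psi>] B.r_inv[of h] B.l_one[of \<psi>] B.inv_closed[of h] hA p by simp
  then have psi: "comp_map xs h \<chi> = \<psi>" using G.AG_inv[OF refl i hA] by (simp add: \<chi>_def)
  have xy: "app \<chi> y = y" if "y \<in> set ys" for y
  proof -
    have y: "y < nn xs" using coset_gens_props(1)[OF i] that G.inN[OF i] by blast
    then show ?thesis using c(3)[OF that] G.app_inv_map(3)[OF refl i hA y] by (simp add: \<chi>_def app_comp_map)
  qed
  define \<kappa> where "\<kappa> = map (\<lambda>x. if x \<in> S ! i then app \<chi> x else x) [0..<nn xs]"
  have k1: "app \<kappa> x = app \<chi> x" if "x \<in> S ! i" for x using that G.inN[OF im that] by (simp add: \<kappa>_def)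
  have sk: "ser_iso G S G S i (app \<kappa>)"
    using L0.ser_iso_down[OF i sx] ser_iso_cong[of S i "app \<kappa>" "app \<chi>"] k1 G.clo(1)[OF im] by auto
  have kA: "\<kappa> \<in> Aut xs G S i" using sk by (simp add: Aut_def \<kappa>_def)
  have fy: "app \<chi> (fst y) = snd y" if "y \<in> set Y0" for y
    using that xy unfolding L0.Yzip by (auto simp: set_zip)
  have rle: "r1 \<le> L0.rr" by (simp add: all_relators_def)
  have "cond_at xs 1 i Y0 Q0 \<kappa> k" if k: "k < r1" for k
  proof (cases "k \<le> i")
    case True
    have "L0.CC (app \<kappa>) k \<longleftrightarrow> L0.CC (app \<chi>) k"
      unfolding L0.CC_def using k1 L0.chn[OF True] L0.conj_in L0.fstY by simp
    then show ?thesis using True L0.commutes_iff[OF sk True] L0.fs_CC[OF sx fy True] by (simp add: cond_at_def)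
  next
    case False
    then have "L0.Q ! (k - Suc i) \<in> set L0.Q" using k by (intro nth_mem) auto
    then have "app \<kappa> (fst (L0.Q ! (k - Suc i))) = snd (L0.Q ! (k - Suc i))"
      using k1 L0.Q_in L0.fs_relators[OF sx fy] by simp
    moreover have "k - Suc i < length L0.Q" using False k by simp
    ultimately show ?thesis using False by (simp add: cond_at_def all_relators_def nth_append)
  qed
  then have r: "r1 \<le> dd \<kappa>" using depth_ge[OF rle, of xs 1 Y0 \<kappa>] by simp
  have "extend xs 1 i W0 \<kappa> = \<chi>"
  proof (rule Aut_eqI[OF extend_facts(1)[OF kA r] xA])
    fix n w assume nw: "n \<in> S ! i" "w \<in> set W0"
    have "app \<chi> (n \<otimes>\<^bsub>G\<^esub> fst w) = app \<chi> n \<otimes>\<^bsub>G\<^esub> app \<chi> (fst w)"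
      using L0.ser_iso_mult[OF i sx L0.NM[OF nw(1)]] L0.gp_in[OF L0.W_gp[OF nw(2)]] by simp
    also have "app \<chi> (fst w) = fst w" using L0.fs_gp[OF sx fy L0.W_gp[OF nw(2)]] L0.gp0[OF L0.W_gp[OF nw(2)]] by simp
    finally show "app (extend xs 1 i W0 \<kappa>) (n \<otimes>\<^bsub>G\<^esub> fst w) = app \<chi> (n \<otimes>\<^bsub>G\<^esub> fst w)"
      using extend_facts(2)[OF kA r nw] k1[OF nw(1)] by simp
  qed
  then have "\<chi> \<in> monoid_gen xs (set (lifts xs i W0 L))" using lift_monoid_gen[OF L_fac[OF kA] r] by simp
  then have "\<chi> \<in> monoid_gen xs (set newL)"
    by (rule monoid_gen_mono) (unfold search_def set_foldl_keep, blast)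
  from monoid_gen.mul[OF hn this] show "\<psi> \<in> monoid_gen xs (set newL)" unfolding psi .
qed

end

lemma climb_fst:
  assumes "set (fst st) \<subseteq> Aut xs G S i" "Aut xs G S i \<subseteq> monoid_gen xs (set (fst st))"
  shows "set (fst (climb xs F z st i)) \<subseteq> Aut xs G S (Suc i)" "Aut xs G S (Suc i) \<subseteq> monoid_gen xs (set (fst (climb xs F z st i)))"
  using newL_Aut[OF assms] newL_gen[OF assms] unfolding climb_def Let_def by simp_all

lemma climb_snd_sound: "\<sigma> \<in> set (snd (climb xs F z st i)) \<Longrightarrow> ser_iso G S H T (Suc i) (app \<sigma>)"
  unfolding climb_def Let_def search_def snd_conv set_foldl_keep using iso_test_ser_iso[OF i] by auto

lemma climb_snd:
  assumes gs: "set (fst st) \<subseteq> Aut xs G S i" "Aut xs G S i \<subseteq> monoid_gen xs (set (fst st))"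
    and s: "snd st \<noteq> []" "\<And>\<sigma>. \<sigma> \<in> set (snd st) \<Longrightarrow> ser_iso G S H T i (app \<sigma>)" and fs: "ser_iso G S H T (Suc i) fs"
  shows "snd (climb xs F z st i) \<noteq> []"
proof -
  have h: "ser_iso G S H T i (app (hd_default (snd st)))" using s by (simp add: hd_default_def)
  from candidate_OK[OF gs pair_axioms h fs]
  have "set (snd (climb xs F z st i)) \<noteq> {}"
    unfolding climb_def Let_def search_def snd_conv set_foldl_keep by blast
  then show ?thesis by auto
qed

end

context pair
begin

lemma ser_iso_down_le: "k \<le> j \<Longrightarrow> j < m \<Longrightarrow> ser_iso G S H T j f \<Longrightarrow> ser_iso G S H T k f"
proof (induction j)
  case (Suc j)
  then show ?case using ser_iso_down[OF Suc.prems(2,3)] by (cases "k = Suc j") auto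
qed simp

text \<open>Any isomorphism of the whole series restricts to every level, so the list of
  isomorphisms stays nonempty if there is one; conversely, every surviving map has passed the test.
  Keeping only the head at each level loses nothing, since all others differ from it by
  automorphisms.\<close>

lemma foldl_climb:
  assumes mn: "m \<le> nn xs" and K: "\<And>j. Suc j < m \<Longrightarrow> length (coset_gens xs j) \<le> K"
  defines "F \<equiv> nn xs ^ (K * K + 6)"
  shows "snd (foldl (climb xs F z) ([], [map (\<lambda>x. one_of xs z) [0..<nn xs]]) [0..<m - 1]) \<noteq> []
     \<longleftrightarrow> (\<exists>f. ser_iso G S H T (m - 1) f)"
proof -
  let ?st = "\<lambda>k. foldl (climb xs F z) ([], [map (\<lambda>x. one_of xs z) [0..<nn xs]]) [0..<k]"
  have inv: "set (fst (?st k)) \<subseteq> Aut xs G S k \<and> Aut xs G S k \<subseteq> monoid_gen xs (set (fst (?st k))) \<and>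
     (\<forall>\<sigma>\<in>set (snd (?st k)). ser_iso G S H T k (app \<sigma>)) \<and> ((\<exists>f. ser_iso G S H T (m - 1) f) \<longrightarrow> snd (?st k) \<noteq> [])"
    if "k < m" for k
    using that
  proof (induction k)
    case 0
    interpret P: pair G G xs 1 m S S by (rule GG)
    have "\<phi> = [0..<nn xs]" if p: "\<phi> \<in> Aut xs G S 0" for \<phi>
    proof (rule app_eqI[of _ "nn xs"])
      fix x assume x: "x < nn xs"
      have s: "ser_iso G S G S 0 (app \<phi>)" using p by (simp add: Aut_def)
      show "app \<phi> x = app [0..<nn xs] x"
        using p x P.ser_iso_one[OF 0 s] G.S0 by (cases "x = \<one>\<^bsub>G\<^esub>") (auto simp: Aut_def)
    qed (use p in \<open>auto simp: Aut_def\<close>)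
    then have "Aut xs G S 0 \<subseteq> monoid_gen xs {}" by (auto intro: monoid_gen.one)
    moreover have "app (map (\<lambda>x. \<one>\<^bsub>H\<^esub>) [0..<nn xs]) \<one>\<^bsub>G\<^esub> = \<one>\<^bsub>H\<^esub>" using G.one_closed by (simp add: G.carN)
    then have "ser_iso G S H T 0 (app (map (\<lambda>x. \<one>\<^bsub>H\<^esub>) [0..<nn xs]))" by (simp add: ser_iso_def G.S0 H.S0)
    ultimately show ?case by (simp add: H.one_eq)
  next
    case (Suc k)
    then have km: "Suc k < m" by simp
    interpret st: stage G H xs z m S T k K by unfold_locales (use km mn K in auto)
    have e: "?st (Suc k) = climb xs F z (?st k) k" by simp
    note IH = Suc.IH[OF Suc_lessD[OF km]]
    have 1: "set (fst (?st (Suc k))) \<subseteq> Aut xs G S (Suc k)" "Aut xs G S (Suc k) \<subseteq> monoid_gen xs (set (fst (?st (Suc k))))"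
      unfolding e unfolding F_def using st.climb_fst[of "?st k"] IH unfolding F_def by blast+
    have 2: "\<forall>\<sigma>\<in>set (snd (?st (Suc k))). ser_iso G S H T (Suc k) (app \<sigma>)"
      unfolding e unfolding F_def using st.climb_snd_sound by blast
    have 3: "snd (?st (Suc k)) \<noteq> []" if f: "ser_iso G S H T (m - 1) f" for f
    proof -
      have "ser_iso G S H T (Suc k) f" by (rule ser_iso_down_le[OF _ _ f]) (use km in auto)
      then show ?thesis unfolding e unfolding F_def using st.climb_snd[of "?st k" f] IH f unfolding F_def by blast
    qed
    show ?case using 1 2 3 by blast
  qed
  have m1: "m - 1 < m" using G.len by simp
  show ?thesis using inv[OF m1] by (metis list.set_intros(1) neq_Nil_conv)
qed

end

section \<open>Encoding and running time\<close>

lemma read_at_append: "read_at (a @ b) k = (if k < length a then read_at a k else read_at b (k - length a))"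
  by (auto simp: read_at_def nth_append)

lemma read_at_shift: "length a = l \<Longrightarrow> read_at (a @ b) (l + k) = read_at b k"
  by (simp add: read_at_append)

lemma read_at_Cons: "read_at (x # b) (1 + k) = read_at b k"
  by (simp add: read_at_def)

lemma read_at_left: "k < length a \<Longrightarrow> read_at (a @ b) k = read_at a k"
  by (simp add: read_at_append)

lemma block_less: "a < k \<Longrightarrow> b < n \<Longrightarrow> n * a + b < n * (k :: nat)"
proof -
  assume "a < k" "b < n"
  then have "n * a + b < n * a + n" by simp
  also have "\<dots> = n * Suc a" by simp
  also have "\<dots> \<le> n * k" using \<open>a < k\<close> by (intro mult_le_mono) auto
  finally show ?thesis .
qed

lemma length_concat_block: "(\<And>l. l \<in> set ls \<Longrightarrow> length l = n) \<Longrightarrow> length (concat ls) = n * length ls"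
  by (induction ls) auto

lemma read_at_concat:
  "(\<And>l. l \<in> set ls \<Longrightarrow> length l = n) \<Longrightarrow> a < length ls \<Longrightarrow> b < n \<Longrightarrow> read_at (concat ls) (n * a + b) = ls ! a ! b"
proof (induction ls arbitrary: a)
  case (Cons l ls)
  have l: "length l = n" using Cons.prems by simp
  show ?case
  proof (cases a)
    case 0 then show ?thesis using l Cons.prems by (simp add: read_at_append) (simp add: read_at_def)
  next
    case (Suc a')
    have "read_at (concat (l # ls)) (n * a + b) = read_at (concat ls) (n * a' + b)"
      using read_at_shift[OF l, of "concat ls" "n * a' + b"] Suc by (simp add: add.assoc)
    then show ?thesis using Cons Suc by simp
  qed
qed simp

lemma length_encode_table: "length (encode_table n G) = n * n"
  unfolding encode_table_def by (subst length_concat_block[of _ n]) auto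

lemma read_at_encode_table: "a < n \<Longrightarrow> b < n \<Longrightarrow> read_at (encode_table n G) (n * a + b) = a \<otimes>\<^bsub>G\<^esub> b"
  unfolding encode_table_def by (subst read_at_concat) auto

lemma length_subsets: "length (concat (map (encode_subset n) S)) = n * length S"
  by (subst length_concat_block[of _ n]) (auto simp: encode_subset_def)

lemma read_at_subsets: "j < length S \<Longrightarrow> x < n \<Longrightarrow>
   read_at (concat (map (encode_subset n) S)) (n * j + x) = (if x \<in> S ! j then 1 else 0)"
  by (subst read_at_concat) (auto simp: encode_subset_def)

context
  fixes n G S H S' xs
  defines "xs \<equiv> encode_instance n G S H S'"
begin

lemma enc_n: "nn xs = n"
  by (simp add: xs_def encode_instance_def read_at_def)

lemma enc1: "read_at xs (1 + k) = read_at (encode_table n G @ length S # concat (map (encode_subset n) S) @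
    encode_table n H @ encode_series n S') k"
  unfolding xs_def encode_instance_def encode_series_def[of n S] read_at_Cons by simp

lemma enc2: "read_at xs (1 + (n * n + k)) = read_at (length S # concat (map (encode_subset n) S) @
    encode_table n H @ encode_series n S') k"
  unfolding enc1 by (rule read_at_shift) (rule length_encode_table)

lemma enc3: "read_at xs (1 + (n * n + (1 + (n * length S + k)))) = read_at (encode_table n H @ encode_series n S') k"
  unfolding enc2 read_at_Cons by (rule read_at_shift) (rule length_subsets)

lemma enc_lenS: "lenS xs = length S"
  using enc2[of 0] by (simp add: lenS_def enc_n) (simp add: read_at_def)

lemma enc_offH: "offH xs = 1 + (n * n + (1 + n * length S))"
  by (simp add: offH_def enc_n enc_lenS)

lemma enc_H: "read_at xs (offH xs + k) = read_at (encode_table n H @ encode_series n S') k"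
  unfolding enc_offH using enc3[of k] by (simp add: add.assoc)

lemma enc_H2: "read_at xs (offH xs + (n * n + k)) = read_at (encode_series n S') k"
  unfolding enc_H by (rule read_at_shift) (rule length_encode_table)

lemma enc_lenS': "read_at xs (offH xs + n * n) = length S'"
  using enc_H2[of 0] by (simp add: encode_series_def) (simp add: read_at_def)

lemma enc_muG: "a < n \<Longrightarrow> b < n \<Longrightarrow> tmul xs 1 a b = a \<otimes>\<^bsub>G\<^esub> b"
  unfolding tmul_def enc_n enc1
  by (subst read_at_left) (auto simp: length_encode_table read_at_encode_table block_less)

lemma enc_meG: "j < length S \<Longrightarrow> x < n \<Longrightarrow> tmem xs 1 j x \<longleftrightarrow> x \<in> S ! j"
  unfolding tmemv_def enc_n enc2 read_at_Cons
  by (subst read_at_left) (auto simp: length_subsets read_at_subsets block_less)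

lemma enc_muH: "a < n \<Longrightarrow> b < n \<Longrightarrow> tmul xs (offH xs) a b = a \<otimes>\<^bsub>H\<^esub> b"
  unfolding tmul_def enc_n enc_H
  by (subst read_at_left) (auto simp: length_encode_table read_at_encode_table block_less)

lemma enc_meH: "j < length S' \<Longrightarrow> x < n \<Longrightarrow> tmem xs (offH xs) j x \<longleftrightarrow> x \<in> S' ! j"
  unfolding tmemv_def enc_n enc_H2 encode_series_def read_at_Cons
  by (auto simp: read_at_subsets)

end

lemma vserI:
  assumes "group G" "carrier G = {..<nn xs}" "subnormal_series G S"
    "\<And>a b. a < nn xs \<Longrightarrow> b < nn xs \<Longrightarrow> tmul xs z a b = a \<otimes>\<^bsub>G\<^esub> b"
    "\<And>j x. j < length S \<Longrightarrow> x < nn xs \<Longrightarrow> tmem xs z j x \<longleftrightarrow> x \<in> S ! j"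
  shows "vser G xs z (length S) S"
proof -
  have S: "S \<noteq> []" "hd S = {\<one>\<^bsub>G\<^esub>}" "last S = carrier G"
    "\<And>i. Suc i < length S \<Longrightarrow> S ! i \<lhd> G\<lparr>carrier := S ! Suc i\<rparr>"
    using assms(3) by (auto simp: subnormal_series_def)
  have "S ! 0 = {\<one>\<^bsub>G\<^esub>}" "S ! (length S - 1) = carrier G" using S by (auto simp: hd_conv_nth last_conv_nth)
  then show ?thesis unfolding vser_def vser_axioms_def using assms S by auto
qed

context vser
begin

text \<open>Without repetitions the terms grow strictly. This bounds the number of levels by
  \<open>n\<close>, as the loop bounds require.\<close>

lemma strict_card: 
  assumes d: "distinct S"
  shows "j < m \<Longrightarrow> Suc j \<le> card (S ! j)"
proof (induction j)
  case 0 then show ?case using S0 by simp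
next
  case (Suc j)
  have "S ! j \<subseteq> S ! Suc j" "S ! j \<noteq> S ! Suc j"
    using step_incl[OF Suc.prems] d Suc.prems len by (auto simp: nth_eq_iff_index_eq)
  then have "S ! j \<subset> S ! Suc j" by blast
  moreover have "finite (S ! Suc j)" using inN[OF Suc.prems] by (auto intro: finite_subset[of _ "{..<nn xs}"])
  ultimately have "card (S ! j) < card (S ! Suc j)" by (rule psubset_card_mono[rotated])
  then show ?case using Suc by simp
qed

lemma m_le: "distinct S \<Longrightarrow> m \<le> nn xs"
  using strict_card[of "m - 1"] Sm car len by simp

lemma card_factor:
  assumes i: "Suc i < m"
  shows "order (series_factor G S i) * card (S ! i) = card (S ! Suc i)"
proof -
  interpret M: group "G\<lparr>carrier := S ! Suc i\<rparr>"
    using subgroup.subgroup_is_group[OF sub[OF i]] group_axioms by simp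
  have "card (rcosets\<^bsub>G\<lparr>carrier := S ! Suc i\<rparr>\<^esub> (S ! i)) * card (S ! i) = order (G\<lparr>carrier := S ! Suc i\<rparr>)"
    by (rule M.lagrange[OF normal_imp_subgroup[OF nrm[OF i]]])
  then show ?thesis by (simp add: series_factor_def FactGroup_def order_def)
qed

end

text \<open>By the doubling bound of \<open>coset_gens_props\<close>, \<open>2\<close> to the number
  of generators is at most the order of the factor, hence at most \<alpha>.\<close>

lemma (in pair) Lmax_bound:
  assumes b: "factor_orders_bounded G S \<alpha>" and m: "2 \<le> m" and d: "distinct S"
  shows "2 \<le> \<alpha>" "real (Lmax xs (m - 1)) \<le> log 2 \<alpha>"
proof -
  have pos: "0 < card (S ! i)" if "i < m" for i
    using G.strict_card[OF d that] by simp
  have q: "real (order (series_factor G S i)) \<le> \<alpha>" if "Suc i < m" for i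
    using b that G.len by (simp add: factor_orders_bounded_def)
  have i0: "Suc 0 < m" using m by simp
  \<comment> \<open>The first factor is nontrivial; this keeps \<open>log 2 \<alpha>\<close> at
    least 1, so dividing by it is harmless.\<close>
  have "2 \<le> card (S ! Suc 0)" using G.strict_card[OF d i0] by simp
  then have "2 \<le> order (series_factor G S 0)" using G.card_factor[OF i0] G.S0 by simp
  then show a: "2 \<le> \<alpha>" using q[OF i0] by linarith
  have g: "real (length (coset_gens xs i)) \<le> log 2 \<alpha>" if i: "Suc i < m" for i
  proof -
    have "2 ^ length (coset_gens xs i) * card (S ! i) \<le> order (series_factor G S i) * card (S ! i)"
      using coset_gens_props(3)[OF i] G.card_factor[OF i] by simp
    then have "2 ^ length (coset_gens xs i) \<le> order (series_factor G S i)"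
      using pos[of i] i by (simp add: mult_le_cancel2)
    then have "real (2 ^ length (coset_gens xs i)) \<le> \<alpha>" using q[OF i] by (meson of_nat_le_iff order_trans)
    then have "2 powr real (length (coset_gens xs i)) \<le> \<alpha>" by (simp add: powr_realpow)
    then show ?thesis using a by (simp add: le_log_iff)
  qed
  have "real (Lmax xs k) \<le> log 2 \<alpha>" if "k \<le> m - 1" for k
    using that
  proof (induction k)
    case 0 then show ?case using a by (simp add: Lmax_def)
  next
    case (Suc k)
    have "Lmax xs (Suc k) = (if Lmax xs k < length (coset_gens xs k) then length (coset_gens xs k) else Lmax xs k)"
      by (simp add: Lmax_def)
    then show ?case using Suc g[of k] by auto
  qed
  then show "real (Lmax xs (m - 1)) \<le> log 2 \<alpha>" by simp
qed

lemma (in pair) series_iso_ser_iso: "series_iso G S H T \<longleftrightarrow> (\<exists>f. ser_iso G S H T (m - 1) f)"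
proof
  have m1: "m - 1 < m" using G.len by simp
  assume "series_iso G S H T"
  then obtain f where f: "f \<in> iso G H" "\<And>i. i < m \<Longrightarrow> f ` (S ! i) = T ! i"
    using G.len by (auto simp: series_iso_def)
  have h: "f \<in> hom G H" "bij_betw f (carrier G) (carrier H)" using f by (auto simp: iso_def)
  have inj: "inj_on f (carrier G)" using h by (simp add: bij_betw_def)
  have mem: "x \<in> S ! j \<longleftrightarrow> f x \<in> T ! j" if "x \<in> carrier G" "j \<le> m - 1" for x j
  proof -
    have jm: "j < m" using that m1 by simp
    show ?thesis
    proof
      assume "x \<in> S ! j"
      then show "f x \<in> T ! j" using f(2)[OF jm] by blast
    next
      assume "f x \<in> T ! j"
      then obtain u where u: "u \<in> S ! j" "f x = f u" using f(2)[OF jm] by blast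
      then show "x \<in> S ! j" using inj_onD[OF inj u(2) that(1) G.inC[OF jm u(1)]] by simp
    qed
  qed
  have "ser_iso G S H T (m - 1) f"
    unfolding ser_iso_def using mem h f(2)[OF m1] G.Sm H.Sm by (auto simp: hom_def)
  then show "\<exists>f. ser_iso G S H T (m - 1) f" by blast
next
  have m1: "m - 1 < m" using G.len by simp
  assume "\<exists>f. ser_iso G S H T (m - 1) f"
  then obtain f where f: "ser_iso G S H T (m - 1) f" by blast
  have "f \<in> iso G H"
    unfolding iso_def hom_def bij_betw_def
    using ser_iso_in(1)[OF m1 f] ser_iso_mult[OF m1 f] ser_iso_inj[OF m1 f] ser_iso_img[OF m1 f, of "m - 1"] G.Sm H.Sm by auto
  moreover have "\<forall>i<length S. f ` (S ! i) = T ! i" using ser_iso_img[OF m1 f] G.len by auto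
  ultimately show "series_iso G S H T" using G.len H.len by (auto simp: series_iso_def)
qed

section \<open>The running time\<close>

text \<open>The estimate for \<open>l = log 2 \<alpha>\<close>. From
  \<open>ln 2 \<ge> 1 / 2\<close>, \<open>l / 6\<close> is at most \<open>l * ln 2 / 3\<close> and
  so at most its exponential; cubing gives \<open>l ^ 3 \<le> 216 * 2 powr l\<close>. With
  \<open>l ^ 2 + 6 \<le> 7 * l ^ 2\<close> the constant is 7 * 216 = 1512.\<close>

lemma cube_le_exp:
  fixes l :: real
  assumes "1 \<le> l"
  shows "l ^ 2 + 6 \<le> 1512 * (2 powr l / l)"
proof -
  define x where "x = l * ln 2"
  have ln2: "1 / 2 \<le> ln (2::real)" using exp_half_le2 ln_ge_iff[of 2 "1 / 2"] by linarith
  have "l * (1 / 2) \<le> x" unfolding x_def using assms ln2 by (intro mult_left_mono) auto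
  then have x: "0 \<le> l / 6" "l / 6 \<le> x / 3" using assms by auto
  have "l / 6 \<le> exp (x / 3)" using x(2) exp_ge_add_one_self[of "x / 3"] by linarith
  then have "(l / 6) ^ 3 \<le> exp (x / 3) ^ 3" using x(1) by (intro power_mono)
  also have "exp (x / 3) ^ 3 = exp x" using exp_of_nat_mult[of 3 "x / 3"] by simp
  also have "exp x = 2 powr l" by (simp add: powr_def x_def)
  finally have p: "l ^ 3 / 216 \<le> 2 powr l" by (simp add: power_divide)
  have "1 \<le> l ^ 2" using assms by (simp add: one_le_power)
  then have "(l ^ 2 + 6) * l \<le> (7 * l ^ 2) * l" using assms by (intro mult_right_mono) auto
  also have "\<dots> = 7 * l ^ 3" by (simp add: power2_eq_square power3_eq_cube)
  also have "\<dots> \<le> 1512 * 2 powr l" using p by simp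
  finally show ?thesis using assms by (simp add: field_simps)
qed

text \<open>One constant serves twice: its part \<open>C * 12 ^ D + 14\<close> absorbs the leading
  factor, and \<open>1512 * D\<close> is the constant of \<open>cube_le_exp\<close> times the degree
  of the polynomial.\<close>

lemma time_bound:
  fixes n L D C :: nat and \<alpha> :: real
  assumes n: "1 \<le> n" and L: "2 \<le> n \<Longrightarrow> 2 \<le> \<alpha> \<and> real L \<le> log 2 \<alpha>"
    and B: "B + 1 \<le> 12 * n ^ (L * L + 6)" and t: "t \<le> C * (B + 1) ^ D + 14"
  defines "c \<equiv> real (C * 12 ^ D + 14 + 1512 * D)"
  shows "real t \<le> c * real n powr (c * (\<alpha> / log 2 \<alpha>))"
proof -
  let ?e = "(L * L + 6) * D"
  have "(B + 1) ^ D \<le> (12 * n ^ (L * L + 6)) ^ D" using B by (rule power_mono) simp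
  also have "\<dots> = 12 ^ D * n ^ ?e" by (simp add: power_mult_distrib power_mult)
  finally have "C * (B + 1) ^ D \<le> C * (12 ^ D * n ^ ?e)" by simp
  moreover have "14 \<le> 14 * n ^ ?e" using n by simp
  ultimately have "t \<le> (C * 12 ^ D + 14) * n ^ ?e" using t
    unfolding distrib_right mult.assoc by linarith
  then have "real t \<le> real (C * 12 ^ D + 14) * real n ^ ?e" 
    using of_nat_mono[of t "(C * 12 ^ D + 14) * n ^ ?e", where 'a = real] by simp
  also have "\<dots> \<le> c * real n powr (c * (\<alpha> / log 2 \<alpha>))"
  proof (rule mult_mono)
    show "real n ^ ?e \<le> real n powr (c * (\<alpha> / log 2 \<alpha>))"
    \<comment> \<open>A trivial group may come without any factor, so \<alpha> can be arbitrary;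
      both powers of \<open>n\<close> are then 1.\<close>
    proof (cases "n = 1")
      case False
      then have n2: "2 \<le> n" using n by simp
      define l where "l = log 2 \<alpha>"
      have a: "2 \<le> \<alpha>" "real L \<le> l" using L[OF n2] by (auto simp: l_def)
      have l1: "1 \<le> l" using a(1) log_mono[of 2 2 \<alpha>] by (simp add: l_def)
      have e: "2 powr l = \<alpha>" using a(1) by (simp add: l_def)
      have "real L * real L \<le> l * l" using a(2) by (intro mult_mono) auto
      then have "real (L * L + 6) \<le> l ^ 2 + 6" by (simp add: power2_eq_square)
      also have "\<dots> \<le> 1512 * (\<alpha> / l)" using cube_le_exp[OF l1] by (simp add: e)
      finally have "real ?e \<le> 1512 * (\<alpha> / l) * real D" 
        using mult_right_mono[of "real (L * L + 6)" "1512 * (\<alpha> / l)" "real D"] by simp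
      also have "\<dots> = (1512 * real D) * (\<alpha> / l)" by simp
      also have "\<dots> \<le> c * (\<alpha> / l)" using a l1 by (intro mult_right_mono) (auto simp: c_def)
      finally have "real n powr real ?e \<le> real n powr (c * (\<alpha> / l))" using n by (intro powr_mono) auto
      moreover have "real n powr real ?e = real n ^ ?e" using n by (intro powr_realpow) simp
      ultimately show ?thesis unfolding l_def by simp
    qed simp
  qed (auto simp: c_def)
  finally show ?thesis .
qed

theorem theorem10:
  "\<exists>(P :: program) (c :: real). c > 0 \<and>
     (\<forall>(n :: nat) (G :: nat monoid) (H :: nat monoid) (S :: nat set list) (S' :: nat set list)
        (\<alpha> :: real).
        group G \<and> carrier G = {..<n} \<and> group H \<and> carrier H = {..<n} \<and>
        composition_series G S \<and> composition_series H S' \<and>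
        factor_orders_bounded G S \<alpha> \<and> factor_orders_bounded H S' \<alpha> \<longrightarrow>
        decides_in_time P (encode_instance n G S H S')
          (c * real n powr (c * (\<alpha> / log 2 \<alpha>))) (series_iso G S H S'))"
proof -
  obtain C D where CD: "\<And>B. steps_bound B mainE \<le> C * (B + 1) ^ D" using steps_bound_poly[of mainE] by blast
  define c where "c = real (C * 12 ^ D + 14 + 1512 * D)"
  have main: "decides_in_time (compile mainE) (encode_instance n G S H S')
          (c * real n powr (c * (\<alpha> / log 2 \<alpha>))) (series_iso G S H S')"
    if G: "group G" "carrier G = {..<n}" and H: "group H" "carrier H = {..<n}"
      and S: "composition_series G S" and S': "composition_series H S'" and b: "factor_orders_bounded G S \<alpha>"
    for n G H S S' \<alpha>
  proof -
    define xs where "xs = encode_instance n G S H S'"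
    note enc = enc_n[of n G S H S', folded xs_def] enc_lenS[of n G S H S', folded xs_def]
      enc_lenS'[of n G S H S', folded xs_def]
    have sn: "subnormal_series G S" "subnormal_series H S'" "distinct S"
      using S S' by (auto simp: composition_series_def)
    have vG: "vser G xs 1 (length S) S"
    proof (rule vserI[OF G(1) _ sn(1)])
      show "carrier G = {..<nn xs}" using G enc by simp
      show "tmul xs 1 a b = a \<otimes>\<^bsub>G\<^esub> b" if "a < nn xs" "b < nn xs" for a b
        using enc_muG[of a n b G S H S'] that unfolding enc xs_def[symmetric] .
      show "tmem xs 1 j x \<longleftrightarrow> x \<in> S ! j" if "j < length S" "x < nn xs" for j x
        using enc_meG[of j S x n G H S'] that unfolding enc xs_def[symmetric] .
    qed
    have vH: "vser H xs (offH xs) (length S') S'"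
    proof (rule vserI[OF H(1) _ sn(2)])
      show "carrier H = {..<nn xs}" using H enc by simp
      show "tmul xs (offH xs) a b = a \<otimes>\<^bsub>H\<^esub> b" if "a < nn xs" "b < nn xs" for a b
        using enc_muH[of a n b G S H S'] that unfolding enc xs_def[symmetric] .
      show "tmem xs (offH xs) j x \<longleftrightarrow> x \<in> S' ! j" if "j < length S'" "x < nn xs" for j x
        using enc_meH[of j S' x n G S H] that unfolding enc xs_def[symmetric] .
    qed
    have mn: "length S \<le> n" using vser.m_le[OF vG sn(3)] enc by simp
    interpret GG: pair G G xs 1 "length S" S S unfolding pair_def using vG by simp
    have n1: "1 \<le> n" using mn GG.G.len by linarith
    have correct: "iso_alg xs \<longleftrightarrow> series_iso G S H S'"
    proof (cases "length S = length S'")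
      case True
      interpret P: pair G H xs "offH xs" "length S" S S' unfolding pair_def using vG vH True by simp
      have "length (coset_gens xs j) \<le> Lmax xs (length S - 1)" if "Suc j < length S" for j
        using that by (intro Lmax_ge) simp
      note K = this
      have "length S \<le> nn xs" using mn enc by simp
      from P.foldl_climb[OF this K] show ?thesis
        unfolding iso_alg_def P.series_iso_ser_iso fuel_def enc using True by blast
    next
      case False
      then show ?thesis unfolding iso_alg_def enc by (simp add: series_iso_def)
    qed
    let ?L = "Lmax xs (length S - 1)"
    define B where "B = length S + (n * n + n) + 6 + 2 * n ^ (?L * ?L + 6)"
    have "ev B xs mainE [] (eB (iso_alg xs))"
    proof (rule ev_mainE)
      show "nn xs \<le> B" "1 \<le> B" "1 \<le> nn xs" "lenS xs + (nn xs * nn xs + nn xs) + 6 \<le> B" "2 * fuel xs \<le> B"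
        unfolding fuel_def enc B_def using n1 by linarith+
    qed
    then have ev: "eval mainE xs [] = eB (iso_alg xs)" "bounded_loops mainE B xs []" by auto
    from compile_correct[OF scoped_mainE ev(2)] obtain t where t: "t \<le> steps_bound B mainE + 14"
      "halted (compile mainE) (run (compile mainE) xs t)"
      "snd (run (compile mainE) xs t) 0 = nv (eB (iso_alg xs))" unfolding ev(1) by blast
    have "real t \<le> c * real n powr (c * (\<alpha> / log 2 \<alpha>))"
      unfolding c_def
    proof (rule time_bound[OF n1])
      show "t \<le> C * (B + 1) ^ D + 14" using t(1) CD[of B] by linarith
      have p: "n ^ k \<le> n ^ (?L * ?L + 6)" if "k \<le> 6" for k using n1 that by (intro power_increasing) auto
      \<comment> \<open>12 = 1 + 1 + 1 + 7 + 2, for \<open>length S \<le> n\<close>,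
        \<open>n * n\<close>, \<open>n\<close>, the constant 6 + 1, and twice the fuel.\<close>
      show "B + 1 \<le> 12 * n ^ (?L * ?L + 6)"
        using p[of 0] p[of 1] p[of 2] mn unfolding B_def power_0 power_one_right power2_eq_square by linarith
      assume n2: "2 \<le> n"
      \<comment> \<open>A series with one term would make the group trivial.\<close>
      have "2 \<le> length S"
      proof (rule ccontr)
        assume "\<not> 2 \<le> length S"
        then have "length S - 1 = 0" by simp
        then have "carrier G = {\<one>\<^bsub>G\<^esub>}" using GG.G.S0 GG.G.Sm by simp
        then have "card {..<n} = 1" using G(2) by simp
        then have "n = 1" by simp
        then show False using n2 by simp
      qed
      then show "2 \<le> \<alpha> \<and> real ?L \<le> log 2 \<alpha>" using GG.Lmax_bound[OF b _ sn(3)] by simp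
    qed
    moreover have "(snd (run (compile mainE) xs t) 0 \<noteq> 0) = series_iso G S H S'"
      unfolding t(3) correct by (simp add: eB_def)
    ultimately show ?thesis unfolding decides_in_time_def xs_def[symmetric] using t(2) by blast
  qed
  have "c > 0" unfolding c_def of_nat_0_less_iff by simp
  with main show ?thesis by blast
qed

end
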